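(* For $r_n>0$, let $\mathbb S^n(r_n)$ be the $n$-dimensional sphere of radius $r_n$ with the standard geodesic distance and the normalised volume measure. As $n\to\infty$: \begin{itemize} \item if $\frac{r_n}{\sqrt n}\to0$, then $\mathbb S^n(r_n)\to\star$ in $d_{\rm conc}$; \item if $\frac{r_n}{\sqrt n}\to\lambda\in(0,\infty)$, then $\mathbb S^n(r_n)\to\Gamma^\infty_{\lambda^2}$ in $\tau_\Pi$; \item if $\frac{r_n}{\sqrt n}\to\infty$, then $\mathbb S^n(r_n)\to\mathbb I_\infty$ in $\tau_\Pi$. \end{itemize} In particular, if $\frac{r_n}{\sqrt n}\to1$, then $\mathbb S^n(r_n)\to\mathbb W$ in $\tau_\Pi$, where $\mathbb W$ is the abstract Wiener space (with infinite-dimensional Cameron–Martin space).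
   Context: $\star$ is the one-point mm-space. $\Gamma^\infty_{\lambda^2}=(\mathbb R^\infty,\tau^\infty,\ell_2,\gamma_{\lambda^2}^{\otimes\infty})$, with $\tau^\infty$ the product topology, $\ell_2(x,y)=(\sum_i(x_i-y_i)^2)^{1/2}\in[0,\infty]$ and $\gamma_{\lambda^2}$ the centred Gaussian measure on $\mathbb R$ with variance $\lambda^2$. $\mathbb I_\infty=([0,1],\tau_{[0,1]},d_\infty,\mathrm{Leb})$ with $\tau_{[0,1]}$ the Euclidean topology, $d_\infty(x,y)=0$ if $x=y$ and $+\infty$ otherwise. An abstract Wiener space is a triple $(W,H,\mu)$, $H$ a separable real Hilbert space continuously and densely embedded in a separable real Banach space $W$, $\mu$ the centred Gaussian measure on $W$ with Cameron–Martin space $H$; it is regarded as the emm-space $\mathbb W=(W,\tau_W,d_H,\mu)$, $\tau_W$ the norm topology, $d_H(w_1,w_2)=\|w_1-w_2\|_H$ if $w_1-w_2\in H$ and $+\infty$ otherwise. An mm-space is a complete separable metric space with a Borel probability measure; $\mathcal X$ is the set of mm-isomorphism classes (isomorphism: measure-preserving map that is distance-preserving on the support). An emm-space is $(X,\tau,d,m)$ with $(X,\tau)$ Polish, $d:X\times X\to[0,+\infty]$ a complete, $\tau\times\tau$-lower semicontinuous extended distance whose induced topology is finer than or equal to $\tau$, and $m$ a $\tau$-Borel probability measure. $Y\prec X$: there are a measurable $\varphi:X\to Y$ with $\varphi_\#m_X=m_Y$ and $E$ with $m_X(E)=1$ such that $d_Y(\varphi(x),\varphi(y))\le d_X(x,y)$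 on $E\times E$. $\mathcal P_X=\{Y\in\mathcal X:Y\prec X\}$. A parameter of an mm-space is a Borel map $\iota_X:[0,1)\to X$ with $(\iota_X)_\#\mathrm{Leb}=m_X$. Box distance: $\square(X,Y)$ is the infimum over parameters of the infimum of $\varepsilon\ge0$ such that some Borel $I_0\subset[0,1)$ has $\mathrm{Leb}(I_0)\ge1-\varepsilon$ and $|d_X(\iota_X(s),\iota_X(t))-d_Y(\iota_Y(s),\iota_Y(t))|\le\varepsilon$ on $I_0\times I_0$. Observable distance: $d_{\rm conc}(X,Y)=\inf_{\iota_X,\iota_Y}d_H^{L^0}(\iota_X^*\mathrm{Lip}_1(X),\iota_Y^*\mathrm{Lip}_1(Y))$ over parameters, where $\mathrm{Lip}_1$ is the set of 1-Lipschitz functions on the support of the measure, $\iota^*f=f\circ\iota$, and $d_H^{L^0}$ is the Hausdorff distance in $L^0([0,1),\mathrm{Leb})$ with the Ky Fan distance $d_{L^0}(f,g)=\inf\{\varepsilon>0:\mathrm{Leb}(|f-g|>\varepsilon)\le\varepsilon\}$. Convergence of emm-spaces $X_n\to X$ in $\tau_\Pi$ means convergence of the associated pyramids: $\overline{\mathcal P_{X_n}}^\square\to\overline{\mathcal P_X}^\square$ in the sense of Painlevé–Kuratowski in $(\mathcal X,\square)$, where $\overline{\,\cdot\,}^\square$ is closure; i.e. $\overline{\mathcal P_X}^\square$ equals both the set of $\square$-limits of sequences $Y_n\in\overline{\mathcal P_{X_n}}^\square$ and the set of $\square$-limits of sequences $Y_{n_k}\in\overline{\mathcal P_{X_{n_k}}}^\square$,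 $n_k\uparrow\infty$. *)

theory Defs
  imports "HOL-Probability.Probability"
begin

definition borel_sets_of :: "'a topology \<Rightarrow> 'a set set" where
  "borel_sets_of T = sigma_sets (topspace T) {U. openin T U}"


section \<open>Metric measure spaces\<close>

text \<open>The underlying set of a space is the \<^const>\<open>space\<close> of its measure.\<close>

record 'a mm =
  mm_dist :: "'a \<Rightarrow> 'a \<Rightarrow> real"
  mm_measure :: "'a measure"

abbreviation mm_carrier :: "'a mm \<Rightarrow> 'a set" where
  "mm_carrier X \<equiv> space (mm_measure X)"

definition mm_top :: "'a mm \<Rightarrow> 'a topology" where
  "mm_top X = Metric_space.mtopology (mm_carrier X) (mm_dist X)"

definition mm_space :: "'a mm \<Rightarrow> bool" where
  "mm_space X \<longleftrightarrow>
     Metric_space (mm_carrier X) (mm_dist X) \<and>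
     Metric_space.mcomplete (mm_carrier X) (mm_dist X) \<and>
     separable_space (mm_top X) \<and>
     sets (mm_measure X) = borel_sets_of (mm_top X) \<and>
     prob_space (mm_measure X)"

definition mm_support :: "'a mm \<Rightarrow> 'a set" where
  "mm_support X =
     {x \<in> mm_carrier X. \<forall>U. openin (mm_top X) U \<and> x \<in> U \<longrightarrow> emeasure (mm_measure X) U > 0}"

definition mm_iso :: "'a mm \<Rightarrow> 'b mm \<Rightarrow> bool" where
  "mm_iso X Y \<longleftrightarrow>
     (\<exists>\<phi> \<in> mm_measure X \<rightarrow>\<^sub>M mm_measure Y.
        distr (mm_measure X) (mm_measure Y) \<phi> = mm_measure Y \<and>
        (\<forall>x \<in> mm_support X. \<forall>y \<in> mm_support X. mm_dist Y (\<phi> x) (\<phi> y) = mm_dist X x y))"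

text \<open>
  A separable metric space has at most the cardinality of the continuum, so every mm-space
  (over any type) is isomorphic to one whose underlying set is a set of reals, with a metric that
  is unrelated to the usual one. Hence the isomorphism classes below are all of them.
\<close>

definition mm_iso_rel :: "(real mm \<times> real mm) set" where
  "mm_iso_rel = {(X, Y). mm_space X \<and> mm_space Y \<and> mm_iso X Y}"

definition mm_classes :: "real mm set set" where
  "mm_classes = {X. mm_space X} // mm_iso_rel"

definition rep :: "real mm set \<Rightarrow> real mm" where
  "rep A = (SOME X. X \<in> A)"


section \<open>Extended metric measure spaces\<close>

record 'a emm =
  emm_top :: "'a topology"
  emm_dist :: "'a \<Rightarrow> 'a \<Rightarrow> ennreal"
  emm_measure :: "'a measure"

definition emm_space :: "'a emm \<Rightarrow> bool" where
  "emm_space X \<longleftrightarrow> (let T = emm_top X; S = topspace T; d = emm_dist X; m = emm_measure X in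
     \<comment> \<open>Polish topology\<close>
     completely_metrizable_space T \<and> separable_space T \<and>
     \<comment> \<open>extended distance\<close>
     (\<forall>x\<in>S. \<forall>y\<in>S. d x y = 0 \<longleftrightarrow> x = y) \<and>
     (\<forall>x\<in>S. \<forall>y\<in>S. d x y = d y x) \<and>
     (\<forall>x\<in>S. \<forall>y\<in>S. \<forall>z\<in>S. d x z \<le> d x y + d y z) \<and>
     \<comment> \<open>completeness\<close>
     (\<forall>u. range u \<subseteq> S \<and> (\<forall>\<epsilon>>0. \<exists>N. \<forall>j\<ge>N. \<forall>k\<ge>N. d (u j) (u k) < \<epsilon>) \<longrightarrow>
        (\<exists>x\<in>S. (\<lambda>j. d (u j) x) \<longlonglongrightarrow> 0)) \<and>
     \<comment> \<open>lower semicontinuity\<close>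
     (\<forall>c. closedin (prod_topology T T) {(x, y) \<in> S \<times> S. d x y \<le> c}) \<and>
     \<comment> \<open>the topology of the distance is finer than or equal to the given one\<close>
     (\<forall>U. openin T U \<longrightarrow> (\<forall>x\<in>U. \<exists>\<epsilon>>0. \<forall>y\<in>S. d x y < \<epsilon> \<longrightarrow> y \<in> U)) \<and>
     \<comment> \<open>Borel probability measure\<close>
     space m = S \<and> sets m = borel_sets_of T \<and> prob_space m)"

definition emm_of_mm :: "'a mm \<Rightarrow> 'a emm" where
  "emm_of_mm X =
     \<lparr>emm_top = mm_top X, emm_dist = (\<lambda>x y. ennreal (mm_dist X x y)), emm_measure = mm_measure X\<rparr>"

definition emm_prec :: "'b emm \<Rightarrow> 'a emm \<Rightarrow> bool" (infix "\<prec>\<prec>" 50) where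
  "Y \<prec>\<prec> X \<longleftrightarrow>
     (\<exists>\<phi> \<in> emm_measure X \<rightarrow>\<^sub>M emm_measure Y. \<exists>E \<in> sets (emm_measure X).
        distr (emm_measure X) (emm_measure Y) \<phi> = emm_measure Y \<and>
        emeasure (emm_measure X) E = 1 \<and>
        (\<forall>x\<in>E. \<forall>y\<in>E. emm_dist Y (\<phi> x) (\<phi> y) \<le> emm_dist X x y))"


section \<open>Box distance and observable distance\<close>

abbreviation unit_interval_measure :: "real measure" where
  "unit_interval_measure \<equiv> restrict_space lborel {0..<1}"

definition parameters :: "'a mm \<Rightarrow> (real \<Rightarrow> 'a) set" where
  "parameters X = {\<iota> \<in> unit_interval_measure \<rightarrow>\<^sub>M mm_measure X.
     distr unit_interval_measure (mm_measure X) \<iota> = mm_measure X}"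

text \<open>All infima and suprema are taken in \<^typ>\<open>ennreal\<close>.\<close>

definition box :: "'a mm \<Rightarrow> 'b mm \<Rightarrow> ennreal" where
  "box X Y = (INF \<iota> \<in> parameters X. INF \<kappa> \<in> parameters Y.
     Inf {ennreal \<epsilon> | \<epsilon>::real. 0 \<le> \<epsilon> \<and>
       (\<exists>I0 \<in> sets unit_interval_measure. measure lborel I0 \<ge> 1 - \<epsilon> \<and>
          (\<forall>s\<in>I0. \<forall>t\<in>I0. \<bar>mm_dist X (\<iota> s) (\<iota> t) - mm_dist Y (\<kappa> s) (\<kappa> t)\<bar> \<le> \<epsilon>))})"

text \<open>
  The functions compared below are only determined off a Lebesgue null set, where they need not be
  Borel; therefore the completed measure \<^const>\<open>lebesgue\<close> is used.
\<close>

definition ky_fan :: "(real \<Rightarrow> real) \<Rightarrow> (real \<Rightarrow> real) \<Rightarrow> ennreal" where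
  "ky_fan f g = Inf {ennreal \<epsilon> | \<epsilon>::real. 0 < \<epsilon> \<and>
     measure lebesgue {s \<in> {0..<1}. \<bar>f s - g s\<bar> > \<epsilon>} \<le> \<epsilon>}"

definition hausdorff_ky_fan :: "(real \<Rightarrow> real) set \<Rightarrow> (real \<Rightarrow> real) set \<Rightarrow> ennreal" where
  "hausdorff_ky_fan A B =
     max (SUP f\<in>A. INF g\<in>B. ky_fan f g) (SUP g\<in>B. INF f\<in>A. ky_fan f g)"

definition Lip1 :: "'a mm \<Rightarrow> ('a \<Rightarrow> real) set" where
  "Lip1 X = {f. \<forall>x \<in> mm_support X. \<forall>y \<in> mm_support X. \<bar>f x - f y\<bar> \<le> mm_dist X x y}"

definition d_conc :: "'a mm \<Rightarrow> 'b mm \<Rightarrow> ennreal" where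
  "d_conc X Y = (INF \<iota> \<in> parameters X. INF \<kappa> \<in> parameters Y.
     hausdorff_ky_fan ((\<lambda>f. f \<circ> \<iota>) ` Lip1 X) ((\<lambda>f. f \<circ> \<kappa>) ` Lip1 Y))"


section \<open>Pyramids and their convergence\<close>

definition box_class :: "real mm set \<Rightarrow> real mm set \<Rightarrow> ennreal" where
  "box_class A B = box (rep A) (rep B)"

definition pyramid :: "'a emm \<Rightarrow> real mm set set" where
  "pyramid X = {A \<in> mm_classes. emm_of_mm (rep A) \<prec>\<prec> X}"

definition box_closure :: "real mm set set \<Rightarrow> real mm set set" where
  "box_closure S = {A \<in> mm_classes. \<forall>\<epsilon>>0. \<exists>B\<in>S. box_class A B < \<epsilon>}"

definition box_liminf :: "(nat \<Rightarrow> real mm set set) \<Rightarrow> real mm set set" where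
  "box_liminf C = {A \<in> mm_classes.
     \<exists>B. (\<forall>n. B n \<in> C n) \<and> (\<lambda>n. box_class (B n) A) \<longlonglongrightarrow> 0}"

definition box_limsup :: "(nat \<Rightarrow> real mm set set) \<Rightarrow> real mm set set" where
  "box_limsup C = {A \<in> mm_classes.
     \<exists>n B. strict_mono n \<and> (\<forall>k. B k \<in> C (n k)) \<and> (\<lambda>k. box_class (B k) A) \<longlonglongrightarrow> 0}"

definition painleve_kuratowski ::
  "(nat \<Rightarrow> real mm set set) \<Rightarrow> real mm set set \<Rightarrow> bool" where
  "painleve_kuratowski C D \<longleftrightarrow> box_liminf C = D \<and> box_limsup C = D"

definition converges_tau_Pi :: "(nat \<Rightarrow> 'a emm) \<Rightarrow> 'b emm \<Rightarrow> bool" where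
  "converges_tau_Pi X Y \<longleftrightarrow> (\<forall>n. emm_space (X n)) \<and> emm_space Y \<and>
     painleve_kuratowski (\<lambda>n. box_closure (pyramid (X n))) (box_closure (pyramid Y))"


section \<open>The spaces\<close>

definition one_point_mm :: "unit mm" where
  "one_point_mm = \<lparr>mm_dist = (\<lambda>x y. 0), mm_measure = return (count_space UNIV) ()\<rparr>"

text \<open>
  The \<open>n\<close>-sphere lies in the Euclidean space of dimension \<open>n + 1\<close>, with coordinates indexed
  by \<open>{..n}\<close>. Its volume measure is the surface measure, normalised: the measure of \<open>A\<close> is
  proportional to the Lebesgue measure of the cone over \<open>A\<close> inside the ball, so that the
  normalised measure is the image of the uniform distribution on the unit ball under
  radial projection.
\<close>

definition sphere_set :: "nat \<Rightarrow> real \<Rightarrow> (nat \<Rightarrow> real) set" where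
  "sphere_set n r = {x \<in> {..n} \<rightarrow>\<^sub>E UNIV. (\<Sum>i\<le>n. (x i)\<^sup>2) = r\<^sup>2}"

definition sphere_geodesic_dist :: "nat \<Rightarrow> real \<Rightarrow> (nat \<Rightarrow> real) \<Rightarrow> (nat \<Rightarrow> real) \<Rightarrow> real" where
  "sphere_geodesic_dist n r x y =
     (if x \<in> sphere_set n r \<and> y \<in> sphere_set n r then r * arccos ((\<Sum>i\<le>n. x i * y i) / r\<^sup>2) else 0)"

definition euclidean_lebesgue :: "nat \<Rightarrow> (nat \<Rightarrow> real) measure" where
  "euclidean_lebesgue n = PiM {..n} (\<lambda>_. lborel)"

definition radial_projection :: "nat \<Rightarrow> real \<Rightarrow> (nat \<Rightarrow> real) \<Rightarrow> nat \<Rightarrow> real" where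
  "radial_projection n r x = (\<lambda>i\<in>{..n}. r * x i / sqrt (\<Sum>j\<le>n. (x j)\<^sup>2))"

definition sphere_measure :: "nat \<Rightarrow> real \<Rightarrow> (nat \<Rightarrow> real) measure" where
  "sphere_measure n r =
     restrict_space
       (distr
          (uniform_measure (euclidean_lebesgue n) {x \<in> {..n} \<rightarrow>\<^sub>E UNIV. (\<Sum>i\<le>n. (x i)\<^sup>2) \<le> 1})
          (euclidean_lebesgue n)
          (radial_projection n r))
       (sphere_set n r)"

definition sphere_mm :: "nat \<Rightarrow> real \<Rightarrow> (nat \<Rightarrow> real) mm" where
  "sphere_mm n r = \<lparr>mm_dist = sphere_geodesic_dist n r, mm_measure = sphere_measure n r\<rparr>"

text \<open>
  The topology \<^term>\<open>euclidean\<close> of \<^typ>\<open>nat \<Rightarrow> real\<close> is the product topology, and the second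
  parameter of \<^const>\<open>normal_density\<close> is the standard deviation.
\<close>

definition ell2_dist :: "(nat \<Rightarrow> real) \<Rightarrow> (nat \<Rightarrow> real) \<Rightarrow> ennreal" where
  "ell2_dist x y =
     (if summable (\<lambda>i. (x i - y i)\<^sup>2) then ennreal (sqrt (\<Sum>i. (x i - y i)\<^sup>2)) else \<infinity>)"

definition gamma_infinity :: "real \<Rightarrow> (nat \<Rightarrow> real) emm" where
  "gamma_infinity l =
     \<lparr>emm_top = euclidean, emm_dist = ell2_dist,
      emm_measure = PiM UNIV (\<lambda>_. density lborel (normal_density 0 l))\<rparr>"

definition I_infinity :: "real emm" where
  "I_infinity =
     \<lparr>emm_top = top_of_set {0..1}, emm_dist = (\<lambda>x y. if x = y then 0 else \<infinity>),
      emm_measure = restrict_space lborel {0..1}\<rparr>"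


section \<open>Abstract Wiener spaces\<close>

definition centred_gaussian_real :: "real measure \<Rightarrow> bool" where
  "centred_gaussian_real \<nu> \<longleftrightarrow>
     \<nu> = return borel 0 \<or> (\<exists>\<sigma>>0. \<nu> = density lborel (normal_density 0 \<sigma>))"

definition centred_gaussian :: "'w::real_normed_vector measure \<Rightarrow> bool" where
  "centred_gaussian \<mu> \<longleftrightarrow> prob_space \<mu> \<and> sets \<mu> = sets borel \<and>
     (\<forall>f::'w \<Rightarrow> real. bounded_linear f \<longrightarrow> centred_gaussian_real (distr \<mu> borel f))"

text \<open>The Cameron-Martin space of \<open>\<mu>\<close> consists of the vectors for which this is finite.\<close>

definition cameron_martin_norm :: "'w::real_normed_vector measure \<Rightarrow> 'w \<Rightarrow> ennreal" where
  "cameron_martin_norm \<mu> h =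
     (SUP f \<in> {f::'w \<Rightarrow> real. bounded_linear f \<and> (\<integral>\<^sup>+w. ennreal ((f w)\<^sup>2) \<partial>\<mu>) \<le> 1}. ennreal (f h))"

definition abstract_wiener_space ::
  "('h::{real_inner, polish_space} \<Rightarrow> 'w::{banach, polish_space}) \<Rightarrow> 'w measure \<Rightarrow> bool" where
  "abstract_wiener_space i \<mu> \<longleftrightarrow>
     bounded_linear i \<and> inj i \<and> closure (range i) = UNIV \<and>
     centred_gaussian \<mu> \<and>
     range i = {w. cameron_martin_norm \<mu> w < \<infinity>} \<and>
     (\<forall>h. cameron_martin_norm \<mu> (i h) = ennreal (norm h))"

definition wiener_emm ::
  "('h::{real_inner, polish_space} \<Rightarrow> 'w::{banach, polish_space}) \<Rightarrow> 'w measure \<Rightarrow> 'w emm" where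
  "wiener_emm i \<mu> =
     \<lparr>emm_top = euclidean,
      emm_dist = (\<lambda>w1 w2. if w1 - w2 \<in> range i then ennreal (norm (inv i (w1 - w2))) else \<infinity>),
      emm_measure = \<mu>\<rparr>"

end

theory Submission
  imports Defs
begin

text \<open>
	Convergence of pyramids is tested on the dominated spaces themselves. The radial projection of a
	Gaussian vector is uniformly distributed on the sphere, and by the law of large numbers its first
	coordinates are hardly moved when \<open>r\<^sub>n\<close> is close to \<open>\<lambda> \<surd>n\<close>. Hence a space dominated by
	\<open>\<Gamma>\<^sup>\<infinity>\<close> through a map of finitely many coordinates, and these suffice by freezing the other ones,
	is almost dominated by the spheres. Conversely the projection is almost 1-Lipschitz on a set of
	almost full measure, and McShane extensions of finitely many distance functions turn a map
	dominated by the sphere into one dominated by \<open>\<Gamma>\<^sup>\<infinity>\<close>. Large spheres dominate small ones, and Gaussian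
	measures of large variance dominate approximations of every mm-space, which gives \<open>I\<^sub>\<infinity>\<close>. For small
	radii the Prekopa-Leindler inequality on the ball gives concentration, following Arias-de-Reyna,
	Ball and Villa. In an abstract Wiener space, functionals whose Cameron-Martin representatives form an
	orthonormal sequence are independent and give an isometry onto \<open>\<Gamma>\<^sup>\<infinity>\<close> up to null sets.
\<close>

text \<open>Arcs and chords shape the Gaussian case. One direction is exact: a chord is never longer
  than its arc, so a map that is 1-Lipschitz in finitely many coordinates is 1-Lipschitz for the
  geodesic distance as it stands, and only its law has to be corrected. In the other direction arcs
  exceed chords, by the factor pi / 2 at antipodes however large the sphere is. What helps is that
  the target is close to a fixed space Z, so most of it has a diameter bounded independently of n;
  at distances small against \<open>r n\<close> arc and chord agree up to a factor tending to 1.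
  Hence the test for upper limits concerns dominated spaces in a box neighbourhood of one Z. The
  remaining Lipschitz constant c > 1 is removed by dividing distance functions by c, at the cost of
  the diameter times c - 1. For Wiener spaces the Hilbert structure is recovered from the
  Cameron-Martin norm: it controls Bochner integrals over compact sets, whose limit represents a
  functional, and its vanishing separates points. Joint laws are found one coordinate at a time,
  turning characters into indicators by uniqueness on the line.\<close>

abbreviation (input) U01 :: "real measure" where
	"U01 \<equiv> unit_interval_measure"

abbreviation leb :: "nat \<Rightarrow> (nat \<Rightarrow> real) measure" where
	"leb \<equiv> euclidean_lebesgue"

abbreviation geo :: "nat \<Rightarrow> real \<Rightarrow> (nat \<Rightarrow> real) \<Rightarrow> (nat \<Rightarrow> real) \<Rightarrow> real" where
	"geo \<equiv> sphere_geodesic_dist"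

section \<open>Parameters\<close>

text \<open>Ternary expansions with digits 0 and 2 are unique, so a bit sequence can be read back
  from its code. The threshold 1/2 lies in the middle gap of the Cantor set, and decoding is a total
  Borel function on the line.\<close>

fun ternary_decode :: "real \<Rightarrow> nat \<Rightarrow> bool" where
	"ternary_decode t 0 \<longleftrightarrow> t \<ge> 1/2"
| "ternary_decode t (Suc k) = ternary_decode (3 * t - 2 * of_bool (t \<ge> 1/2)) k"

definition ternary_code :: "(nat \<Rightarrow> bool) \<Rightarrow> real" where
	"ternary_code b = (\<Sum>k. 2 * of_bool (b k) / 3 ^ Suc k)"

lemma ternary_summable: "summable (\<lambda>k. 2 * of_bool (b k) / 3 ^ Suc k :: real)"
proof (rule summable_comparison_test')
	show "summable (\<lambda>k. (2/3) * (1/3) ^ k :: real)"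
		by (intro summable_mult summable_geometric) auto
	show "norm (2 * of_bool (b k) / 3 ^ Suc k :: real) \<le> (2/3) * (1/3) ^ k" if "k \<ge> 0" for k
		by (cases "b k") (auto simp: power_divide)
qed

lemma ternary_code_bounds: "0 \<le> ternary_code b" "ternary_code b \<le> 1"
proof -
	show "0 \<le> ternary_code b"
		unfolding ternary_code_def by (intro suminf_nonneg ternary_summable) auto
	have "ternary_code b \<le> (\<Sum>k. (2/3) * (1/3) ^ k :: real)"
		unfolding ternary_code_def
	proof (intro suminf_le ternary_summable)
		show "summable (\<lambda>k. (2/3) * (1/3) ^ k :: real)"
			by (intro summable_mult summable_geometric) auto
		show "2 * of_bool (b k) / 3 ^ Suc k \<le> (2/3 :: real) * (1/3) ^ k" for k
			by (cases "b k") (auto simp: power_divide)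
	qed
	also have "\<dots> = 1"
		by (subst suminf_mult) (auto simp: suminf_geometric)
	finally show "ternary_code b \<le> 1" .
qed

lemma ternary_code_rec: "3 * ternary_code b = 2 * of_bool (b 0) + ternary_code (\<lambda>k. b (Suc k))"
proof -
	have "ternary_code b = (\<Sum>k. 2 * of_bool (b (Suc k)) / 3 ^ Suc (Suc k)) + 2 * of_bool (b 0) / 3"
		unfolding ternary_code_def using suminf_split_head[OF ternary_summable[of b]] by simp
	also have "(\<Sum>k. 2 * of_bool (b (Suc k)) / 3 ^ Suc (Suc k)) = (\<Sum>k. (1/3) * (2 * of_bool (b (Suc k)) / 3 ^ Suc k :: real))"
		by (intro suminf_cong) auto
	also have "\<dots> = (1/3) * ternary_code (\<lambda>k. b (Suc k))"
		unfolding ternary_code_def by (intro suminf_mult ternary_summable)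
	finally show ?thesis by simp
qed

lemma ternary_decode_code: "ternary_decode (ternary_code b) k = b k"
proof (induction k arbitrary: b)
	case 0
	show ?case
		using ternary_code_rec[of b] ternary_code_bounds[of "\<lambda>k. b (Suc k)"] by (cases "b 0") auto
next
	case (Suc k)
	have "(ternary_code b \<ge> 1/2) = b 0"
		using ternary_code_rec[of b] ternary_code_bounds[of "\<lambda>k. b (Suc k)"] by (cases "b 0") auto
	then have "3 * ternary_code b - 2 * of_bool (ternary_code b \<ge> 1/2) = ternary_code (\<lambda>k. b (Suc k))"
		using ternary_code_rec[of b] by simp
	then show ?case using Suc.IH[of "\<lambda>k. b (Suc k)"] by simp
qed

lemma measurable_ternary_decode [measurable]: "(\<lambda>t. ternary_decode t k) \<in> borel \<rightarrow>\<^sub>M count_space UNIV"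
proof (induction k)
	case 0 then show ?case by simp
next
	case (Suc k)
	have "(\<lambda>t. 3 * t - 2 * of_bool (t \<ge> 1/2) :: real) \<in> borel_measurable borel" by measurable
	from measurable_compose[OF this Suc.IH] show ?case by simp
qed

lemma measurable_ternary_code:
	assumes [measurable]: "\<And>k. Measurable.pred N (\<lambda>x. b x k)"
	shows "(\<lambda>x. ternary_code (b x)) \<in> borel_measurable N"
	unfolding ternary_code_def by measurable

text \<open>M is a measurable retract of the line. Only the sigma-algebra enters, so one code serves
  all probability measures on it.\<close>

definition real_coded :: "'a measure \<Rightarrow> bool" where
	"real_coded M \<longleftrightarrow> (\<exists>e \<in> M \<rightarrow>\<^sub>M borel. \<exists>h \<in> borel \<rightarrow>\<^sub>M M. \<forall>x \<in> space M. h (e x :: real) = x)"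

lemma real_coded_cong: "sets M = sets N \<Longrightarrow> real_coded M \<Longrightarrow> real_coded N"
	unfolding real_coded_def
	using measurable_cong_sets[of M N "borel :: real measure" borel] measurable_cong_sets[of "borel :: real measure" borel M N]
		sets_eq_imp_space_eq[of M N] by auto

section \<open>Measurability, completeness and coding in an mm-space\<close>

locale mm_sp =
	fixes X :: "'a mm"
	assumes mm: "mm_space X"
begin

abbreviation "C \<equiv> mm_carrier X"
abbreviation "D \<equiv> mm_dist X"
abbreviation "M \<equiv> mm_measure X"

sublocale Metric_space C D
	using mm by (simp add: mm_space_def)

sublocale P: prob_space M
	using mm by (simp add: mm_space_def)

lemma top_eq: "mm_top X = mtopology" by (simp add: mm_top_def)

lemma mcomplete: "mcomplete"
	using mm by (simp add: mm_space_def)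

lemma sets_M: "sets M = sigma_sets C {U. openin mtopology U}"
	using mm by (simp add: mm_space_def borel_sets_of_def top_eq)

lemma open_sets: "openin mtopology U \<Longrightarrow> U \<in> sets M"
	by (auto simp: sets_M)

lemma dense_sequence:
	obtains q :: "nat \<Rightarrow> 'a" where "\<And>j. q j \<in> C" "\<And>x r. x \<in> C \<Longrightarrow> r > 0 \<Longrightarrow> \<exists>j. D (q j) x < r"
proof -
	obtain Q where Q: "countable Q" "Q \<subseteq> C" "mtopology closure_of Q = C"
		using mm by (auto simp: mm_space_def separable_space_def top_eq)
	have "Q \<noteq> {}" using Q(3) P.not_empty by auto
	show thesis
	proof (rule that[of "from_nat_into Q"])
		show "from_nat_into Q j \<in> C" for j
			using from_nat_into[OF \<open>Q \<noteq> {}\<close>] Q by auto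
		fix x and r :: real assume "x \<in> C" "r > 0"
		then obtain y where "y \<in> Q" "D x y < r"
			using Q(3) by (auto simp: metric_closure_of)
		then show "\<exists>j. D (from_nat_into Q j) x < r"
			using from_nat_into_surj[OF Q(1) \<open>y \<in> Q\<close>] by (metis commute)
	qed
qed

lemma measurable_dist_point:
	assumes [measurable]: "f \<in> N \<rightarrow>\<^sub>M M" and c: "c \<in> C"
	shows "(\<lambda>w. D c (f w)) \<in> borel_measurable N"
	unfolding borel_measurable_iff_less
proof
	fix a
	have "{w \<in> space N. D c (f w) < a} = f -` mball c a \<inter> space N"
		using c measurable_space[OF assms(1)] by auto
	also have "\<dots> \<in> sets N" by (intro measurable_sets[OF assms(1)] open_sets openin_mball)
	finally show "{w \<in> space N. D c (f w) < a} \<in> sets N" .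
qed

text \<open>The distance of two moving points is the infimum, over a dense sequence, of the sum of
  their distances to a fixed point; this reduces joint measurability to countably many distances to
  points.\<close>

lemma measurable_dist:
	assumes [measurable]: "f \<in> N \<rightarrow>\<^sub>M M" "g \<in> N \<rightarrow>\<^sub>M M"
	shows "(\<lambda>w. D (f w) (g w)) \<in> borel_measurable N"
	unfolding borel_measurable_iff_less
proof
	fix a
	obtain q :: "nat \<Rightarrow> 'a" where q: "\<And>j. q j \<in> C" "\<And>x r. x \<in> C \<Longrightarrow> r > 0 \<Longrightarrow> \<exists>j. D (q j) x < r"
		by (rule dense_sequence) blast
	have [measurable]: "(\<lambda>w. D (q j) (f w)) \<in> borel_measurable N" "(\<lambda>w. D (q j) (g w)) \<in> borel_measurable N" for j
		by (auto intro: measurable_dist_point q assms)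
	have "(D (f w) (g w) < a) \<longleftrightarrow> (\<exists>j. D (q j) (f w) + D (q j) (g w) < a)" if "w \<in> space N" for w
	proof
		have fg: "f w \<in> C" "g w \<in> C" using that measurable_space[OF assms(1)] measurable_space[OF assms(2)] by auto
		assume "D (f w) (g w) < a"
		then obtain j where "D (q j) (f w) < (a - D (f w) (g w)) / 2"
			using q(2)[OF fg(1), of "(a - D (f w) (g w)) / 2"] by auto
		moreover have "D (q j) (g w) \<le> D (q j) (f w) + D (f w) (g w)" using fg q by (auto intro: triangle)
		ultimately show "\<exists>j. D (q j) (f w) + D (q j) (g w) < a"
			by (intro exI[of _ j]) (auto simp: field_simps)
	next
		have fg: "f w \<in> C" "g w \<in> C" using that measurable_space[OF assms(1)] measurable_space[OF assms(2)] by auto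
		assume "\<exists>j. D (q j) (f w) + D (q j) (g w) < a"
		then obtain j where "D (q j) (f w) + D (q j) (g w) < a" by auto
		moreover have "D (f w) (g w) \<le> D (q j) (f w) + D (q j) (g w)"
			using triangle[of "f w" "q j" "g w"] fg q by (auto simp: commute)
		ultimately show "D (f w) (g w) < a" by simp
	qed
	then have "{w \<in> space N. D (f w) (g w) < a} = {w \<in> space N. \<exists>j. D (q j) (f w) + D (q j) (g w) < a}"
		by auto
	also have "\<dots> \<in> sets N" by measurable
	finally show "{w \<in> space N. D (f w) (g w) < a} \<in> sets N" .
qed

text \<open>Balls of radius 1 / (l + 1) around a dense sequence form a countable base, so distances
  to points detect measurability.\<close>

lemma measurable_into:
	assumes f: "f \<in> space N \<rightarrow> C" and meas: "\<And>c. c \<in> C \<Longrightarrow> (\<lambda>w. D c (f w)) \<in> borel_measurable N"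
	shows "f \<in> N \<rightarrow>\<^sub>M M"
proof (rule measurable_sigma_sets[OF sets_M _ f])
	show "{U. openin mtopology U} \<subseteq> Pow C" using openin_subset[of mtopology] by auto
	fix U assume "U \<in> {U. openin mtopology U}"
	then have U: "openin mtopology U" by simp
	obtain q :: "nat \<Rightarrow> 'a" where q: "\<And>j. q j \<in> C" "\<And>x r. x \<in> C \<Longrightarrow> r > 0 \<Longrightarrow> \<exists>j. D (q j) x < r"
		by (rule dense_sequence) blast
	have [measurable]: "(\<lambda>w. D (q j) (f w)) \<in> borel_measurable N" for j
		by (rule meas) (rule q)
	let ?I = "{(j, l). mball (q j) (1 / real (Suc l)) \<subseteq> U}"
	have "f -` U \<inter> space N = (\<Union>(j, l)\<in>?I. {w \<in> space N. D (q j) (f w) < 1 / real (Suc l)})" (is "?L = ?R")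
	proof (intro equalityI subsetI)
		fix w assume w: "w \<in> ?L"
		then have "f w \<in> U" by simp
		then have "f w \<in> C" "\<exists>r>0. mball (f w) r \<subseteq> U"
			using U by (auto simp only: openin_mtopology)
		then obtain r where r: "r > 0" "mball (f w) r \<subseteq> U" "f w \<in> C" by blast
		obtain l where l: "1 / real (Suc l) < r / 2"
			using r(1) nat_approx_posE[of "r/2"] by auto
		obtain j where j: "D (q j) (f w) < 1 / real (Suc l)" using q(2)[OF r(3), of "1 / real (Suc l)"] by auto
		have "mball (q j) (1 / real (Suc l)) \<subseteq> mball (f w) r"
		proof
			fix z assume z: "z \<in> mball (q j) (1 / real (Suc l))"
			then have "D (f w) z \<le> D (q j) (f w) + D (q j) z"
				using triangle[of "f w" "q j" z] r(3) by (auto simp: commute)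
			with z j l show "z \<in> mball (f w) r" using r(3) by auto
		qed
		then show "w \<in> ?R" using j r w by blast
	next
		fix w assume "w \<in> ?R"
		then obtain j l where "mball (q j) (1 / real (Suc l)) \<subseteq> U" "w \<in> space N" "D (q j) (f w) < 1 / real (Suc l)"
			by blast
		moreover have "q j \<in> C" "f w \<in> C" using q(1) f \<open>w \<in> space N\<close> by auto
		ultimately show "w \<in> ?L" by auto
	qed
	also have "\<dots> \<in> sets N"
		by (intro sets.countable_UN') (auto intro: countable_subset[OF subset_UNIV])
	finally show "f -` U \<inter> space N \<in> sets N" .
qed

text \<open>The form of completeness used twice: to decode a point from its approximations, and to
  extend a Lipschitz map from a dense set. The bound in the induction is the partial sum of the
  geometric series 2 / 2^j starting at l.\<close>

lemma summable_dist_limit: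
	assumes a: "\<And>l. a l \<in> C" "\<And>l. D (a l) (a (Suc l)) \<le> 2 / 2 ^ l"
	shows "\<exists>x. limitin mtopology a x sequentially"
proof -
	have *: "D (a l) (a (l + m)) \<le> 4 / 2 ^ l - 4 / 2 ^ (l + m)" for l m
	proof (induction m)
		case 0 then show ?case using a by simp
	next
		case (Suc m)
		have "D (a l) (a (l + Suc m)) \<le> D (a l) (a (l + m)) + D (a (l + m)) (a (l + Suc m))"
			using a by (intro triangle) auto
		also have "\<dots> \<le> (4 / 2 ^ l - 4 / 2 ^ (l + m)) + 2 / 2 ^ (l + m)"
			using a(2)[of "l + m"] Suc by (intro add_mono) auto
		finally show ?case by simp
	qed
	have "MCauchy a"
		unfolding MCauchy_def
	proof (intro conjI allI impI)
		show "range a \<subseteq> C" using a by auto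
		fix e :: real assume "e > 0"
		then obtain N where N: "4 * (1/2) ^ N < e"
			using real_arch_pow_inv[of "e/4" "1/2"] \<open>e > 0\<close> by (auto simp: mult.commute)
		have "D (a n) (a n') < e" if "N \<le> n" "n \<le> n'" for n n'
		proof -
			have "D (a n) (a n') \<le> 4 / 2 ^ n - 4 / 2 ^ n'" using *[of n "n' - n"] that by simp
			also have "\<dots> \<le> 4 * (1/2) ^ n" by (simp add: power_divide)
			also have "\<dots> \<le> 4 * (1/2) ^ N" using that by (intro mult_left_mono power_decreasing) auto
			finally show ?thesis using N by simp
		qed
		then show "\<exists>N. \<forall>n n'. N \<le> n \<longrightarrow> N \<le> n' \<longrightarrow> D (a n) (a n') < e"
			by (metis commute nle_le)
	qed
	then show ?thesis using mcomplete unfolding mcomplete_def by blast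
qed

lemma limit_dist:
	assumes "limitin mtopology a x sequentially" "\<And>l. a l \<in> C" "c \<in> C"
	shows "(\<lambda>l. D c (a l)) \<longlonglongrightarrow> D c x"
proof -
	have x: "x \<in> C" using assms(1) by (simp add: limitin_metric)
	have lim: "(\<lambda>l. D (a l) x) \<longlonglongrightarrow> 0"
	proof (rule tendstoI)
		fix e :: real assume "e > 0"
		then have "\<forall>\<^sub>F l in sequentially. a l \<in> C \<and> D (a l) x < e"
			using assms(1) by (simp add: limitin_metric)
		then show "\<forall>\<^sub>F l in sequentially. dist (D (a l) x) 0 < e"
			by eventually_elim simp
	qed
	have "\<bar>D c (a l) - D c x\<bar> \<le> D (a l) x" for l
		using triangle[OF assms(3) assms(2)[of l] x] triangle[OF assms(3) x assms(2)[of l]] commute[of x "a l"]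
		by linarith
	then have "\<forall>\<^sub>F l in sequentially. norm (D c (a l) - D c x) \<le> D (a l) x"
		by simp
	then have "(\<lambda>l. D c (a l) - D c x) \<longlonglongrightarrow> 0"
		by (rule Lim_null_comparison) (rule lim)
	then show ?thesis by (rule LIM_zero_cancel)
qed

text \<open>A point is coded by the bits telling whether \<open>q j\<close> is closer to it than 1 /
  2^l. Decoding takes for each l the first such j and passes to the limit of the chosen
  points.\<close>

lemma real_coded: "real_coded M"
proof -
	obtain q :: "nat \<Rightarrow> 'a" where q: "\<And>j. q j \<in> C" "\<And>x r. x \<in> C \<Longrightarrow> r > 0 \<Longrightarrow> \<exists>j. D (q j) x < r"
		by (rule dense_sequence) blast
	define near where "near x k \<longleftrightarrow> D (q (fst (prod_decode k))) x < 1 / 2 ^ snd (prod_decode k)" for x k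
	define e where "e x = ternary_code (near x)" for x
	have Dq: "(\<lambda>x. D (q j) x) \<in> borel_measurable M" for j
		using measurable_dist_point[of "\<lambda>x. x" M "q j"] q(1) by simp
	have "Measurable.pred M (\<lambda>x. near x k)" for k
		unfolding near_def pred_def by (rule borel_measurable_less[OF Dq borel_measurable_const])
	then have e: "e \<in> borel_measurable M"
		unfolding e_def by (rule measurable_ternary_code)
	define idx where "idx l t = (LEAST j. ternary_decode t (prod_encode (j, l)))" for l t
	define a where "a l t = q (idx l t)" for l t
	have [measurable]: "idx l \<in> borel \<rightarrow>\<^sub>M count_space UNIV" for l
		unfolding idx_def by measurable
	have [measurable]: "a l \<in> borel \<rightarrow>\<^sub>M M" for l
	proof -
		have "q \<in> count_space UNIV \<rightarrow>\<^sub>M M" using q(1) by auto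
		then show ?thesis unfolding a_def by measurable
	qed
	have aC: "a l t \<in> C" for l t by (simp add: a_def q(1))
	\<comment> \<open>Most reals are not codes. G is a Borel set on which the decoded points converge,
	  and it contains all codes because 1 / 2^l + 1 / 2^(l+1) is at most 2 / 2^l; elsewhere h is the
	  constant \<open>q 0\<close>.\<close>
	define G where "G = {t. \<forall>l. D (a l t) (a (Suc l) t) \<le> 2 / 2 ^ l}"
	have [measurable]: "(\<lambda>t. D (a l t) (a (Suc l) t)) \<in> borel_measurable borel" for l
		by (rule measurable_dist) measurable
	have G: "G \<in> sets borel" unfolding G_def by measurable
	define lm where "lm t = (SOME x. limitin mtopology (\<lambda>l. a l t) x sequentially)" for t
	have lm: "limitin mtopology (\<lambda>l. a l t) (lm t) sequentially" if "t \<in> G" for t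
		unfolding lm_def by (rule someI_ex, rule summable_dist_limit) (use that aC in \<open>auto simp: G_def\<close>)
	define h where "h t = (if t \<in> G then lm t else q 0)" for t
	have hC: "h t \<in> C" for t
		using lm[of t] q(1) by (auto simp: h_def limitin_metric)
	have "h \<in> borel \<rightarrow>\<^sub>M M"
	proof (rule measurable_into)
		show "h \<in> space borel \<rightarrow> C" using hC by auto
		fix c assume c: "c \<in> C"
		show "(\<lambda>w. D c (h w)) \<in> borel_measurable borel"
		proof (rule borel_measurable_LIMSEQ_real)
			fix t
			show "(\<lambda>l. if t \<in> G then D c (a l t) else D c (q 0)) \<longlonglongrightarrow> D c (h t)"
				using limit_dist[OF lm aC c, of t] by (simp add: h_def)
		next
			fix l
			have [measurable]: "(\<lambda>t. D c (a l t)) \<in> borel_measurable borel"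
				by (rule measurable_dist_point[OF _ c]) measurable
			show "(\<lambda>t. if t \<in> G then D c (a l t) else D c (q 0)) \<in> borel_measurable borel"
				using G by measurable
		qed
	qed
	moreover have "h (e x) = x" if x: "x \<in> C" for x
	proof -
		have near: "D (a l (e x)) x < 1 / 2 ^ l" for l
		proof -
			obtain j where "D (q j) x < 1 / 2 ^ l" using q(2)[OF x, of "1 / 2 ^ l"] by auto
			then have "ternary_decode (e x) (prod_encode (j, l))"
				by (simp add: e_def ternary_decode_code near_def)
			then have "ternary_decode (e x) (prod_encode (idx l (e x), l))"
				unfolding idx_def by (rule LeastI)
			then show ?thesis by (simp add: e_def ternary_decode_code near_def a_def)
		qed
		have "D (a l (e x)) (a (Suc l) (e x)) \<le> 2 / 2 ^ l" for l
		proof -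
			have "D (a l (e x)) (a (Suc l) (e x)) \<le> D (a l (e x)) x + D (a (Suc l) (e x)) x"
				using triangle[of "a l (e x)" x "a (Suc l) (e x)"] aC x by (simp add: commute)
			also have "\<dots> \<le> 1 / 2 ^ l + 1 / 2 ^ l"
				using near[of l] near[of "Suc l"] by (intro add_mono) (auto simp: field_simps intro: less_imp_le order.strict_trans)
			finally show ?thesis by simp
		qed
		then have G': "e x \<in> G" by (simp add: G_def)
		have "limitin mtopology (\<lambda>l. a l (e x)) x sequentially"
			unfolding limitin_metric
		proof (intro conjI allI impI x)
			fix \<epsilon> :: real assume "\<epsilon> > 0"
			then obtain N where N: "(1/2) ^ N < \<epsilon>" using real_arch_pow_inv[of "\<epsilon>" "1/2"] by auto
			have "D (a l (e x)) x < \<epsilon>" if "l \<ge> N" for l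
			proof -
				have "D (a l (e x)) x < (1/2) ^ l" using near[of l] by (simp add: power_divide)
				also have "\<dots> \<le> (1/2) ^ N" using that by (intro power_decreasing) auto
				finally show ?thesis using N by simp
			qed
			then show "\<forall>\<^sub>F l in sequentially. a l (e x) \<in> C \<and> D (a l (e x)) x < \<epsilon>"
				using aC by (auto simp: eventually_sequentially)
		qed
		from limitin_metric_unique[OF lm[OF G'] this] show ?thesis using G' by (simp add: h_def)
	qed
	ultimately show ?thesis using e unfolding real_coded_def by blast
qed

end

section \<open>Parameters from quantile functions\<close>

lemma prob_space_unit: "prob_space U01"
	by (auto simp: emeasure_restrict_space intro!: prob_spaceI)

text \<open>The quantile function. Its adjunction with the distribution function is recorded because
  it later inverts an atomless distribution function and produces medians.\<close>

lemma real_param_quantile: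
	fixes \<nu> :: "real measure"
	assumes "prob_space \<nu>" "sets \<nu> = sets borel"
	shows "\<exists>q \<in> borel_measurable U01. distr U01 borel q = \<nu> \<and>
		(\<forall>s\<in>{0<..<1}. \<forall>x. s \<le> cdf \<nu> x \<longleftrightarrow> q s \<le> x)"
proof -
	interpret prob_space \<nu> by fact
	interpret cdf_distribution \<nu>
		using assms by (simp add: cdf_distribution_def real_distribution_def real_distribution_axioms_def sets_eq_imp_space_eq)
	\<comment> \<open>The pseudo-inverse of the distribution function is controlled on the open
	  interval only; at the null point 0 the value is set to 0.\<close>
	let ?q = "\<lambda>t. if t \<in> {0<..<1} then I t else 0"
	have "?q \<in> borel_measurable borel"
		by (rule measurable_restrict_space_iff[THEN iffD1, OF _ _ measurable_CI]) auto
	then have q: "?q \<in> borel_measurable lborel" by (simp only: measurable_lborel2)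
	have "distr U01 borel ?q = distr (restrict_space lborel {0<..<1}) borel I"
	proof (rule measure_eqI)
		fix A assume "A \<in> sets (distr U01 borel ?q)"
		then have [measurable]: "A \<in> sets borel" by simp
		have "emeasure (distr U01 borel ?q) A = emeasure lborel (?q -` A \<inter> {0..<1})"
			by (subst emeasure_distr[OF measurable_restrict_space1[OF q]]) (auto simp: emeasure_restrict_space)
		also have "\<dots> = emeasure lborel (?q -` A \<inter> {0<..<1})"
		proof (rule emeasure_eq_AE)
			show "AE x in lborel. (x \<in> ?q -` A \<inter> {0..<1}) = (x \<in> ?q -` A \<inter> {0<..<1})"
				using AE_lborel_singleton[of 0] by eventually_elim auto
			have *: "?q -` A \<in> sets lborel" using measurable_sets[OF q, of A] by simp
			show "?q -` A \<inter> {0..<1} \<in> sets lborel" "?q -` A \<inter> {0<..<1} \<in> sets lborel"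
				using * by auto
		qed
		also have "?q -` A \<inter> {0<..<1} = I -` A \<inter> {0<..<1}" by auto
		also have "emeasure lborel \<dots> = emeasure (distr (restrict_space lborel {0<..<1}) borel I) A"
			using measurable_CI
			by (subst emeasure_distr) (auto simp: emeasure_restrict_space space_restrict_space cong: measurable_cong_sets sets_restrict_space_cong)
		finally show "emeasure (distr U01 borel ?q) A = emeasure (distr (restrict_space lborel {0<..<1}) borel I) A" .
	qed simp
	then have "distr U01 borel ?q = \<nu>" unfolding distr_I_eq_M .
	moreover have "\<forall>s\<in>{0<..<1}. \<forall>x. s \<le> cdf \<nu> x \<longleftrightarrow> ?q s \<le> x"
	proof (intro ballI allI)
		fix s x :: real assume s: "s \<in> {0<..<1}"
		show "s \<le> cdf \<nu> x \<longleftrightarrow> ?q s \<le> x" unfolding if_P[OF s] by (rule pseudoinverse'[rule_format, OF s])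
	qed
	ultimately show ?thesis
		by (intro bexI[OF _ measurable_restrict_space1[OF q]] conjI)
qed

text \<open>Send the measure to the line by the code, take the quantile function there, and
  decode.\<close>

lemma real_coded_param:
	assumes "real_coded M" "prob_space M"
	shows "\<exists>\<theta> \<in> U01 \<rightarrow>\<^sub>M M. distr U01 M \<theta> = M"
proof -
	interpret prob_space M by fact
	obtain e h where [measurable]: "e \<in> M \<rightarrow>\<^sub>M borel" "h \<in> borel \<rightarrow>\<^sub>M M" and he: "\<And>x. x \<in> space M \<Longrightarrow> h (e x :: real) = x"
		using assms unfolding real_coded_def by blast
	obtain q where q[measurable]: "q \<in> borel_measurable U01" "distr U01 borel q = distr M borel e"
		using real_param_quantile[of "distr M borel e"] prob_space_distr[of e borel] by auto
	have "distr U01 M (h \<circ> q) = distr (distr U01 borel q) M h"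
		by (subst distr_distr) auto
	also have "\<dots> = distr M M (h \<circ> e)"
		unfolding q(2) by (subst distr_distr) auto
	also have "\<dots> = distr M M (\<lambda>x. x)"
		by (rule distr_cong) (auto simp: he)
	finally show ?thesis
		by (intro bexI[of _ "h \<circ> q"]) (auto simp: distr_id2)
qed

lemma real_coded_pair:
	assumes "real_coded (borel \<Otimes>\<^sub>M borel :: (real \<times> real) measure)" "real_coded M" "real_coded N"
	shows "real_coded (M \<Otimes>\<^sub>M N)"
proof -
	obtain e h where [measurable]: "e \<in> M \<rightarrow>\<^sub>M borel" "h \<in> borel \<rightarrow>\<^sub>M M" and he: "\<And>x. x \<in> space M \<Longrightarrow> h (e x :: real) = x"
		using assms unfolding real_coded_def by blast
	obtain e' h' where [measurable]: "e' \<in> N \<rightarrow>\<^sub>M borel" "h' \<in> borel \<rightarrow>\<^sub>M N" and he': "\<And>x. x \<in> space N \<Longrightarrow> h' (e' x :: real) = x"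
		using assms unfolding real_coded_def by blast
	obtain E H where [measurable]: "E \<in> (borel \<Otimes>\<^sub>M borel :: (real \<times> real) measure) \<rightarrow>\<^sub>M borel" "H \<in> borel \<rightarrow>\<^sub>M (borel \<Otimes>\<^sub>M borel)"
		and HE: "\<And>x. x \<in> space (borel \<Otimes>\<^sub>M borel) \<Longrightarrow> H (E x :: real) = x"
		using assms(1) unfolding real_coded_def by blast
	have 1: "(\<lambda>(x, y). E (e x, e' y)) \<in> (M \<Otimes>\<^sub>M N) \<rightarrow>\<^sub>M borel" by measurable
	have 2: "(\<lambda>t. (h (fst (H t)), h' (snd (H t)))) \<in> borel \<rightarrow>\<^sub>M (M \<Otimes>\<^sub>M N)" by measurable
	show ?thesis
		unfolding real_coded_def
		by (intro bexI[OF _ 1] bexI[OF _ 2]) (auto simp: space_pair_measure HE he he')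
qed

lemma mm_space_polish:
	fixes M :: "'a::polish_space measure"
	assumes "prob_space M" "sets M = sets borel"
	shows "mm_space \<lparr>mm_dist = dist, mm_measure = M\<rparr>"
proof -
	have sp: "space M = UNIV" using sets_eq_imp_space_eq[OF assms(2)] by simp
	have "separable_space (euclidean :: 'a topology)"
	proof -
		obtain Q :: "'a set" where "countable Q" "\<And>X. open X \<Longrightarrow> X \<noteq> {} \<Longrightarrow> \<exists>d\<in>Q. d \<in> X"
			by (rule countable_dense_setE) blast
		then show ?thesis
			unfolding separable_space_def
			by (intro exI[of _ Q]) (auto simp: closure_of_def)
	qed
	moreover have "Met_TC.mcomplete TYPE('a)"
		unfolding Met_TC.mcomplete_def by (auto dest: Cauchy_convergent simp: convergent_def)
	ultimately show ?thesis
		using assms Met_TC.Metric_space_axioms unfolding mm_space_def mm_top_def borel_sets_of_def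
		by (simp add: sp borel_def)
qed

text \<open>A point mass turns the Polish space into an mm-space; since codes depend on the
  sigma-algebra alone, this settles every measure on the Borel sets.\<close>

lemma real_coded_borel: "sets M = sets (borel :: 'a::polish_space measure) \<Longrightarrow> real_coded M"
proof -
	assume M: "sets M = sets borel"
	let ?R = "return borel (undefined :: 'a)"
	have "mm_sp \<lparr>mm_dist = dist, mm_measure = ?R\<rparr>"
		by (simp add: mm_sp_def mm_space_polish prob_space_return)
	from mm_sp.real_coded[OF this] show ?thesis
		by (rule real_coded_cong[rotated]) (simp add: M)
qed

lemma real_coded_unit: "real_coded U01"
	unfolding real_coded_def
proof (intro bexI ballI)
	show "(\<lambda>t. if t \<in> {0..<1} then t else 0) \<in> borel \<rightarrow>\<^sub>M U01"
		by (rule measurable_restrict_space2) (auto simp: measurable_lborel1)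
	show "(\<lambda>x. x) \<in> borel_measurable U01"
		by (rule measurable_restrict_space1) simp
qed auto

lemma real_coded_unit_pair: "real_coded (U01 \<Otimes>\<^sub>M U01)"
	by (rule real_coded_pair[OF real_coded_borel real_coded_unit real_coded_unit]) (rule arg_cong[OF borel_prod])

lemma (in mm_sp) parameters_nonempty: "parameters X \<noteq> {}"
	using real_coded_param[OF real_coded P.prob_space_axioms] by (auto simp: parameters_def)

section \<open>The box distance\<close>

lemma box_lessD:
	assumes "box X Y < ennreal e"
	obtains \<iota> \<kappa> I0 \<epsilon> where "\<iota> \<in> parameters X" "\<kappa> \<in> parameters Y" "I0 \<in> sets U01"
		"0 \<le> \<epsilon>" "\<epsilon> < e" "measure lborel I0 \<ge> 1 - \<epsilon>"
		"\<And>s t. s \<in> I0 \<Longrightarrow> t \<in> I0 \<Longrightarrow> \<bar>mm_dist X (\<iota> s) (\<iota> t) - mm_dist Y (\<kappa> s) (\<kappa> t)\<bar> \<le> \<epsilon>"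
proof -
	obtain \<iota> \<kappa> where k: "\<iota> \<in> parameters X" "\<kappa> \<in> parameters Y"
		"Inf {ennreal \<epsilon> | \<epsilon>::real. 0 \<le> \<epsilon> \<and>
			 (\<exists>I0 \<in> sets U01. measure lborel I0 \<ge> 1 - \<epsilon> \<and>
					(\<forall>s\<in>I0. \<forall>t\<in>I0. \<bar>mm_dist X (\<iota> s) (\<iota> t) - mm_dist Y (\<kappa> s) (\<kappa> t)\<bar> \<le> \<epsilon>))} < ennreal e"
		using assms unfolding box_def INF_less_iff by blast
	from k(3) obtain \<epsilon> I0 where e: "ennreal \<epsilon> < ennreal e" "0 \<le> \<epsilon>" "I0 \<in> sets U01" "measure lborel I0 \<ge> 1 - \<epsilon>"
		"\<forall>s\<in>I0. \<forall>t\<in>I0. \<bar>mm_dist X (\<iota> s) (\<iota> t) - mm_dist Y (\<kappa> s) (\<kappa> t)\<bar> \<le> \<epsilon>"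
		unfolding Inf_less_iff by blast
	have "\<epsilon> < e" using e(1,2) by (simp add: ennreal_less_iff)
	with k e that show thesis by blast
qed

lemma box_leI:
	assumes "\<iota> \<in> parameters X" "\<kappa> \<in> parameters Y" "I0 \<in> sets U01"
		"0 \<le> e" "measure lborel I0 \<ge> 1 - e"
		"\<And>s t. s \<in> I0 \<Longrightarrow> t \<in> I0 \<Longrightarrow> \<bar>mm_dist X (\<iota> s) (\<iota> t) - mm_dist Y (\<kappa> s) (\<kappa> t)\<bar> \<le> e"
	shows "box X Y \<le> ennreal e"
	unfolding box_def
	by (rule INF_lower2[OF assms(1)], rule INF_lower2[OF assms(2)], rule Inf_lower) (use assms in blast)

lemma box_commute: "box X Y = box Y X"
	unfolding box_def by (subst INF_commute) (simp only: abs_minus_commute[of "mm_dist X _ _"])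

text \<open>Box distances are bounded later by two maps on one convenient probability space, usually
  a Gaussian one. Composing both with a parameter of P turns them into parameters of X and
  Y.\<close>

lemma box_le_coupling:
	assumes P: "real_coded P" "prob_space P"
		and f: "f \<in> P \<rightarrow>\<^sub>M mm_measure X" "distr P (mm_measure X) f = mm_measure X"
		and g: "g \<in> P \<rightarrow>\<^sub>M mm_measure Y" "distr P (mm_measure Y) g = mm_measure Y"
		and S: "S \<in> sets P" "measure P S \<ge> 1 - e" "0 \<le> e"
		and dist: "\<And>s t. s \<in> S \<Longrightarrow> t \<in> S \<Longrightarrow> \<bar>mm_dist X (f s) (f t) - mm_dist Y (g s) (g t)\<bar> \<le> e"
	shows "box X Y \<le> ennreal e"
proof -
	obtain \<theta> where \<theta>: "\<theta> \<in> U01 \<rightarrow>\<^sub>M P" "distr U01 P \<theta> = P"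
		using real_coded_param[OF P] by blast
	have 1: "f \<circ> \<theta> \<in> parameters X"
		using distr_distr[OF f(1) \<theta>(1)] f \<theta> by (simp add: parameters_def)
	have 2: "g \<circ> \<theta> \<in> parameters Y"
		using distr_distr[OF g(1) \<theta>(1)] g \<theta> by (simp add: parameters_def)
	let ?I = "\<theta> -` S \<inter> space U01"
	have 3: "?I \<in> sets U01" using \<theta>(1) S(1) by (rule measurable_sets)
	have "measure lborel ?I = measure U01 ?I"
		by (subst measure_restrict_space) auto
	also have "\<dots> = measure (distr U01 P \<theta>) S"
		using \<theta>(1) S(1) by (rule measure_distr[symmetric])
	finally have 4: "measure lborel ?I \<ge> 1 - e" using S(2) \<theta>(2) by simp
	show ?thesis
		by (rule box_leI[OF 1 2 3 S(3) 4]) (use dist in auto)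
qed

lemma sets_nat_eq:
	fixes f g :: "'a \<Rightarrow> nat"
	assumes "f \<in> N \<rightarrow>\<^sub>M count_space UNIV" "g \<in> N \<rightarrow>\<^sub>M count_space UNIV"
	shows "{z \<in> space N. f z = g z} \<in> sets N"
proof -
	have "{z \<in> space N. f z = g z} = (\<Union>j. (f -` {j} \<inter> space N) \<inter> (g -` {j} \<inter> space N))" by auto
	also have "\<dots> \<in> sets N" by (rule sets.countable_UN) (auto intro!: sets.Int measurable_sets[OF assms(1)] measurable_sets[OF assms(2)])
	finally show ?thesis .
qed

text \<open>The coupling has the density 1 / \<open>p j\<close> with respect to the product measure
  on the block where both labels equal j, and 0 off these blocks. With countably many labels of
  equal distribution this replaces a disintegration.\<close>

lemma discrete_gluing:
	fixes c1 c2 :: "'a \<Rightarrow> nat"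
	assumes "prob_space Q" and [measurable]: "c1 \<in> Q \<rightarrow>\<^sub>M count_space UNIV" "c2 \<in> Q \<rightarrow>\<^sub>M count_space UNIV"
		and eq: "\<And>j. emeasure Q {s \<in> space Q. c1 s = j} = emeasure Q {s \<in> space Q. c2 s = j}"
	obtains P where "prob_space P" "sets P = sets (Q \<Otimes>\<^sub>M Q)" "distr P Q fst = Q" "distr P Q snd = Q"
		"AE z in P. c1 (fst z) = c2 (snd z)"
proof -
	interpret Q: prob_space Q by fact
	interpret pair_sigma_finite Q Q by standard
	define p where "p j = emeasure Q {s \<in> space Q. c1 s = j}" for j
	define w where "w z = (if c1 (fst z) = c2 (snd z) then inverse (p (c1 (fst z))) else 0)" for z
	have [measurable]: "p \<in> borel_measurable (count_space UNIV)" by simp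
	have [measurable]: "w \<in> borel_measurable (Q \<Otimes>\<^sub>M Q)"
	proof -
		have 1: "(\<lambda>z. c1 (fst z)) \<in> Q \<Otimes>\<^sub>M Q \<rightarrow>\<^sub>M count_space UNIV" by measurable
		have [measurable]: "(\<lambda>z. inverse (p (c1 (fst z)))) \<in> borel_measurable (Q \<Otimes>\<^sub>M Q)"
			by (rule measurable_compose[OF 1]) simp
		show ?thesis unfolding w_def by (intro measurable_If sets_nat_eq) measurable
	qed
	\<comment> \<open>In \<open>ennreal\<close> the inverse of 0 is \<infinity>, so labels of
	  probability 0 must first be seen to occur on a null set.\<close>
	have null: "AE s in Q. p (c s) \<noteq> 0" if [measurable]: "c \<in> Q \<rightarrow>\<^sub>M count_space UNIV"
		and c: "\<And>j. emeasure Q {s \<in> space Q. c s = j} = p j" for c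
	proof -
		have "AE s in Q. p j = 0 \<longrightarrow> c s \<noteq> j" for j
		proof (cases "p j = 0")
			case True
			then show ?thesis using c[of j] by (auto simp: AE_iff_measurable[OF _ refl])
		qed auto
		then have "AE s in Q. \<forall>j. p j = 0 \<longrightarrow> c s \<noteq> j" by (simp add: AE_all_countable)
		then show ?thesis by eventually_elim auto
	qed
	have n1: "AE s in Q. p (c1 s) \<noteq> 0" by (rule null) (simp_all add: p_def)
	have n2: "AE s in Q. p (c2 s) \<noteq> 0" by (rule null) (simp_all add: p_def eq)
	have inv: "inverse (p j) * p j = 1" if "p j \<noteq> 0" for j
	proof -
		have "p j < top" by (simp add: p_def less_top[symmetric])
		then show ?thesis using that ennreal_divide_self[of "p j"]
			by (simp add: divide_ennreal_def mult.commute)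
	qed
	have w1: "AE s in Q. (\<integral>\<^sup>+t. w (s, t) \<partial>Q) = 1"
		using n1
	proof (eventually_elim)
		case (elim s)
		have "(\<integral>\<^sup>+t. w (s, t) \<partial>Q) = (\<integral>\<^sup>+t. inverse (p (c1 s)) * indicator {t \<in> space Q. c2 t = c1 s} t \<partial>Q)"
			by (intro nn_integral_cong) (auto simp: w_def indicator_def)
		also have "\<dots> = inverse (p (c1 s)) * p (c1 s)"
			by (subst nn_integral_cmult_indicator) (auto simp: p_def eq)
		finally show ?case using inv elim by simp
	qed
	have w2: "AE t in Q. (\<integral>\<^sup>+s. w (s, t) \<partial>Q) = 1"
		using n2
	proof (eventually_elim)
		case (elim t)
		have "(\<integral>\<^sup>+s. w (s, t) \<partial>Q) = (\<integral>\<^sup>+s. inverse (p (c2 t)) * indicator {s \<in> space Q. c1 s = c2 t} s \<partial>Q)"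
			by (intro nn_integral_cong) (auto simp: w_def indicator_def)
		also have "\<dots> = inverse (p (c2 t)) * p (c2 t)"
			by (subst nn_integral_cmult_indicator) (auto simp: p_def)
		finally show ?case using inv elim by simp
	qed
	define P where "P = density (Q \<Otimes>\<^sub>M Q) w"
	have [measurable_cong]: "sets P = sets (Q \<Otimes>\<^sub>M Q)" by (simp add: P_def)
	have d1: "distr P Q fst = Q"
	proof (rule measure_eqI)
		fix A assume "A \<in> sets (distr P Q fst)"
		then have A[measurable]: "A \<in> sets Q" by simp
		have "emeasure (distr P Q fst) A = (\<integral>\<^sup>+z. w z * indicator (fst -` A \<inter> space (Q \<Otimes>\<^sub>M Q)) z \<partial>(Q \<Otimes>\<^sub>M Q))"
			by (subst emeasure_distr) (auto simp: P_def emeasure_density)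
		also have "\<dots> = (\<integral>\<^sup>+s. \<integral>\<^sup>+t. w (s, t) * indicator (fst -` A \<inter> space (Q \<Otimes>\<^sub>M Q)) (s, t) \<partial>Q \<partial>Q)"
			using Q.nn_integral_fst[of "\<lambda>z. w z * indicator (fst -` A \<inter> space (Q \<Otimes>\<^sub>M Q)) z" Q] by simp
		also have "\<dots> = (\<integral>\<^sup>+s. (\<integral>\<^sup>+t. w (s, t) \<partial>Q) * indicator A s \<partial>Q)"
			by (intro nn_integral_cong, subst nn_integral_multc[symmetric])
				 (auto simp: space_pair_measure intro!: nn_integral_cong split: split_indicator)
		also have "\<dots> = (\<integral>\<^sup>+s. 1 * indicator A s \<partial>Q)"
			by (rule nn_integral_cong_AE) (use w1 in eventually_elim, simp)
		finally show "emeasure (distr P Q fst) A = emeasure Q A" by simp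
	qed simp
	have d2: "distr P Q snd = Q"
	proof (rule measure_eqI)
		fix A assume "A \<in> sets (distr P Q snd)"
		then have A[measurable]: "A \<in> sets Q" by simp
		have "emeasure (distr P Q snd) A = (\<integral>\<^sup>+z. w z * indicator (snd -` A \<inter> space (Q \<Otimes>\<^sub>M Q)) z \<partial>(Q \<Otimes>\<^sub>M Q))"
			by (subst emeasure_distr) (auto simp: P_def emeasure_density)
		also have "\<dots> = (\<integral>\<^sup>+t. \<integral>\<^sup>+s. w (s, t) * indicator (snd -` A \<inter> space (Q \<Otimes>\<^sub>M Q)) (s, t) \<partial>Q \<partial>Q)"
			by (rule nn_integral_snd[symmetric]) measurable
		also have "\<dots> = (\<integral>\<^sup>+t. (\<integral>\<^sup>+s. w (s, t) \<partial>Q) * indicator A t \<partial>Q)"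
			by (intro nn_integral_cong, subst nn_integral_multc[symmetric])
				 (auto simp: space_pair_measure intro!: nn_integral_cong split: split_indicator)
		also have "\<dots> = (\<integral>\<^sup>+s. 1 * indicator A s \<partial>Q)"
			by (rule nn_integral_cong_AE) (use w2 in eventually_elim, simp)
		finally show "emeasure (distr P Q snd) A = emeasure Q A" by simp
	qed simp
	have "prob_space P"
		by (rule prob_space_distrD[of fst P Q]) (simp_all add: d1 Q.prob_space_axioms)
	moreover have "AE z in P. c1 (fst z) = c2 (snd z)"
		unfolding P_def by (subst AE_density) (auto simp: w_def)
	ultimately show thesis using that d1 d2 \<open>sets P = sets (Q \<Otimes>\<^sub>M Q)\<close> by blast
qed

lemma parameterD:
	assumes "\<iota> \<in> parameters X"
	shows "\<iota> \<in> U01 \<rightarrow>\<^sub>M mm_measure X" "distr U01 (mm_measure X) \<iota> = mm_measure X"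
	using assms by (auto simp: parameters_def)

text \<open>The two parameters of the middle space are made to almost agree by gluing along a countable partition into cells of small diameter.\<close>

lemma box_triangle:
	fixes Y :: "'b mm"
	assumes Y: "mm_space Y" and XY: "box X Y < ennreal a" and YZ: "box Y Z < ennreal b"
	shows "box X Z \<le> ennreal (a + b)"
proof -
	interpret Y: mm_sp Y by standard fact
	interpret U: prob_space U01 by (rule prob_space_unit)
	obtain \<iota> \<kappa> I1 e1 where 1: "\<iota> \<in> parameters X" "\<kappa> \<in> parameters Y" "I1 \<in> sets U01"
		"0 \<le> e1" "e1 < a" "measure lborel I1 \<ge> 1 - e1"
		"\<And>s t. s \<in> I1 \<Longrightarrow> t \<in> I1 \<Longrightarrow> \<bar>mm_dist X (\<iota> s) (\<iota> t) - mm_dist Y (\<kappa> s) (\<kappa> t)\<bar> \<le> e1"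
		by (rule box_lessD[OF XY]) blast
	obtain \<kappa>' \<zeta> I2 e2 where 2: "\<kappa>' \<in> parameters Y" "\<zeta> \<in> parameters Z" "I2 \<in> sets U01"
		"0 \<le> e2" "e2 < b" "measure lborel I2 \<ge> 1 - e2"
		"\<And>s t. s \<in> I2 \<Longrightarrow> t \<in> I2 \<Longrightarrow> \<bar>mm_dist Y (\<kappa>' s) (\<kappa>' t) - mm_dist Z (\<zeta> s) (\<zeta> t)\<bar> \<le> e2"
		by (rule box_lessD[OF YZ]) blast
	note [measurable] = parameterD(1)[OF 1(1)] parameterD(1)[OF 1(2)] parameterD(1)[OF 2(1)] parameterD(1)[OF 2(2)] 1(3) 2(3)
	\<comment> \<open>The slack left by e1 < a and e2 < b is 4 * \<delta>. A cell has diameter at most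
	  2 * \<delta>, and a distance involves two points, each moved inside its cell.\<close>
	define \<delta> where "\<delta> = (a - e1 + (b - e2)) / 4"
	have \<delta>: "\<delta> > 0" using 1 2 by (simp add: \<delta>_def)
	obtain q :: "nat \<Rightarrow> 'b" where q: "\<And>j. q j \<in> Y.C" "\<And>x r. x \<in> Y.C \<Longrightarrow> r > 0 \<Longrightarrow> \<exists>j. Y.D (q j) x < r"
		by (rule Y.dense_sequence) blast
	define c where "c y = (LEAST j. Y.D (q j) y < \<delta>)" for y
	have cD: "Y.D (q (c y)) y < \<delta>" if "y \<in> Y.C" for y
		unfolding c_def using q(2)[OF that \<delta>] by (rule LeastI_ex)
	have c2: "Y.D y y' \<le> 2 * \<delta>" if "y \<in> Y.C" "y' \<in> Y.C" "c y = c y'" for y y'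
		using cD[OF that(1)] cD[OF that(2)] Y.triangle[OF that(1) q(1) that(2), of "c y"] that(3) Y.commute[of y "q (c y)"]
		by simp
	have Dq: "(\<lambda>x. Y.D (q j) x) \<in> borel_measurable Y.M" for j
		using Y.measurable_dist_point[of "\<lambda>x. x" Y.M "q j"] q(1) by simp
	have [measurable]: "c \<in> Y.M \<rightarrow>\<^sub>M count_space UNIV"
		unfolding c_def using Dq by measurable
	have law: "emeasure U01 {s \<in> space U01. c (k s) = j} = emeasure Y.M {y \<in> Y.C. c y = j}"
		if k: "k \<in> parameters Y" for k j
	proof -
		note [measurable] = parameterD(1)[OF k]
		have "emeasure Y.M {y \<in> Y.C. c y = j} = emeasure (distr U01 Y.M k) {y \<in> Y.C. c y = j}"
			using parameterD(2)[OF k] by simp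
		also have "\<dots> = emeasure U01 (k -` {y \<in> Y.C. c y = j} \<inter> space U01)"
			by (subst emeasure_distr) auto
		also have "k -` {y \<in> Y.C. c y = j} \<inter> space U01 = {s \<in> space U01. c (k s) = j}"
			using measurable_space[OF parameterD(1)[OF k]] by auto
		finally show ?thesis by simp
	qed
	have m1: "(\<lambda>s. c (\<kappa> s)) \<in> U01 \<rightarrow>\<^sub>M count_space UNIV" by measurable
	have m2: "(\<lambda>s. c (\<kappa>' s)) \<in> U01 \<rightarrow>\<^sub>M count_space UNIV" by measurable
	obtain P where P: "prob_space P" "sets P = sets (U01 \<Otimes>\<^sub>M U01)"
		"distr P U01 fst = U01" "distr P U01 snd = U01"
		"AE z in P. c (\<kappa> (fst z)) = c (\<kappa>' (snd z))"
		by (rule discrete_gluing[OF U.prob_space_axioms m1 m2]) (simp only: law[OF 1(2)] law[OF 2(1)], blast)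
	interpret P: prob_space P by fact
	note [measurable_cong] = P(2)
	have spP: "space P = {0..<1} \<times> {0..<1}" using sets_eq_imp_space_eq[OF P(2)] by (simp add: space_pair_measure)
	define S where "S = {z \<in> space P. fst z \<in> I1 \<and> snd z \<in> I2 \<and> c (\<kappa> (fst z)) = c (\<kappa>' (snd z))}"
	have "{z \<in> space P. c (\<kappa> (fst z)) = c (\<kappa>' (snd z))} \<in> sets P"
		by (rule sets_nat_eq) measurable
	then have [measurable]: "Measurable.pred P (\<lambda>z. c (\<kappa> (fst z)) = c (\<kappa>' (snd z)))"
		by (simp add: pred_def)
	have [measurable]: "S \<in> sets P" unfolding S_def by measurable
	have mI1: "measure P {z \<in> space P. fst z \<in> I1} \<ge> 1 - e1"
	proof -
		have "measure P {z \<in> space P. fst z \<in> I1} = measure (distr P U01 fst) I1"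
			by (subst measure_distr) (auto intro!: arg_cong[where f = "measure P"])
		also have "\<dots> = measure lborel I1"
			unfolding P(3) using sets.sets_into_space[OF 1(3)] by (subst measure_restrict_space) auto
		finally show ?thesis using 1(6) by simp
	qed
	have mI2: "measure P {z \<in> space P. snd z \<in> I2} \<ge> 1 - e2"
	proof -
		have "measure P {z \<in> space P. snd z \<in> I2} = measure (distr P U01 snd) I2"
			by (subst measure_distr) (auto intro!: arg_cong[where f = "measure P"])
		also have "\<dots> = measure lborel I2"
			unfolding P(4) using sets.sets_into_space[OF 2(3)] by (subst measure_restrict_space) auto
		finally show ?thesis using 2(6) by simp
	qed
	have "measure P S = measure P ({z \<in> space P. fst z \<in> I1} \<inter> {z \<in> space P. snd z \<in> I2})"
	proof (rule P.finite_measure_eq_AE)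
		show "AE z in P. (z \<in> S) = (z \<in> {z \<in> space P. fst z \<in> I1} \<inter> {z \<in> space P. snd z \<in> I2})"
			using P(5) by eventually_elim (auto simp: S_def)
	qed measurable
	also have "\<dots> \<ge> measure P {z \<in> space P. fst z \<in> I1} + measure P {z \<in> space P. snd z \<in> I2} - 1"
		using P.finite_measure_Union'[of "{z \<in> space P. fst z \<in> I1}" "{z \<in> space P. snd z \<in> I2}"]
			P.finite_measure_Diff'[of "{z \<in> space P. snd z \<in> I2}" "{z \<in> space P. fst z \<in> I1}"]
			P.prob_le_1[of "{z \<in> space P. fst z \<in> I1} \<union> {z \<in> space P. snd z \<in> I2}"]
		by (simp add: Int_commute)
	finally have mS: "measure P S \<ge> 1 - (a + b)" using mI1 mI2 1(5) 2(5) by linarith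
	show ?thesis
	proof (rule box_le_coupling[where P = P and f = "\<iota> \<circ> fst" and g = "\<zeta> \<circ> snd" and S = S])
		show "real_coded P" by (rule real_coded_cong[OF P(2)[symmetric] real_coded_unit_pair])
		show "distr P (mm_measure X) (\<iota> \<circ> fst) = mm_measure X"
			using parameterD(2)[OF 1(1)] P(3) distr_distr[OF parameterD(1)[OF 1(1)], of fst P] by simp
		show "distr P (mm_measure Z) (\<zeta> \<circ> snd) = mm_measure Z"
			using parameterD(2)[OF 2(2)] P(4) distr_distr[OF parameterD(1)[OF 2(2)], of snd P] by simp
		show "0 \<le> a + b" using 1 2 by linarith
		fix s t assume s: "s \<in> S" and t: "t \<in> S"
		let ?y = "\<kappa> (fst s)" and ?y' = "\<kappa>' (snd s)" and ?x = "\<kappa> (fst t)" and ?x' = "\<kappa>' (snd t)"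
		have C: "?y \<in> Y.C" "?y' \<in> Y.C" "?x \<in> Y.C" "?x' \<in> Y.C"
			using measurable_space[OF parameterD(1)[OF 1(2)]] measurable_space[OF parameterD(1)[OF 2(1)]] s t
			by (auto simp: S_def spP)
		have "Y.D ?y ?y' \<le> 2 * \<delta>" "Y.D ?x ?x' \<le> 2 * \<delta>"
			using s t by (auto simp: S_def intro!: c2 C)
		then have "\<bar>Y.D ?y ?x - Y.D ?y' ?x'\<bar> \<le> 4 * \<delta>"
			using Y.triangle[OF C(1) C(2) C(3)] Y.triangle[OF C(2) C(4) C(3)] Y.triangle[OF C(2) C(1) C(4)] Y.triangle[OF C(1) C(3) C(4)]
				Y.commute[of ?y' ?y] Y.commute[of ?x' ?x] by linarith
		moreover have "\<bar>mm_dist X (\<iota> (fst s)) (\<iota> (fst t)) - Y.D ?y ?x\<bar> \<le> e1"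
			using s t by (intro 1) (auto simp: S_def)
		moreover have "\<bar>Y.D ?y' ?x' - mm_dist Z (\<zeta> (snd s)) (\<zeta> (snd t))\<bar> \<le> e2"
			using s t by (intro 2) (auto simp: S_def)
		moreover have "4 * \<delta> + e1 + e2 = a + b" unfolding \<delta>_def by (simp add: field_simps)
		ultimately have "\<bar>mm_dist X (\<iota> (fst s)) (\<iota> (fst t)) - mm_dist Z (\<zeta> (snd s)) (\<zeta> (snd t))\<bar> \<le> a + b"
			by linarith
		then show "\<bar>mm_dist X ((\<iota> \<circ> fst) s) ((\<iota> \<circ> fst) t) - mm_dist Z ((\<zeta> \<circ> snd) s) ((\<zeta> \<circ> snd) t)\<bar> \<le> a + b"
			by simp
	next
		show "prob_space P" by fact
		show "\<iota> \<circ> fst \<in> P \<rightarrow>\<^sub>M mm_measure X" "\<zeta> \<circ> snd \<in> P \<rightarrow>\<^sub>M mm_measure Z"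
			unfolding comp_def by measurable
		show "S \<in> sets P" "measure P S \<ge> 1 - (a + b)" by fact+
	qed
qed

context mm_sp
begin

text \<open>The complement of the support is the union of the null balls of a countable base, hence
  a null open set.\<close>

lemma support_sets: "mm_support X \<in> sets M"
	and emeasure_support: "emeasure M (mm_support X) = 1"
proof -
	obtain q :: "nat \<Rightarrow> 'a" where q: "\<And>j. q j \<in> C" "\<And>x r. x \<in> C \<Longrightarrow> r > 0 \<Longrightarrow> \<exists>j. D (q j) x < r"
		by (rule dense_sequence) blast
	define B where "B = (\<lambda>(j, l). mball (q j) (1 / real (Suc l)))"
	define I where "I = {k. emeasure M (B k) = 0}"
	have Bopen: "openin mtopology (B k)" for k by (auto simp: B_def split: prod.split)
	have Bsets: "B k \<in> sets M" for k by (rule open_sets[OF Bopen])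
	have eq: "mm_support X = C - (\<Union>k\<in>I. B k)"
	proof (intro equalityI subsetI)
		fix x assume x: "x \<in> mm_support X"
		have "x \<notin> B k" if "k \<in> I" for k
		proof
			assume "x \<in> B k"
			then have "emeasure M (B k) > 0" using x Bopen[of k] unfolding mm_support_def top_eq by blast
			then show False using that by (simp add: I_def)
		qed
		moreover have "x \<in> C" using x by (simp add: mm_support_def)
		ultimately show "x \<in> C - (\<Union>k\<in>I. B k)" by blast
	next
		fix x assume x: "x \<in> C - (\<Union>k\<in>I. B k)"
		then have xC: "x \<in> C" by simp
		have "emeasure M U > 0" if U: "openin mtopology U" "x \<in> U" for U
		proof -
			from U have "\<exists>r>0. mball x r \<subseteq> U" by (simp add: openin_mtopology)
			then obtain r where r: "r > 0" "mball x r \<subseteq> U" by blast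
			obtain l where l: "1 / real (Suc l) < r / 2"
				using r(1) nat_approx_posE[of "r/2"] by auto
			obtain j where j: "D (q j) x < 1 / real (Suc l)" using q(2)[OF xC, of "1 / real (Suc l)"] by auto
			have "B (j, l) \<subseteq> mball x r"
			proof
				fix z assume z: "z \<in> B (j, l)"
				then have zC: "z \<in> C" "D (q j) z < 1 / real (Suc l)" by (auto simp: B_def)
				then have "D x z \<le> D (q j) x + D (q j) z"
					using triangle[OF xC q(1)[of j] zC(1)] commute[of x "q j"] by simp
				with zC j l show "z \<in> mball x r" using xC by simp
			qed
			then have "B (j, l) \<subseteq> U" using r by blast
			moreover have "x \<in> B (j, l)" using j xC q(1)[of j] by (simp add: B_def)
			then have "(j, l) \<notin> I" using x by auto
			then have "emeasure M (B (j, l)) > 0" by (auto simp: I_def zero_less_iff_neq_zero)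
			ultimately show ?thesis
				using emeasure_mono[OF \<open>B (j, l) \<subseteq> U\<close> open_sets[OF U(1)]] by (meson order_less_le_trans)
		qed
		then show "x \<in> mm_support X" using x by (simp add: mm_support_def top_eq)
	qed
	have U: "(\<Union>k\<in>I. B k) \<in> sets M" using Bsets by (intro sets.countable_UN') auto
	have "(\<Union>k\<in>I. B k) \<in> null_sets M"
		by (rule null_sets_UN') (use Bsets in \<open>auto simp: I_def\<close>)
	then have "emeasure M (\<Union>k\<in>I. B k) = 0" by auto
	then show "emeasure M (mm_support X) = 1"
		unfolding eq using emeasure_compl[OF U] P.emeasure_space_1 by simp
	show "mm_support X \<in> sets M" unfolding eq using U by blast
qed

end

lemma box_iso:
	assumes "mm_space X" "mm_iso X Y"
	shows "box X Y = 0"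
proof -
	interpret X: mm_sp X by standard fact
	obtain \<phi> where \<phi>: "\<phi> \<in> X.M \<rightarrow>\<^sub>M mm_measure Y" "distr X.M (mm_measure Y) \<phi> = mm_measure Y"
		"\<And>x y. x \<in> mm_support X \<Longrightarrow> y \<in> mm_support X \<Longrightarrow> mm_dist Y (\<phi> x) (\<phi> y) = X.D x y"
		using assms(2) unfolding mm_iso_def by blast
	have "box X Y \<le> ennreal 0"
		by (rule box_le_coupling[OF X.real_coded X.P.prob_space_axioms measurable_ident_sets[OF refl] _ \<phi>(1,2) X.support_sets])
			 (simp_all add: \<phi>(3) X.emeasure_support measure_def distr_id2)
	then show ?thesis by simp
qed

lemma iso_prec:
	assumes "mm_space X" "mm_iso X Y"
	shows "emm_of_mm Y \<prec>\<prec> emm_of_mm X"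
proof -
	interpret X: mm_sp X by standard fact
	obtain \<phi> where \<phi>: "\<phi> \<in> X.M \<rightarrow>\<^sub>M mm_measure Y" "distr X.M (mm_measure Y) \<phi> = mm_measure Y"
		"\<And>x y. x \<in> mm_support X \<Longrightarrow> y \<in> mm_support X \<Longrightarrow> mm_dist Y (\<phi> x) (\<phi> y) = X.D x y"
		using assms(2) unfolding mm_iso_def by blast
	then show ?thesis
		unfolding emm_prec_def emm_of_mm_def
		by (intro bexI[of _ \<phi>] bexI[of _ "mm_support X"]) (auto simp: X.support_sets X.emeasure_support)
qed

lemma emm_prec_trans:
	assumes "prob_space (emm_measure X)" "Z \<prec>\<prec> Y" "Y \<prec>\<prec> X"
	shows "Z \<prec>\<prec> X"
proof -
	interpret X: prob_space "emm_measure X" by fact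
	obtain \<phi> E where 1: "\<phi> \<in> emm_measure Y \<rightarrow>\<^sub>M emm_measure Z" "E \<in> sets (emm_measure Y)"
		"distr (emm_measure Y) (emm_measure Z) \<phi> = emm_measure Z" "emeasure (emm_measure Y) E = 1"
		"\<And>x y. x \<in> E \<Longrightarrow> y \<in> E \<Longrightarrow> emm_dist Z (\<phi> x) (\<phi> y) \<le> emm_dist Y x y"
		using assms(2) unfolding emm_prec_def by blast
	obtain \<psi> F where 2: "\<psi> \<in> emm_measure X \<rightarrow>\<^sub>M emm_measure Y" "F \<in> sets (emm_measure X)"
		"distr (emm_measure X) (emm_measure Y) \<psi> = emm_measure Y" "emeasure (emm_measure X) F = 1"
		"\<And>x y. x \<in> F \<Longrightarrow> y \<in> F \<Longrightarrow> emm_dist Y (\<psi> x) (\<psi> y) \<le> emm_dist X x y"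
		using assms(3) unfolding emm_prec_def by blast
	let ?G = "\<psi> -` E \<inter> space (emm_measure X)"
	have G: "?G \<in> sets (emm_measure X)" using 2(1) 1(2) by (rule measurable_sets)
	have "emeasure (emm_measure X) ?G = emeasure (distr (emm_measure X) (emm_measure Y) \<psi>) E"
		using 2(1) 1(2) by (rule emeasure_distr[symmetric])
	then have "emeasure (emm_measure X) ?G = 1" using 1(4) 2(3) by simp
	then have "AE x in emm_measure X. x \<in> ?G" "AE x in emm_measure X. x \<in> F"
		using X.AE_in_set_eq_1[OF G] X.AE_in_set_eq_1[OF 2(2)] 2(4) by (auto simp: measure_def)
	then have "AE x in emm_measure X. x \<in> F \<inter> ?G" by eventually_elim auto
	then have "emeasure (emm_measure X) (F \<inter> ?G) = 1"
		using X.AE_in_set_eq_1[of "F \<inter> ?G"] 2(2) G by (simp add: X.emeasure_eq_measure)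
	then show ?thesis
		unfolding emm_prec_def
	proof (intro bexI[of _ "\<phi> \<circ> \<psi>"] bexI[of _ "F \<inter> ?G"] conjI ballI)
		show "distr (emm_measure X) (emm_measure Z) (\<phi> \<circ> \<psi>) = emm_measure Z"
			using distr_distr[OF 1(1) 2(1)] 1(3) 2(3) by simp
		fix x y assume xy: "x \<in> F \<inter> ?G" "y \<in> F \<inter> ?G"
		have "emm_dist Z (\<phi> (\<psi> x)) (\<phi> (\<psi> y)) \<le> emm_dist Y (\<psi> x) (\<psi> y)"
			using xy by (intro 1) auto
		also have "\<dots> \<le> emm_dist X x y" using xy by (intro 2) auto
		finally show "emm_dist Z ((\<phi> \<circ> \<psi>) x) ((\<phi> \<circ> \<psi>) y) \<le> emm_dist X x y" by simp
	qed (use 1 2 G in \<open>auto intro: measurable_comp\<close>)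
qed

section \<open>Isomorphism classes and pyramids\<close>

text \<open>The space is transported along its code e: the image of the carrier with the metric read
  through h. The point to check is that the transported sigma-algebra is the Borel one of the
  transported metric.\<close>

lemma mm_real_copy:
	assumes "mm_space X"
	shows "\<exists>B::real mm. mm_space B \<and> mm_iso X B"
proof -
	interpret X: mm_sp X by standard fact
	obtain e h where e: "e \<in> borel_measurable X.M" and h: "h \<in> borel \<rightarrow>\<^sub>M X.M" and he: "\<And>x. x \<in> X.C \<Longrightarrow> h (e x :: real) = x"
		using X.real_coded unfolding real_coded_def by blast
	have inj: "inj_on e X.C" by (rule inj_on_inverseI[of _ h]) (rule he)
	let ?C = "e ` X.C" and ?D = "\<lambda>s t. X.D (h s) (h t)"
	\<comment> \<open>\<open>embed_measure\<close> makes exactly the images of measurable sets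
	  measurable, which keeps the sigma-algebra explicit.\<close>
	define m where "m = distr X.M (embed_measure X.M e) e"
	define B where "B = \<lparr>mm_dist = ?D, mm_measure = m\<rparr>"
	have spm: "space m = ?C" by (simp add: m_def space_embed_measure)
	have stm: "sets m = {e ` A | A. A \<in> sets X.M}" by (simp add: m_def sets_embed_measure'[OF inj])
	have em0: "e \<in> X.M \<rightarrow>\<^sub>M embed_measure X.M e" by (rule measurable_embed_measure2'[OF inj])
	then have em: "e \<in> X.M \<rightarrow>\<^sub>M m" by (simp add: m_def)
	interpret B: Metric_space ?C ?D
	proof
		show "0 \<le> ?D x y" for x y by simp
		show "?D x y = ?D y x" for x y by (rule X.commute)
		show "?D x y = 0 \<longleftrightarrow> x = y" if "x \<in> ?C" "y \<in> ?C" for x y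
			using that by (auto simp: he)
		show "?D x z \<le> ?D x y + ?D y z" if "x \<in> ?C" "y \<in> ?C" "z \<in> ?C" for x y z
			using that by (auto simp: he X.triangle)
	qed
	have ball: "B.mball (e x) r = e ` X.mball x r" if "x \<in> X.C" for x r
		using that by (force simp: he)
	have hC: "h s \<in> X.C" for s using measurable_space[OF h] by simp
	have openB: "{V. openin B.mtopology V} = (`) e ` {U. openin X.mtopology U}"
	proof (intro equalityI subsetI)
		fix V assume "V \<in> {V. openin B.mtopology V}"
		then have V: "V \<subseteq> ?C" "\<And>x. x \<in> V \<Longrightarrow> \<exists>r>0. B.mball x r \<subseteq> V" by (auto simp: B.openin_mtopology)
		have Ve: "V = e ` (h ` V)" using V(1) by (force simp: he image_image)
		have "openin X.mtopology (h ` V)"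
			unfolding X.openin_mtopology
		proof (intro conjI allI impI)
			show "h ` V \<subseteq> X.C" using hC by auto
			fix x assume "x \<in> h ` V"
			then obtain y where y: "y \<in> V" "x = h y" by auto
			then obtain z where z: "z \<in> X.C" "y = e z" using V(1) by auto
			have xz: "x = z" using y z he by simp
			obtain r where r: "r > 0" "B.mball y r \<subseteq> V" using V(2) y by blast
			have "e ` X.mball x r \<subseteq> V" using r ball[OF z(1), of r] z xz by simp
			then have "h ` e ` X.mball x r \<subseteq> h ` V" by blast
			moreover have "h ` e ` X.mball x r = X.mball x r" by (force simp: he image_image)
			ultimately show "\<exists>r>0. X.mball x r \<subseteq> h ` V" using r(1) by auto
		qed
		then show "V \<in> (`) e ` {U. openin X.mtopology U}" using Ve by blast
	next
		fix V assume "V \<in> (`) e ` {U. openin X.mtopology U}"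
		then obtain U where U: "openin X.mtopology U" "V = e ` U" by blast
		have "openin B.mtopology V"
			unfolding B.openin_mtopology
		proof (intro conjI allI impI)
			have UC: "U \<subseteq> X.C" using U(1) by (simp add: X.openin_mtopology)
			then show "V \<subseteq> ?C" using U(2) by blast
			fix y assume "y \<in> V"
			then obtain x where x: "x \<in> U" "y = e x" using U(2) by auto
			obtain r where r: "r > 0" "X.mball x r \<subseteq> U" using U(1) x(1) unfolding X.openin_mtopology by blast
			then have "e ` X.mball x r \<subseteq> V" using U(2) by blast
			moreover have "x \<in> X.C" using x UC by blast
			ultimately have "B.mball y r \<subseteq> V" using ball[of x r] x(2) by simp
			then show "\<exists>r>0. B.mball y r \<subseteq> V" using r(1) by blast
		qed
		then show "V \<in> {V. openin B.mtopology V}" by simp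
	qed
	have "mm_space B"
		unfolding mm_space_def
	proof (intro conjI)
		have eqs: "mm_carrier B = ?C" "mm_dist B = ?D" by (simp_all add: B_def spm)
		show "Metric_space (mm_carrier B) (mm_dist B)" unfolding eqs by (rule B.Metric_space_axioms)
		have top: "mm_top B = B.mtopology" unfolding mm_top_def eqs ..
		show "Metric_space.mcomplete (mm_carrier B) (mm_dist B)"
			unfolding eqs B.mcomplete_def
		proof (intro allI impI)
			fix \<sigma> assume \<sigma>: "B.MCauchy \<sigma>"
			have "X.MCauchy (h \<circ> \<sigma>)"
				using \<sigma> hC unfolding B.MCauchy_def X.MCauchy_def by auto
			then obtain x where x: "limitin X.mtopology (h \<circ> \<sigma>) x sequentially"
				using X.mcomplete unfolding X.mcomplete_def by blast
			have "limitin B.mtopology \<sigma> (e x) sequentially"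
				unfolding B.limitin_metric
			proof (intro conjI allI impI)
				have xC: "x \<in> X.C" using x by (simp add: X.limitin_metric)
				then show "e x \<in> ?C" by blast
				fix \<epsilon> :: real assume "\<epsilon> > 0"
				then have "\<forall>\<^sub>F n in sequentially. X.D ((h \<circ> \<sigma>) n) x < \<epsilon>"
					using x unfolding X.limitin_metric by (auto elim!: eventually_mono)
				then show "\<forall>\<^sub>F n in sequentially. \<sigma> n \<in> ?C \<and> X.D (h (\<sigma> n)) (h (e x)) < \<epsilon>"
					using \<sigma> by (auto simp: he[OF xC] B.MCauchy_def elim!: eventually_mono)
			qed
			then show "\<exists>x. limitin B.mtopology \<sigma> x sequentially" by blast
		qed
		show "separable_space (mm_top B)"
		proof -
			obtain q :: "nat \<Rightarrow> 'a" where q: "\<And>j. q j \<in> X.C" "\<And>x r. x \<in> X.C \<Longrightarrow> r > 0 \<Longrightarrow> \<exists>j. X.D (q j) x < r"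
				by (rule X.dense_sequence) blast
			have "x \<in> B.mtopology closure_of range (e \<circ> q)" if "x \<in> ?C" for x
			proof -
				from \<open>x \<in> ?C\<close> obtain z where z: "z \<in> X.C" "x = e z" by blast
				have "\<exists>y\<in>range (e \<circ> q). y \<in> B.mball x r" if "r > 0" for r
				proof -
					obtain j where "X.D (q j) z < r" using q(2)[OF z(1) \<open>r > 0\<close>] by blast
					then have "e (q j) \<in> B.mball x r" using z q(1) by (simp add: he X.commute)
					then show ?thesis by auto
				qed
				then show ?thesis using that by (simp add: B.metric_closure_of)
			qed
			then have "B.mtopology closure_of range (e \<circ> q) = ?C"
				using closure_of_subset_topspace[of B.mtopology] unfolding B.topspace_mtopology by blast
			moreover have "range (e \<circ> q) \<subseteq> ?C" using q(1) by auto
			ultimately show ?thesis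
				unfolding top separable_space_def B.topspace_mtopology
				by (intro exI[of _ "range (e \<circ> q)"]) simp
		qed
		\<comment> \<open>Written as a preimage under h, the image commutes with the generation of
		  sigma-algebras.\<close>
		have eA: "e ` A = h -` A \<inter> ?C" if "A \<subseteq> X.C" for A
			using that by (auto simp: he subset_iff)
		have "sets m = {h -` A \<inter> ?C | A. A \<in> sets X.M}"
			unfolding stm setcompr_eq_image Collect_mem_eq by (rule image_cong[OF refl]) (rule eA[OF sets.sets_into_space])
		also have "\<dots> = sigma_sets ?C {h -` A \<inter> ?C | A. A \<in> {U. openin X.mtopology U}}"
			unfolding X.sets_M by (rule sigma_sets_vimage_commute) (use hC in auto)
		also have "{h -` A \<inter> ?C | A. A \<in> {U. openin X.mtopology U}} = {V. openin B.mtopology V}"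
			unfolding openB setcompr_eq_image Collect_mem_eq
			by (rule image_cong[OF refl], rule eA[symmetric]) (auto dest: openin_subset[of X.mtopology, unfolded X.topspace_mtopology])
		finally show "sets (mm_measure B) = borel_sets_of (mm_top B)"
			unfolding top borel_sets_of_def B.topspace_mtopology by (simp add: B_def)
		show "prob_space (mm_measure B)"
			using X.P.prob_space_distr[OF em0] unfolding B_def m_def by simp
	qed
	moreover have "mm_iso X B"
		unfolding mm_iso_def
	proof (intro bexI[of _ e] conjI ballI)
		show "e \<in> X.M \<rightarrow>\<^sub>M mm_measure B" using em by (simp add: B_def)
		show "distr X.M (mm_measure B) e = mm_measure B"
			unfolding B_def m_def by (simp, rule distr_cong) simp_all
		fix x y assume "x \<in> mm_support X" "y \<in> mm_support X"
		then have "x \<in> X.C" "y \<in> X.C" by (auto simp: mm_support_def)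
		then show "mm_dist B (e x) (e y) = X.D x y" by (simp add: B_def he)
	qed
	ultimately show ?thesis by blast
qed

lemma mm_class_rep:
	assumes "mm_space (X :: real mm)"
	obtains A where "A \<in> mm_classes" "mm_space (rep A)" "mm_iso X (rep A)"
proof -
	let ?A = "mm_iso_rel `` {X}"
	have "mm_iso X X"
		unfolding mm_iso_def by (intro bexI[of _ "\<lambda>x. x"]) (auto simp: distr_id2)
	then have "X \<in> ?A" using assms by (simp add: mm_iso_rel_def)
	then have "rep ?A \<in> ?A" unfolding rep_def by (rule someI)
	moreover have "?A \<in> mm_classes" unfolding mm_classes_def using assms by (intro quotientI) simp
	ultimately show thesis using that by (auto simp: mm_iso_rel_def)
qed

lemma mm_space_rep: "A \<in> mm_classes \<Longrightarrow> mm_space (rep A)"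
proof -
	assume "A \<in> mm_classes"
	then obtain X where X: "mm_space X" "A = mm_iso_rel `` {X}" by (auto simp: mm_classes_def quotient_def)
	have "mm_iso X X"
		unfolding mm_iso_def by (intro bexI[of _ "\<lambda>x. x"]) (auto simp: distr_id2)
	then have "X \<in> A" using X by (simp add: mm_iso_rel_def)
	then have "rep A \<in> A" unfolding rep_def by (rule someI)
	then show ?thesis using X by (auto simp: mm_iso_rel_def)
qed

lemma ennreal_pos_real:
	assumes "0 < (a::ennreal)"
	obtains e where "e > 0" "ennreal e \<le> a"
proof (cases a)
	case (real r)
	then show ?thesis using assms by (intro that[of r]) auto
next
	case top
	then show ?thesis by (intro that[of 1]) auto
qed

lemma box_triangle_less:
	assumes "mm_space Y" "box X Y < ennreal a" "box Y Z < ennreal b" "a + b < c"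
	shows "box X Z < ennreal c"
proof -
	have "a > 0" "b > 0" using assms(2,3) by (metis ennreal_neg linorder_not_le not_less_zero)+
	then have "ennreal (a + b) < ennreal c" using assms(4) by (simp add: ennreal_less_iff del: ennreal_plus)
	then show ?thesis using box_triangle[OF assms(1-3)] by (rule order_le_less_trans[rotated])
qed

text \<open>Passes from a dominated space over any type to an isomorphism class in the pyramid, at
  an arbitrarily small cost in the box distance. The two isomorphisms involved have box distance
  0.\<close>

lemma pyramid_approx:
	assumes X: "prob_space (emm_measure X)" and Z: "mm_space (Z :: 'b mm)" "emm_of_mm Z \<prec>\<prec> X" and e: "e > 0"
	obtains A where "A \<in> pyramid X" "box (rep A) Z < ennreal e"
proof -
	obtain B :: "real mm" where B: "mm_space B" "mm_iso Z B" using mm_real_copy[OF Z(1)] by blast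
	obtain A where A: "A \<in> mm_classes" "mm_space (rep A)" "mm_iso B (rep A)" by (rule mm_class_rep[OF B(1)])
	have p: "prob_space (emm_measure (emm_of_mm B))" "prob_space (emm_measure (emm_of_mm Z))"
		using B(1) Z(1) by (auto simp: emm_of_mm_def mm_space_def)
	have "emm_of_mm (rep A) \<prec>\<prec> X"
		by (rule emm_prec_trans[OF X _ Z(2)], rule emm_prec_trans[OF p(2) iso_prec[OF B(1) A(3)] iso_prec[OF Z(1) B(2)]])
	then have "A \<in> pyramid X" using A(1) by (simp add: pyramid_def)
	moreover have "box (rep A) Z < ennreal e"
	proof (rule box_triangle_less[OF B(1)])
		show "box (rep A) B < ennreal (e/3)" "box B Z < ennreal (e/3)"
			using box_iso[OF B(1) A(3)] box_iso[OF Z(1) B(2)] e box_commute[of "rep A" B] box_commute[of B Z] by simp_all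
	qed (use e in simp)
	ultimately show thesis using that by blast
qed

lemma pyramidD: "A \<in> pyramid X \<Longrightarrow> mm_space (rep A)" "A \<in> pyramid X \<Longrightarrow> emm_of_mm (rep A) \<prec>\<prec> X"
	"A \<in> pyramid X \<Longrightarrow> A \<in> mm_classes"
	by (auto simp: pyramid_def mm_space_rep)

lemma box_refl: "mm_space X \<Longrightarrow> box X X = 0"
	by (rule box_iso) (auto simp: mm_iso_def distr_id2 intro!: bexI[of _ "\<lambda>x. x"])

lemma pyramid_subset_closure: "pyramid X \<subseteq> box_closure (pyramid X)"
	unfolding box_closure_def box_class_def
	using pyramidD box_refl by (force intro: bexI)

lemma mm_space_point: "mm_space one_point_mm"
proof -
	let ?T = "Metric_space.mtopology UNIV (\<lambda>x y :: unit. 0 :: real)"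
	have M: "Metric_space UNIV (\<lambda>x y :: unit. 0 :: real)" by standard auto
	have "openin ?T U" for U :: "unit set"
		unfolding Metric_space.openin_mtopology[OF M] by (cases "U = {}") (auto intro!: exI[of _ 1])
	then have top: "?T = discrete_topology UNIV"
		by (auto simp: topology_eq)
	have 1: "Metric_space.mcomplete UNIV (\<lambda>x y :: unit. 0 :: real)"
		unfolding Metric_space.mcomplete_def[OF M] Metric_space.limitin_metric[OF M] by auto
	have 2: "sets (return (count_space UNIV) ()) = borel_sets_of ?T"
		unfolding top borel_sets_of_def by (auto intro: sigma_sets.Basic)
	have eqs: "space (return (count_space UNIV) ()) = UNIV" "mm_dist one_point_mm = (\<lambda>x y. 0)"
		"mm_measure one_point_mm = return (count_space UNIV) ()"
		by (simp_all add: one_point_mm_def)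
	show ?thesis
		unfolding mm_space_def mm_top_def eqs
	proof (intro conjI)
		show "separable_space ?T" unfolding top by (simp add: separable_space_discrete_topology)
		show "prob_space (return (count_space UNIV) ())" by (rule prob_space_return) simp
	qed (rule 1 2 M)+
qed

text \<open>Keeps all pyramids nonempty: a sequence witnessing a lower limit must have a term for
  every n, also where nothing close is available.\<close>

lemma point_prec:
	assumes "prob_space (emm_measure X)"
	shows "emm_of_mm one_point_mm \<prec>\<prec> X"
proof -
	interpret prob_space "emm_measure X" by fact
	have "distr (emm_measure X) (return (count_space UNIV) ()) (\<lambda>_. ()) = return (count_space UNIV) ()"
	proof (rule measure_eqI)
		fix A :: "unit set"
		assume "A \<in> sets (distr (emm_measure X) (return (count_space UNIV) ()) (\<lambda>_. ()))"
		show "emeasure (distr (emm_measure X) (return (count_space UNIV) ()) (\<lambda>_. ())) A = emeasure (return (count_space UNIV) ()) A"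
			by (subst emeasure_distr) (cases "() \<in> A"; auto simp: emeasure_space_1)+
	qed simp
	then show ?thesis
		unfolding emm_prec_def emm_of_mm_def one_point_mm_def
		by (intro bexI[of _ "\<lambda>_. ()"] bexI[of _ "space (emm_measure X)"]) (auto simp: emeasure_space_1)
qed

text \<open>Convergence of pyramids tested on the spaces themselves, so that closures and isomorphism classes disappear.\<close>

lemma painleve_kuratowskiI:
	assumes probX: "\<And>n. prob_space (emm_measure (X n))" and probY: "prob_space (emm_measure Y)"
		and lower: "\<And>Z e. mm_space (Z :: real mm) \<Longrightarrow> emm_of_mm Z \<prec>\<prec> Y \<Longrightarrow> e > 0 \<Longrightarrow>
			\<forall>\<^sub>F n in sequentially. \<exists>Z'::real mm. mm_space Z' \<and> emm_of_mm Z' \<prec>\<prec> X n \<and> box Z' Z < ennreal e"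
		and upper: "\<And>Z e. mm_space (Z :: real mm) \<Longrightarrow> e > 0 \<Longrightarrow> \<exists>d>0. \<forall>\<^sub>F n in sequentially.
			\<forall>Z'::real mm. mm_space Z' \<and> emm_of_mm Z' \<prec>\<prec> X n \<and> box Z' Z < ennreal d \<longrightarrow>
				(\<exists>B::real mm. mm_space B \<and> emm_of_mm B \<prec>\<prec> Y \<and> box B Z < ennreal e)"
	shows "painleve_kuratowski (\<lambda>n. box_closure (pyramid (X n))) (box_closure (pyramid Y))"
proof -
	let ?C = "\<lambda>n. box_closure (pyramid (X n))" and ?D = "box_closure (pyramid Y)"
	have classD: "A \<in> mm_classes" if "A \<in> box_closure S" for A S using that by (simp add: box_closure_def)
	have lim: "?D \<subseteq> box_liminf ?C"
	proof
		fix A assume A: "A \<in> ?D"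
		then have Ac: "A \<in> mm_classes" by (rule classD)
		have ne: "\<exists>B. B \<in> ?C n" for n
		proof -
			obtain B where "B \<in> pyramid (X n)"
				by (rule pyramid_approx[OF probX mm_space_point point_prec[OF probX], of 1 n]) auto
			then show ?thesis using pyramid_subset_closure by blast
		qed
		have ev: "\<forall>\<^sub>F n in sequentially. \<exists>B\<in>?C n. box_class B A < ennreal e" if e: "e > 0" for e
		proof -
			obtain A' where A': "A' \<in> pyramid Y" "box_class A A' < ennreal (e/4)"
				using A e unfolding box_closure_def by (auto dest!: spec[of _ "ennreal (e/4)"])
			have "\<forall>\<^sub>F n in sequentially. \<exists>Z'::real mm. mm_space Z' \<and> emm_of_mm Z' \<prec>\<prec> X n \<and> box Z' (rep A') < ennreal (e/4)"
				by (rule lower[OF pyramidD(1,2)[OF A'(1)]]) (use e in simp)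
			then show ?thesis
			proof eventually_elim
				case (elim n)
				then obtain Z' :: "real mm" where Z': "mm_space Z'" "emm_of_mm Z' \<prec>\<prec> X n" "box Z' (rep A') < ennreal (e/4)" by blast
				obtain B where B: "B \<in> pyramid (X n)" "box (rep B) Z' < ennreal (e/4)"
					by (rule pyramid_approx[OF probX Z'(1,2), of "e/4"]) (use e in auto)
				have "box (rep B) (rep A') < ennreal (e * (5/8))"
					by (rule box_triangle_less[OF Z'(1) B(2) Z'(3)]) (use e in simp)
				then have "box (rep B) (rep A) < ennreal e"
				proof (rule box_triangle_less[OF pyramidD(1)[OF A'(1)]])
					show "box (rep A') (rep A) < ennreal (e/4)" using A'(2) by (simp add: box_class_def box_commute[of "rep A'"])
				qed (use e in simp)
				then show ?case using B(1) pyramid_subset_closure by (auto simp: box_class_def)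
			qed
		qed
		\<comment> \<open>One sequence has to serve all e at once, so its n-th term almost minimises the
		  distance to A, up to 1 / (n + 1).\<close>
		define v where "v n = (INF B'\<in>?C n. box_class B' A)" for n
		have "\<exists>B\<in>?C n. box_class B A \<le> v n + ennreal (1 / real (Suc n))" for n
		proof (cases "v n = \<infinity>")
			case True
			then show ?thesis using ne[of n] by auto
		next
			case False
			then obtain r where r: "v n = ennreal r" "0 \<le> r" by (cases "v n") auto
			have "v n < v n + ennreal (1 / real (Suc n))"
				unfolding r(1) using r(2) by (simp add: ennreal_less_iff flip: ennreal_plus)
			then obtain B where "B \<in> ?C n" "box_class B A < v n + ennreal (1 / real (Suc n))"
				unfolding v_def INF_less_iff by blast
			then show ?thesis by (auto intro: less_imp_le)
		qed
		then obtain B where B: "\<And>n. B n \<in> ?C n" "\<And>n. box_class (B n) A \<le> v n + ennreal (1 / real (Suc n))"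
			by metis
		have "v \<longlonglongrightarrow> 0"
		proof (rule order_tendstoI)
			fix a :: ennreal assume "0 < a"
			then obtain e where e: "e > 0" "ennreal e \<le> a" by (rule ennreal_pos_real)
			show "\<forall>\<^sub>F n in sequentially. v n < a"
				using ev[OF e(1)]
			proof eventually_elim
				case (elim n)
				then have "v n < ennreal e" unfolding v_def INF_less_iff .
				then show ?case using e(2) by simp
			qed
		qed simp
		moreover have "(\<lambda>n. ennreal (1 / real (Suc n))) \<longlonglongrightarrow> ennreal 0"
			by (intro tendsto_ennrealI LIMSEQ_Suc[OF lim_1_over_n])
		ultimately have "(\<lambda>n. v n + ennreal (1 / real (Suc n))) \<longlonglongrightarrow> 0 + ennreal 0"
			by (rule tendsto_add)
		then have "(\<lambda>n. v n + ennreal (1 / real (Suc n))) \<longlonglongrightarrow> 0" by simp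
		from tendsto_sandwich[OF _ _ tendsto_const this, of "\<lambda>n. box_class (B n) A"]
		have "(\<lambda>n. box_class (B n) A) \<longlonglongrightarrow> 0" using B(2) by simp
		then show "A \<in> box_liminf ?C" unfolding box_liminf_def using Ac B(1) by blast
	qed
	have "box_liminf ?C \<subseteq> box_limsup ?C"
		unfolding box_liminf_def box_limsup_def using strict_mono_id by fastforce
	moreover have "box_limsup ?C \<subseteq> ?D"
	proof
		fix A assume "A \<in> box_limsup ?C"
		then obtain n B where A: "A \<in> mm_classes" and n: "strict_mono n" and B: "\<And>k. B k \<in> ?C (n k)"
			and lim: "(\<lambda>k. box_class (B k) A) \<longlonglongrightarrow> 0"
			unfolding box_limsup_def by blast
		have "\<exists>B\<in>pyramid Y. box_class A B < a" if "a > 0" for a :: ennreal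
		proof -
			obtain e where e: "e > 0" "ennreal e \<le> a" using \<open>a > 0\<close> by (rule ennreal_pos_real)
			have "e/4 > 0" using e by simp
			from upper[OF mm_space_rep[OF A] this] obtain d where d: "d > 0"
				"\<forall>\<^sub>F n in sequentially. \<forall>Z'::real mm. mm_space Z' \<and> emm_of_mm Z' \<prec>\<prec> X n \<and> box Z' (rep A) < ennreal d \<longrightarrow>
					(\<exists>B::real mm. mm_space B \<and> emm_of_mm B \<prec>\<prec> Y \<and> box B (rep A) < ennreal (e/4))"
				by blast
			have "\<forall>\<^sub>F k in sequentially. box_class (B k) A < ennreal (d/4)"
				using lim by (rule order_tendstoD) (use d in simp)
			with filterlim_subseq[OF n, unfolded filterlim_iff, rule_format, OF d(2)]
			have "\<forall>\<^sub>F k in sequentially. box_class (B k) A < ennreal (d/4) \<and>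
				(\<forall>Z'::real mm. mm_space Z' \<and> emm_of_mm Z' \<prec>\<prec> X (n k) \<and> box Z' (rep A) < ennreal d \<longrightarrow>
					(\<exists>B::real mm. mm_space B \<and> emm_of_mm B \<prec>\<prec> Y \<and> box B (rep A) < ennreal (e/4)))"
				by eventually_elim blast
			then obtain k where k: "box_class (B k) A < ennreal (d/4)"
				"\<And>Z'::real mm. mm_space Z' \<Longrightarrow> emm_of_mm Z' \<prec>\<prec> X (n k) \<Longrightarrow> box Z' (rep A) < ennreal d \<Longrightarrow>
					(\<exists>B::real mm. mm_space B \<and> emm_of_mm B \<prec>\<prec> Y \<and> box B (rep A) < ennreal (e/4))"
				unfolding eventually_sequentially by blast
			\<comment> \<open>\<open>B k\<close> lies in the closure of the pyramid only; it is replaced by a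
			  nearby member, to which \<open>upper\<close> applies.\<close>
			have "ennreal (d/4) > 0" using d by simp
			then obtain A' where A': "A' \<in> pyramid (X (n k))" "box_class (B k) A' < ennreal (d/4)"
				using B[of k] unfolding box_closure_def by blast
			have "box (rep A') (rep A) < ennreal d"
			proof (rule box_triangle_less)
				show "mm_space (rep (B k))" using mm_space_rep[OF classD[OF B]] .
				show "box (rep A') (rep (B k)) < ennreal (d/4)" using A'(2) by (simp add: box_class_def box_commute[of "rep A'"])
				show "box (rep (B k)) (rep A) < ennreal (d/4)" using k(1) by (simp add: box_class_def)
			qed (use d in simp)
			from k(2)[OF pyramidD(1,2)[OF A'(1)] this] obtain E :: "real mm" where
				E: "mm_space E" "emm_of_mm E \<prec>\<prec> Y" "box E (rep A) < ennreal (e/4)" by blast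
			obtain G where G: "G \<in> pyramid Y" "box (rep G) E < ennreal (e/4)"
				by (rule pyramid_approx[OF probY E(1,2) \<open>e/4 > 0\<close>])
			have "box (rep G) (rep A) < ennreal e"
				by (rule box_triangle_less[OF E(1) G(2) E(3)]) (use e in simp)
			then have "box_class A G < a" using e(2) by (simp add: box_class_def box_commute[of "rep A"])
			then show ?thesis using G(1) by blast
		qed
		then show "A \<in> ?D" unfolding box_closure_def using A by blast
	qed
	ultimately show ?thesis unfolding painleve_kuratowski_def using lim by blast
qed

section \<open>Gaussian sequences and the uniform measure on the sphere\<close>

text \<open>A pseudometric on all sequences. Points of the sphere are sequences with the value
  \<open>undefined\<close> beyond n, so they and Gaussian sequences are compared by the same
  function.\<close>

definition euc :: "nat \<Rightarrow> (nat \<Rightarrow> real) \<Rightarrow> (nat \<Rightarrow> real) \<Rightarrow> real" where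
	"euc k x y = L2_set (\<lambda>i. x i - y i) {..<k}"

lemma euc_nonneg [simp]: "0 \<le> euc k x y" by (simp add: euc_def)

lemma euc_refl [simp]: "euc k x x = 0" by (simp add: euc_def L2_set_def)

lemma euc_commute: "euc k x y = euc k y x"
	by (simp add: euc_def L2_set_def power2_commute)

lemma euc_triangle: "euc k x z \<le> euc k x y + euc k y z"
	using L2_set_triangle_ineq[of "\<lambda>i. x i - y i" "\<lambda>i. y i - z i" "{..<k}"] by (simp add: euc_def)

lemma euc_mono: "k \<le> m \<Longrightarrow> euc k x y \<le> euc m x y"
	unfolding euc_def L2_set_def by (intro real_sqrt_le_mono sum_mono2) auto

lemma euc_component: "i < k \<Longrightarrow> \<bar>x i - y i\<bar> \<le> euc k x y"
proof -
	assume i: "i < k"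
	have "\<bar>x i - y i\<bar> = sqrt ((x i - y i)^2)" by simp
	also have "\<dots> \<le> euc k x y"
		unfolding euc_def L2_set_def using i by (intro real_sqrt_le_mono member_le_sum) auto
	finally show ?thesis .
qed

lemma euc_power2: "(euc k x y)^2 = (\<Sum>i<k. (x i - y i)^2)"
	by (simp add: euc_def L2_set_def sum_nonneg)

lemma continuous_on_coordinate: "continuous_on S (\<lambda>x::nat \<Rightarrow> real. x i)"
	by (rule continuous_on_subset[OF continuous_on_product_coordinates]) auto

lemma continuous_euc: "continuous_on S (\<lambda>x. euc k x y)"
	unfolding euc_def L2_set_def by (intro continuous_intros continuous_on_coordinate)

lemma measurable_euc [measurable]:
	assumes [measurable]: "f \<in> borel_measurable N" "g \<in> borel_measurable N"
	shows "(\<lambda>x. euc k (f x) (g x)) \<in> borel_measurable N"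
proof -
	have [measurable]: "(\<lambda>x. f x i) \<in> borel_measurable N" "(\<lambda>x. g x i) \<in> borel_measurable N" for i
		by (rule measurable_product_then_coordinatewise, fact)+
	show ?thesis unfolding euc_def L2_set_def by measurable
qed

lemma measurable_cylinder_continuous:
	assumes "\<And>x y. \<bar>g x - g y\<bar> \<le> c * euc k x y"
	shows "g \<in> borel_measurable borel"
proof (rule borel_measurable_continuous_onI)
	show "continuous_on UNIV g"
		unfolding continuous_on_def
	proof
		fix x
		have "((\<lambda>y. euc k y x) \<longlongrightarrow> euc k x x) (at x)"
			using continuous_euc[of UNIV k x] unfolding continuous_on_def by blast
		then have "((\<lambda>y. c * euc k y x) \<longlongrightarrow> 0) (at x)"
			by (intro tendsto_mult_right_zero) simp
		then have "((\<lambda>y. g y - g x) \<longlongrightarrow> 0) (at x)"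
			by (rule Lim_null_comparison[rotated]) (use assms in simp)
		then show "(g \<longlongrightarrow> g x) (at x within UNIV)" by (rule LIM_zero_cancel)
	qed
qed

definition gauss :: "real \<Rightarrow> (nat \<Rightarrow> real) measure" where
	"gauss l = PiM UNIV (\<lambda>_. density lborel (normal_density 0 l))"

lemma gaussian_product: "l > 0 \<Longrightarrow> product_prob_space (\<lambda>_. density lborel (normal_density 0 l))"
	by (simp add: product_prob_spaceI prob_space_normal_density)

lemma prob_space_gauss: "l > 0 \<Longrightarrow> prob_space (gauss l)"
	unfolding gauss_def by (intro prob_space_PiM prob_space_normal_density)

lemma sets_gauss [measurable_cong, simp]: "sets (gauss l) = sets borel"
proof -
	have "sets (gauss l) = sets (PiM UNIV (\<lambda>_::nat. borel :: real measure))"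
		unfolding gauss_def by (intro sets_PiM_cong) auto
	then show ?thesis by (simp add: sets_PiM_equal_borel)
qed

lemma space_gauss [simp]: "space (gauss l) = UNIV"
	using sets_eq_imp_space_eq[OF sets_gauss] by simp

lemma AE_gaussian_nonzero: "l > 0 \<Longrightarrow> AE x in gauss l. x i \<noteq> 0"
proof -
	assume l: "l > 0"
	interpret product_prob_space "\<lambda>_. density lborel (normal_density 0 l)" "UNIV :: nat set"
		by (rule gaussian_product[OF l])
	have "AE x in density lborel (normal_density 0 l). x \<noteq> 0"
		using AE_lborel_singleton[of "0::real"] by (subst AE_density) (auto elim: eventually_mono)
	then show ?thesis unfolding gauss_def by (rule AE_component[rotated]) simp
qed

section \<open>Cones under Lebesgue and Gaussian measure\<close>

interpretation lb: product_sigma_finite "\<lambda>_. lborel :: real measure"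
	by standard

lemma nn_integral_scale_PiM:
	assumes "finite I" "t > 0" "f \<in> borel_measurable (PiM I (\<lambda>_. lborel :: real measure))"
	shows "(\<integral>\<^sup>+x. f x \<partial>PiM I (\<lambda>_. lborel)) = ennreal (t ^ card I) * (\<integral>\<^sup>+x. f (\<lambda>i\<in>I. t * x i) \<partial>PiM I (\<lambda>_. lborel))"
	using assms(1,3)
proof (induction I arbitrary: f)
	case empty
	show ?case by (simp add: PiM_empty nn_integral_count_space_finite restrict_def)
next
	case (insert i I)
	note [measurable] = insert.prems
	let ?P = "PiM I (\<lambda>_. lborel :: real measure)"
	let ?s = "\<lambda>x. (\<lambda>j\<in>I. t * x j)"
	interpret I: sigma_finite_measure ?P by (rule lb.sigma_finite) fact
	have s[measurable]: "?s \<in> ?P \<rightarrow>\<^sub>M ?P" by measurable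
	have s'[measurable]: "(\<lambda>x. \<lambda>j\<in>insert i I. t * x j) \<in> PiM (insert i I) (\<lambda>_. lborel) \<rightarrow>\<^sub>M PiM (insert i I) (\<lambda>_. lborel)"
		by measurable
	have fm: "(\<lambda>x. f (x(i := y))) \<in> borel_measurable ?P" for y
		by (rule measurable_compose[OF _ insert.prems]) measurable
	have Gm: "(\<lambda>y. \<integral>\<^sup>+x. f ((?s x)(i := y)) \<partial>?P) \<in> borel_measurable lborel"
	proof -
		have "(\<lambda>z. (?s (snd z))(i := fst z)) \<in> lborel \<Otimes>\<^sub>M ?P \<rightarrow>\<^sub>M PiM (insert i I) (\<lambda>_. lborel)"
			by measurable
		from measurable_compose[OF this insert.prems]
		have "(\<lambda>(y, x). f ((?s x)(i := y))) \<in> borel_measurable (lborel \<Otimes>\<^sub>M ?P)"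
			by (simp add: case_prod_beta')
		then show ?thesis by (rule I.borel_measurable_nn_integral)
	qed
	have "(\<integral>\<^sup>+x. f x \<partial>PiM (insert i I) (\<lambda>_. lborel)) = (\<integral>\<^sup>+y. \<integral>\<^sup>+x. f (x(i := y)) \<partial>?P \<partial>lborel)"
		by (rule lb.product_nn_integral_insert_rev) (use insert in auto)
	also have "\<dots> = (\<integral>\<^sup>+y. ennreal (t ^ card I) * (\<integral>\<^sup>+x. f ((?s x)(i := y)) \<partial>?P) \<partial>lborel)"
		by (rule nn_integral_cong, rule insert.IH[OF fm])
	also have "\<dots> = ennreal (t ^ card I) * (\<integral>\<^sup>+y. \<integral>\<^sup>+x. f ((?s x)(i := y)) \<partial>?P \<partial>lborel)"
		by (rule nn_integral_cmult[OF Gm])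
	also have "(\<integral>\<^sup>+y. \<integral>\<^sup>+x. f ((?s x)(i := y)) \<partial>?P \<partial>lborel) = ennreal t * (\<integral>\<^sup>+y. \<integral>\<^sup>+x. f ((?s x)(i := t * y)) \<partial>?P \<partial>lborel)"
		using nn_integral_real_affine[OF Gm[unfolded measurable_lborel2], of t 0] assms(2) by simp
	also have "(\<integral>\<^sup>+y. \<integral>\<^sup>+x. f ((?s x)(i := t * y)) \<partial>?P \<partial>lborel) = (\<integral>\<^sup>+y. \<integral>\<^sup>+x. f (\<lambda>j\<in>insert i I. t * (x(i := y)) j) \<partial>?P \<partial>lborel)"
	proof (intro nn_integral_cong arg_cong[where f = f] ext)
		fix y :: real and x :: "'a \<Rightarrow> real" and j
		show "((?s x)(i := t * y)) j = (\<lambda>j\<in>insert i I. t * (x(i := y)) j) j"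
			using insert(2) by auto
	qed
	also have "\<dots> = (\<integral>\<^sup>+x. f (\<lambda>j\<in>insert i I. t * x j) \<partial>PiM (insert i I) (\<lambda>_. lborel))"
		by (rule lb.product_nn_integral_insert_rev[symmetric]) (use insert in auto)
	also have "ennreal (t ^ card I) * (ennreal t * (\<integral>\<^sup>+x. f (\<lambda>j\<in>insert i I. t * x j) \<partial>PiM (insert i I) (\<lambda>_. lborel)))
			= ennreal (t ^ card (insert i I)) * (\<integral>\<^sup>+x. f (\<lambda>j\<in>insert i I. t * x j) \<partial>PiM (insert i I) (\<lambda>_. lborel))"
		using insert assms(2) by (simp add: ennreal_mult'' mult.assoc[symmetric] mult.commute[of t])
	finally show ?case .
qed

abbreviation sqn :: "nat \<Rightarrow> (nat \<Rightarrow> real) \<Rightarrow> real" where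
	"sqn n x \<equiv> (\<Sum>i\<le>n. (x i)^2)"

lemma measurable_component_euclidean:
	"i \<le> n \<Longrightarrow> (\<lambda>x. x i) \<in> borel_measurable (leb n)"
	unfolding euclidean_lebesgue_def
	using measurable_component_singleton[of i "{..n}" "\<lambda>_. lborel :: real measure"] by simp

lemma measurable_sqn [measurable]: "sqn n \<in> borel_measurable (leb n)"
	by (intro borel_measurable_sum borel_measurable_power measurable_component_euclidean) auto

lemma space_euclidean_lebesgue [simp]: "space (leb n) = {..n} \<rightarrow>\<^sub>E UNIV"
	by (simp add: euclidean_lebesgue_def space_PiM)

text \<open>Dilation by t maps the cone to itself and its part in the unit ball onto its part in the
  ball of radius t; in dimension n + 1 the Jacobian is t^(n+1).\<close>

lemma emeasure_scaled_cone:
	assumes K[measurable]: "K \<in> sets (leb n)" and t: "t > 0"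
		and cone: "\<And>x. x \<in> space (leb n) \<Longrightarrow> (\<lambda>i\<in>{..n}. t * x i) \<in> K \<longleftrightarrow> x \<in> K"
	shows "emeasure (leb n) {x \<in> K. sqn n x \<le> t^2} =
		ennreal (t ^ Suc n) * emeasure (leb n) {x \<in> K. sqn n x \<le> 1}"
proof -
	have KS: "K \<subseteq> space (leb n)" by (rule sets.sets_into_space) fact
	have [measurable]: "{x \<in> K. sqn n x \<le> c} \<in> sets (leb n)" for c
	proof -
		have "{x \<in> K. sqn n x \<le> c} = K \<inter> {x \<in> space (leb n). sqn n x \<le> c}" using KS by auto
		also have "\<dots> \<in> sets (leb n)" by measurable
		finally show ?thesis .
	qed
	have "emeasure (leb n) {x \<in> K. sqn n x \<le> t^2} = (\<integral>\<^sup>+x. indicator {x \<in> K. sqn n x \<le> t^2} x \<partial>leb n)"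
		by simp
	also have "\<dots> = ennreal (t ^ card {..n}) * (\<integral>\<^sup>+x. indicator {x \<in> K. sqn n x \<le> t^2} (\<lambda>i\<in>{..n}. t * x i) \<partial>leb n)"
		unfolding euclidean_lebesgue_def
		by (rule nn_integral_scale_PiM) (use t in \<open>auto simp flip: euclidean_lebesgue_def\<close>)
	also have "(\<integral>\<^sup>+x. indicator {x \<in> K. sqn n x \<le> t^2} (\<lambda>i\<in>{..n}. t * x i) \<partial>leb n)
			= (\<integral>\<^sup>+x. indicator {x \<in> K. sqn n x \<le> 1} x \<partial>leb n)"
	proof (rule nn_integral_cong)
		fix x assume x: "x \<in> space (leb n)"
		have "sqn n (\<lambda>i\<in>{..n}. t * x i) = t^2 * sqn n x"
			by (simp add: sum_distrib_left power_mult_distrib)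
		then have "sqn n (\<lambda>i\<in>{..n}. t * x i) \<le> t^2 \<longleftrightarrow> sqn n x \<le> 1" using t by simp
		then show "indicator {x \<in> K. sqn n x \<le> t^2} (\<lambda>i\<in>{..n}. t * x i) = (indicator {x \<in> K. sqn n x \<le> 1} x :: ennreal)"
			using cone[OF x] by (simp add: indicator_def)
	qed
	finally show ?thesis by simp
qed

definition gaussian_fin :: "nat \<Rightarrow> real \<Rightarrow> (nat \<Rightarrow> real) measure" where
	"gaussian_fin n l = PiM {..n} (\<lambda>_. density lborel (normal_density 0 l))"

lemma sets_gaussian_fin [measurable_cong, simp]: "sets (gaussian_fin n l) = sets (leb n)"
	unfolding gaussian_fin_def euclidean_lebesgue_def by (intro sets_PiM_cong) auto

lemma gaussian_fin_density:
	assumes l: "l > 0"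
	shows "gaussian_fin n l = density (leb n) (\<lambda>x. \<Prod>i\<le>n. ennreal (normal_density 0 l (x i)))"
proof -
	interpret G: product_prob_space "\<lambda>_. density lborel (normal_density 0 l)" "UNIV :: nat set"
		by (rule gaussian_product[OF l])
	show ?thesis
		unfolding gaussian_fin_def
	proof (rule G.PiM_eqI[symmetric])
		show "sets (density (leb n) (\<lambda>x. \<Prod>i\<le>n. ennreal (normal_density 0 l (x i)))) =
			 sets (PiM {..n} (\<lambda>_. density lborel (normal_density 0 l)))"
			using sets_gaussian_fin[of n l] by (simp add: gaussian_fin_def)
		fix A :: "nat \<Rightarrow> real set" assume "\<And>i. i \<in> {..n} \<Longrightarrow> A i \<in> sets (density lborel (normal_density 0 l))"
		then have A: "\<And>i. i \<le> n \<Longrightarrow> A i \<in> sets borel" by simp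
		have [measurable]: "Pi\<^sub>E {..n} A \<in> sets (leb n)"
			unfolding euclidean_lebesgue_def by (rule sets_PiM_I_finite) (use A in auto)
		have "emeasure (density (leb n) (\<lambda>x. \<Prod>i\<le>n. ennreal (normal_density 0 l (x i)))) (Pi\<^sub>E {..n} A)
			= (\<integral>\<^sup>+x. (\<Prod>i\<le>n. ennreal (normal_density 0 l (x i))) * indicator (Pi\<^sub>E {..n} A) x \<partial>leb n)"
		proof (rule emeasure_density)
			show "(\<lambda>x. \<Prod>i\<le>n. ennreal (normal_density 0 l (x i))) \<in> borel_measurable (leb n)"
				by (intro borel_measurable_prod_ennreal measurable_compose[OF measurable_component_euclidean]) auto
		qed fact
		also have "\<dots> = (\<integral>\<^sup>+x. (\<Prod>i\<le>n. ennreal (normal_density 0 l (x i)) * indicator (A i) (x i)) \<partial>leb n)"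
		proof (rule nn_integral_cong)
			fix x assume x: "x \<in> space (leb n)"
			have "indicator (Pi\<^sub>E {..n} A) x = (\<Prod>i\<le>n. indicator (A i) (x i) :: ennreal)"
				using x by (auto simp: indicator_def PiE_def Pi_def prod_zero_iff)
			then show "(\<Prod>i\<le>n. ennreal (normal_density 0 l (x i))) * indicator (Pi\<^sub>E {..n} A) x =
				 (\<Prod>i\<le>n. ennreal (normal_density 0 l (x i)) * indicator (A i) (x i))"
				by (simp add: prod.distrib)
		qed
		also have "\<dots> = (\<Prod>i\<le>n. \<integral>\<^sup>+x. ennreal (normal_density 0 l x) * indicator (A i) x \<partial>lborel)"
			unfolding euclidean_lebesgue_def by (rule lb.product_nn_integral_prod) (use A in auto)
		also have "\<dots> = (\<Prod>i\<le>n. emeasure (density lborel (normal_density 0 l)) (A i))"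
			by (rule prod.cong[OF refl]) (use A in \<open>simp add: emeasure_density\<close>)
		finally show "emeasure (density (leb n) (\<lambda>x. \<Prod>i\<le>n. ennreal (normal_density 0 l (x i)))) (Pi\<^sub>E {..n} A)
			= (\<Prod>i\<in>{..n}. emeasure (density lborel (normal_density 0 l)) (A i))" by simp
	qed simp
qed

text \<open>The Gaussian density is a mixture of indicator functions of balls, so on cones the Gaussian
	measure is proportional to the Lebesgue measure inside the unit ball.\<close>

lemma gaussian_fin_cone:
	assumes l: "l > 0" and K[measurable]: "K \<in> sets (leb n)"
		and cone: "\<And>x t. x \<in> space (leb n) \<Longrightarrow> t > 0 \<Longrightarrow> (\<lambda>i\<in>{..n}. t * x i) \<in> K \<longleftrightarrow> x \<in> K"
	shows "emeasure (gaussian_fin n l) K =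
		(ennreal ((1 / sqrt (2 * pi * l^2)) ^ Suc n) * (\<integral>\<^sup>+u. indicator {0<..<1} u * ennreal ((l * sqrt (- 2 * ln u)) ^ Suc n) \<partial>lborel)) *
			emeasure (leb n) {x \<in> K. sqn n x \<le> 1}"
proof -
	let ?E = "leb n"
	let ?c = "ennreal ((1 / sqrt (2 * pi * l^2)) ^ Suc n)"
	interpret E: sigma_finite_measure ?E
		unfolding euclidean_lebesgue_def by (rule lb.sigma_finite) simp
	interpret pair_sigma_finite lborel ?E by standard
	have KS: "K \<subseteq> space ?E" by (rule sets.sets_into_space) fact
	have dens: "(\<Prod>i\<le>n. ennreal (normal_density 0 l (x i))) = ?c * ennreal (exp (- sqn n x / (2 * l^2)))" for x
	proof -
		have "(\<Prod>i\<le>n. ennreal (normal_density 0 l (x i))) = ennreal (\<Prod>i\<le>n. normal_density 0 l (x i))"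
			by (rule prod_ennreal) simp
		also have "(\<Prod>i\<le>n. normal_density 0 l (x i)) = (1 / sqrt (2 * pi * l^2)) ^ Suc n * (\<Prod>i\<le>n. exp (- (x i)\<^sup>2 / (2 * l^2)))"
			by (simp add: normal_density_def prod_dividef power_divide)
		also have "(\<Prod>i\<le>n. exp (- (x i)\<^sup>2 / (2 * l^2))) = exp (\<Sum>i\<le>n. - (x i)\<^sup>2 / (2 * l^2))"
			by (rule exp_sum[symmetric]) simp
		also have "(\<Sum>i\<le>n. - (x i)\<^sup>2 / (2 * l^2)) = - sqn n x / (2 * l^2)"
			by (simp add: sum_divide_distrib sum_negf)
		finally have e: "(\<Prod>i\<le>n. ennreal (normal_density 0 l (x i))) =
			ennreal ((1 / sqrt (2 * pi * l^2)) ^ Suc n * exp (- sqn n x / (2 * l^2)))" .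
		show ?thesis unfolding e by (rule ennreal_mult'') simp
	qed
	\<comment> \<open>exp (- q) is the length of the set of heights u below it. With q = |x|^2 / (2
	  l^2), the points above height u form the ball of radius
	  \<open>l * sqrt (- 2 * ln u)\<close>.\<close>
	have layer: "ennreal (exp (- q)) = (\<integral>\<^sup>+u. indicator {0<..<1} u * indicator {u. q \<le> - ln u} u \<partial>lborel)" if "q \<ge> 0" for q :: real
	proof -
		have "(\<integral>\<^sup>+u. indicator {0<..<1} u * indicator {u. q \<le> - ln u} u \<partial>lborel) = (\<integral>\<^sup>+u. indicator {0<..exp (- q)} u \<partial>lborel)"
		proof (rule nn_integral_cong_AE)
			show "AE u in lborel. indicator {0<..<1} u * indicator {u. q \<le> - ln u} u = (indicator {0<..exp (- q)} u :: ennreal)"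
				using AE_lborel_singleton[of "1::real"]
			proof eventually_elim
				case (elim u)
				have "u \<le> exp (- q) \<longleftrightarrow> ln u \<le> - q" if "u > 0"
					using that by (metis exp_le_cancel_iff exp_ln)
				moreover have "u \<le> 1" if "u \<le> exp (- q)"
					using \<open>q \<ge> 0\<close> by (intro order_trans[OF that]) simp
				ultimately show ?case using elim by (auto simp: indicator_def less_le)
			qed
		qed
		also have "\<dots> = ennreal (exp (- q))" by simp
		finally show ?thesis by simp
	qed
	have iff: "sqn n x / (2 * l^2) \<le> - ln u \<longleftrightarrow> sqn n x \<le> (l * sqrt (- 2 * ln u))^2" if "u \<in> {0<..<1}" for x u
	proof -
		have "ln u < 0" using that by simp
		then have "(l * sqrt (- 2 * ln u))^2 = l^2 * (- 2 * ln u)" by (simp add: power_mult_distrib)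
		then show ?thesis using l by (simp add: field_simps)
	qed
	have m[measurable]: "(\<lambda>z. indicator {0<..<1} (fst z) * indicator {u. sqn n (snd z) / (2 * l^2) \<le> - ln u} (fst z) * indicator K (snd z) :: ennreal)
			\<in> borel_measurable (lborel \<Otimes>\<^sub>M ?E)"
		unfolding indicator_def mem_Collect_eq by measurable
	have "emeasure (gaussian_fin n l) K = (\<integral>\<^sup>+x. (?c * ennreal (exp (- sqn n x / (2 * l^2)))) * indicator K x \<partial>?E)"
		unfolding gaussian_fin_density[OF l] by (subst emeasure_density) (auto simp: dens)
	also have "\<dots> = (\<integral>\<^sup>+x. ?c * (ennreal (exp (- sqn n x / (2 * l^2))) * indicator K x) \<partial>?E)"
		by (simp add: mult.assoc)
	also have "\<dots> = ?c * (\<integral>\<^sup>+x. ennreal (exp (- sqn n x / (2 * l^2))) * indicator K x \<partial>?E)"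
		by (rule nn_integral_cmult) measurable
	also have "(\<integral>\<^sup>+x. ennreal (exp (- sqn n x / (2 * l^2))) * indicator K x \<partial>?E)
			= (\<integral>\<^sup>+x. \<integral>\<^sup>+u. indicator {0<..<1} u * indicator {u. sqn n x / (2 * l^2) \<le> - ln u} u * indicator K x \<partial>lborel \<partial>?E)"
	proof (rule nn_integral_cong)
		fix x
		have "ennreal (exp (- sqn n x / (2 * l^2))) = (\<integral>\<^sup>+u. indicator {0<..<1} u * indicator {u. sqn n x / (2 * l^2) \<le> - ln u} u \<partial>lborel)"
			using layer[of "sqn n x / (2 * l^2)"] l by (simp add: sum_nonneg)
		then show "ennreal (exp (- sqn n x / (2 * l^2))) * indicator K x =
				(\<integral>\<^sup>+u. indicator {0<..<1} u * indicator {u. sqn n x / (2 * l^2) \<le> - ln u} u * indicator K x \<partial>lborel)"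
			by (simp only:) (rule nn_integral_multc[symmetric], measurable)
	qed
	also have "\<dots> = (\<integral>\<^sup>+u. \<integral>\<^sup>+x. indicator {0<..<1} u * indicator {u. sqn n x / (2 * l^2) \<le> - ln u} u * indicator K x \<partial>?E \<partial>lborel)"
		using Fubini[OF m] by simp
	also have "\<dots> = (\<integral>\<^sup>+u. indicator {0<..<1} u * ennreal ((l * sqrt (- 2 * ln u)) ^ Suc n) * emeasure ?E {x \<in> K. sqn n x \<le> 1} \<partial>lborel)"
	proof (rule nn_integral_cong)
		fix u :: real
		show "(\<integral>\<^sup>+x. indicator {0<..<1} u * indicator {u. sqn n x / (2 * l^2) \<le> - ln u} u * indicator K x \<partial>?E)
				= indicator {0<..<1} u * ennreal ((l * sqrt (- 2 * ln u)) ^ Suc n) * emeasure ?E {x \<in> K. sqn n x \<le> 1}"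
		proof (cases "u \<in> {0<..<1}")
			case True
			have t: "l * sqrt (- 2 * ln u) > 0" using l True by simp
			have [measurable]: "{x \<in> K. sqn n x \<le> c} \<in> sets ?E" for c
			proof -
				have "{x \<in> K. sqn n x \<le> c} = K \<inter> {x \<in> space ?E. sqn n x \<le> c}" using KS by auto
				also have "\<dots> \<in> sets ?E" by measurable
				finally show ?thesis .
			qed
			have "(\<integral>\<^sup>+x. indicator {0<..<1} u * indicator {u. sqn n x / (2 * l^2) \<le> - ln u} u * indicator K x \<partial>?E)
					= (\<integral>\<^sup>+x. indicator {x \<in> K. sqn n x \<le> (l * sqrt (- 2 * ln u))^2} x \<partial>?E)"
				using True by (intro nn_integral_cong) (auto simp: indicator_def iff[OF True])
			also have "\<dots> = emeasure ?E {x \<in> K. sqn n x \<le> (l * sqrt (- 2 * ln u))^2}"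
				by (rule nn_integral_indicator) measurable
			also have "\<dots> = ennreal ((l * sqrt (- 2 * ln u)) ^ Suc n) * emeasure ?E {x \<in> K. sqn n x \<le> 1}"
				by (rule emeasure_scaled_cone[OF K t]) (rule cone[OF _ t])
			finally show ?thesis using True by simp
		qed simp
	qed
	also have "\<dots> = (\<integral>\<^sup>+u. indicator {0<..<1} u * ennreal ((l * sqrt (- 2 * ln u)) ^ Suc n) \<partial>lborel) * emeasure ?E {x \<in> K. sqn n x \<le> 1}"
		by (rule nn_integral_multc) measurable
	finally show ?thesis by (simp add: mult.assoc)
qed

lemma ball_space: "{x \<in> {..n} \<rightarrow>\<^sub>E UNIV. sqn n x \<le> c} \<in> sets (leb n)"
proof -
	have "{x \<in> space (leb n). sqn n x \<le> c} \<in> sets (leb n)" by measurable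
	then show ?thesis by simp
qed

abbreviation unit_ball_measure :: "nat \<Rightarrow> (nat \<Rightarrow> real) measure" where
	"unit_ball_measure n \<equiv> uniform_measure (leb n) {x \<in> {..n} \<rightarrow>\<^sub>E UNIV. sqn n x \<le> 1}"

lemma prob_space_gaussian_fin: "l > 0 \<Longrightarrow> prob_space (gaussian_fin n l)"
	unfolding gaussian_fin_def by (intro prob_space_PiM prob_space_normal_density)

lemma space_gaussian_fin [simp]: "space (gaussian_fin n l) = {..n} \<rightarrow>\<^sub>E UNIV"
	by (simp add: gaussian_fin_def space_PiM)

text \<open>Applied to the whole space, the cone formula says that a constant times the volume of
  the ball is 1, so the volume is neither 0 nor infinite.\<close>

lemma unit_ball_emeasure: "emeasure (leb n) {x \<in> {..n} \<rightarrow>\<^sub>E UNIV. sqn n x \<le> 1} \<noteq> 0"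
	"emeasure (leb n) {x \<in> {..n} \<rightarrow>\<^sub>E UNIV. sqn n x \<le> 1} \<noteq> \<infinity>"
proof -
	interpret G: prob_space "gaussian_fin n 1" by (rule prob_space_gaussian_fin) simp
	have sp: "space (leb n) \<in> sets (leb n)" by (rule sets.top)
	define c where "c = ennreal ((1 / sqrt (2 * pi * 1^2)) ^ Suc n) * (\<integral>\<^sup>+u. indicator {0<..<1} u * ennreal ((1 * sqrt (- 2 * ln u)) ^ Suc n) \<partial>lborel)"
	have "emeasure (gaussian_fin n 1) (space (leb n)) = c * emeasure (leb n) {x \<in> space (leb n). sqn n x \<le> 1}"
		unfolding c_def by (rule gaussian_fin_cone[OF _ sp]) auto
	then have *: "c * emeasure (leb n) {x \<in> {..n} \<rightarrow>\<^sub>E UNIV. sqn n x \<le> 1} = 1"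
		using G.emeasure_space_1 by simp
	show "emeasure (leb n) {x \<in> {..n} \<rightarrow>\<^sub>E UNIV. sqn n x \<le> 1} \<noteq> 0"
		using * by (metis mult_zero_right zero_neq_one)
	show "emeasure (leb n) {x \<in> {..n} \<rightarrow>\<^sub>E UNIV. sqn n x \<le> 1} \<noteq> \<infinity>"
		using * by (metis ennreal_mult_eq_top_iff ennreal_one_neq_top infinity_ennreal_def mult_zero_left zero_neq_one)
qed

text \<open>The factor in \<open>gaussian_fin_cone\<close> does not depend on the cone, so the whole
  space determines it.\<close>

lemma gaussian_fin_cone_eq:
	assumes l: "l > 0" and K[measurable]: "K \<in> sets (leb n)"
		and cone: "\<And>x t. x \<in> space (leb n) \<Longrightarrow> t > 0 \<Longrightarrow> (\<lambda>i\<in>{..n}. t * x i) \<in> K \<longleftrightarrow> x \<in> K"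
	shows "emeasure (gaussian_fin n l) K = emeasure (unit_ball_measure n) K"
proof -
	interpret G: prob_space "gaussian_fin n l" by (rule prob_space_gaussian_fin) fact
	let ?B = "{x \<in> {..n} \<rightarrow>\<^sub>E UNIV. sqn n x \<le> 1}" and ?E = "leb n"
	obtain c where c: "\<And>K. K \<in> sets ?E \<Longrightarrow> (\<And>x t. x \<in> space ?E \<Longrightarrow> t > 0 \<Longrightarrow> (\<lambda>i\<in>{..n}. t * x i) \<in> K \<longleftrightarrow> x \<in> K)
			\<Longrightarrow> emeasure (gaussian_fin n l) K = c * emeasure ?E {x \<in> K. sqn n x \<le> 1}"
		using gaussian_fin_cone[OF l] by blast
	have "c * emeasure ?E ?B = emeasure (gaussian_fin n l) (space ?E)"
		using c[OF sets.top] by simp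
	then have c1: "c * emeasure ?E ?B = 1" using G.emeasure_space_1 by simp
	have KS: "K \<subseteq> space ?E" by (rule sets.sets_into_space) fact
	have "c = 1 / emeasure ?E ?B"
	proof -
		have "c = c * (emeasure ?E ?B / emeasure ?E ?B)"
			using unit_ball_emeasure[of n] by (simp add: ennreal_divide_self less_top)
		also have "\<dots> = c * emeasure ?E ?B / emeasure ?E ?B" by (rule ennreal_times_divide)
		finally show ?thesis unfolding c1 .
	qed
	moreover have "{x \<in> K. sqn n x \<le> 1} = ?B \<inter> K" using KS by auto
	ultimately have "emeasure (gaussian_fin n l) K = (1 / emeasure ?E ?B) * emeasure ?E (?B \<inter> K)"
		using c[OF K cone] by simp
	also have "\<dots> = emeasure (unit_ball_measure n) K"
		by (subst emeasure_uniform_measure) (auto simp: ball_space divide_ennreal_def mult.commute)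
	finally show ?thesis .
qed

lemma measurable_radial [measurable]: "radial_projection n r \<in> leb n \<rightarrow>\<^sub>M leb n"
proof -
	have "(\<lambda>x. r * x i / sqrt (sqn n x)) \<in> borel_measurable (leb n)" if "i \<le> n" for i
		using measurable_component_euclidean[OF that] by measurable
	then show ?thesis
		unfolding radial_projection_def
		by (subst (2) euclidean_lebesgue_def) (intro measurable_restrict, auto)
qed

text \<open>Preimages under the radial projection are cones, and on cones the two measures
  agree.\<close>

lemma radial_gaussian_fin:
	assumes l: "l > 0"
	shows "distr (gaussian_fin n l) (leb n) (radial_projection n r)
		= distr (unit_ball_measure n) (leb n) (radial_projection n r)"
proof (rule measure_eqI)
	fix A assume "A \<in> sets (distr (gaussian_fin n l) (leb n) (radial_projection n r))"
	then have A: "A \<in> sets (leb n)" by simp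
	let ?K = "radial_projection n r -` A \<inter> space (leb n)"
	have K: "?K \<in> sets (leb n)" by (rule measurable_sets[OF measurable_radial A])
	have inv: "radial_projection n r (\<lambda>i\<in>{..n}. t * x i) = radial_projection n r x" if "t > 0" for t x
	proof -
		have "sqn n (\<lambda>i\<in>{..n}. t * x i) = t^2 * sqn n x"
			by (simp add: sum_distrib_left power_mult_distrib)
		then have "sqrt (sqn n (\<lambda>i\<in>{..n}. t * x i)) = t * sqrt (sqn n x)"
			using that by (simp add: real_sqrt_mult)
		then show ?thesis
			unfolding radial_projection_def using that by (intro restrict_ext) simp
	qed
	have "emeasure (distr (gaussian_fin n l) (leb n) (radial_projection n r)) A = emeasure (gaussian_fin n l) ?K"
		by (subst emeasure_distr) (use A in \<open>auto simp: space_gaussian_fin\<close>)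
	also have "\<dots> = emeasure (unit_ball_measure n) ?K"
		by (rule gaussian_fin_cone_eq[OF l K]) (use inv in auto)
	also have "\<dots> = emeasure (distr (unit_ball_measure n) (leb n) (radial_projection n r)) A"
		by (subst emeasure_distr) (use A in auto)
	finally show "emeasure (distr (gaussian_fin n l) (leb n) (radial_projection n r)) A
		= emeasure (distr (unit_ball_measure n) (leb n) (radial_projection n r)) A" .
qed simp

lemma restrict_gauss:
	assumes l: "l > 0"
	shows "distr (gauss l) (gaussian_fin n l) (\<lambda>x. restrict x {..n}) = gaussian_fin n l"
		"(\<lambda>x. restrict x {..n}) \<in> gauss l \<rightarrow>\<^sub>M gaussian_fin n l"
proof -
	interpret product_prob_space "\<lambda>_. density lborel (normal_density 0 l)" "UNIV :: nat set"
		by (rule gaussian_product[OF l])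
	show "distr (gauss l) (gaussian_fin n l) (\<lambda>x. restrict x {..n}) = gaussian_fin n l"
		unfolding gauss_def gaussian_fin_def by (rule distr_PiM_restrict_finite) auto
	show "(\<lambda>x. restrict x {..n}) \<in> gauss l \<rightarrow>\<^sub>M gaussian_fin n l"
		unfolding gauss_def gaussian_fin_def by (rule measurable_restrict_subset) simp
qed

text \<open>Division by zero makes \<open>radial_projection\<close> send the origin to itself, off
  the sphere. A pole is substituted, so that every sequence is mapped into the sphere.\<close>

definition to_sphere :: "nat \<Rightarrow> real \<Rightarrow> (nat \<Rightarrow> real) \<Rightarrow> nat \<Rightarrow> real" where
	"to_sphere n r x = (if sqn n x = 0 then (\<lambda>i\<in>{..n}. if i = 0 then r else 0) else radial_projection n r x)"

lemma to_sphere_mem: "r > 0 \<Longrightarrow> to_sphere n r x \<in> sphere_set n r"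
proof (cases "sqn n x = 0")
	case True
	then show ?thesis by (auto simp: to_sphere_def sphere_set_def if_distrib[of "\<lambda>x. x^2"] sum.delta cong: if_cong)
next
	case False
	have "sqn n x \<ge> 0" by (intro sum_nonneg) auto
	then have "(\<Sum>i\<le>n. (r * x i / sqrt (sqn n x))^2) = r^2"
		using False by (simp add: power_divide power_mult_distrib flip: sum_divide_distrib sum_distrib_left)
	then show ?thesis using False by (simp add: to_sphere_def radial_projection_def sphere_set_def)
qed

lemma sphere_set_sets: "sphere_set n r \<in> sets (leb n)"
proof -
	have "sphere_set n r = {x \<in> space (leb n). sqn n x = r^2}" by (auto simp: sphere_set_def)
	also have "\<dots> \<in> sets (leb n)" by measurable
	finally show ?thesis .
qed

lemma space_sphere_measure [simp]: "space (sphere_measure n r) = sphere_set n r"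
	using sets.sets_into_space[OF sphere_set_sets[of n r]] unfolding sphere_measure_def by (auto simp: space_restrict_space)

lemma sets_sphere_measure [measurable_cong]: "sets (sphere_measure n r) = sets (restrict_space (leb n) (sphere_set n r))"
	unfolding sphere_measure_def by (intro sets_restrict_space_cong) simp

text \<open>The direction of a centred Gaussian vector does not depend on its variance, so l is
  free: it can be the limit of the rescaled radii, or simply 1 when different radii are
  compared.\<close>

lemma to_sphere_law:
	assumes l: "l > 0" and r: "r > 0"
	shows "to_sphere n r \<in> gauss l \<rightarrow>\<^sub>M sphere_measure n r"
		"distr (gauss l) (sphere_measure n r) (to_sphere n r) = sphere_measure n r"
proof -
	let ?E = "leb n" and ?S = "sphere_set n r"
	have coord: "(\<lambda>x. x i) \<in> borel_measurable (gauss l)" for i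
		using measurable_product_coordinates[of i] by (simp cong: measurable_cong_sets)
	have res: "(\<lambda>x. restrict x {..n}) \<in> gauss l \<rightarrow>\<^sub>M ?E"
		using restrict_gauss(2)[OF l, of n] by (simp cong: measurable_cong_sets)
	have rr: "radial_projection n r x = radial_projection n r (restrict x {..n})" for x
		unfolding radial_projection_def by (intro restrict_ext) simp
	have rad: "radial_projection n r \<in> gauss l \<rightarrow>\<^sub>M ?E"
		using measurable_compose[OF res measurable_radial[of n r]] rr by simp
	have "to_sphere n r \<in> gauss l \<rightarrow>\<^sub>M ?E"
		unfolding to_sphere_def
	proof (rule measurable_If[OF _ rad])
		show "(\<lambda>x. \<lambda>i\<in>{..n}. if i = 0 then r else 0) \<in> gauss l \<rightarrow>\<^sub>M ?E"
			by (rule measurable_const) simp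
		have "sqn n \<in> borel_measurable (gauss l)"
			by (intro borel_measurable_sum borel_measurable_power coord)
		then show "{x \<in> space (gauss l). sqn n x = 0} \<in> sets (gauss l)" by measurable
	qed
	then have "to_sphere n r \<in> gauss l \<rightarrow>\<^sub>M restrict_space ?E ?S"
		by (intro measurable_restrict_space2) (auto intro: to_sphere_mem[OF r])
	then show M: "to_sphere n r \<in> gauss l \<rightarrow>\<^sub>M sphere_measure n r"
		by (simp cong: measurable_cong_sets add: sets_sphere_measure)
	show "distr (gauss l) (sphere_measure n r) (to_sphere n r) = sphere_measure n r"
	proof (rule measure_eqI)
		fix A assume "A \<in> sets (distr (gauss l) (sphere_measure n r) (to_sphere n r))"
		then have A: "A \<in> sets (sphere_measure n r)" by simp
		then have A': "A \<in> sets ?E" "A \<subseteq> ?S"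
			using sphere_set_sets[of n r] sets.sets_into_space[OF A]
			by (auto simp: sets_sphere_measure sets_restrict_space)
		have "emeasure (distr (gauss l) (sphere_measure n r) (to_sphere n r)) A = emeasure (gauss l) (to_sphere n r -` A \<inter> space (gauss l))"
			by (rule emeasure_distr[OF M A])
		also have "\<dots> = emeasure (gauss l) (radial_projection n r -` A \<inter> space (gauss l))"
		proof (rule emeasure_eq_AE)
			show "AE x in gauss l. (x \<in> to_sphere n r -` A \<inter> space (gauss l)) = (x \<in> radial_projection n r -` A \<inter> space (gauss l))"
				using AE_gaussian_nonzero[OF l, of 0]
			proof eventually_elim
				case (elim x)
				have "0 < (x 0)^2" using elim by simp
				also have "\<dots> \<le> sqn n x" by (rule member_le_sum) auto
				finally show ?case by (simp add: to_sphere_def)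
			qed
		qed (use measurable_sets[OF M A] measurable_sets[OF rad A'(1)] in auto)
		also have "\<dots> = emeasure (distr (gauss l) ?E (radial_projection n r)) A"
			by (rule emeasure_distr[OF rad A'(1), symmetric])
		also have "distr (gauss l) ?E (radial_projection n r) = distr (distr (gauss l) (gaussian_fin n l) (\<lambda>x. restrict x {..n})) ?E (radial_projection n r)"
			using rr by (subst distr_distr[OF _ restrict_gauss(2)[OF l]]) (auto simp: comp_def cong: measurable_cong_sets)
		also have "\<dots> = distr (unit_ball_measure n) ?E (radial_projection n r)"
			unfolding restrict_gauss(1)[OF l] by (rule radial_gaussian_fin[OF l])
		also have "emeasure \<dots> A = emeasure (sphere_measure n r) A"
			unfolding sphere_measure_def using A' sphere_set_sets[of n r] sets.sets_into_space[OF sphere_set_sets[of n r]]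
			by (subst emeasure_restrict_space) (auto simp: Int_absorb2)
		finally show "emeasure (distr (gauss l) (sphere_measure n r) (to_sphere n r)) A = emeasure (sphere_measure n r) A" .
	qed simp
qed

lemma prob_space_sphere_measure: "r > 0 \<Longrightarrow> prob_space (sphere_measure n r)"
	using prob_space.prob_space_distr[OF prob_space_gauss to_sphere_law(1), of 1 r n] to_sphere_law(2)[of 1 r n] by simp

section \<open>The sphere as a metric measure space\<close>

text \<open>Taylor's bound. It is used at half the angle of two points, where it says that chord and
  arc agree up to a relative error of second order.\<close>

lemma sin_ge_cubic: "0 \<le> x \<Longrightarrow> x * (1 - x^2 / 6) \<le> sin (x :: real)"
proof -
	assume x: "0 \<le> x"
	have "\<bar>sin x - (\<Sum>m<3. sin_coeff m * x ^ m)\<bar> \<le> inverse (fact 3) * \<bar>x\<bar> ^ 3"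
		by (rule Maclaurin_sin_bound)
	moreover have "(\<Sum>m<3. sin_coeff m * x ^ m) = x"
		by (simp add: sin_coeff_def numeral_3_eq_3)
	moreover have "inverse (fact 3) * \<bar>x\<bar> ^ 3 = x ^ 3 / 6"
		using x by (simp add: fact_numeral)
	ultimately have "x - x ^ 3 / 6 \<le> sin x" by linarith
	then show ?thesis by (simp add: algebra_simps power2_eq_square power3_eq_cube)
qed

text \<open>The hypothesis gives s \<ge> p q - sqrt (1 - p^2) sqrt (1 - q^2), which is the cosine of
  the sum of the two angles, and arccos is decreasing. A sum beyond pi is no restriction.\<close>

lemma arccos_triangle:
	assumes "\<bar>p\<bar> \<le> 1" "\<bar>q\<bar> \<le> 1" "\<bar>s\<bar> \<le> 1" "(s - p * q)^2 \<le> (1 - p^2) * (1 - q^2)"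
	shows "arccos s \<le> arccos p + arccos q"
proof (cases "arccos p + arccos q \<le> pi")
	case False
	moreover have "arccos s \<le> pi" using assms(3) by (intro arccos_ubound) (auto simp: abs_le_iff)
	ultimately show ?thesis by linarith
next
	case True
	have "\<bar>s - p * q\<bar> \<le> sqrt ((1 - p^2) * (1 - q^2))"
		using assms(4) by (metis real_sqrt_abs real_sqrt_le_iff)
	then have "p * q - sqrt (1 - p^2) * sqrt (1 - q^2) \<le> s"
		by (simp add: real_sqrt_mult abs_le_iff)
	then have "cos (arccos p + arccos q) \<le> s"
		using assms by (simp add: cos_add cos_arccos_abs sin_arccos_abs)
	moreover have "- 1 \<le> cos (arccos p + arccos q)" by simp
	ultimately have "arccos s \<le> arccos (cos (arccos p + arccos q))"
		using assms by (intro arccos_le_arccos) auto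
	also have "\<dots> = arccos p + arccos q"
		using True assms arccos_lbound[of p] arccos_lbound[of q] by (intro arccos_cos) (auto simp: abs_le_iff)
	finally show ?thesis .
qed

context
	fixes n :: nat and r :: real
	assumes r: "r > 0"
begin

lemma sphere_inner_bound:
	assumes "x \<in> sphere_set n r" "y \<in> sphere_set n r"
	shows "\<bar>(\<Sum>i\<le>n. x i * y i) / r^2\<bar> \<le> 1"
proof -
	have "(\<Sum>i\<le>n. x i * y i)^2 \<le> sqn n x * sqn n y" by (rule Cauchy_Schwarz_ineq_sum)
	also have "\<dots> = (r^2)^2" using assms by (simp add: sphere_set_def power2_eq_square)
	finally have "\<bar>\<Sum>i\<le>n. x i * y i\<bar> \<le> r^2" by (metis abs_le_square_iff abs_power2)
	then show ?thesis using r by (simp add: abs_divide)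
qed

lemma sphere_chord_cos:
	assumes "x \<in> sphere_set n r" "y \<in> sphere_set n r"
	shows "(euc (Suc n) x y)^2 = 2 * r^2 * (1 - (\<Sum>i\<le>n. x i * y i) / r^2)"
proof -
	have "(euc (Suc n) x y)^2 = (\<Sum>i\<le>n. (x i)^2 + (y i)^2 - 2 * (x i * y i))"
		unfolding euc_power2 lessThan_Suc_atMost by (simp add: power2_diff mult.assoc)
	also have "\<dots> = 2 * r^2 - 2 * (\<Sum>i\<le>n. x i * y i)"
		using assms by (simp add: sum.distrib sum_subtractf sphere_set_def flip: sum_distrib_left)
	finally show ?thesis using r by (simp add: right_diff_distrib)
qed

lemma sphere_geodesic_chord:
	assumes "x \<in> sphere_set n r" "y \<in> sphere_set n r"
	obtains a where "0 \<le> a" "a \<le> pi" "geo n r x y = r * a" "euc (Suc n) x y = 2 * r * sin (a / 2)"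
proof
	let ?u = "(\<Sum>i\<le>n. x i * y i) / r^2" let ?a = "arccos ?u"
	have u: "-1 \<le> ?u" "?u \<le> 1" using sphere_inner_bound[OF assms] by linarith+
	show a: "0 \<le> ?a" "?a \<le> pi" using arccos_bounded[OF u] by auto
	show "geo n r x y = r * ?a" using assms by (simp add: sphere_geodesic_dist_def)
	have "?u = 1 - 2 * (sin (?a / 2))^2"
		using cos_arccos[OF u] cos_double_sin[of "?a / 2"] by simp
	then have eq: "(euc (Suc n) x y)^2 = (2 * r * sin (?a / 2))^2"
		unfolding sphere_chord_cos[OF assms] by (simp add: power_mult_distrib)
	have "0 \<le> sin (?a / 2)" using a by (intro sin_ge_zero) auto
	then show "euc (Suc n) x y = 2 * r * sin (?a / 2)"
		by (intro power2_eq_imp_eq[OF eq]) (use r in auto)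
qed

lemma euc_le_geodesic:
	assumes "x \<in> sphere_set n r" "y \<in> sphere_set n r"
	shows "euc (Suc n) x y \<le> geo n r x y"
proof -
	obtain a where "0 \<le> a" "a \<le> pi" "geo n r x y = r * a" "euc (Suc n) x y = 2 * r * sin (a / 2)"
		by (rule sphere_geodesic_chord[OF assms])
	then show ?thesis using r sin_x_le_x[of "a/2"] by simp
qed

lemma geodesic_le_euc:
	assumes "x \<in> sphere_set n r" "y \<in> sphere_set n r"
	shows "geo n r x y \<le> 3 * euc (Suc n) x y"
proof -
	obtain a where a: "0 \<le> a" "a \<le> pi" "geo n r x y = r * a" "euc (Suc n) x y = 2 * r * sin (a / 2)"
		by (rule sphere_geodesic_chord[OF assms])
	\<comment> \<open>From pi / 2 \<le> 2 the factor 1 - 2^2 / 6 = 1 / 3 remains, which is the origin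
	  of the constant 3.\<close>
	have "a / 2 \<le> 2" using a(2) pi_less_4 by simp
	then have "(a / 2)^2 \<le> 2^2" using a(1) by (intro power_mono) auto
	then have "(a / 2) * (1 / 3) \<le> (a / 2) * (1 - (a / 2)^2 / 6)" using a(1) by (intro mult_left_mono) auto
	also have "\<dots> \<le> sin (a / 2)" using a(1) by (intro sin_ge_cubic) simp
	finally have "a \<le> 6 * sin (a / 2)" by simp
	then have "r * a \<le> r * (6 * sin (a / 2))" using r by (intro mult_left_mono) auto
	then show ?thesis using a by simp
qed

text \<open>d is a distance in a target that is bounded by D as well as by the arc. Even if the arc
  is long, its chord is at least the chord of an arc of length d, by monotonicity of the sine up to
  pi / 2. The constant 24 is 6 * 2^2, from the cubic bound at half the angle.\<close>

lemma geodesic_truncated_le_euc: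
	assumes "x \<in> sphere_set n r" "y \<in> sphere_set n r" "0 \<le> d" "d \<le> geo n r x y" "d \<le> D" "D \<le> 2 * r"
	shows "d * (1 - (D / r)^2 / 24) \<le> euc (Suc n) x y"
proof -
	obtain a where a: "0 \<le> a" "a \<le> pi" "geo n r x y = r * a" "euc (Suc n) x y = 2 * r * sin (a / 2)"
		by (rule sphere_geodesic_chord[OF assms(1,2)])
	define b where "b = d / r"
	have b: "0 \<le> b" "b \<le> a" "b \<le> D / r" "b \<le> 2"
		using assms a r by (auto simp: b_def field_simps)
	have "pi / 2 > 1" using pi_gt3 by simp
	have "sin (b / 2) \<le> sin (a / 2)"
		using b a \<open>pi / 2 > 1\<close> by (intro sin_monotone_2pi_le) auto
	have "b^2 \<le> (D / r)^2" using b by (intro power_mono) auto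
	then have "(b / 2) * (1 - (D / r)^2 / 24) \<le> (b / 2) * (1 - (b / 2)^2 / 6)"
		using b by (intro mult_left_mono) (auto simp: power_divide)
	also have "\<dots> \<le> sin (b / 2)" using b by (intro sin_ge_cubic) simp
	also have "\<dots> \<le> sin (a / 2)" by fact
	finally have "2 * r * ((b / 2) * (1 - (D / r)^2 / 24)) \<le> 2 * r * sin (a / 2)" using r by (intro mult_left_mono) auto
	moreover have "2 * r * ((b / 2) * (1 - (D / r)^2 / 24)) = d * (1 - (D / r)^2 / 24)"
	proof -
		have "r * b = d" using r by (simp add: b_def)
		then show ?thesis by (simp flip: mult.assoc)
	qed
	ultimately show ?thesis unfolding a(4) by (simp only:)
qed

lemma sphere_metric: "Metric_space (sphere_set n r) (geo n r)"
proof
	fix x y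
	show nn: "0 \<le> geo n r x y"
	proof (cases "x \<in> sphere_set n r \<and> y \<in> sphere_set n r")
		case True
		then have "0 \<le> arccos ((\<Sum>i\<le>n. x i * y i) / r^2)"
			using sphere_inner_bound[of x y] by (intro arccos_lbound) linarith+
		then show ?thesis using r by (simp add: sphere_geodesic_dist_def)
	qed (auto simp: sphere_geodesic_dist_def)
	show "geo n r x y = geo n r y x"
		by (simp add: sphere_geodesic_dist_def mult.commute)
	assume xy: "x \<in> sphere_set n r" "y \<in> sphere_set n r"
	show "geo n r x y = 0 \<longleftrightarrow> x = y"
	proof
		assume "geo n r x y = 0"
		then have "euc (Suc n) x y = 0" using euc_le_geodesic[OF xy] euc_nonneg[of "Suc n" x y] by simp
		then have "x i = y i" if "i \<le> n" for i using euc_component[of i "Suc n" x y] that by simp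
		moreover have "x i = y i" if "\<not> i \<le> n" for i
			using xy that by (auto simp: sphere_set_def PiE_def extensional_def)
		ultimately show "x = y" by auto
	next
		assume "x = y"
		then show "geo n r x y = 0" using geodesic_le_euc[OF xy] nn by simp
	qed
	fix z assume z: "z \<in> sphere_set n r"
	define p where "p = (\<Sum>i\<le>n. x i * y i) / r^2"
	define q where "q = (\<Sum>i\<le>n. y i * z i) / r^2"
	define s where "s = (\<Sum>i\<le>n. x i * z i) / r^2"
	have ip: "(\<Sum>i\<le>n. x i * y i) = p * r^2" "(\<Sum>i\<le>n. y i * z i) = q * r^2" "(\<Sum>i\<le>n. x i * z i) = s * r^2"
		using r by (simp_all add: p_def q_def s_def)
	have sq: "sqn n x = r^2" "sqn n y = r^2" "sqn n z = r^2" using xy z by (auto simp: sphere_set_def)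
	\<comment> \<open>x - p y and z - q y are the components of x and z orthogonal to y. The
	  Cauchy-Schwarz inequality for them is the hypothesis of \<open>arccos_triangle\<close>.\<close>
	have "(\<Sum>i\<le>n. (x i - p * y i) * (z i - q * y i)) = (\<Sum>i\<le>n. x i * z i - q * (x i * y i) - p * (y i * z i) + p * q * (y i)^2)"
		by (intro sum.cong) (auto simp: algebra_simps power2_eq_square)
	also have "\<dots> = r^2 * (s - p * q)"
		by (simp add: sum.distrib sum_subtractf ip sq algebra_simps flip: sum_distrib_left)
	finally have 1: "(\<Sum>i\<le>n. (x i - p * y i) * (z i - q * y i)) = r^2 * (s - p * q)" .
	have "(\<Sum>i\<le>n. (x i - p * y i)^2) = (\<Sum>i\<le>n. (x i)^2 - 2 * p * (x i * y i) + p^2 * (y i)^2)"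
		by (intro sum.cong) (auto simp: algebra_simps power2_eq_square)
	also have "\<dots> = sqn n x - 2 * p * (\<Sum>i\<le>n. x i * y i) + p^2 * sqn n y"
		by (simp add: sum.distrib sum_subtractf sum_distrib_left)
	also have "\<dots> = r^2 * (1 - p^2)"
		unfolding ip sq by (simp add: algebra_simps power2_eq_square)
	finally have 2: "(\<Sum>i\<le>n. (x i - p * y i)^2) = r^2 * (1 - p^2)" .
	have "(\<Sum>i\<le>n. (z i - q * y i)^2) = (\<Sum>i\<le>n. (z i)^2 - 2 * q * (y i * z i) + q^2 * (y i)^2)"
		by (intro sum.cong) (auto simp: algebra_simps power2_eq_square)
	also have "\<dots> = sqn n z - 2 * q * (\<Sum>i\<le>n. y i * z i) + q^2 * sqn n y"
		by (simp add: sum.distrib sum_subtractf sum_distrib_left)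
	also have "\<dots> = r^2 * (1 - q^2)"
		unfolding ip sq by (simp add: algebra_simps power2_eq_square)
	finally have 3: "(\<Sum>i\<le>n. (z i - q * y i)^2) = r^2 * (1 - q^2)" .
	have "(r^2 * (s - p * q))^2 \<le> (r^2 * (1 - p^2)) * (r^2 * (1 - q^2))"
		using Cauchy_Schwarz_ineq_sum[of "\<lambda>i. x i - p * y i" "\<lambda>i. z i - q * y i" "{..n}"] unfolding 1 2 3 .
	then have "(r^2)^2 * (s - p * q)^2 \<le> (r^2)^2 * ((1 - p^2) * (1 - q^2))"
		by (simp add: power_mult_distrib power2_eq_square mult_ac)
	then have "(s - p * q)^2 \<le> (1 - p^2) * (1 - q^2)" using r by (simp add: mult_le_cancel_left_pos)
	then have "arccos s \<le> arccos p + arccos q"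
		using sphere_inner_bound[OF xy] sphere_inner_bound[OF xy(2) z] sphere_inner_bound[OF xy(1) z]
		by (intro arccos_triangle) (auto simp: p_def q_def s_def)
	then have "r * arccos s \<le> r * arccos p + r * arccos q" using r by (simp flip: distrib_left)
	then show "geo n r x z \<le> geo n r x y + geo n r y z"
		using xy z by (simp add: sphere_geodesic_dist_def p_def q_def s_def)
qed

interpretation S: Metric_space "sphere_set n r" "geo n r"
	by (rule sphere_metric)

lemma tendsto_euc:
	assumes "\<And>k. u k \<in> sphere_set n r" "x \<in> sphere_set n r" "(\<lambda>k. geo n r (u k) x) \<longlonglongrightarrow> 0"
	shows "u \<longlonglongrightarrow> x"
proof -
	have "(\<lambda>k. u k i) \<longlonglongrightarrow> x i" for i
	proof (cases "i \<le> n")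
		case True
		have "\<bar>u k i - x i\<bar> \<le> geo n r (u k) x" for k
			using euc_component[of i "Suc n" "u k" x] True euc_le_geodesic[OF assms(1) assms(2), of k] by simp
		then have "(\<lambda>k. u k i - x i) \<longlonglongrightarrow> 0" using assms(3) by (intro Lim_null_comparison[OF _ assms(3)]) simp
		then show ?thesis by (rule LIM_zero_cancel)
	next
		case False
		then have "u k i = x i" for k
			using assms(1)[of k] assms(2) by (auto simp: sphere_set_def PiE_def extensional_def)
		then show ?thesis by simp
	qed
	then have "limitin (product_topology (\<lambda>_. euclidean) UNIV) u x sequentially"
		by (simp add: limitin_componentwise)
	then show ?thesis by (simp add: euclidean_product_topology)
qed

text \<open>Chord and arc bound each other up to a constant, and the coordinates beyond n do not
  vary on the sphere, so the metric topology is the trace of the product topology.\<close>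

lemma sphere_mtopology: "S.mtopology = top_of_set (sphere_set n r)"
	unfolding topology_eq
proof (intro allI iffI)
	fix U assume U: "openin S.mtopology U"
	show "openin (top_of_set (sphere_set n r)) U"
	proof (subst openin_subopen, intro ballI)
		fix x assume x: "x \<in> U"
		then obtain \<epsilon> where e: "\<epsilon> > 0" "S.mball x \<epsilon> \<subseteq> U" and xS: "x \<in> sphere_set n r"
			using U unfolding S.openin_mtopology by blast
		let ?T = "sphere_set n r \<inter> (\<lambda>y. euc (Suc n) y x) -` {..<\<epsilon>/3}"
		have "openin (top_of_set (sphere_set n r)) ?T"
			by (rule continuous_openin_preimage_gen[OF continuous_euc]) simp
		moreover have "?T \<subseteq> U"
		proof
			fix y assume y: "y \<in> ?T"
			then have "geo n r x y \<le> 3 * euc (Suc n) y x"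
				using geodesic_le_euc[OF xS, of y] by (simp add: euc_commute)
			then show "y \<in> U" using y e xS by auto
		qed
		moreover have "x \<in> ?T" using xS e by simp
		ultimately show "\<exists>T. openin (top_of_set (sphere_set n r)) T \<and> x \<in> T \<and> T \<subseteq> U" by blast
	qed
next
	fix U assume "openin (top_of_set (sphere_set n r)) U"
	then obtain T where T: "open T" "U = sphere_set n r \<inter> T" by (auto simp: openin_open)
	show "openin S.mtopology U"
		unfolding S.openin_mtopology
	proof (intro conjI allI impI)
		show "U \<subseteq> sphere_set n r" using T by blast
		fix x assume x: "x \<in> U"
		then have xS: "x \<in> sphere_set n r" using T by blast
		show "\<exists>\<epsilon>>0. S.mball x \<epsilon> \<subseteq> U"
		proof (rule ccontr)
			assume neg: "\<not> (\<exists>\<epsilon>>0. S.mball x \<epsilon> \<subseteq> U)"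
			have "\<exists>y. y \<in> sphere_set n r \<and> geo n r x y < 1 / real (Suc k) \<and> y \<notin> U" for k
				using neg[simplified, rule_format, of "1 / real (Suc k)"] by auto
			then obtain u where u: "\<And>k. u k \<in> sphere_set n r" "\<And>k. geo n r x (u k) < 1 / real (Suc k)" "\<And>k. u k \<notin> U"
				by metis
			have "(\<lambda>k. geo n r (u k) x) \<longlonglongrightarrow> 0"
			proof (rule Lim_null_comparison[OF always_eventually LIMSEQ_Suc[OF lim_1_over_n]], intro allI)
				fix k show "norm (geo n r (u k) x) \<le> 1 / real (Suc k)"
					using u(2)[of k] by (simp add: S.commute[of "u k"])
			qed
			then have "u \<longlonglongrightarrow> x" by (rule tendsto_euc[OF u(1) xS])
			then have "\<forall>\<^sub>F k in sequentially. u k \<in> T" using T x by (intro topological_tendstoD) auto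
			then obtain k where "u k \<in> T" unfolding eventually_sequentially by blast
			then show False using u(1,3)[of k] T by blast
		qed
	qed
qed

lemma sphere_mcomplete: "S.mcomplete"
	unfolding S.mcomplete_def
proof (intro allI impI)
	fix u assume u: "S.MCauchy u"
	then have uS: "u k \<in> sphere_set n r" for k by (auto simp: S.MCauchy_def)
	have "Cauchy (\<lambda>k. u k i)" if "i \<le> n" for i
	proof (rule metric_CauchyI)
		fix e :: real assume "e > 0"
		then obtain N where N: "\<And>k k'. N \<le> k \<Longrightarrow> N \<le> k' \<Longrightarrow> geo n r (u k) (u k') < e"
			using u unfolding S.MCauchy_def by blast
		have "dist (u k i) (u k' i) < e" if "k \<ge> N" "k' \<ge> N" for k k'
			using euc_component[of i "Suc n" "u k" "u k'"] \<open>i \<le> n\<close> euc_le_geodesic[OF uS uS, of k k'] N[OF that]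
			by (simp add: dist_real_def)
		then show "\<exists>M. \<forall>m\<ge>M. \<forall>n\<ge>M. dist (u m i) (u n i) < e" by blast
	qed
	then have "\<exists>l. (\<lambda>k. u k i) \<longlonglongrightarrow> l" if "i \<le> n" for i
		using that by (simp add: Cauchy_convergent_iff convergent_def)
	then obtain l where l: "\<And>i. i \<le> n \<Longrightarrow> (\<lambda>k. u k i) \<longlonglongrightarrow> l i" by metis
	define x where "x = restrict l {..n}"
	have "(\<lambda>k. sqn n (u k)) \<longlonglongrightarrow> sqn n x"
		unfolding x_def by (intro tendsto_sum tendsto_power) (use l in auto)
	moreover have "(\<lambda>k. sqn n (u k)) = (\<lambda>_. r^2)" using uS by (auto simp: sphere_set_def)
	ultimately have "(\<lambda>_::nat. r^2) \<longlonglongrightarrow> sqn n x" by simp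
	then have "sqn n x = r^2" using LIMSEQ_unique[OF tendsto_const] by metis
	then have xS: "x \<in> sphere_set n r" by (simp add: sphere_set_def x_def)
	have "(\<lambda>k. euc (Suc n) (u k) x) \<longlonglongrightarrow> euc (Suc n) x x"
		unfolding euc_def L2_set_def lessThan_Suc_atMost
		by (intro tendsto_intros) (use l in \<open>auto simp: x_def\<close>)
	then have "(\<lambda>k. 3 * euc (Suc n) (u k) x) \<longlonglongrightarrow> 0" by (intro tendsto_mult_right_zero) simp
	then have "(\<lambda>k. geo n r (u k) x) \<longlonglongrightarrow> 0"
		by (rule Lim_null_comparison[rotated]) (use geodesic_le_euc[OF uS xS] in simp)
	then have "limitin S.mtopology u x sequentially"
		unfolding S.limitin_metric using xS uS by (auto dest: order_tendstoD(2))
	then show "\<exists>x. limitin S.mtopology u x sequentially" by blast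
qed

text \<open>The measure is built on a finite product, the topology on the space of all sequences. On
  the sphere the remaining coordinates are constant, so the identity is measurable in both
  directions.\<close>

lemma sets_sphere_borel: "sets (sphere_measure n r) = sigma_sets (sphere_set n r) {U. openin (top_of_set (sphere_set n r)) U}"
proof -
	let ?S = "sphere_set n r"
	have eq: "sets (sphere_measure n r) = sets (restrict_space (leb n) ?S)" by (rule sets_sphere_measure)
	have "sigma_sets ?S {U. openin (top_of_set ?S) U} = sets (restrict_space borel ?S)"
	proof -
		have "{(\<lambda>x. x) -` A \<inter> ?S | A. A \<in> {S. open S}} = {U. openin (top_of_set ?S) U}"
			by (auto simp: openin_open)
		moreover have "{(\<lambda>x. x) -` A \<inter> ?S | A. A \<in> sigma_sets UNIV {S. open S}} = sets (restrict_space borel ?S)"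
			by (auto simp: sets_restrict_space sets_borel)
		ultimately show ?thesis using sigma_sets_vimage_commute[of "\<lambda>x. x" ?S UNIV "{S. open S}"] by simp
	qed
	moreover have "sets (restrict_space (leb n) ?S) = sets (restrict_space borel ?S)"
	proof (intro equalityI)
		have 1: "(\<lambda>x. x) \<in> restrict_space (leb n) ?S \<rightarrow>\<^sub>M restrict_space borel ?S"
		proof (rule measurable_restrict_space2)
			show "(\<lambda>x. x) \<in> space (restrict_space (leb n) ?S) \<rightarrow> ?S" by (auto simp: space_restrict_space)
			show "(\<lambda>x. x) \<in> borel_measurable (restrict_space (leb n) ?S)"
			proof (rule measurable_coordinatewise_then_product)
				fix i show "(\<lambda>x. x i) \<in> borel_measurable (restrict_space (leb n) ?S)"
				proof (cases "i \<le> n")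
					case True
					then show ?thesis by (intro measurable_restrict_space1 measurable_component_euclidean)
				next
					case False
					then have "x i = undefined" if "x \<in> space (restrict_space (leb n) ?S)" for x
						using that by (auto simp: space_restrict_space PiE_def extensional_def)
					then show ?thesis by (subst measurable_cong[where g = "\<lambda>_. undefined"]) auto
				qed
			qed
		qed
		have 2: "(\<lambda>x. x) \<in> restrict_space borel ?S \<rightarrow>\<^sub>M restrict_space (leb n) ?S"
		proof (rule measurable_restrict_space2)
			show "(\<lambda>x. x) \<in> space (restrict_space borel ?S) \<rightarrow> ?S" by (auto simp: space_restrict_space)
			show "(\<lambda>x. x) \<in> restrict_space borel ?S \<rightarrow>\<^sub>M leb n"
				unfolding euclidean_lebesgue_def
			proof (rule measurable_PiM_single')
				show "(\<lambda>x. x i) \<in> restrict_space borel ?S \<rightarrow>\<^sub>M lborel" for i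
					by (simp add: measurable_restrict_space1)
				show "(\<lambda>x i. x i) \<in> space (restrict_space borel ?S) \<rightarrow> {..n} \<rightarrow>\<^sub>E space lborel"
					by (auto simp: space_restrict_space sphere_set_def)
			qed
		qed
		have sp: "space (restrict_space (leb n) ?S) = ?S" "space (restrict_space borel ?S) = ?S"
			by (auto simp: space_restrict_space sphere_set_def)
		show "sets (restrict_space borel ?S) \<subseteq> sets (restrict_space (leb n) ?S)"
		proof
			fix A assume A: "A \<in> sets (restrict_space borel ?S)"
			then show "A \<in> sets (restrict_space (leb n) ?S)"
				using measurable_sets[OF 1 A] sets.sets_into_space[OF A] unfolding sp by (simp add: Int_absorb2)
		qed
		show "sets (restrict_space (leb n) ?S) \<subseteq> sets (restrict_space borel ?S)"
		proof
			fix A assume A: "A \<in> sets (restrict_space (leb n) ?S)"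
			then show "A \<in> sets (restrict_space borel ?S)"
				using measurable_sets[OF 2 A] sets.sets_into_space[OF A] unfolding sp by (simp add: Int_absorb2)
		qed
	qed
	ultimately show ?thesis using eq by simp
qed

lemma mm_space_sphere: "mm_space (sphere_mm n r)"
proof -
	have top: "mm_top (sphere_mm n r) = top_of_set (sphere_set n r)"
		by (simp add: mm_top_def sphere_mm_def sphere_mtopology)
	obtain T where T: "countable T" "T \<subseteq> sphere_set n r" "sphere_set n r \<subseteq> closure T"
		by (rule separable)
	have "separable_space (top_of_set (sphere_set n r))"
		unfolding separable_space_def
	proof (intro exI conjI)
		show "countable T" by fact
		show "T \<subseteq> topspace (top_of_set (sphere_set n r))" using T by simp
		show "top_of_set (sphere_set n r) closure_of T = topspace (top_of_set (sphere_set n r))"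
			using T by (auto simp: closure_of_subtopology Int_absorb1)
	qed
	then show ?thesis
		unfolding mm_space_def top
		using sphere_metric sphere_mcomplete sets_sphere_borel prob_space_sphere_measure[OF r]
		by (simp add: sphere_mm_def borel_sets_of_def)
qed

end

lemma mm_simps [simp]:
	"mm_measure (sphere_mm n r) = sphere_measure n r" "mm_dist (sphere_mm n r) = geo n r"
	by (simp_all add: sphere_mm_def)

lemma emm_simps [simp]:
	"emm_measure (emm_of_mm X) = mm_measure X" "emm_dist (emm_of_mm X) x y = ennreal (mm_dist X x y)"
	"emm_top (emm_of_mm X) = mm_top X"
	by (simp_all add: emm_of_mm_def)

lemma (in mm_sp) emm_space_of_mm: "emm_space (emm_of_mm X)"
	unfolding emm_space_def Let_def emm_simps top_eq topspace_mtopology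
proof (intro conjI ballI allI impI)
	show "completely_metrizable_space mtopology"
		using completely_metrizable_space_mtopology mcomplete by blast
	show "separable_space mtopology" using mm by (simp add: mm_space_def top_eq)
	show "space M = C" "prob_space M" "sets M = borel_sets_of mtopology"
		using mm by (simp_all add: mm_space_def top_eq)
	fix x y assume xy: "x \<in> C" "y \<in> C"
	show "ennreal (D x y) = 0 \<longleftrightarrow> x = y" using zero[OF xy] nonneg[of x y] by (auto simp: ennreal_eq_0_iff le_less)
	show "ennreal (D x y) = ennreal (D y x)" by (simp add: commute)
	fix z assume z: "z \<in> C"
	show "ennreal (D x z) \<le> ennreal (D x y) + ennreal (D y z)"
		using triangle[OF xy z] by (simp flip: ennreal_plus)
next
	fix u :: "nat \<Rightarrow> 'a" assume u: "range u \<subseteq> C \<and> (\<forall>e>0. \<exists>N. \<forall>j\<ge>N. \<forall>k\<ge>N. ennreal (D (u j) (u k)) < e)"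
	have "MCauchy u"
		unfolding MCauchy_def
	proof (intro conjI allI impI)
		show "range u \<subseteq> C" using u by blast
		fix e :: real assume "e > 0"
		then have "ennreal e > 0" by simp
		then obtain N where "\<forall>j\<ge>N. \<forall>k\<ge>N. ennreal (D (u j) (u k)) < ennreal e" using u by blast
		then show "\<exists>N. \<forall>n n'. N \<le> n \<longrightarrow> N \<le> n' \<longrightarrow> D (u n) (u n') < e"
			by (intro exI[of _ N]) (auto simp: ennreal_less_iff)
	qed
	then obtain x where x: "limitin mtopology u x sequentially" using mcomplete unfolding mcomplete_def by blast
	then have xC: "x \<in> C" by (simp add: limitin_metric)
	have "(\<lambda>j. D (u j) x) \<longlonglongrightarrow> 0"
	proof -
		have "(\<lambda>j. D x (u j)) \<longlonglongrightarrow> D x x" by (rule limit_dist[OF x _ xC]) (use u in auto)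
		moreover have "(\<lambda>j. D (u j) x) = (\<lambda>j. D x (u j))" by (auto intro: commute)
		ultimately show ?thesis using xC by simp
	qed
	from tendsto_ennrealI[OF this] have "(\<lambda>j. ennreal (D (u j) x)) \<longlonglongrightarrow> 0" by simp
	then show "\<exists>x\<in>C. (\<lambda>j. ennreal (D (u j) x)) \<longlonglongrightarrow> 0" using xC by blast
next
	fix c :: ennreal
	let ?m = "metric (C, D)"
	have m: "mtopology_of ?m = mtopology" "mdist ?m = D" by (simp_all add: mtopology_of)
	show "closedin (prod_topology mtopology mtopology) {(x, y) \<in> C \<times> C. ennreal (D x y) \<le> c}"
	proof (cases "c = \<infinity>")
		case True
		then have "{(x, y) \<in> C \<times> C. ennreal (D x y) \<le> c} = topspace (prod_topology mtopology mtopology)" by auto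
		then show ?thesis by (metis closedin_topspace)
	next
		case False
		then obtain r where r: "c = ennreal r" "0 \<le> r" by (cases c) auto
		have "closedin (prod_topology mtopology mtopology)
			{z \<in> topspace (prod_topology mtopology mtopology). (\<lambda>(x, y). D x y) z \<in> {..r}}"
			using continuous_map_metric[of ?m] unfolding m by (rule closedin_continuous_map_preimage) simp
		moreover have "{z \<in> topspace (prod_topology mtopology mtopology). (\<lambda>(x, y). D x y) z \<in> {..r}} = {(x, y) \<in> C \<times> C. ennreal (D x y) \<le> c}"
			using r by auto
		ultimately show ?thesis by simp
	qed
next
	fix U x assume U: "openin mtopology U" and x: "x \<in> U"
	then obtain r where r: "r > 0" "mball x r \<subseteq> U" "x \<in> C" unfolding openin_mtopology by blast
	then show "\<exists>e>0. \<forall>y\<in>C. ennreal (D x y) < e \<longrightarrow> y \<in> U"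
		by (intro exI[of _ "ennreal r"]) (auto simp: ennreal_less_iff)
qed

lemma emm_space_sphere: "r > 0 \<Longrightarrow> emm_space (emm_of_mm (sphere_mm n r))"
	by (rule mm_sp.emm_space_of_mm) (simp add: mm_sp_def mm_space_sphere)

section \<open>The limit spaces\<close>

lemma ell2_dist_le_iff:
	assumes "0 \<le> c"
	shows "ell2_dist x y \<le> ennreal c \<longleftrightarrow> (\<forall>m. euc m x y \<le> c)"
proof
	assume le: "ell2_dist x y \<le> ennreal c"
	then have s: "summable (\<lambda>i. (x i - y i)^2)" by (auto simp: ell2_dist_def top_unique split: if_splits)
	then have c: "sqrt (\<Sum>i. (x i - y i)^2) \<le> c" using le assms by (simp add: ell2_dist_def suminf_nonneg)
	have "euc m x y \<le> sqrt (\<Sum>i. (x i - y i)^2)" for m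
		unfolding euc_def L2_set_def using s by (intro real_sqrt_le_mono sum_le_suminf) auto
	then show "\<forall>m. euc m x y \<le> c" using c order_trans by blast
next
	assume le: "\<forall>m. euc m x y \<le> c"
	have b: "(\<Sum>i<m. (x i - y i)^2) \<le> c^2" for m
		using le[rule_format, of m] power_mono[OF _ euc_nonneg, of m x y c 2] by (simp add: euc_power2)
	then have s: "summable (\<lambda>i. (x i - y i)^2)" by (intro summableI_nonneg_bounded) auto
	have "(\<Sum>i. (x i - y i)^2) \<le> c^2" by (rule suminf_le_const[OF s b])
	then have "sqrt (\<Sum>i. (x i - y i)^2) \<le> c" using assms by (intro real_le_lsqrt)
	then show "ell2_dist x y \<le> ennreal c" using s by (simp add: ell2_dist_def ennreal_leI)
qed

text \<open>Triangle inequality, completeness and lower semicontinuity are inherited from the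
  finite-dimensional distances because all three pass to suprema of this kind.\<close>

lemma ell2_dist_SUP: "ell2_dist x y = (SUP m. ennreal (euc m x y))"
proof (rule antisym)
	show "ell2_dist x y \<le> (SUP m. ennreal (euc m x y))"
	proof (cases "SUP m. ennreal (euc m x y)")
		case (real c)
		have "ennreal (euc m x y) \<le> ennreal c" for m unfolding real(2)[symmetric] by (rule SUP_upper) simp
		then have "\<forall>m. euc m x y \<le> c" using real(1) by simp
		then show ?thesis using real by (simp add: ell2_dist_le_iff)
	next
		case top
		show ?thesis unfolding top by simp
	qed
	show "(SUP m. ennreal (euc m x y)) \<le> ell2_dist x y"
	proof (rule SUP_least)
		fix m
		show "ennreal (euc m x y) \<le> ell2_dist x y"
		proof (cases "ell2_dist x y")
			case (real c)
			then show ?thesis using ell2_dist_le_iff[of c x y] by (auto intro: ennreal_leI)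
		qed simp
	qed
qed

lemma euc_le_ell2: "ennreal (euc m x y) \<le> ell2_dist x y"
	unfolding ell2_dist_SUP by (rule SUP_upper) simp

lemma ell2_dist_commute: "ell2_dist x y = ell2_dist y x"
	by (simp add: ell2_dist_SUP euc_commute[of _ x y])

lemma ell2_dist_triangle: "ell2_dist x z \<le> ell2_dist x y + ell2_dist y z"
	unfolding ell2_dist_SUP[of x z]
proof (rule SUP_least)
	fix m
	have "ennreal (euc m x z) \<le> ennreal (euc m x y) + ennreal (euc m y z)"
		using euc_triangle[of m x z y] by (simp flip: ennreal_plus)
	also have "\<dots> \<le> ell2_dist x y + ell2_dist y z" by (intro add_mono euc_le_ell2)
	finally show "ennreal (euc m x z) \<le> ell2_dist x y + ell2_dist y z" .
qed

lemma ell2_dist_eq_0: "ell2_dist x y = 0 \<longleftrightarrow> x = y"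
proof
	assume "ell2_dist x y = 0"
	then have "euc m x y \<le> 0" for m using ell2_dist_le_iff[of 0 x y] by simp
	then have "x i = y i" for i using euc_component[of i "Suc i" x y] by (metis abs_le_zero_iff eq_iff_diff_eq_0 lessI order_trans)
	then show "x = y" by auto
qed (simp add: ell2_dist_SUP)

lemma tendsto_coordinatewise:
	fixes u :: "nat \<Rightarrow> nat \<Rightarrow> real"
	assumes "\<And>i. (\<lambda>k. u k i) \<longlonglongrightarrow> x i"
	shows "u \<longlonglongrightarrow> x"
proof -
	have "limitin (product_topology (\<lambda>_. euclidean) UNIV) u x sequentially"
		using assms by (simp add: limitin_componentwise)
	then show ?thesis by (simp add: euclidean_product_topology)
qed

lemma separable_space_euclidean: "separable_space (euclidean :: 'a::second_countable_topology topology)"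
proof -
	obtain Q :: "'a set" where "countable Q" "\<And>X. open X \<Longrightarrow> X \<noteq> {} \<Longrightarrow> \<exists>d\<in>Q. d \<in> X"
		by (rule countable_dense_setE) blast
	then show ?thesis
		unfolding separable_space_def by (intro exI[of _ Q]) (auto simp: closure_of_def)
qed

lemma closedin_prod_euclidean: "closedin (prod_topology euclidean euclidean) S \<longleftrightarrow> closed S"
	by (simp add: closedin_def closed_def Compl_eq_Diff_UNIV)

lemma emm_space_gamma_infinity: "l > 0 \<Longrightarrow> emm_space (gamma_infinity l)"
	unfolding emm_space_def Let_def gamma_infinity_def emm.simps gauss_def[symmetric]
proof (intro conjI ballI allI impI)
	assume l: "l > 0"
	show "completely_metrizable_space (euclidean :: (nat \<Rightarrow> real) topology)" by (rule completely_metrizable_space_euclidean)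
	show "separable_space (euclidean :: (nat \<Rightarrow> real) topology)" by (rule separable_space_euclidean)
	show "space (gauss l) = topspace euclidean" by simp
	show "prob_space (gauss l)" by (rule prob_space_gauss[OF l])
	show "sets (gauss l) = borel_sets_of euclidean" by (simp add: borel_sets_of_def sets_borel)
	fix x y
	show "ell2_dist x y = 0 \<longleftrightarrow> x = y" by (rule ell2_dist_eq_0)
	show "ell2_dist x y = ell2_dist y x" by (rule ell2_dist_commute)
	fix z show "ell2_dist x z \<le> ell2_dist x y + ell2_dist y z" by (rule ell2_dist_triangle)
next
	fix u :: "nat \<Rightarrow> nat \<Rightarrow> real"
	assume "range u \<subseteq> topspace euclidean \<and> (\<forall>\<epsilon>>0. \<exists>N. \<forall>j\<ge>N. \<forall>k\<ge>N. ell2_dist (u j) (u k) < \<epsilon>)"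
	then have u: "\<And>\<epsilon>. \<epsilon> > 0 \<Longrightarrow> \<exists>N. \<forall>j\<ge>N. \<forall>k\<ge>N. ell2_dist (u j) (u k) < \<epsilon>" by blast
	have ue: "\<exists>N. \<forall>j\<ge>N. \<forall>k\<ge>N. \<forall>m. euc m (u j) (u k) \<le> \<epsilon>" if e: "\<epsilon> > 0" for \<epsilon> :: real
	proof -
		obtain N where N: "\<forall>j\<ge>N. \<forall>k\<ge>N. ell2_dist (u j) (u k) < ennreal \<epsilon>" using u[of "ennreal \<epsilon>"] e by auto
		then have "\<forall>m. euc m (u j) (u k) \<le> \<epsilon>" if "j \<ge> N" "k \<ge> N" for j k
			using that e ell2_dist_le_iff[of \<epsilon> "u j" "u k"] by (auto intro: less_imp_le)
		then show ?thesis by blast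
	qed
	have "Cauchy (\<lambda>k. u k i)" for i
	proof (rule metric_CauchyI)
		fix e :: real assume "e > 0"
		then obtain N where N: "\<forall>j\<ge>N. \<forall>k\<ge>N. \<forall>m. euc m (u j) (u k) \<le> e / 2" using ue[of "e/2"] by auto
		have "dist (u j i) (u k i) < e" if "j \<ge> N" "k \<ge> N" for j k
		proof -
			have "\<bar>u j i - u k i\<bar> \<le> euc (Suc i) (u j) (u k)" by (rule euc_component) simp
			also have "\<dots> \<le> e / 2" using N that by blast
			finally show ?thesis using \<open>e > 0\<close> by (simp add: dist_real_def)
		qed
		then show "\<exists>M. \<forall>m\<ge>M. \<forall>n\<ge>M. dist (u m i) (u n i) < e" by blast
	qed
	then have "\<exists>l. (\<lambda>k. u k i) \<longlonglongrightarrow> l" for i by (simp add: Cauchy_convergent_iff convergent_def)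
	then obtain x where x: "\<And>i. (\<lambda>k. u k i) \<longlonglongrightarrow> x i" by metis
	have "(\<lambda>j. ell2_dist (u j) x) \<longlonglongrightarrow> 0"
	proof (rule order_tendstoI)
		fix a :: ennreal assume "0 < a"
		then obtain \<epsilon> where e: "\<epsilon> > 0" "ennreal \<epsilon> \<le> a" by (rule ennreal_pos_real)
		then obtain N where N: "\<forall>j\<ge>N. \<forall>k\<ge>N. \<forall>m. euc m (u j) (u k) \<le> \<epsilon> / 2" using ue[of "\<epsilon>/2"] by auto
		have "ell2_dist (u j) x < a" if "j \<ge> N" for j
		proof -
			\<comment> \<open>Only coordinatewise convergence is at hand. It suffices for each fixed m, and
			  the bound, being uniform in m, passes to the supremum.\<close>
			have "euc m (u j) x \<le> \<epsilon> / 2" for m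
			proof (rule LIMSEQ_le_const2)
				show "(\<lambda>k. euc m (u j) (u k)) \<longlonglongrightarrow> euc m (u j) x"
					unfolding euc_def L2_set_def by (intro tendsto_intros x)
				show "\<exists>N. \<forall>k\<ge>N. euc m (u j) (u k) \<le> \<epsilon> / 2" using N that by blast
			qed
			then have "ell2_dist (u j) x \<le> ennreal (\<epsilon> / 2)" using e by (simp add: ell2_dist_le_iff)
			also have "\<dots> < ennreal \<epsilon>" using e by (simp add: ennreal_less_iff)
			finally show ?thesis using e by simp
		qed
		then show "\<forall>\<^sub>F j in sequentially. ell2_dist (u j) x < a" by (auto simp: eventually_sequentially)
	qed simp
	then show "\<exists>x\<in>topspace euclidean. (\<lambda>j. ell2_dist (u j) x) \<longlonglongrightarrow> 0" by auto
next
	fix c :: ennreal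
	have "{(x, y) \<in> topspace euclidean \<times> topspace euclidean. ell2_dist x y \<le> c} = (\<Inter>m. {z. ennreal (euc m (fst z) (snd z)) \<le> c})"
		by (auto simp: ell2_dist_SUP SUP_le_iff)
	moreover have "closed {z. ennreal (euc m (fst z) (snd z)) \<le> c}" for m
	proof (cases c)
		case (real r)
		have "continuous_on UNIV (\<lambda>z. euc m (fst z) (snd z))"
			unfolding euc_def L2_set_def
			by (intro continuous_intros continuous_on_product_then_coordinatewise)
		then have "closed {z. euc m (fst z) (snd z) \<le> r}" by (intro closed_Collect_le continuous_intros)
		then show ?thesis using real by simp
	qed simp
	ultimately show "closedin (prod_topology euclidean euclidean) {(x, y) \<in> topspace euclidean \<times> topspace euclidean. ell2_dist x y \<le> c}"
		by (simp add: closedin_prod_euclidean closed_INT)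
next
	fix U and x :: "nat \<Rightarrow> real" assume "openin euclidean U" and x: "x \<in> U"
	then have U: "open U" by simp
	show "\<exists>\<epsilon>>0. \<forall>y\<in>topspace euclidean. ell2_dist x y < \<epsilon> \<longrightarrow> y \<in> U"
	proof (rule ccontr)
		assume neg: "\<not> ?thesis"
		have "\<exists>y. ell2_dist x y < ennreal (1 / real (Suc k)) \<and> y \<notin> U" for k
			using neg by (auto dest!: spec[of _ "ennreal (1 / real (Suc k))"])
		then obtain u where u: "\<And>k. ell2_dist x (u k) < ennreal (1 / real (Suc k))" "\<And>k. u k \<notin> U" by metis
		have "u \<longlonglongrightarrow> x"
		proof (rule tendsto_coordinatewise)
			fix i
			have "(\<lambda>k. u k i - x i) \<longlonglongrightarrow> 0"
			proof (rule Lim_null_comparison[OF always_eventually LIMSEQ_Suc[OF lim_1_over_n]], intro allI)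
				fix k
				have "ell2_dist x (u k) \<le> ennreal (1 / real (Suc k))" using u(1)[of k] by (rule less_imp_le)
				then have "euc (Suc i) x (u k) \<le> 1 / real (Suc k)" using ell2_dist_le_iff[of "1 / real (Suc k)" x "u k"] by simp
				then show "norm (u k i - x i) \<le> 1 / real (Suc k)"
					using euc_component[of i "Suc i" x "u k"] by (simp add: abs_minus_commute)
			qed
			then show "(\<lambda>k. u k i) \<longlonglongrightarrow> x i" by (rule LIM_zero_cancel)
		qed
		then have "\<forall>\<^sub>F k in sequentially. u k \<in> U" using U x by (rule topological_tendstoD)
		then show False using u(2) by (auto simp: eventually_sequentially)
	qed
qed

lemma emm_space_I_infinity: "emm_space I_infinity"
proof -
	have top: "topspace (top_of_set {0..1::real}) = {0..1}" by simp
	have cm: "completely_metrizable_space (top_of_set {0..1::real})"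
		by (rule completely_metrizable_space_closedin[OF completely_metrizable_space_euclidean]) simp
	obtain T :: "real set" where T: "countable T" "T \<subseteq> {0..1}" "{0..1} \<subseteq> closure T" by (rule separable)
	have sep: "separable_space (top_of_set {0..1::real})"
		unfolding separable_space_def
	proof (intro exI conjI)
		show "countable T" by fact
		show "T \<subseteq> topspace (top_of_set {0..1})" using T by simp
		show "top_of_set {0..1} closure_of T = topspace (top_of_set {0..1})"
			using T by (auto simp: closure_of_subtopology Int_absorb1)
	qed
	have sets: "sets (restrict_space lborel {0..1::real}) = borel_sets_of (top_of_set {0..1})"
	proof -
		have "{(\<lambda>x. x) -` A \<inter> {0..1::real} | A. A \<in> {S. open S}} = {U. openin (top_of_set {0..1}) U}"
			by (auto simp: openin_open)
		moreover have "{(\<lambda>x. x) -` A \<inter> {0..1::real} | A. A \<in> sigma_sets UNIV {S. open S}} = sets (restrict_space borel {0..1})"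
			by (auto simp: sets_restrict_space sets_borel)
		ultimately show ?thesis
			using sigma_sets_vimage_commute[of "\<lambda>x. x" "{0..1::real}" UNIV "{S. open S}"]
			by (simp add: borel_sets_of_def sets_restrict_space)
	qed
	have prob: "prob_space (restrict_space lborel {0..1::real})"
		by (auto simp: emeasure_restrict_space space_restrict_space intro!: prob_spaceI)
	show ?thesis
		unfolding emm_space_def Let_def I_infinity_def emm.simps top
	proof (intro conjI ballI allI impI cm sep prob sets)
		show "space (restrict_space lborel {0..1::real}) = {0..1}" by (simp add: space_restrict_space)
		fix x y z :: real
		show "((if x = y then 0 else \<infinity>) = (0::ennreal)) \<longleftrightarrow> x = y" by simp
		show "(if x = y then 0 else \<infinity> :: ennreal) = (if y = x then 0 else \<infinity>)" by simp
		show "(if x = z then 0 else \<infinity> :: ennreal) \<le> (if x = y then 0 else \<infinity>) + (if y = z then 0 else \<infinity>)" by simp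
	next
		fix u :: "nat \<Rightarrow> real"
		assume u: "range u \<subseteq> {0..1} \<and> (\<forall>e>0. \<exists>N. \<forall>j\<ge>N. \<forall>k\<ge>N. (if u j = u k then 0 else \<infinity> :: ennreal) < e)"
		then obtain N where N: "\<forall>j\<ge>N. \<forall>k\<ge>N. (if u j = u k then 0 else \<infinity> :: ennreal) < 1" by (meson zero_less_one)
		have eq: "u j = u N" if "j \<ge> N" for j
		proof (rule ccontr)
			assume "u j \<noteq> u N"
			then show False using N[rule_format, OF that order_refl] by simp
		qed
		have "(\<lambda>j. if u j = u N then 0 else \<infinity> :: ennreal) \<longlonglongrightarrow> 0"
		proof (rule tendsto_eventually)
			show "\<forall>\<^sub>F j in sequentially. (if u j = u N then 0 else \<infinity> :: ennreal) = 0"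
				using eventually_ge_at_top[of N]
			proof eventually_elim
				case (elim j)
				show ?case using eq[OF elim] by simp
			qed
		qed
		moreover have "u N \<in> {0..1}" using u by (meson range_subsetD)
		ultimately show "\<exists>x\<in>{0..1}. (\<lambda>j. if u j = x then 0 else \<infinity> :: ennreal) \<longlonglongrightarrow> 0" by (rule bexI)
	next
		fix c :: ennreal
		have "closed {(x, y) \<in> {0..1} \<times> {0..1::real}. (if x = y then 0 else \<infinity>) \<le> c}"
		proof (cases "c = \<infinity>")
			case True
			then have "{(x, y) \<in> {0..1} \<times> {0..1::real}. (if x = y then 0 else \<infinity>) \<le> c} = {0..1} \<times> {0..1}" by auto
			then show ?thesis by (simp add: closed_Times)
		next
			case False
			then have "{(x, y) \<in> {0..1} \<times> {0..1::real}. (if x = y then 0 else \<infinity>) \<le> c} = ({0..1} \<times> {0..1}) \<inter> {z. fst z = snd z}"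
				by (auto simp: top_unique split: if_splits)
			moreover have "closed {z :: real \<times> real. fst z = snd z}" by (intro closed_Collect_eq continuous_intros)
			ultimately show ?thesis by (simp add: closed_Int closed_Times)
		qed
		then have "closedin (top_of_set ({0..1} \<times> {0..1})) {(x, y) \<in> {0..1} \<times> {0..1::real}. (if x = y then 0 else \<infinity>) \<le> c}"
			by (rule closed_subset[rotated]) auto
		moreover have "prod_topology (top_of_set {0..1}) (top_of_set {0..1::real}) = top_of_set ({0..1} \<times> {0..1})"
			by (simp add: prod_topology_subtopology_eu)
		ultimately show "closedin (prod_topology (top_of_set {0..1}) (top_of_set {0..1}))
				{(x, y) \<in> {0..1} \<times> {0..1::real}. (if x = y then 0 else \<infinity>) \<le> c}" by simp
	next
		fix U and x :: real assume "openin (top_of_set {0..1}) U" "x \<in> U"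
		then show "\<exists>e>0. \<forall>y\<in>{0..1}. (if x = y then 0 else \<infinity> :: ennreal) < e \<longrightarrow> y \<in> U"
			by (intro exI[of _ 1]) auto
	qed
qed

section \<open>The law of large numbers for Gaussian sequences\<close>

context
	fixes l :: real
	assumes l: "l > 0"
begin

interpretation G: product_prob_space "\<lambda>_. density lborel (normal_density 0 l)" "UNIV :: nat set"
	by (rule gaussian_product[OF l])

interpretation G: prob_space "gauss l" by (rule prob_space_gauss[OF l])

lemma measurable_gaussian_coordinate [measurable]: "(\<lambda>x. x i) \<in> borel_measurable (gauss l)"
	using measurable_product_coordinates[of i] by (simp cong: measurable_cong_sets)

lemma distr_gaussian_coordinate: "distr (gauss l) borel (\<lambda>x. x i) = density lborel (normal_density 0 l)"
proof -
	have "distr (gauss l) borel (\<lambda>x. x i) = distr (gauss l) (density lborel (normal_density 0 l)) (\<lambda>x. x i)"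
		by (rule distr_cong) auto
	also have "\<dots> = density lborel (normal_density 0 l)"
		unfolding gauss_def by (rule G.PiM_component) simp
	finally show ?thesis .
qed

lemma gaussian_coordinate_integral:
	assumes [measurable]: "g \<in> borel_measurable borel" and int: "integrable lborel (\<lambda>x. normal_density 0 l x * g x)"
	shows "integrable (gauss l) (\<lambda>x. g (x i))"
		"integral\<^sup>L (gauss l) (\<lambda>x. g (x i)) = (\<integral>x. normal_density 0 l x * g x \<partial>lborel)"
proof -
	have "integrable (density lborel (normal_density 0 l)) g"
		using int by (subst integrable_density) auto
	then show "integrable (gauss l) (\<lambda>x. g (x i))"
		unfolding distr_gaussian_coordinate[symmetric, of i] by (subst (asm) integrable_distr_eq) auto
	have "integral\<^sup>L (gauss l) (\<lambda>x. g (x i)) = integral\<^sup>L (distr (gauss l) borel (\<lambda>x. x i)) g"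
		by (rule integral_distr[symmetric]) auto
	also have "\<dots> = (\<integral>x. normal_density 0 l x * g x \<partial>lborel)"
		unfolding distr_gaussian_coordinate by (subst integral_density) auto
	finally show "integral\<^sup>L (gauss l) (\<lambda>x. g (x i)) = (\<integral>x. normal_density 0 l x * g x \<partial>lborel)" .
qed

text \<open>The variables x_i^2 - l^2 are centred and independent, so the mixed expectations vanish
  and the variances add up. V is the variance of one square.\<close>

lemma gaussian_second_moment:
	"\<exists>V. \<forall>n. integrable (gauss l) (\<lambda>x. (\<Sum>i\<le>n. (x i)^2 - l^2)^2) \<and>
		 integral\<^sup>L (gauss l) (\<lambda>x. (\<Sum>i\<le>n. (x i)^2 - l^2)^2) = real (Suc n) * V"
proof -
	let ?Y = "\<lambda>i (x :: nat \<Rightarrow> real). (x i)^2 - l^2"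
	have mom: "integrable lborel (\<lambda>x. normal_density 0 l x * x ^ k)" for k
		using integrable_normal_moment[of l 0 k] l by simp
	have c2: "(\<integral>x. normal_density 0 l x * x^2 \<partial>lborel) = l^2"
		using integral_normal_moment_even[of l 0 1] l by (simp add: power2_eq_square fact_numeral field_simps)
	have int2: "integrable lborel (\<lambda>x. normal_density 0 l x * (x^2 - l^2))"
		unfolding right_diff_distrib using mom[of 2] mom[of 0] by (intro Bochner_Integration.integrable_diff integrable_mult_left) simp_all
	have int4: "integrable lborel (\<lambda>x. normal_density 0 l x * (x^2 - l^2)^2)"
	proof -
		have "(\<lambda>x. normal_density 0 l x * (x^2 - l^2)^2) = (\<lambda>x. normal_density 0 l x * x ^ 4 - (normal_density 0 l x * x ^ 2) * (2 * l^2) + (normal_density 0 l x * x ^ 0) * (l ^ 4))"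
			by (auto simp: power2_eq_square power4_eq_xxxx algebra_simps)
		then show ?thesis using mom[of 4] mom[of 2] mom[of 0]
			by (simp only:) (intro Bochner_Integration.integrable_diff Bochner_Integration.integrable_add integrable_mult_left)
	qed
	have EY: "integral\<^sup>L (gauss l) (?Y i) = 0" for i
	proof -
		have "integral\<^sup>L (gauss l) (?Y i) = (\<integral>x. normal_density 0 l x * (x^2 - l^2) \<partial>lborel)"
			by (rule gaussian_coordinate_integral(2)[of "\<lambda>x. x^2 - l^2"]) (use int2 in auto)
		also have "\<dots> = (\<integral>x. normal_density 0 l x * x^2 - normal_density 0 l x * l^2 \<partial>lborel)"
			by (simp add: right_diff_distrib)
		also have "\<dots> = l^2 - (\<integral>x. normal_density 0 l x \<partial>lborel) * l^2"
			using mom[of 2] mom[of 0] c2 by (subst Bochner_Integration.integral_diff) simp_all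
		also have "\<dots> = 0" using integral_normal_density[of l 0] l by simp
		finally show ?thesis .
	qed
	have iY: "integrable (gauss l) (?Y i)" for i
		by (rule gaussian_coordinate_integral(1)[of "\<lambda>x. x^2 - l^2"]) (use int2 in auto)
	define V where "V = (\<integral>x. normal_density 0 l x * (x^2 - l^2)^2 \<partial>lborel)"
	have Y2: "integrable (gauss l) (\<lambda>x. ?Y i x * ?Y i x)" "integral\<^sup>L (gauss l) (\<lambda>x. ?Y i x * ?Y i x) = V" for i
		using gaussian_coordinate_integral[of "\<lambda>x. (x^2 - l^2)^2" i] int4 by (simp_all add: V_def power2_eq_square)
	have ind0: "G.indep_vars (\<lambda>_. borel) (\<lambda>i x. x i) (UNIV :: nat set)"
	proof (subst G.indep_vars_iff_distr_eq_PiM)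
		show "UNIV \<noteq> ({} :: nat set)" by simp
		show "\<And>i. G.random_variable borel (\<lambda>x. x i)" by measurable
		have "distr (gauss l) (PiM UNIV (\<lambda>_. borel)) (\<lambda>x. \<lambda>i\<in>UNIV. x i) = distr (gauss l) (gauss l) (\<lambda>x. x)"
			by (rule distr_cong) (auto simp: sets_PiM_equal_borel)
		also have "\<dots> = gauss l" by (simp add: distr_id2)
		finally show "distr (gauss l) (PiM UNIV (\<lambda>_. borel)) (\<lambda>x. \<lambda>i\<in>UNIV. x i) = PiM UNIV (\<lambda>i. distr (gauss l) borel (\<lambda>x. x i))"
			unfolding distr_gaussian_coordinate by (simp add: gauss_def)
	qed
	have ind: "G.indep_vars (\<lambda>_. borel) ?Y UNIV"
		using G.indep_vars_compose2[OF ind0, of "\<lambda>_ t. t^2 - l^2" "\<lambda>_. borel"] by simp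
	have YY: "integrable (gauss l) (\<lambda>x. ?Y i x * ?Y j x)" "integral\<^sup>L (gauss l) (\<lambda>x. ?Y i x * ?Y j x) = (if i = j then V else 0)" for i j
	proof -
		have "integrable (gauss l) (\<lambda>x. ?Y i x * ?Y j x) \<and> integral\<^sup>L (gauss l) (\<lambda>x. ?Y i x * ?Y j x) = 0" if "i \<noteq> j"
		proof -
			have ij: "G.indep_vars (\<lambda>_. borel) ?Y {i, j}" by (rule G.indep_vars_subset[OF ind]) simp
			have pr: "(\<lambda>x. \<Prod>k\<in>{i, j}. ?Y k x) = (\<lambda>x. ?Y i x * ?Y j x)" using that by auto
			show ?thesis
				using G.indep_vars_integrable[OF _ ij] G.indep_vars_lebesgue_integral[OF _ ij] iY EY that unfolding pr by simp
		qed
		then show "integrable (gauss l) (\<lambda>x. ?Y i x * ?Y j x)" "integral\<^sup>L (gauss l) (\<lambda>x. ?Y i x * ?Y j x) = (if i = j then V else 0)"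
			using Y2[of i] by (cases "i = j"; simp)+
	qed
	have sq: "(\<Sum>i\<le>n. ?Y i x)^2 = (\<Sum>i\<le>n. \<Sum>j\<le>n. ?Y i x * ?Y j x)" for n x
		by (simp add: power2_eq_square sum_product)
	show ?thesis
	proof (intro exI[of _ V] allI conjI)
		fix n
		show "integrable (gauss l) (\<lambda>x. (\<Sum>i\<le>n. ?Y i x)^2)"
			unfolding sq by (intro Bochner_Integration.integrable_sum YY)
		have "integral\<^sup>L (gauss l) (\<lambda>x. (\<Sum>i\<le>n. ?Y i x)^2) = (\<Sum>i\<le>n. \<Sum>j\<le>n. if i = j then V else 0)"
			unfolding sq by (subst Bochner_Integration.integral_sum, intro Bochner_Integration.integrable_sum YY(1))
				(subst Bochner_Integration.integral_sum, auto intro: YY(1) simp del: YY simp: YY(2))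
		also have "\<dots> = real (Suc n) * V" by (simp add: sum.delta)
		finally show "integral\<^sup>L (gauss l) (\<lambda>x. (\<Sum>i\<le>n. ?Y i x)^2) = real (Suc n) * V" .
	qed
qed

text \<open>Chebyshev's inequality. Half of d absorbs the distance of
  \<open>real (Suc n) * l^2 / (r n)^2\<close> from 1, the other half the fluctuation, whose variance
  divided by \<open>(r n)^4\<close> is of order 1 / n.\<close>

lemma gaussian_norm_lln:
	assumes r: "(\<lambda>n. r n / sqrt (real n)) \<longlonglongrightarrow> l" and rpos: "\<And>n. r n > 0" and d: "d > 0"
	shows "(\<lambda>n. measure (gauss l) {x. \<bar>sqn n x / (r n)^2 - 1\<bar> > d}) \<longlonglongrightarrow> 0"
proof -
	obtain V where V: "\<And>n. integrable (gauss l) (\<lambda>x. (\<Sum>i\<le>n. (x i)^2 - l^2)^2)"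
		"\<And>n. integral\<^sup>L (gauss l) (\<lambda>x. (\<Sum>i\<le>n. (x i)^2 - l^2)^2) = real (Suc n) * V"
		using gaussian_second_moment by blast
	have "(\<lambda>n. (r n / sqrt (real n))^2) \<longlonglongrightarrow> l^2" by (intro tendsto_power r)
	then have r2: "(\<lambda>n. (r n)^2 / real n) \<longlonglongrightarrow> l^2" by (simp add: power_divide)
	then have inv: "(\<lambda>n. inverse ((r n)^2 / real n)) \<longlonglongrightarrow> inverse (l^2)" using l by (intro tendsto_inverse) auto
	have n1: "(\<lambda>n. real (Suc n) / real n) \<longlonglongrightarrow> 1" by real_asymp
	have "(\<lambda>n. (real (Suc n) / real n) * inverse ((r n)^2 / real n) * l^2) \<longlonglongrightarrow> 1 * inverse (l^2) * l^2"
		by (intro tendsto_mult n1 inv tendsto_const)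
	moreover have "\<forall>\<^sub>F n in sequentially. (real (Suc n) / real n) * inverse ((r n)^2 / real n) * l^2 = real (Suc n) * l^2 / (r n)^2"
		using eventually_gt_at_top[of 0] by eventually_elim simp
	ultimately have "(\<lambda>n. real (Suc n) * l^2 / (r n)^2) \<longlonglongrightarrow> 1 * inverse (l^2) * l^2"
		by (rule Lim_transform_eventually)
	then have lim1: "(\<lambda>n. real (Suc n) * l^2 / (r n)^2) \<longlonglongrightarrow> 1" using l by simp
	have "(\<lambda>n. (real (Suc n) / real n) * (inverse ((r n)^2 / real n))^2 * (1 / real n) * (V * 4 / d^2)) \<longlonglongrightarrow> 1 * (inverse (l^2))^2 * 0 * (V * 4 / d^2)"
		by (intro tendsto_mult n1 tendsto_power inv tendsto_const lim_1_over_n)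
	moreover have "\<forall>\<^sub>F n in sequentially. (real (Suc n) / real n) * (inverse ((r n)^2 / real n))^2 * (1 / real n) * (V * 4 / d^2)
			= real (Suc n) * V / ((d / 2) * (r n)^2)^2"
		using eventually_gt_at_top[of 0]
	proof eventually_elim
		case (elim n)
		have nz: "r n \<noteq> 0" "real n \<noteq> 0" "d \<noteq> 0" using rpos[of n] elim d by auto
		have "(inverse ((r n)^2 / real n))^2 = (real n)^2 / ((r n)^2)^2" by (simp add: power_divide)
		then show ?case using nz by (simp add: power2_eq_square mult_ac)
	qed
	ultimately have "(\<lambda>n. real (Suc n) * V / ((d / 2) * (r n)^2)^2) \<longlonglongrightarrow> 1 * (inverse (l^2))^2 * 0 * (V * 4 / d^2)"
		by (rule Lim_transform_eventually)
	then have lim2: "(\<lambda>n. real (Suc n) * V / ((d / 2) * (r n)^2)^2) \<longlonglongrightarrow> 0" by simp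
	have "\<forall>\<^sub>F n in sequentially. dist (real (Suc n) * l^2 / (r n)^2) 1 < d / 2"
		using lim1 d by (intro tendstoD) auto
	then have "\<forall>\<^sub>F n in sequentially. measure (gauss l) {x. \<bar>sqn n x / (r n)^2 - 1\<bar> > d} \<le> real (Suc n) * V / ((d / 2) * (r n)^2)^2"
	proof eventually_elim
		case (elim n)
		let ?S = "\<lambda>x. \<Sum>i\<le>n. (x i)^2 - l^2"
		have a: "(d / 2) * (r n)^2 > 0" using d rpos[of n] by simp
		have S: "?S x = sqn n x - real (Suc n) * l^2" for x by (simp add: sum_subtractf)
		have [measurable]: "?S \<in> borel_measurable (gauss l)" by measurable
		have "measure (gauss l) {x. \<bar>sqn n x / (r n)^2 - 1\<bar> > d} \<le> measure (gauss l) {x \<in> space (gauss l). \<bar>?S x\<bar> \<ge> (d / 2) * (r n)^2}"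
		proof (rule G.finite_measure_mono)
			show "{x \<in> space (gauss l). \<bar>?S x\<bar> \<ge> (d / 2) * (r n)^2} \<in> sets (gauss l)" by measurable
			show "{x. \<bar>sqn n x / (r n)^2 - 1\<bar> > d} \<subseteq> {x \<in> space (gauss l). \<bar>?S x\<bar> \<ge> (d / 2) * (r n)^2}"
			proof safe
				fix x :: "nat \<Rightarrow> real" assume x: "\<bar>sqn n x / (r n)^2 - 1\<bar> > d"
				have "?S x / (r n)^2 = sqn n x / (r n)^2 - real (Suc n) * l^2 / (r n)^2" unfolding S by (rule diff_divide_distrib)
				then have "\<bar>?S x / (r n)^2\<bar> \<ge> d / 2" using x elim unfolding dist_real_def by linarith
				then show "\<bar>?S x\<bar> \<ge> (d / 2) * (r n)^2" using rpos[of n] by (simp add: abs_divide field_simps)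
			qed simp
		qed
		also have "\<dots> \<le> integral\<^sup>L (gauss l) (\<lambda>x. (?S x)^2) / ((d / 2) * (r n)^2)^2"
			by (rule G.second_moment_method) (use V(1) a in auto)
		finally show ?case unfolding V(2) .
	qed
	then show ?thesis
		by (intro tendsto_sandwich[OF _ _ tendsto_const lim2]) (auto intro: always_eventually)
qed

end

section \<open>Domination by Gaussian sequences\<close>

declare measurable_gaussian_coordinate [measurable del]

definition cyl_set :: "nat \<Rightarrow> (nat \<Rightarrow> real) set \<Rightarrow> bool" where
	"cyl_set k A \<longleftrightarrow> A \<in> sets borel \<and> (\<forall>x y. (\<forall>i<k. x i = y i) \<longrightarrow> (x \<in> A \<longleftrightarrow> y \<in> A))"

lemma cyl_set_mono: "cyl_set k A \<Longrightarrow> k \<le> m \<Longrightarrow> cyl_set m A"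
	unfolding cyl_set_def by (meson order_less_le_trans)

lemma sets_borel_cylinder:
	"sets (borel :: (nat \<Rightarrow> real) measure) = sigma_sets UNIV {{f. f i \<in> A} | i A. A \<in> sets borel}"
proof -
	have "sets (borel :: (nat \<Rightarrow> real) measure) = sets (PiM UNIV (\<lambda>_::nat. borel :: real measure))"
		by (simp add: sets_PiM_equal_borel)
	also have "\<dots> = sigma_sets UNIV {{f. f i \<in> A} | i A. A \<in> sets borel}"
		by (simp add: sets_PiM_single)
	finally show ?thesis .
qed

context
	fixes l :: real
	assumes l: "l > 0"
begin

interpretation N: product_prob_space "\<lambda>_. density lborel (normal_density 0 l)" "UNIV :: nat set"
	by (rule gaussian_product[OF l])

interpretation G: prob_space "gauss l" by (rule prob_space_gauss[OF l])

interpretation GG: pair_prob_space "gauss l" "gauss l" ..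

text \<open>The sets that can be approximated by cylinders contain the generators and are closed
  under complements and countable unions.\<close>

lemma cylinder_approx:
	assumes "A \<in> sets borel" "e > 0"
	shows "\<exists>k C. cyl_set k C \<and> measure (gauss l) ((A - C) \<union> (C - A)) < e"
	using assms(1) assms(2) unfolding sets_borel_cylinder
proof (induction arbitrary: e rule: sigma_sets.induct)
	case (Basic a)
	then obtain i A where a: "a = {f. f i \<in> A}" "A \<in> sets borel" by blast
	have "a = (\<lambda>x. x i) -` A \<inter> space borel" using a by auto
	also have "\<dots> \<in> sets borel" by (rule measurable_sets[OF measurable_product_coordinates a(2)])
	finally have "cyl_set (Suc i) a" using a by (auto simp: cyl_set_def)
	then show ?case using Basic by (intro exI[of _ "Suc i"] exI[of _ a]) simp
next
	case Empty
	then show ?case by (intro exI[of _ 0] exI[of _ "{}"]) (simp add: cyl_set_def)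
next
	case (Compl a)
	then obtain k C where C: "cyl_set k C" "measure (gauss l) ((a - C) \<union> (C - a)) < e" by blast
	have "cyl_set k (UNIV - C)" using C(1) unfolding cyl_set_def by auto
	moreover have "(UNIV - a - (UNIV - C)) \<union> (UNIV - C - (UNIV - a)) = (a - C) \<union> (C - a)" by auto
	ultimately show ?case using C(2) by metis
next
	case (Union a)
	have as: "a n \<in> sets borel" for n using Union.hyps unfolding sets_borel_cylinder by blast
	have [measurable]: "a n \<in> sets (gauss l)" for n using as by simp
	have "(\<lambda>n. measure (gauss l) ((\<Union>i. a i) - (\<Union>i<n. a i))) \<longlonglongrightarrow> measure (gauss l) (\<Inter>n. (\<Union>i. a i) - (\<Union>i<n. a i))"
	proof (rule G.finite_Lim_measure_decseq)
		have "(\<Union>i. a i) - (\<Union>i<n. a i) \<in> sets (gauss l)" for n by measurable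
		then show "range (\<lambda>n. (\<Union>i. a i) - (\<Union>i<n. a i)) \<subseteq> sets (gauss l)" by blast
		show "decseq (\<lambda>n. (\<Union>i. a i) - (\<Union>i<n. a i))" by (auto simp: decseq_def intro: less_le_trans)
	qed
	moreover have "(\<Inter>n. (\<Union>i. a i) - (\<Union>i<n. a i)) = {}" by blast
	ultimately have "(\<lambda>n. measure (gauss l) ((\<Union>i. a i) - (\<Union>i<n. a i))) \<longlonglongrightarrow> 0"
		by (simp only: measure_empty)
	then have "\<forall>\<^sub>F n in sequentially. measure (gauss l) ((\<Union>i. a i) - (\<Union>i<n. a i)) < e / 2"
		by (rule order_tendstoD) (use Union.prems in simp)
	then obtain n where n: "measure (gauss l) ((\<Union>i. a i) - (\<Union>i<n. a i)) < e / 2"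
		unfolding eventually_sequentially by blast
	\<comment> \<open>Half of e is spent on the tail of the union, the other half is shared by the
	  first n sets; the successor covers n = 0.\<close>
	have "e / (2 * real (Suc n)) > 0" using Union.prems by simp
	then have "\<forall>i. \<exists>k C. cyl_set k C \<and> measure (gauss l) ((a i - C) \<union> (C - a i)) < e / (2 * real (Suc n))"
		using Union.IH by blast
	then obtain k C where C: "\<And>i. cyl_set (k i) (C i)" "\<And>i. measure (gauss l) ((a i - C i) \<union> (C i - a i)) < e / (2 * real (Suc n))"
		by metis
	have Cs[measurable]: "C i \<in> sets (gauss l)" for i using C(1)[of i] by (simp add: cyl_set_def)
	define K where "K = Max (insert 0 (k ` {..<n}))"
	have K: "cyl_set K (C i)" if "i < n" for i
		by (rule cyl_set_mono[OF C(1)]) (use that in \<open>auto simp: K_def\<close>)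
	have cyl: "cyl_set K (\<Union>i<n. C i)"
		using K Cs unfolding cyl_set_def by (auto intro!: sets.finite_UN)
	have "measure (gauss l) (((\<Union>i. a i) - (\<Union>i<n. C i)) \<union> ((\<Union>i<n. C i) - (\<Union>i. a i)))
			\<le> measure (gauss l) (((\<Union>i. a i) - (\<Union>i<n. a i)) \<union> (\<Union>i<n. (a i - C i) \<union> (C i - a i)))"
	proof (rule G.finite_measure_mono)
		show "((\<Union>i. a i) - (\<Union>i<n. C i)) \<union> ((\<Union>i<n. C i) - (\<Union>i. a i))
			\<subseteq> ((\<Union>i. a i) - (\<Union>i<n. a i)) \<union> (\<Union>i<n. (a i - C i) \<union> (C i - a i))" by blast
	qed measurable
	also have "\<dots> \<le> measure (gauss l) ((\<Union>i. a i) - (\<Union>i<n. a i)) + measure (gauss l) (\<Union>i<n. (a i - C i) \<union> (C i - a i))"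
		by (intro measure_Un_le sets.Diff sets.Un sets.countable_UN' sets.finite_UN) (use as Cs in auto)
	also have "measure (gauss l) (\<Union>i<n. (a i - C i) \<union> (C i - a i)) \<le> (\<Sum>i<n. measure (gauss l) ((a i - C i) \<union> (C i - a i)))"
		by (rule measure_UNION_le) (use as Cs in \<open>auto intro!: sets.Un sets.Diff\<close>)
	also have "\<dots> \<le> (\<Sum>i<n. e / (2 * real (Suc n)))"
		by (intro sum_mono less_imp_le C(2))
	also have "\<dots> \<le> e / 2" using Union.prems by (simp add: field_simps)
	finally show ?case using n cyl by (intro exI[of _ K] exI[of _ "\<Union>i<n. C i"]) auto
qed

definition mix :: "nat \<Rightarrow> (nat \<Rightarrow> real) \<Rightarrow> (nat \<Rightarrow> real) \<Rightarrow> nat \<Rightarrow> real" where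
	"mix k x y = (\<lambda>i. if i < k then x i else y i)"

lemma measurable_mix [measurable]:
	"(\<lambda>z. mix k (fst z) (snd z)) \<in> gauss l \<Otimes>\<^sub>M gauss l \<rightarrow>\<^sub>M gauss l"
proof -
	have "(\<lambda>z. mix k (fst z) (snd z)) \<in> borel_measurable (gauss l \<Otimes>\<^sub>M gauss l)"
	proof (rule measurable_coordinatewise_then_product)
		fix i show "(\<lambda>z. mix k (fst z) (snd z) i) \<in> borel_measurable (gauss l \<Otimes>\<^sub>M gauss l)"
			unfolding mix_def
			using measurable_compose[OF measurable_fst measurable_gaussian_coordinate[OF l, of i], of "gauss l"]
				measurable_compose[OF measurable_snd measurable_gaussian_coordinate[OF l, of i], of "gauss l"]
			by (cases "i < k") auto
	qed
	then show ?thesis by (simp cong: measurable_cong_sets)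
qed

text \<open>Finite rectangles determine the law, and each splits at k into two rectangles that
  depend on independent copies.\<close>

lemma distr_mix: "distr (gauss l \<Otimes>\<^sub>M gauss l) (gauss l) (\<lambda>z. mix k (fst z) (snd z)) = gauss l"
proof -
	let ?N = "density lborel (normal_density 0 l)"
	let ?D = "distr (gauss l \<Otimes>\<^sub>M gauss l) (gauss l) (\<lambda>z. mix k (fst z) (snd z))"
	have "?D = PiM UNIV (\<lambda>_. ?N)"
	proof (rule N.PiM_eq)
		show "sets ?D = sets (PiM UNIV (\<lambda>_. ?N))" by (simp add: gauss_def)
		fix J :: "nat set" and F :: "nat \<Rightarrow> real set"
		assume J: "finite J" "J \<subseteq> UNIV" and F: "\<And>j. j \<in> J \<Longrightarrow> F j \<in> sets ?N"
		let ?A = "\<lambda>I. prod_emb UNIV (\<lambda>_. ?N) I (Pi\<^sub>E I F)"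
		let ?J1 = "J \<inter> {..<k}" and ?J2 = "J - {..<k}"
		have A: "?A I \<in> sets (gauss l)" if "I \<subseteq> J" for I
			unfolding gauss_def using that J F by (intro sets_PiM_I) (auto intro: finite_subset)
		have emb: "?A I = {x. \<forall>i\<in>I. x i \<in> F i}" for I by (auto simp: prod_emb_def PiE_iff restrict_def)
		have "emeasure ?D (?A J) = emeasure (gauss l \<Otimes>\<^sub>M gauss l) (?A ?J1 \<times> ?A ?J2)"
		proof (subst emeasure_distr[OF measurable_mix A[OF order_refl]], rule arg_cong[where f = "emeasure _"])
			show "(\<lambda>z. mix k (fst z) (snd z)) -` ?A J \<inter> space (gauss l \<Otimes>\<^sub>M gauss l) = ?A ?J1 \<times> ?A ?J2"
				unfolding emb by (auto simp: mix_def space_pair_measure split: if_splits)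
		qed
		also have "\<dots> = emeasure (gauss l) (?A ?J1) * emeasure (gauss l) (?A ?J2)"
			by (rule G.emeasure_pair_measure_Times) (use A in auto)
		also have "\<dots> = (\<Prod>j\<in>?J1. emeasure ?N (F j)) * (\<Prod>j\<in>?J2. emeasure ?N (F j))"
			unfolding gauss_def using J F by (subst (1 2) N.emeasure_PiM_emb) auto
		also have "\<dots> = (\<Prod>j\<in>J. emeasure ?N (F j))"
			using J by (subst prod.union_disjoint[symmetric]) (auto intro!: prod.cong)
		finally show "emeasure ?D (?A J) = (\<Prod>j\<in>J. emeasure ?N (F j))" .
	qed
	then show ?thesis by (simp add: gauss_def)
qed

lemma distr_fst_gaussian: "distr (gauss l \<Otimes>\<^sub>M gauss l) (gauss l) fst = gauss l"
proof (rule measure_eqI)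
	fix A assume "A \<in> sets (distr (gauss l \<Otimes>\<^sub>M gauss l) (gauss l) fst)"
	then have A: "A \<in> sets (gauss l)" by simp
	have "emeasure (distr (gauss l \<Otimes>\<^sub>M gauss l) (gauss l) fst) A = emeasure (gauss l \<Otimes>\<^sub>M gauss l) (A \<times> space (gauss l))"
		by (subst emeasure_distr[OF measurable_fst A]) (auto simp: space_pair_measure intro!: arg_cong[where f = "emeasure _"])
	also have "\<dots> = emeasure (gauss l) A"
		by (subst G.emeasure_pair_measure_Times[OF A sets.top]) (simp only: G.emeasure_space_1 mult_1_right)
	finally show "emeasure (distr (gauss l \<Otimes>\<^sub>M gauss l) (gauss l) fst) A = emeasure (gauss l) A" .
qed simp

text \<open>Replacing the tail of a Gaussian sequence by an independent copy changes a given discrete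
	observable only with small probability: this holds for cylinder sets, and those are dense.\<close>

lemma mix_discrete:
	fixes c :: "(nat \<Rightarrow> real) \<Rightarrow> nat"
	assumes c[measurable]: "c \<in> gauss l \<rightarrow>\<^sub>M count_space UNIV" and e: "e > 0"
	shows "\<exists>k. measure (gauss l \<Otimes>\<^sub>M gauss l)
		{z \<in> space (gauss l \<Otimes>\<^sub>M gauss l). c (fst z) \<noteq> c (mix k (fst z) (snd z))} < e"
proof -
	let ?GG = "gauss l \<Otimes>\<^sub>M gauss l"
	have V[measurable]: "{x. c x = j} \<in> sets (gauss l)" for j
		using measurable_sets[OF c, of "{j}"] by (simp add: vimage_def)
	have tail[measurable]: "{x. n \<le> c x} \<in> sets (gauss l)" for n
		using measurable_sets[OF c, of "{n..}"] by (simp add: vimage_def)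
	have "(\<lambda>n. measure (gauss l) {x. n \<le> c x}) \<longlonglongrightarrow> measure (gauss l) (\<Inter>n. {x. n \<le> c x})"
		by (rule G.finite_Lim_measure_decseq) (auto simp: decseq_def)
	moreover have "(\<Inter>n. {x. n \<le> c x}) = {}" using not_less_eq_eq by auto
	ultimately have "(\<lambda>n. measure (gauss l) {x. n \<le> c x}) \<longlonglongrightarrow> 0" by simp
	then have "\<forall>\<^sub>F n in sequentially. measure (gauss l) {x. n \<le> c x} < e / 2"
		by (rule order_tendstoD) (use e in simp)
	then obtain n where n: "measure (gauss l) {x. n \<le> c x} < e / 2"
		unfolding eventually_sequentially by blast
	\<comment> \<open>For each label below n both the original and the resampled sequence may fall into
	  an exceptional set, which costs 2 * \<eta> per label and at most e / 2 in all.\<close>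
	define \<eta> where "\<eta> = e / (4 * real (Suc n))"
	have \<eta>: "\<eta> > 0" using e by (simp add: \<eta>_def)
	have "\<forall>j. \<exists>k C. cyl_set k C \<and> measure (gauss l) (({x. c x = j} - C) \<union> (C - {x. c x = j})) < \<eta>"
		using cylinder_approx[OF _ \<eta>] V by simp
	then obtain k C where C: "\<And>i. cyl_set (k i) (C i)" "\<And>j. measure (gauss l) (({x. c x = j} - C j) \<union> (C j - {x. c x = j})) < \<eta>"
		by metis
	have Cs[measurable]: "C i \<in> sets (gauss l)" for i using C(1)[of i] by (simp add: cyl_set_def)
	define K where "K = Max (insert 0 (k ` {..<n}))"
	have K: "cyl_set K (C i)" if "i < n" for i
		by (rule cyl_set_mono[OF C(1)]) (use that in \<open>auto simp: K_def\<close>)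
	define B where "B j = ({x. c x = j} - C j) \<union> (C j - {x. c x = j})" for j
	have B[measurable]: "B j \<in> sets (gauss l)" for j unfolding B_def by measurable
	let ?m = "\<lambda>z. mix K (fst z) (snd z)"
	have m1: "measure ?GG (fst -` A \<inter> space ?GG) = measure (gauss l) A" if "A \<in> sets (gauss l)" for A
		using measure_distr[OF measurable_fst that, of "gauss l"] distr_fst_gaussian by simp
	have m2: "measure ?GG (?m -` A \<inter> space ?GG) = measure (gauss l) A" if "A \<in> sets (gauss l)" for A
		using measure_distr[OF measurable_mix that, of K] distr_mix by simp
	have s1: "fst -` A \<inter> space ?GG \<in> sets ?GG" if "A \<in> sets (gauss l)" for A
		using measurable_fst that by (rule measurable_sets)
	have s2: "?m -` A \<inter> space ?GG \<in> sets ?GG" if "A \<in> sets (gauss l)" for A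
		using measurable_mix that by (rule measurable_sets)
	have "measure ?GG {z \<in> space ?GG. c (fst z) \<noteq> c (?m z)}
		 \<le> measure ?GG ((fst -` {x. n \<le> c x} \<inter> space ?GG) \<union> (\<Union>j<n. (fst -` B j \<inter> space ?GG) \<union> (?m -` B j \<inter> space ?GG)))"
	proof (rule GG.finite_measure_mono)
		show "{z \<in> space ?GG. c (fst z) \<noteq> c (?m z)} \<subseteq> (fst -` {x. n \<le> c x} \<inter> space ?GG) \<union> (\<Union>j<n. (fst -` B j \<inter> space ?GG) \<union> (?m -` B j \<inter> space ?GG))"
		proof
			fix z assume z: "z \<in> {z \<in> space ?GG. c (fst z) \<noteq> c (?m z)}"
			show "z \<in> (fst -` {x. n \<le> c x} \<inter> space ?GG) \<union> (\<Union>j<n. (fst -` B j \<inter> space ?GG) \<union> (?m -` B j \<inter> space ?GG))"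
			proof (cases "n \<le> c (fst z)")
				case False
				let ?j = "c (fst z)"
				have "fst z \<in> C ?j \<longleftrightarrow> ?m z \<in> C ?j"
					using K[of ?j] False unfolding cyl_set_def by (auto simp: mix_def)
				then have "fst z \<in> B ?j \<or> ?m z \<in> B ?j" using z by (auto simp: B_def)
				then show ?thesis using False z by auto
			qed (use z in auto)
		qed
		show "(fst -` {x. n \<le> c x} \<inter> space ?GG) \<union> (\<Union>j<n. (fst -` B j \<inter> space ?GG) \<union> (?m -` B j \<inter> space ?GG)) \<in> sets ?GG"
			by (intro sets.Un sets.finite_UN s1 s2 tail B) auto
	qed
	also have "\<dots> \<le> measure ?GG (fst -` {x. n \<le> c x} \<inter> space ?GG) + measure ?GG (\<Union>j<n. (fst -` B j \<inter> space ?GG) \<union> (?m -` B j \<inter> space ?GG))"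
		by (intro measure_Un_le sets.Un sets.finite_UN s1 s2 tail B) auto
	also have "measure ?GG (\<Union>j<n. (fst -` B j \<inter> space ?GG) \<union> (?m -` B j \<inter> space ?GG))
			\<le> (\<Sum>j<n. measure ?GG ((fst -` B j \<inter> space ?GG) \<union> (?m -` B j \<inter> space ?GG)))"
		by (intro measure_UNION_le sets.Un s1 s2 B) auto
	also have "\<dots> \<le> (\<Sum>j<n. \<eta> + \<eta>)"
	proof (rule sum_mono)
		fix j
		have "measure ?GG ((fst -` B j \<inter> space ?GG) \<union> (?m -` B j \<inter> space ?GG)) \<le> measure ?GG (fst -` B j \<inter> space ?GG) + measure ?GG (?m -` B j \<inter> space ?GG)"
			by (intro measure_Un_le s1 s2 B)
		also have "\<dots> \<le> \<eta> + \<eta>" unfolding m1[OF B] m2[OF B] using C(2)[of j] by (simp add: B_def)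
		finally show "measure ?GG ((fst -` B j \<inter> space ?GG) \<union> (?m -` B j \<inter> space ?GG)) \<le> \<eta> + \<eta>" .
	qed
	also have "\<dots> = real n * (2 * \<eta>)" by simp
	also have "\<dots> \<le> real (Suc n) * (2 * \<eta>)" using \<eta> by (intro mult_right_mono) auto
	also have "\<dots> = e / 2" by (simp add: \<eta>_def del: of_nat_Suc)
	finally show ?thesis using n unfolding m1[OF tail] by (intro exI[of _ K]) simp
qed

text \<open>A box in the first k coordinates has positive Gaussian measure, so it meets every set of
  full measure. The side \<open>d / real (Suc k)\<close> makes the sum of the k coordinate distances
  smaller than d.\<close>

lemma gaussian_full_dense:
	assumes D: "AE x in gauss l. x \<in> D" and d: "d > 0"
	shows "\<exists>u\<in>D. euc k x u < d"
proof -
	let ?N = "density lborel (normal_density 0 l)"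
	define \<eta> where "\<eta> = d / real (Suc k)"
	have \<eta>: "\<eta> > 0" using d by (simp add: \<eta>_def)
	let ?B = "{u \<in> space (PiM UNIV (\<lambda>_. ?N)). \<forall>i\<in>{..<k}. u i \<in> {x i - \<eta><..<x i + \<eta>}}"
	have N: "emeasure ?N {a - \<eta><..<a + \<eta>} \<noteq> 0" for a
	proof
		assume "emeasure ?N {a - \<eta><..<a + \<eta>} = 0"
		then have "{a - \<eta><..<a + \<eta>} \<in> null_sets ?N" by (rule null_setsI) simp
		then have "AE t in ?N. t \<notin> {a - \<eta><..<a + \<eta>}" by (rule AE_not_in)
		then have "AE t in lborel. t \<notin> {a - \<eta><..<a + \<eta>}"
			using normal_density_pos[OF l] by (subst (asm) AE_density) auto
		then have "{a - \<eta><..<a + \<eta>} \<in> null_sets lborel" by (subst AE_iff_null_sets) auto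
		then have "emeasure lborel {a - \<eta><..<a + \<eta>} = 0" by (rule null_setsD1)
		then show False using \<eta> by simp
	qed
	have "emeasure (PiM UNIV (\<lambda>_. ?N)) ?B = (\<Prod>i\<in>{..<k}. emeasure ?N {x i - \<eta><..<x i + \<eta>})"
		by (rule N.emeasure_PiM_Collect) auto
	then have "emeasure (gauss l) ?B \<noteq> 0" using N by (simp add: gauss_def prod_zero_iff)
	moreover have "emeasure (gauss l) ?B = 0" if "?B \<inter> D = {}"
	proof -
		have "AE u in gauss l. u \<notin> ?B" using D by eventually_elim (use that in blast)
		moreover have "?B \<in> sets (gauss l)" unfolding gauss_def by measurable
		ultimately show ?thesis by (subst (asm) AE_iff_measurable[OF _ refl]) (auto simp: gauss_def)
	qed
	ultimately obtain u where u: "u \<in> D" "\<And>i. i < k \<Longrightarrow> \<bar>x i - u i\<bar> < \<eta>" by (auto simp: abs_less_iff algebra_simps)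
	have "euc k x u \<le> (\<Sum>i<k. \<bar>x i - u i\<bar>)" unfolding euc_def by (rule L2_set_le_sum_abs)
	also have "\<dots> \<le> (\<Sum>i<k. \<eta>)" using u(2) by (intro sum_mono less_imp_le) auto
	also have "\<dots> < d" using d by (simp add: \<eta>_def field_simps)
	finally show ?thesis using u(1) by blast
qed

text \<open>Fubini's theorem: almost every tail y satisfies the second demand, and if all of these
  had a section of measure at least e, so would B.\<close>

lemma AE_pair_choose:
	assumes [measurable]: "B \<in> sets (gauss l \<Otimes>\<^sub>M gauss l)" and "measure (gauss l \<Otimes>\<^sub>M gauss l) B < e"
		and Q: "AE z in gauss l \<Otimes>\<^sub>M gauss l. Q z" "Measurable.pred (gauss l \<Otimes>\<^sub>M gauss l) Q"
	shows "\<exists>y. measure (gauss l) {x. (x, y) \<in> B} < e \<and> (AE x in gauss l. Q (x, y))"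
proof (rule ccontr)
	assume neg: "\<not> ?thesis"
	have "AE x in gauss l. AE y in gauss l. Q (x, y)" by (rule GG.AE_pair[OF Q(1)])
	then have AEy: "AE y in gauss l. AE x in gauss l. Q (x, y)"
		using GG.AE_commute[of "\<lambda>x y. Q (x, y)"] Q(2) by (simp add: pred_def)
	have em: "emeasure (gauss l \<Otimes>\<^sub>M gauss l) B < ennreal e"
		using assms(2) by (simp add: GG.emeasure_eq_measure ennreal_less_iff)
	have "emeasure (gauss l \<Otimes>\<^sub>M gauss l) B = (\<integral>\<^sup>+y. emeasure (gauss l) ((\<lambda>x. (x, y)) -` B) \<partial>gauss l)"
		by (rule GG.emeasure_pair_measure_alt2) fact
	also have "\<dots> \<ge> (\<integral>\<^sup>+y. ennreal e \<partial>gauss l)"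
	proof (rule nn_integral_mono_AE)
		show "AE y in gauss l. ennreal e \<le> emeasure (gauss l) ((\<lambda>x. (x, y)) -` B)"
			using AEy
		proof eventually_elim
			case (elim y)
			then have "measure (gauss l) {x. (x, y) \<in> B} \<ge> e" using neg by (meson not_le)
			then show ?case by (simp add: G.emeasure_eq_measure vimage_def)
		qed
	qed
	finally show False using em G.emeasure_space_1 by simp
qed

text \<open>Freezing the tail at a typical value makes a 1-Lipschitz map into a complete space depend on
	finitely many coordinates; being 1-Lipschitz on a dense set it then extends to all of them.\<close>

lemma cylindrical_approximation:
	assumes Z: "mm_space Z" and \<phi>: "\<phi> \<in> gauss l \<rightarrow>\<^sub>M mm_measure Z"
		and E: "E \<in> sets (gauss l)" "emeasure (gauss l) E = 1"
		and lip: "\<And>x y. x \<in> E \<Longrightarrow> y \<in> E \<Longrightarrow> ennreal (mm_dist Z (\<phi> x) (\<phi> y)) \<le> ell2_dist x y"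
		and \<epsilon>: "\<epsilon> > 0"
	shows "\<exists>k \<psi>. (\<forall>x. \<psi> x \<in> mm_carrier Z) \<and> (\<forall>x y. mm_dist Z (\<psi> x) (\<psi> y) \<le> euc k x y) \<and>
		measure (gauss l) {x. mm_dist Z (\<phi> x) (\<psi> x) > \<epsilon>} \<le> \<epsilon>"
proof -
	interpret Z: mm_sp Z by standard fact
	let ?G = "gauss l"
	let ?GG = "?G \<Otimes>\<^sub>M ?G"
	have \<phi>C: "\<phi> x \<in> Z.C" for x using measurable_space[OF \<phi>] by simp
	obtain q :: "nat \<Rightarrow> 'a" where q: "\<And>j. q j \<in> Z.C" "\<And>x r. x \<in> Z.C \<Longrightarrow> r > 0 \<Longrightarrow> \<exists>j. Z.D (q j) x < r"
		by (rule Z.dense_sequence) blast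
	define c where "c y = (LEAST j. Z.D (q j) y < \<epsilon> / 2)" for y
	have cD: "Z.D (q (c y)) y < \<epsilon> / 2" if "y \<in> Z.C" for y
		unfolding c_def by (rule LeastI_ex) (use q(2)[OF that, of "\<epsilon> / 2"] \<epsilon> in simp)
	have same: "Z.D y y' \<le> \<epsilon>" if "y \<in> Z.C" "y' \<in> Z.C" "c y = c y'" for y y'
		using cD[OF that(1)] cD[OF that(2)] Z.triangle[OF that(1) q(1) that(2), of "c y"] that(3) Z.commute[of y "q (c y)"]
		by simp
	have Dq: "(\<lambda>x. Z.D (q j) x) \<in> borel_measurable Z.M" for j
		using Z.measurable_dist_point[of "\<lambda>x. x" Z.M "q j"] q(1) by simp
	have cm: "c \<in> Z.M \<rightarrow>\<^sub>M count_space UNIV"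
		unfolding c_def using Dq by measurable
	have c\<phi>: "(\<lambda>x. c (\<phi> x)) \<in> ?G \<rightarrow>\<^sub>M count_space UNIV" by (rule measurable_compose[OF \<phi> cm])
	obtain k where k: "measure ?GG {z \<in> space ?GG. c (\<phi> (fst z)) \<noteq> c (\<phi> (mix k (fst z) (snd z)))} < \<epsilon>"
		using mix_discrete[OF c\<phi> \<epsilon>] by blast
	let ?B = "{z \<in> space ?GG. c (\<phi> (fst z)) \<noteq> c (\<phi> (mix k (fst z) (snd z)))}"
	have B: "?B \<in> sets ?GG"
	proof -
		have "{z \<in> space ?GG. c (\<phi> (fst z)) = c (\<phi> (mix k (fst z) (snd z)))} \<in> sets ?GG"
			by (intro sets_nat_eq measurable_compose[OF measurable_fst c\<phi>] measurable_compose[OF measurable_mix c\<phi>])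
		moreover have "?B = space ?GG - {z \<in> space ?GG. c (\<phi> (fst z)) = c (\<phi> (mix k (fst z) (snd z)))}" by auto
		ultimately show ?thesis by (simp only: sets.compl_sets)
	qed
	have AE_E: "AE x in ?G. x \<in> E" using G.AE_in_set_eq_1[OF E(1)] E(2) by (simp add: measure_def)
	have "AE x in distr ?GG ?G (\<lambda>z. mix k (fst z) (snd z)). x \<in> E"
		unfolding distr_mix by (rule AE_E)
	then have "AE z in ?GG. mix k (fst z) (snd z) \<in> E" by (rule AE_distrD[OF measurable_mix])
	moreover have "Measurable.pred ?GG (\<lambda>z. mix k (fst z) (snd z) \<in> E)"
		by (rule pred_sets2[OF E(1) measurable_mix])
	ultimately obtain y where y: "measure ?G {x. (x, y) \<in> ?B} < \<epsilon>" "AE x in ?G. mix k x y \<in> E"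
		using AE_pair_choose[OF B k, of "\<lambda>z. mix k (fst z) (snd z) \<in> E"] by auto
	define f where "f x = \<phi> (mix k x y)" for x
	define F where "F = {x. mix k x y \<in> E}"
	have fC: "f x \<in> Z.C" for x by (simp add: f_def \<phi>C)
	have fl: "Z.D (f u) (f v) \<le> euc k u v" if "u \<in> F" "v \<in> F" for u v
	proof -
		\<comment> \<open>With a common frozen tail the differences beyond k vanish, and the possibly
		  infinite \<ell>2 distance becomes the distance in k coordinates.\<close>
		have "euc m (mix k u y) (mix k v y) \<le> euc k u v" for m
		proof -
			have "(\<Sum>i<m. (mix k u y i - mix k v y i)^2) = (\<Sum>i\<in>{..<m} \<inter> {..<k}. (u i - v i)^2)"
				by (rule sum.mono_neutral_cong_right) (auto simp: mix_def)
			also have "\<dots> \<le> (\<Sum>i<k. (u i - v i)^2)" by (rule sum_mono2) auto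
			finally show ?thesis unfolding euc_def L2_set_def by (rule real_sqrt_le_mono)
		qed
		then have "ell2_dist (mix k u y) (mix k v y) \<le> ennreal (euc k u v)" by (simp add: ell2_dist_le_iff)
		then have "ennreal (Z.D (f u) (f v)) \<le> ennreal (euc k u v)"
			using lip[of "mix k u y" "mix k v y"] that unfolding f_def F_def by (simp add: order_trans)
		then show ?thesis by simp
	qed
	have dense: "\<exists>u\<in>F. euc k x u < d" if "d > 0" for x d
		by (rule gaussian_full_dense[OF _ that]) (use y(2) in \<open>simp add: F_def\<close>)
	\<comment> \<open>The value at x is a limit of f along points of F approaching x. Comparing it with
	  all of F at once yields both agreement with f on F and the Lipschitz bound.\<close>
	have ex: "\<exists>z\<in>Z.C. \<forall>u\<in>F. Z.D z (f u) \<le> euc k x u" for x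
	proof -
		have "\<exists>u. u \<in> F \<and> euc k x u < 1 / 2 ^ m" for m using dense[of "1 / 2 ^ m" x] by auto
		then obtain u where u: "\<And>m. u m \<in> F" "\<And>m::nat. euc k x (u m) < 1 / 2 ^ m" by metis
		have "Z.D (f (u m)) (f (u (Suc m))) \<le> 2 / 2 ^ m" for m
		proof -
			have "Z.D (f (u m)) (f (u (Suc m))) \<le> euc k (u m) (u (Suc m))" by (rule fl[OF u(1) u(1)])
			also have "\<dots> \<le> euc k x (u m) + euc k x (u (Suc m))" using euc_triangle[of k "u m" "u (Suc m)" x] by (simp add: euc_commute)
			also have "\<dots> \<le> 1 / 2 ^ m + 1 / 2 ^ Suc m" using u(2)[of m] u(2)[of "Suc m"] by linarith
			also have "\<dots> \<le> 2 / 2 ^ m" by (simp add: field_simps)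
			finally show ?thesis .
		qed
		then obtain z where z: "limitin Z.mtopology (\<lambda>m. f (u m)) z sequentially"
			using Z.summable_dist_limit[of "\<lambda>m. f (u m)"] fC by blast
		have zC: "z \<in> Z.C" using z by (simp add: Z.limitin_metric)
		have "Z.D z (f v) \<le> euc k x v" if v: "v \<in> F" for v
		proof -
			have "(\<lambda>m. Z.D (f v) (f (u m))) \<longlonglongrightarrow> Z.D (f v) z" by (rule Z.limit_dist[OF z fC fC])
			moreover have "(\<lambda>m. euc k x v + 1 / 2 ^ m) \<longlonglongrightarrow> euc k x v + 0"
				by (intro tendsto_add tendsto_const) real_asymp
			moreover have "Z.D (f v) (f (u m)) \<le> euc k x v + 1 / 2 ^ m" for m
				using fl[OF v u(1)[of m]] euc_triangle[of k v "u m" x] u(2)[of m] by (simp add: euc_commute)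
			ultimately have "Z.D (f v) z \<le> euc k x v + 0" by (intro LIMSEQ_le) auto
			then show ?thesis by (simp add: Z.commute)
		qed
		then show ?thesis using zC by blast
	qed
	then obtain \<psi> where \<psi>: "\<And>x. \<psi> x \<in> Z.C" "\<And>x u. u \<in> F \<Longrightarrow> Z.D (\<psi> x) (f u) \<le> euc k x u" by metis
	have lip\<psi>: "Z.D (\<psi> x) (\<psi> x') \<le> euc k x x'" for x x'
	proof (rule field_le_epsilon)
		fix e :: real assume "e > 0"
		then obtain u where u: "u \<in> F" "euc k x u < e / 2" using dense[of "e/2" x] by auto
		have "Z.D (\<psi> x) (\<psi> x') \<le> Z.D (\<psi> x) (f u) + Z.D (f u) (\<psi> x')" using \<psi>(1) fC by (intro Z.triangle)
		also have "\<dots> \<le> euc k x u + euc k x' u" using \<psi>(2)[OF u(1)] by (intro add_mono) (auto simp: Z.commute[of "f u"])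
		also have "\<dots> \<le> euc k x u + (euc k x x' + euc k x u)" using euc_triangle[of k x' u x] by (simp add: euc_commute)
		finally show "Z.D (\<psi> x) (\<psi> x') \<le> euc k x x' + e" using u(2) by linarith
	qed
	have agree: "\<psi> u = f u" if "u \<in> F" for u
	proof -
		have "Z.D (\<psi> u) (f u) \<le> 0" using \<psi>(2)[OF that, of u] by simp
		then show ?thesis using Z.zero[OF \<psi>(1) fC] Z.nonneg[of "\<psi> u" "f u"] by (simp add: order_antisym)
	qed
	have "\<psi> \<in> borel \<rightarrow>\<^sub>M Z.M"
	proof (rule Z.measurable_into)
		fix z assume z: "z \<in> Z.C"
		show "(\<lambda>x. Z.D z (\<psi> x)) \<in> borel_measurable borel"
		proof (rule measurable_cylinder_continuous[where c = 1 and k = k])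
			fix x x'
			show "\<bar>Z.D z (\<psi> x) - Z.D z (\<psi> x')\<bar> \<le> 1 * euc k x x'"
				using Z.triangle[OF z \<psi>(1)[of x] \<psi>(1)[of x']] Z.triangle[OF z \<psi>(1)[of x'] \<psi>(1)[of x]] lip\<psi>[of x x'] Z.commute[of "\<psi> x" "\<psi> x'"]
				by linarith
		qed
	qed (use \<psi> in auto)
	then have \<psi>m: "\<psi> \<in> ?G \<rightarrow>\<^sub>M Z.M" by (simp cong: measurable_cong_sets)
	have "measure ?G {x. Z.D (\<phi> x) (\<psi> x) > \<epsilon>} \<le> measure ?G {x. (x, y) \<in> ?B}"
	proof (rule G.finite_measure_mono_AE)
		show "AE x in ?G. x \<in> {x. Z.D (\<phi> x) (\<psi> x) > \<epsilon>} \<longrightarrow> x \<in> {x. (x, y) \<in> ?B}"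
			using y(2)
		proof eventually_elim
			case (elim x)
			have "\<psi> x = f x" using elim by (intro agree) (simp add: F_def)
			then show ?case using same[OF \<phi>C \<phi>C, of x "mix k x y"] by (auto simp: f_def space_pair_measure)
		qed
		show "{x. (x, y) \<in> ?B} \<in> sets ?G"
			using sets_Pair2[OF B, of y] by (simp add: vimage_def)
	qed
	then show ?thesis using \<psi>(1) lip\<psi> y(1) by (intro exI[of _ k] exI[of _ \<psi>]) auto
qed

end

section \<open>Finite-dimensional approximation of dominated spaces\<close>

text \<open>The metric of \<ell>\<infinity> in dimension N. Inserting 0 gives \<open>Max\<close> a
  nonempty set for N = 0.\<close>

definition supd :: "nat \<Rightarrow> (nat \<Rightarrow> real) \<Rightarrow> (nat \<Rightarrow> real) \<Rightarrow> real" where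
	"supd N x y = Max (insert 0 ((\<lambda>i. \<bar>x i - y i\<bar>) ` {..<N}))"

definition sup_space :: "nat \<Rightarrow> (nat \<Rightarrow> real) set" where
	"sup_space N = {x. \<forall>i\<ge>N. x i = 0}"

lemma supd_le_iff: "supd N x y \<le> c \<longleftrightarrow> 0 \<le> c \<and> (\<forall>i<N. \<bar>x i - y i\<bar> \<le> c)"
	by (auto simp: supd_def)

lemma supd_less_iff: "supd N x y < c \<longleftrightarrow> 0 < c \<and> (\<forall>i<N. \<bar>x i - y i\<bar> < c)"
	by (auto simp: supd_def)

lemma supd_component: "i < N \<Longrightarrow> \<bar>x i - y i\<bar> \<le> supd N x y"
	using supd_le_iff[of N x y "supd N x y"] by auto

lemma supd_nonneg: "0 \<le> supd N x y"
	using supd_le_iff[of N x y "supd N x y"] by auto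

interpretation supd: Metric_space "sup_space N" "supd N" for N
proof
	fix x y z
	show "0 \<le> supd N x y" by (rule supd_nonneg)
	show "supd N x y = supd N y x" by (simp add: supd_def abs_minus_commute)
	show "supd N x y = 0 \<longleftrightarrow> x = y" if "x \<in> sup_space N" "y \<in> sup_space N"
	proof
		assume "supd N x y = 0"
		then have "x i = y i" if "i < N" for i using supd_component[OF that, of x y] by simp
		moreover have "x i = y i" if "\<not> i < N" for i
			using that \<open>x \<in> sup_space N\<close> \<open>y \<in> sup_space N\<close> by (simp add: sup_space_def)
		ultimately show "x = y" by auto
	next
		assume "x = y"
		then have "supd N x y \<le> 0" by (simp add: supd_le_iff)
		then show "supd N x y = 0" using supd_nonneg[of N x y] by simp
	qed
	show "supd N x z \<le> supd N x y + supd N y z"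
		unfolding supd_le_iff
	proof (intro conjI allI impI)
		show "0 \<le> supd N x y + supd N y z" using supd_nonneg[of N x y] supd_nonneg[of N y z] by simp
		fix i assume "i < N"
		then show "\<bar>x i - z i\<bar> \<le> supd N x y + supd N y z"
			using supd_component[of i N x y] supd_component[of i N y z] by linarith
	qed
qed

lemma supd_mcomplete: "supd.mcomplete N"
	unfolding supd.mcomplete_def
proof (intro allI impI)
	fix u assume u: "supd.MCauchy N u"
	then have uS: "u k \<in> sup_space N" for k by (auto simp: supd.MCauchy_def)
	have "Cauchy (\<lambda>k. u k i)" if "i < N" for i
	proof (rule metric_CauchyI)
		fix e :: real assume "e > 0"
		then obtain K where K: "\<And>k k'. K \<le> k \<Longrightarrow> K \<le> k' \<Longrightarrow> supd N (u k) (u k') < e"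
			using u unfolding supd.MCauchy_def by blast
		then have "dist (u k i) (u k' i) < e" if "k \<ge> K" "k' \<ge> K" for k k'
			using K[OF that] \<open>i < N\<close> by (auto simp: supd_less_iff dist_real_def)
		then show "\<exists>M. \<forall>m\<ge>M. \<forall>n\<ge>M. dist (u m i) (u n i) < e" by blast
	qed
	then have "\<exists>l. (\<lambda>k. u k i) \<longlonglongrightarrow> l" if "i < N" for i
		using that by (simp add: Cauchy_convergent_iff convergent_def)
	then obtain l where l: "\<And>i. i < N \<Longrightarrow> (\<lambda>k. u k i) \<longlonglongrightarrow> l i" by metis
	define x where "x i = (if i < N then l i else 0)" for i
	have "limitin (supd.mtopology N) u x sequentially"
		unfolding supd.limitin_metric
	proof (intro conjI allI impI)
		show "x \<in> sup_space N" by (simp add: x_def sup_space_def)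
		fix e :: real assume e: "e > 0"
		have "\<forall>\<^sub>F k in sequentially. \<forall>i\<in>{..<N}. \<bar>u k i - x i\<bar> < e"
		proof (intro eventually_ball_finite ballI)
			fix i assume "i \<in> {..<N}"
			then have "(\<lambda>k. u k i) \<longlonglongrightarrow> x i" using l by (simp add: x_def)
			from tendstoD[OF this e] show "\<forall>\<^sub>F k in sequentially. \<bar>u k i - x i\<bar> < e" by (simp add: dist_real_def)
		qed simp
		then show "\<forall>\<^sub>F k in sequentially. u k \<in> sup_space N \<and> supd N (u k) x < e"
			by eventually_elim (use uS e in \<open>auto simp: supd_less_iff\<close>)
	qed
	then show "\<exists>x. limitin (supd.mtopology N) u x sequentially" by blast
qed

lemma supd_dense:
	obtains q :: "nat \<Rightarrow> nat \<Rightarrow> real" where "\<And>j. q j \<in> sup_space N"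
		"\<And>x r. x \<in> sup_space N \<Longrightarrow> r > 0 \<Longrightarrow> \<exists>j. supd N (q j) x < r"
proof -
	define Q :: "rat list \<Rightarrow> nat \<Rightarrow> real" where "Q xs = (\<lambda>i. if i < N \<and> i < length xs then of_rat (xs ! i) else 0)" for xs
	have "\<exists>xs. supd N (Q xs) x < r" if x: "x \<in> sup_space N" "r > 0" for x r
	proof -
		have "\<exists>p::rat. x i < of_rat p \<and> of_rat p < x i + r" for i using of_rat_dense[of "x i" "x i + r"] x(2) by auto
		then obtain p where p: "\<And>i. x i < of_rat (p i)" "\<And>i. of_rat (p i) < x i + r" by metis
		have "supd N (Q (map p [0..<N])) x < r"
			unfolding supd_less_iff
		proof (intro conjI allI impI x(2))
			fix i assume "i < N"
			then show "\<bar>Q (map p [0..<N]) i - x i\<bar> < r" using p(1)[of i] p(2)[of i] by (simp add: Q_def abs_less_iff)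
		qed
		then show ?thesis by blast
	qed
	moreover have "Q xs \<in> sup_space N" for xs by (simp add: Q_def sup_space_def)
	ultimately show thesis
		by (intro that[of "\<lambda>j. Q (from_nat j)"]) (auto, metis from_nat_to_nat)
qed

lemma supd_separable: "separable_space (supd.mtopology N)"
proof -
	obtain q :: "nat \<Rightarrow> nat \<Rightarrow> real" where q: "\<And>j. q j \<in> sup_space N"
		"\<And>x r. x \<in> sup_space N \<Longrightarrow> r > 0 \<Longrightarrow> \<exists>j. supd N (q j) x < r"
		by (rule supd_dense) blast
	have "sup_space N \<subseteq> supd.mtopology N closure_of range q"
	proof
		fix x assume x: "x \<in> sup_space N"
		have "\<exists>y\<in>range q. y \<in> supd.mball N x r" if r: "r > 0" for r
		proof -
			obtain j where "supd N (q j) x < r" using q(2)[OF x r] by blast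
			then have "q j \<in> supd.mball N x r" using x q(1)[of j] supd.commute[of N "q j" x] by simp
			then show ?thesis by blast
		qed
		then show "x \<in> supd.mtopology N closure_of range q" using x by (simp add: supd.metric_closure_of)
	qed
	then have "supd.mtopology N closure_of range q = sup_space N"
		using closure_of_subset_topspace[of "supd.mtopology N" "range q"] unfolding supd.topspace_mtopology by blast
	then show ?thesis
		unfolding separable_space_def supd.topspace_mtopology using q(1)
		by (intro exI[of _ "range q"]) auto
qed

text \<open>Turns finitely many random variables into the mm-space of their joint law. The supremum
  metric is used because a map into it is 1-Lipschitz as soon as each coordinate is.\<close>

lemma supd_mm_space:
	assumes P: "prob_space P" and f: "\<And>i. i < N \<Longrightarrow> f i \<in> borel_measurable P"
	defines "g \<equiv> \<lambda>w i. if i < N then f i w else (0::real)"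
	obtains B where "mm_space B" "g \<in> P \<rightarrow>\<^sub>M mm_measure B" "distr P (mm_measure B) g = mm_measure B"
		"mm_dist B = supd N"
proof -
	define S where "S = sigma (sup_space N) {U. openin (supd.mtopology N) U}"
	have sub: "{U. openin (supd.mtopology N) U} \<subseteq> Pow (sup_space N)" using openin_subset[of "supd.mtopology N"] by auto
	have spS: "space S = sup_space N" "sets S = sigma_sets (sup_space N) {U. openin (supd.mtopology N) U}"
		unfolding S_def using sub by (simp_all add: space_measure_of sets_measure_of)
	have zero: "(\<lambda>_. 0) \<in> sup_space N" by (simp add: sup_space_def)
	have mmB: "mm_space \<lparr>mm_dist = supd N, mm_measure = distr Q S h\<rparr>" if "prob_space (distr Q S h)" for Q and h :: "'b \<Rightarrow> _"
		unfolding mm_space_def mm_top_def using that supd.Metric_space_axioms supd_mcomplete supd_separable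
		by (simp add: spS borel_sets_of_def)
	\<comment> \<open>The law of g can be formed only after g is known to be measurable, while the
	  criterion for measurability speaks of mm-spaces; a point mass on the same sigma-algebra supplies
	  one.\<close>
	have R: "prob_space (distr (return (count_space UNIV) ()) S (\<lambda>_::unit. \<lambda>_. 0))"
		by (rule prob_space.prob_space_distr[OF prob_space_return]) (simp_all add: spS zero)
	interpret R: mm_sp "\<lparr>mm_dist = supd N, mm_measure = distr (return (count_space UNIV) ()) S (\<lambda>_::unit. \<lambda>_. 0)\<rparr>"
		using mmB[OF R] by (simp add: mm_sp_def)
	have gS: "g w \<in> sup_space N" for w by (simp add: g_def sup_space_def)
	have "g \<in> P \<rightarrow>\<^sub>M R.M"
	proof (rule R.measurable_into)
		show "g \<in> space P \<rightarrow> R.C" using gS by (simp add: spS)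
		fix c assume "c \<in> R.C"
		show "(\<lambda>w. R.D c (g w)) \<in> borel_measurable P"
			unfolding borel_measurable_iff_less
		proof
			fix a
			have "{w \<in> space P. R.D c (g w) < a} = {w \<in> space P. 0 < a \<and> (\<forall>i\<in>{..<N}. \<bar>c i - f i w\<bar> < a)}"
				by (auto simp: supd_less_iff g_def)
			also have "\<dots> \<in> sets P"
			proof (cases "0 < a")
				case True
				have "{w \<in> space P. \<forall>i\<in>{..<N}. \<bar>c i - f i w\<bar> < a} \<in> sets P"
				proof (rule sets.sets_Collect_finite_All)
					fix i assume "i \<in> {..<N}"
					then have [measurable]: "f i \<in> borel_measurable P" using f by simp
					show "{w \<in> space P. \<bar>c i - f i w\<bar> < a} \<in> sets P" by measurable
				qed simp
				then show ?thesis using True by simp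
			qed simp
			finally show "{w \<in> space P. R.D c (g w) < a} \<in> sets P" .
		qed
	qed
	then have g: "g \<in> P \<rightarrow>\<^sub>M S" by (simp cong: measurable_cong_sets)
	show thesis
	proof (rule that)
		show "mm_space \<lparr>mm_dist = supd N, mm_measure = distr P S g\<rparr>"
			by (rule mmB) (rule prob_space.prob_space_distr[OF P g])
	qed (use g in \<open>simp_all cong: distr_cong\<close>)
qed

text \<open>The largest c-Lipschitz extension, an infimum of cones with vertices over A.
  Nonnegativity of f bounds the infimum from below.\<close>

lemma mcshane:
	assumes A: "A \<noteq> {}" and c: "0 \<le> c" and f: "\<And>x. x \<in> A \<Longrightarrow> 0 \<le> f x" "\<And>x y. x \<in> A \<Longrightarrow> y \<in> A \<Longrightarrow> \<bar>f x - f y\<bar> \<le> c * euc k x y"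
	shows "\<exists>g. (\<forall>x\<in>A. g x = f x) \<and> (\<forall>x y. \<bar>g x - g y\<bar> \<le> c * euc k x y)"
proof -
	define g where "g x = (INF a\<in>A. f a + c * euc k x a)" for x
	have bdd: "bdd_below ((\<lambda>a. f a + c * euc k x a) ` A)" for x
		using f(1) c by (intro bdd_belowI2[of _ 0]) (auto intro!: add_nonneg_nonneg)
	have le: "g x \<le> f a + c * euc k x a" if "a \<in> A" for x a
		unfolding g_def by (rule cINF_lower[OF bdd that])
	have "g x = f x" if x: "x \<in> A" for x
	proof (rule antisym)
		show "g x \<le> f x" using le[OF x, of x] by simp
		show "f x \<le> g x" unfolding g_def
		proof (rule cINF_greatest[OF A])
			fix a assume "a \<in> A"
			then show "f x \<le> f a + c * euc k x a" using f(2)[OF x, of a] by linarith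
		qed
	qed
	moreover have half: "g x - c * euc k x y \<le> g y" for x y
		unfolding g_def[of y]
	proof (rule cINF_greatest[OF A])
		fix a assume a: "a \<in> A"
		have "c * euc k x a \<le> c * (euc k x y + euc k y a)" using c by (intro mult_left_mono euc_triangle)
		then show "g x - c * euc k x y \<le> f a + c * euc k y a" using le[OF a, of x] by (simp add: distrib_left)
	qed
	have "\<bar>g x - g y\<bar> \<le> c * euc k x y" for x y
		using half[of x y] half[of y x] euc_commute[of k x y] by simp
	ultimately show ?thesis by blast
qed

text \<open>A map that is almost 1-Lipschitz on most of a Gaussian space need not extend to its target;
	the distances to a finite net of the target do extend, and they determine the target up to
	a small error in the box distance.\<close>

lemma gaussian_lipschitz_net:
	assumes l: "l > 0" and Y: "mm_space Y" and \<phi>: "\<phi> \<in> gauss l \<rightarrow>\<^sub>M mm_measure Y"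
		and law: "distr (gauss l) (mm_measure Y) \<phi> = mm_measure Y"
		and E: "E \<in> sets (gauss l)" "measure (gauss l) E \<ge> 1 - e" and e: "0 < e" "e < 1"
		and c: "c \<ge> 1" and lip: "\<And>x y. x \<in> E \<Longrightarrow> y \<in> E \<Longrightarrow> mm_dist Y (\<phi> x) (\<phi> y) \<le> c * euc k x y"
		and diam: "\<And>x y. x \<in> E \<Longrightarrow> y \<in> E \<Longrightarrow> mm_dist Y (\<phi> x) (\<phi> y) \<le> diam" and small: "diam * (c - 1) \<le> e"
	shows "\<exists>B::(nat \<Rightarrow> real) mm. mm_space B \<and> emm_of_mm B \<prec>\<prec> gamma_infinity l \<and> box B Y \<le> ennreal (6 * e)"
proof -
	interpret Y: mm_sp Y by standard fact
	interpret G: prob_space "gauss l" by (rule prob_space_gauss[OF l])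
	let ?G = "gauss l"
	have \<phi>C: "\<phi> x \<in> Y.C" for x using measurable_space[OF \<phi>] by simp
	obtain q :: "nat \<Rightarrow> 'a" where q: "\<And>j. q j \<in> Y.C" "\<And>x r. x \<in> Y.C \<Longrightarrow> r > 0 \<Longrightarrow> \<exists>j. Y.D (q j) x < r"
		by (rule Y.dense_sequence) blast
	define V where "V j = {x. Y.D (q j) (\<phi> x) < e}" for j
	have V[measurable]: "V j \<in> sets ?G" for j
	proof -
		have [measurable]: "(\<lambda>x. Y.D (q j) (\<phi> x)) \<in> borel_measurable ?G" by (rule Y.measurable_dist_point[OF \<phi> q(1)])
		have "{x \<in> space ?G. Y.D (q j) (\<phi> x) < e} \<in> sets ?G" by measurable
		then show ?thesis by (simp add: V_def)
	qed
	have "(\<lambda>n. measure ?G (\<Union>j<n. V j)) \<longlonglongrightarrow> measure ?G (\<Union>n. \<Union>j<n. V j)"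
	proof (rule G.finite_Lim_measure_incseq)
		have "(\<Union>j<n. V j) \<in> sets ?G" for n by measurable
		then show "range (\<lambda>n. \<Union>j<n. V j) \<subseteq> sets ?G" by blast
		show "incseq (\<lambda>n. \<Union>j<n. V j)" by (auto simp: incseq_def intro: less_le_trans)
	qed
	moreover have "(\<Union>n. \<Union>j<n. V j) = space ?G"
		using q(2)[OF \<phi>C e(1)] by (auto simp: V_def)
	ultimately have "(\<lambda>n. measure ?G (\<Union>j<n. V j)) \<longlonglongrightarrow> 1" using G.prob_space by simp
	then have "\<forall>\<^sub>F n in sequentially. measure ?G (\<Union>j<n. V j) > 1 - e"
		by (rule order_tendstoD) (use e in simp)
	then obtain N where N: "measure ?G (\<Union>j<N. V j) > 1 - e" unfolding eventually_sequentially by blast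
	define S where "S = E \<inter> (\<Union>j<N. V j)"
	have S: "S \<in> sets ?G" unfolding S_def using E(1) by (intro sets.Int sets.finite_UN V) auto
	have "measure ?G E + measure ?G (\<Union>j<N. V j) = measure ?G (E \<union> (\<Union>j<N. V j)) + measure ?G S"
	proof -
		have U: "(\<Union>j<N. V j) \<in> sets ?G" by measurable
		show ?thesis
			using G.finite_measure_Union'[OF E(1) U] G.finite_measure_Diff'[OF U E(1)] by (simp add: S_def Int_commute)
	qed
	then have mS: "measure ?G S \<ge> 1 - 6 * e"
		using N E(2) G.prob_le_1[of "E \<union> (\<Union>j<N. V j)"] e by linarith
	have Ene: "E \<noteq> {}" using E(2) e by auto
	\<comment> \<open>Distances are taken to net points of the form \<open>\<phi> (p j)\<close> with
	  \<open>p j\<close> in E, where the Lipschitz bound is known. If E misses \<open>V j\<close>, any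
	  point of E will do.\<close>
	define p where "p j = (if \<exists>x\<in>E. x \<in> V j then SOME x. x \<in> E \<and> x \<in> V j else (SOME x. x \<in> E))" for j
	have pE: "p j \<in> E" for j
		unfolding p_def using someI_ex[of "\<lambda>x. x \<in> E \<and> x \<in> V j"] some_in_eq[of E] Ene by auto
	have pV: "p j \<in> V j" if "x \<in> E" "x \<in> V j" for x j
		unfolding p_def using someI_ex[of "\<lambda>x. x \<in> E \<and> x \<in> V j"] that by auto
	define f where "f j x = Y.D (\<phi> x) (\<phi> (p j))" for j x
	have f_lip: "\<bar>f j x - f j y\<bar> \<le> Y.D (\<phi> x) (\<phi> y)" for j x y
		using Y.triangle[OF \<phi>C[of x] \<phi>C[of y] \<phi>C[of "p j"]] Y.triangle[OF \<phi>C[of y] \<phi>C[of x] \<phi>C[of "p j"]] Y.commute[of "\<phi> x" "\<phi> y"]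
		unfolding f_def by linarith
	have "\<exists>g. (\<forall>x\<in>E. g x = f j x) \<and> (\<forall>x y. \<bar>g x - g y\<bar> \<le> c * euc k x y)" for j
	proof (rule mcshane[OF Ene])
		show "\<bar>f j x - f j y\<bar> \<le> c * euc k x y" if "x \<in> E" "y \<in> E" for x y
			using f_lip[of j x y] lip[OF that] by linarith
	qed (use c in \<open>auto simp: f_def\<close>)
	then obtain g where g: "\<And>j x. x \<in> E \<Longrightarrow> g j x = f j x" "\<And>j x y. \<bar>g j x - g j y\<bar> \<le> c * euc k x y"
		by metis
	\<comment> \<open>Dividing by c makes the extensions 1-Lipschitz. The distance d becomes d / c, and
	  the loss is at most d * (c - 1), which \<open>small\<close> bounds by e.\<close>
	define h where "h j x = g j x / c" for j x
	have h1: "\<bar>h j x - h j y\<bar> \<le> euc k x y" for j x y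
	proof -
		have "\<bar>h j x - h j y\<bar> = \<bar>g j x - g j y\<bar> / c" using c by (simp add: h_def abs_divide flip: diff_divide_distrib)
		also have "\<dots> \<le> euc k x y" using g(2)[of j x y] c by (simp add: divide_le_eq mult.commute)
		finally show ?thesis .
	qed
	have hm: "h j \<in> borel_measurable ?G" for j
		using measurable_cylinder_continuous[of "h j" 1 k] h1 by (simp cong: measurable_cong_sets)
	define H where "H w i = (if i < N then h i w else 0)" for w i
	obtain B where B: "mm_space B" "H \<in> ?G \<rightarrow>\<^sub>M mm_measure B" "distr ?G (mm_measure B) H = mm_measure B" "mm_dist B = supd N"
		using supd_mm_space[OF G.prob_space_axioms, of N h] hm unfolding H_def[abs_def] by blast
	have "emm_of_mm B \<prec>\<prec> gamma_infinity l"
		unfolding emm_prec_def gamma_infinity_def emm_simps emm.simps gauss_def[symmetric]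
	proof (intro bexI[OF _ B(2)] bexI[of _ UNIV] conjI ballI B(3))
		show "UNIV \<in> sets ?G" using sets.top[of ?G] by simp
		show "emeasure ?G UNIV = 1" using G.emeasure_space_1 by simp
		fix x y
		have "supd N (H x) (H y) \<le> euc k x y" unfolding supd_le_iff using h1 by (simp add: H_def)
		then have "ennreal (supd N (H x) (H y)) \<le> ennreal (euc k x y)" by (rule ennreal_leI)
		also have "\<dots> \<le> ell2_dist x y" by (rule euc_le_ell2)
		finally show "ennreal (mm_dist B (H x) (H y)) \<le> ell2_dist x y" by (simp add: B(4))
	qed
	moreover have "box B Y \<le> ennreal (6 * e)"
	proof (rule box_le_coupling[where P = ?G and S = S, OF _ G.prob_space_axioms B(2,3) \<phi> law S mS])
		show "real_coded ?G" by (rule real_coded_borel) simp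
		show "0 \<le> 6 * e" using e by simp
		fix x y assume x: "x \<in> S" and y: "y \<in> S"
		then have xE: "x \<in> E" "y \<in> E" by (auto simp: S_def)
		let ?d = "Y.D (\<phi> x) (\<phi> y)"
		have hf: "\<bar>h j x - h j y\<bar> = \<bar>f j x - f j y\<bar> / c" for j
			using g(1)[OF xE(1)] g(1)[OF xE(2)] c by (simp add: h_def abs_divide flip: diff_divide_distrib)
		have up: "supd N (H x) (H y) \<le> ?d"
			unfolding supd_le_iff
		proof (intro conjI allI impI)
			fix i assume "i < N"
			have "\<bar>f i x - f i y\<bar> / c \<le> \<bar>f i x - f i y\<bar>" using c by (simp add: divide_le_eq mult_le_cancel_left1)
			then show "\<bar>H x i - H y i\<bar> \<le> ?d" using f_lip[of i x y] \<open>i < N\<close> by (simp add: H_def hf)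
		qed simp
		\<comment> \<open>Both \<open>\<phi> x\<close> and \<open>\<phi> (p j)\<close> are within e of
		  \<open>q j\<close>, so the j-th coordinate alone recovers the distance up to 4 e, and the
		  division by c costs one further e.\<close>
		obtain j where j: "j < N" "x \<in> V j" using x by (auto simp: S_def)
		have "Y.D (q j) (\<phi> (p j)) < e" "Y.D (q j) (\<phi> x) < e" using pV[OF xE(1) j(2)] j(2) by (auto simp: V_def)
		then have fx: "f j x < 2 * e"
			using Y.triangle[OF \<phi>C[of x] q(1)[of j] \<phi>C[of "p j"]] Y.commute[of "\<phi> x" "q j"] by (simp add: f_def)
		have "?d \<le> f j x + f j y"
			using Y.triangle[OF \<phi>C[of x] \<phi>C[of "p j"] \<phi>C[of y]] Y.commute[of "\<phi> (p j)" "\<phi> y"] by (simp add: f_def)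
		then have "?d - 4 * e \<le> \<bar>f j x - f j y\<bar>" using fx by linarith
		then have "(?d - 4 * e) / c \<le> \<bar>f j x - f j y\<bar> / c" using c by (intro divide_right_mono) auto
		also have "\<dots> = \<bar>H x j - H y j\<bar>" using j(1) by (simp add: H_def hf)
		also have "\<dots> \<le> supd N (H x) (H y)" by (rule supd_component[OF j(1)])
		finally have low: "(?d - 4 * e) / c \<le> supd N (H x) (H y)" .
		have "?d * (c - 1) \<le> diam * (c - 1)" using diam[OF xE] c by (intro mult_right_mono) auto
		then have "?d * c \<le> ?d + e" using small by (simp add: algebra_simps)
		moreover have "5 * e \<le> 5 * e * c" using c e by (simp add: mult_le_cancel_left1)
		ultimately have "(?d - 5 * e) * c \<le> ?d - 4 * e" by (simp add: algebra_simps)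
		then have "?d - 5 * e \<le> (?d - 4 * e) / c" using c by (simp add: le_divide_eq)
		then show "\<bar>mm_dist B (H x) (H y) - Y.D (\<phi> x) (\<phi> y)\<bar> \<le> 6 * e"
			using up low e by (simp add: B(4))
	qed
	ultimately show ?thesis using B(1) by blast
qed

section \<open>Spheres of radius comparable to the square root of the dimension\<close>

lemma (in prob_space) prob_Int_ge:
	assumes "A \<in> events" "B \<in> events"
	shows "prob A + prob B - 1 \<le> prob (A \<inter> B)"
	using finite_measure_Union'[OF assms] finite_measure_Diff'[OF assms(2,1)] prob_le_1[of "A \<union> B"] Int_commute[of A B]
	by simp

lemma (in mm_sp) measurable_lipschitz_cylinder:
	assumes C: "\<And>x. \<psi> x \<in> C" and lip: "\<And>x y. D (\<psi> x) (\<psi> y) \<le> euc k x y"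
	shows "\<psi> \<in> borel \<rightarrow>\<^sub>M M"
proof (rule measurable_into)
	fix z assume z: "z \<in> C"
	show "(\<lambda>x. D z (\<psi> x)) \<in> borel_measurable borel"
	proof (rule measurable_cylinder_continuous[where c = 1 and k = k])
		fix x x'
		show "\<bar>D z (\<psi> x) - D z (\<psi> x')\<bar> \<le> 1 * euc k x x'"
			using triangle[OF z C[of x] C[of x']] triangle[OF z C[of x'] C[of x]] lip[of x x'] commute[of "\<psi> x" "\<psi> x'"]
			by linarith
	qed
qed (use C in auto)

lemma (in mm_sp) mm_space_distr:
	assumes "prob_space P" "\<psi> \<in> P \<rightarrow>\<^sub>M M"
	shows "mm_space \<lparr>mm_dist = D, mm_measure = distr P M \<psi>\<rparr>"
	using mm prob_space.prob_space_distr[OF assms] unfolding mm_space_def mm_top_def by simp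

lemma measurable_id_sphere: "r > 0 \<Longrightarrow> (\<lambda>x. x) \<in> borel_measurable (sphere_measure n r)"
proof (rule borel_measurableI)
	fix T :: "(nat \<Rightarrow> real) set" assume r: "r > 0" and T: "open T"
	have "openin (top_of_set (sphere_set n r)) (sphere_set n r \<inter> T)" using T by blast
	then show "(\<lambda>x. x) -` T \<inter> space (sphere_measure n r) \<in> sets (sphere_measure n r)"
		unfolding sets_sphere_borel[OF r] by (auto simp: Int_commute intro: sigma_sets.Basic)
qed

lemma measurable_to_sphere: "l > 0 \<Longrightarrow> r > 0 \<Longrightarrow> to_sphere n r \<in> borel_measurable (gauss l)"
	using measurable_compose[OF to_sphere_law(1) measurable_id_sphere] by simp

lemma abs_sqrt_minus_one_le: "0 \<le> q \<Longrightarrow> \<bar>sqrt q - 1\<bar> \<le> \<bar>q - 1\<bar>"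
proof -
	assume q: "0 \<le> q"
	have "q - 1 = (sqrt q - 1) * (sqrt q + 1)" using q by (simp add: algebra_simps)
	then have "\<bar>q - 1\<bar> = \<bar>sqrt q - 1\<bar> * (sqrt q + 1)" using q by (simp add: abs_mult)
	moreover have "\<bar>sqrt q - 1\<bar> * 1 \<le> \<bar>sqrt q - 1\<bar> * (sqrt q + 1)" using q by (intro mult_left_mono) auto
	ultimately show ?thesis by simp
qed

lemma sphere_shell:
	assumes r: "r > 0" and d: "d < 1" and x: "\<bar>sqn n x / r^2 - 1\<bar> \<le> d"
	shows "sqn n x > 0" "\<bar>sqrt (sqn n x) / r - 1\<bar> \<le> d" "(1 - d) * r \<le> sqrt (sqn n x)"
proof -
	have "sqn n x / r^2 > 0" using x d by linarith
	then show pos: "sqn n x > 0" using r by (simp add: zero_less_divide_iff)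
	have "sqrt (sqn n x / r^2) = sqrt (sqn n x) / r" using r by (simp add: real_sqrt_divide)
	then show "\<bar>sqrt (sqn n x) / r - 1\<bar> \<le> d"
		using abs_sqrt_minus_one_le[of "sqn n x / r^2"] pos x by simp
	then have "1 - d \<le> sqrt (sqn n x) / r" by linarith
	then show "(1 - d) * r \<le> sqrt (sqn n x)" using r by (simp add: le_divide_eq)
qed

lemma to_sphere_component:
	assumes "sqn n x > 0" "i \<le> n"
	shows "to_sphere n r x i = r / sqrt (sqn n x) * x i"
	using assms by (simp add: to_sphere_def radial_projection_def)

text \<open>The projection multiplies x by r / |x|, a factor tending to 1 in probability, while the
  first k coordinates stay bounded by some R with high probability.\<close>

lemma to_sphere_close:
	assumes l: "l > 0" and r: "(\<lambda>n. r n / sqrt (real n)) \<longlonglongrightarrow> l" and rpos: "\<And>n. r n > 0" and h: "h > 0"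
	shows "\<forall>\<^sub>F n in sequentially. measure (gauss l) {x. euc k x (to_sphere n (r n) x) > h} \<le> h"
proof -
	interpret G: prob_space "gauss l" by (rule prob_space_gauss[OF l])
	let ?G = "gauss l"
	have em: "{x. euc k x (\<lambda>_. 0) > a} \<in> sets ?G" for a
	proof -
		have "{x \<in> space borel. euc k x (\<lambda>_. 0) > a} \<in> sets borel" by measurable
		then show ?thesis by simp
	qed
	have "(\<lambda>m::nat. measure ?G {x. euc k x (\<lambda>_. 0) > real m}) \<longlonglongrightarrow> measure ?G (\<Inter>m::nat. {x. euc k x (\<lambda>_. 0) > real m})"
		by (rule G.finite_Lim_measure_decseq) (use em in \<open>auto simp: decseq_def\<close>)
	moreover have "(\<Inter>m::nat. {x. euc k x (\<lambda>_. 0) > real m}) = {}"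
	proof -
		show ?thesis by (auto, meson linorder_not_less real_arch_simple)
	qed
	ultimately have "(\<lambda>m::nat. measure ?G {x. euc k x (\<lambda>_. 0) > real m}) \<longlonglongrightarrow> 0" by (simp only: measure_empty)
	then have "\<forall>\<^sub>F m::nat in sequentially. measure ?G {x. euc k x (\<lambda>_. 0) > real m} < h / 2"
		by (rule order_tendstoD) (use h in simp)
	then obtain R :: nat where R: "measure ?G {x. euc k x (\<lambda>_. 0) > real R} < h / 2" unfolding eventually_sequentially by blast
	\<comment> \<open>If t = |x| / r differs from 1 by at most \<delta> \<le> 1/2, then |1 - 1 / t|
	  \<le> 2 * \<delta>, and 2 * \<delta> * R \<le> h.\<close>
	define \<delta> where "\<delta> = min (1/2) (h / (2 * real R + 2))"
	have \<delta>: "\<delta> > 0" "\<delta> \<le> 1/2" "2 * \<delta> * real R \<le> h"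
	proof -
		show "\<delta> > 0" using h by (simp add: \<delta>_def)
		show "\<delta> \<le> 1/2" unfolding \<delta>_def by (rule min.cobounded1)
		have "\<delta> * (2 * real R + 2) \<le> h" using mult_right_mono[of \<delta> "h / (2 * real R + 2)" "2 * real R + 2"] by (simp add: \<delta>_def)
		then show "2 * \<delta> * real R \<le> h" using \<open>\<delta> > 0\<close> by (simp add: algebra_simps)
	qed
	have "\<forall>\<^sub>F n in sequentially. measure ?G {x. \<bar>sqn n x / (r n)^2 - 1\<bar> > \<delta>} < h / 2"
		by (rule order_tendstoD[OF gaussian_norm_lln[OF l r rpos \<delta>(1)]]) (use h in simp)
	then show ?thesis
		using eventually_ge_at_top[of k]
	proof eventually_elim
		case (elim n)
		have coord: "(\<lambda>x. x i) \<in> borel_measurable ?G" for i by (rule measurable_gaussian_coordinate[OF l])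
		have sm: "{x. \<bar>sqn n x / (r n)^2 - 1\<bar> > \<delta>} \<in> sets ?G"
		proof -
			have [measurable]: "sqn n \<in> borel_measurable ?G" by (intro borel_measurable_sum borel_measurable_power coord)
			have "{x \<in> space ?G. \<bar>sqn n x / (r n)^2 - 1\<bar> > \<delta>} \<in> sets ?G" by measurable
			then show ?thesis by simp
		qed
		have sub: "{x. euc k x (to_sphere n (r n) x) > h} \<subseteq> {x. euc k x (\<lambda>_. 0) > real R} \<union> {x. \<bar>sqn n x / (r n)^2 - 1\<bar> > \<delta>}"
		proof (rule subsetI, rule ccontr)
			fix x assume x: "x \<in> {x. euc k x (to_sphere n (r n) x) > h}"
				and neg: "x \<notin> {x. euc k x (\<lambda>_. 0) > real R} \<union> {x. \<bar>sqn n x / (r n)^2 - 1\<bar> > \<delta>}"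
			have a: "euc k x (\<lambda>_. 0) \<le> real R" "\<bar>sqn n x / (r n)^2 - 1\<bar> \<le> \<delta>" using neg by auto
			have sh: "sqn n x > 0" "\<bar>sqrt (sqn n x) / r n - 1\<bar> \<le> \<delta>" using sphere_shell[OF rpos _ a(2)] \<delta> by auto
			define t where "t = sqrt (sqn n x) / r n"
			have t: "\<bar>t - 1\<bar> \<le> \<delta>" "t \<ge> 1/2" using sh(2) \<delta>(2) unfolding t_def by linarith+
			have "euc k x (to_sphere n (r n) x) = L2_set (\<lambda>i. (1 - 1 / t) * x i) {..<k}"
				unfolding euc_def by (intro L2_set_cong) (use elim sh in \<open>auto simp: to_sphere_component t_def algebra_simps\<close>)
			also have "\<dots> = \<bar>1 - 1 / t\<bar> * euc k x (\<lambda>_. 0)"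
				by (simp add: euc_def L2_set_def power_mult_distrib real_sqrt_mult flip: sum_distrib_left)
			also have "\<bar>1 - 1 / t\<bar> = \<bar>t - 1\<bar> / t"
				proof -
					have "1 - 1 / t = (t - 1) / t" using t(2) by (simp add: diff_divide_distrib)
					then show ?thesis using t(2) by (simp add: abs_divide)
				qed
			also have "\<bar>t - 1\<bar> / t * euc k x (\<lambda>_. 0) \<le> (\<delta> / (1/2)) * real R"
				using t a(1) \<delta> by (intro mult_mono frac_le) auto
			also have "\<dots> \<le> h" using \<delta>(3) by simp
			finally show False using x by simp
		qed
		have "measure ?G {x. euc k x (to_sphere n (r n) x) > h} \<le> measure ?G ({x. euc k x (\<lambda>_. 0) > real R} \<union> {x. \<bar>sqn n x / (r n)^2 - 1\<bar> > \<delta>})"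
			by (rule G.finite_measure_mono[OF sub]) (use em sm in auto)
		also have "\<dots> \<le> measure ?G {x. euc k x (\<lambda>_. 0) > real R} + measure ?G {x. \<bar>sqn n x / (r n)^2 - 1\<bar> > \<delta>}"
			by (rule measure_Un_le[OF em sm])
		finally show ?case using R elim by linarith
	qed
qed

text \<open>The approximating cylinder map \<psi> is used on the sphere unchanged; it is 1-Lipschitz
  there because \<open>euc k\<close> is below the chord and the chord below the arc. Its law on the
  sphere differs from the law of Z, and the coupling of a Gaussian sequence with its projection
  measures the difference.\<close>

lemma sphere_lower:
	fixes Z :: "'a mm"
	assumes l: "l > 0" and r: "(\<lambda>n. r n / sqrt (real n)) \<longlonglongrightarrow> l" and rpos: "\<And>n. r n > 0"
		and Z: "mm_space Z" "emm_of_mm Z \<prec>\<prec> gamma_infinity l" and e: "e > 0"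
	shows "\<forall>\<^sub>F n in sequentially. \<exists>Z'::'a mm. mm_space Z' \<and> emm_of_mm Z' \<prec>\<prec> emm_of_mm (sphere_mm n (r n)) \<and> box Z' Z < ennreal e"
proof -
	interpret Z: mm_sp Z by standard fact
	interpret G: prob_space "gauss l" by (rule prob_space_gauss[OF l])
	let ?G = "gauss l"
	obtain \<phi> E where \<phi>: "\<phi> \<in> ?G \<rightarrow>\<^sub>M Z.M" "E \<in> sets ?G" "distr ?G Z.M \<phi> = Z.M" "emeasure ?G E = 1"
		"\<And>x y. x \<in> E \<Longrightarrow> y \<in> E \<Longrightarrow> ennreal (Z.D (\<phi> x) (\<phi> y)) \<le> ell2_dist x y"
		using Z(2) unfolding emm_prec_def gamma_infinity_def emm_simps emm.simps gauss_def[symmetric] by blast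
	have \<phi>C: "\<phi> x \<in> Z.C" for x using measurable_space[OF \<phi>(1)] by simp
	define \<eta> where "\<eta> = e / 8"
	have \<eta>: "\<eta> > 0" using e by (simp add: \<eta>_def)
	obtain k \<psi> where \<psi>: "\<And>x. \<psi> x \<in> Z.C" "\<And>x y. Z.D (\<psi> x) (\<psi> y) \<le> euc k x y"
		"measure ?G {x. Z.D (\<phi> x) (\<psi> x) > \<eta>} \<le> \<eta>"
		using cylindrical_approximation[OF l Z(1) \<phi>(1,2,4,5) \<eta>] by blast
	have \<psi>m: "\<psi> \<in> borel \<rightarrow>\<^sub>M Z.M" by (rule Z.measurable_lipschitz_cylinder[OF \<psi>(1,2)])
	show ?thesis
		using to_sphere_close[OF l r rpos \<eta>, of k] eventually_ge_at_top[of k]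
	proof eventually_elim
		case (elim n)
		let ?S = "sphere_measure n (r n)" and ?s = "to_sphere n (r n)"
		have \<psi>S: "\<psi> \<in> ?S \<rightarrow>\<^sub>M Z.M" using measurable_compose[OF measurable_id_sphere[OF rpos] \<psi>m] by simp
		define Z' where "Z' = \<lparr>mm_dist = Z.D, mm_measure = distr ?S Z.M \<psi>\<rparr>"
		have mmZ': "mm_space Z'" unfolding Z'_def by (rule Z.mm_space_distr[OF prob_space_sphere_measure[OF rpos] \<psi>S])
		have Z's: "mm_dist Z' = Z.D" "mm_measure Z' = distr ?S Z.M \<psi>" by (simp_all add: Z'_def)
		interpret S: prob_space ?S by (rule prob_space_sphere_measure[OF rpos])
		have dom: "emm_of_mm Z' \<prec>\<prec> emm_of_mm (sphere_mm n (r n))"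
			unfolding emm_prec_def emm_simps mm_simps Z's
		proof (intro bexI[of _ \<psi>] bexI[of _ "space ?S"] conjI ballI)
			show "distr ?S (distr ?S Z.M \<psi>) \<psi> = distr ?S Z.M \<psi>" by (rule distr_cong) simp_all
			show "\<psi> \<in> ?S \<rightarrow>\<^sub>M distr ?S Z.M \<psi>" using \<psi>S by simp
			show "emeasure ?S (space ?S) = 1" by (rule S.emeasure_space_1)
			fix x y assume "x \<in> space ?S" "y \<in> space ?S"
			then have xy: "x \<in> sphere_set n (r n)" "y \<in> sphere_set n (r n)" by simp_all
			have "Z.D (\<psi> x) (\<psi> y) \<le> euc k x y" by (rule \<psi>(2))
			also have "\<dots> \<le> euc (Suc n) x y" using elim by (intro euc_mono) simp
			also have "\<dots> \<le> geo n (r n) x y" by (rule euc_le_geodesic[OF rpos xy])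
			finally show "ennreal (Z.D (\<psi> x) (\<psi> y)) \<le> ennreal (geo n (r n) x y)" by (rule ennreal_leI)
		qed (rule sets.top)
		have sm: "?s \<in> ?G \<rightarrow>\<^sub>M ?S" "distr ?G ?S ?s = ?S" by (rule to_sphere_law[OF l rpos])+
		define A where "A = {x. Z.D (\<phi> x) (\<psi> x) > \<eta>}"
		define B where "B = {x. euc k x (?s x) > \<eta>}"
		have A: "A \<in> sets ?G"
		proof -
			have "\<psi> \<in> ?G \<rightarrow>\<^sub>M Z.M" using \<psi>m by (simp cong: measurable_cong_sets)
			then have [measurable]: "(\<lambda>x. Z.D (\<phi> x) (\<psi> x)) \<in> borel_measurable ?G" by (intro Z.measurable_dist \<phi>(1))
			have "{x \<in> space ?G. Z.D (\<phi> x) (\<psi> x) > \<eta>} \<in> sets ?G" by measurable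
			then show ?thesis by (simp add: A_def)
		qed
		have B: "B \<in> sets ?G"
		proof -
			have [measurable]: "?s \<in> borel_measurable ?G" by (rule measurable_to_sphere[OF l rpos])
			have [measurable]: "(\<lambda>x. x) \<in> borel_measurable ?G" by (simp cong: measurable_cong_sets)
			have "{x \<in> space ?G. euc k x (?s x) > \<eta>} \<in> sets ?G" by measurable
			then show ?thesis by (simp add: B_def)
		qed
		\<comment> \<open>Off A and B the points \<open>\<psi> (?s x)\<close> and \<open>\<phi> x\<close>
		  are within 2 * \<eta>, so distances between two such points change by at most 4 * \<eta>, half
		  of e.\<close>
		have "box Z' Z \<le> ennreal (4 * \<eta>)"
		proof (rule box_le_coupling[where P = ?G and f = "\<psi> \<circ> ?s" and g = \<phi> and S = "space ?G - (A \<union> B)"])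
			show "real_coded ?G" by (rule real_coded_borel) simp
			show "\<psi> \<circ> ?s \<in> ?G \<rightarrow>\<^sub>M mm_measure Z'" using measurable_comp[OF sm(1) \<psi>S] by (simp add: Z's)
			have "distr ?G (distr ?S Z.M \<psi>) (\<psi> \<circ> ?s) = distr ?G Z.M (\<psi> \<circ> ?s)" by (rule distr_cong) simp_all
			also have "\<dots> = distr (distr ?G ?S ?s) Z.M \<psi>" by (rule distr_distr[OF \<psi>S sm(1), symmetric])
			finally show "distr ?G (mm_measure Z') (\<psi> \<circ> ?s) = mm_measure Z'" by (simp add: Z's sm(2))
			show "space ?G - (A \<union> B) \<in> sets ?G" using A B by (intro sets.Diff sets.top sets.Un)
			have "measure ?G (space ?G - (A \<union> B)) = 1 - measure ?G (A \<union> B)" using A B by (intro G.prob_compl) auto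
			moreover have "measure ?G (A \<union> B) \<le> \<eta> + \<eta>"
				using measure_Un_le[OF A B] \<psi>(3) elim(1) unfolding A_def B_def by linarith
			ultimately show "measure ?G (space ?G - (A \<union> B)) \<ge> 1 - 4 * \<eta>" using \<eta> by linarith
			fix x y assume xy: "x \<in> space ?G - (A \<union> B)" "y \<in> space ?G - (A \<union> B)"
			have d: "Z.D (\<psi> (?s z)) (\<phi> z) \<le> 2 * \<eta>" if "z \<in> space ?G - (A \<union> B)" for z
			proof -
				have "Z.D (\<psi> (?s z)) (\<phi> z) \<le> Z.D (\<psi> (?s z)) (\<psi> z) + Z.D (\<psi> z) (\<phi> z)" using \<psi>(1) \<phi>C by (intro Z.triangle)
				also have "\<dots> \<le> euc k z (?s z) + Z.D (\<phi> z) (\<psi> z)"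
					using \<psi>(2)[of "?s z" z] by (simp add: euc_commute[of k z] Z.commute[of "\<phi> z"])
				finally show ?thesis using that by (simp add: A_def B_def)
			qed
			show "\<bar>mm_dist Z' ((\<psi> \<circ> ?s) x) ((\<psi> \<circ> ?s) y) - Z.D (\<phi> x) (\<phi> y)\<bar> \<le> 4 * \<eta>"
				unfolding Z's comp_def
				using Z.triangle[OF \<psi>(1)[of "?s x"] \<phi>C[of x] \<psi>(1)[of "?s y"]] Z.triangle[OF \<phi>C[of x] \<phi>C[of y] \<psi>(1)[of "?s y"]]
					Z.triangle[OF \<phi>C[of x] \<psi>(1)[of "?s x"] \<phi>C[of y]] Z.triangle[OF \<psi>(1)[of "?s x"] \<psi>(1)[of "?s y"] \<phi>C[of y]]
					Z.commute[of "\<phi> x" "\<psi> (?s x)"] Z.commute[of "\<phi> y" "\<psi> (?s y)"] d[OF xy(1)] d[OF xy(2)]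
				by linarith
		qed (use \<phi> \<eta> G.prob_space_axioms in auto)
		also have "\<dots> < ennreal e" using e by (simp add: \<eta>_def ennreal_less_iff)
		finally show ?case using mmZ' dom by blast
	qed
qed

text \<open>With norms a, b and inner product m one has |x - y|^2 = (a - b)^2 + a b (2 - 2 m / (a
  b)). The last bracket is the squared chord of the projections divided by r^2, and a b is at least
  (\<rho> r)^2.\<close>

lemma to_sphere_lipschitz:
	assumes r: "r > 0" and \<rho>: "\<rho> > 0" and x: "\<rho> * r \<le> sqrt (sqn n x)" and y: "\<rho> * r \<le> sqrt (sqn n y)"
	shows "euc (Suc n) (to_sphere n r x) (to_sphere n r y) \<le> euc (Suc n) x y / \<rho>"
proof -
	define a b where "a = sqrt (sqn n x)" and "b = sqrt (sqn n y)"
	have ab: "\<rho> * r \<le> a" "\<rho> * r \<le> b" "0 < \<rho> * r" using assms by (auto simp: a_def b_def)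
	then have pos: "a > 0" "b > 0" by linarith+
	have sq: "sqn n x = a^2" "sqn n y = b^2" by (simp_all add: a_def b_def sum_nonneg)
	define m where "m = (\<Sum>i\<le>n. x i * y i)"
	have e1: "(euc (Suc n) x y)^2 = a^2 + b^2 - 2 * m"
		unfolding euc_power2 lessThan_Suc_atMost
		by (simp add: power2_diff sum.distrib sum_subtractf sq m_def sum_distrib_left mult.assoc)
	have "(euc (Suc n) (to_sphere n r x) (to_sphere n r y))^2 = (\<Sum>i\<le>n. (r / a * x i - r / b * y i)^2)"
		unfolding euc_power2 lessThan_Suc_atMost
		by (intro sum.cong refl) (use pos in \<open>auto simp: to_sphere_component sq a_def[symmetric] b_def[symmetric]\<close>)
	also have "\<dots> = (r / a)^2 * sqn n x + (r / b)^2 * sqn n y - 2 * (r / a) * (r / b) * m"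
	proof -
		have "(r / a * x i - r / b * y i)^2 = (r / a)^2 * (x i)^2 + (r / b)^2 * (y i)^2 - 2 * (r / a) * (r / b) * (x i * y i)" for i
			by (simp add: power2_diff power_mult_distrib power_divide mult_ac)
		then show ?thesis by (simp only: sum.distrib sum_subtractf m_def sum_distrib_left)
	qed
	also have "\<dots> = r^2 * (2 - 2 * m / (a * b))"
		using pos unfolding sq by (simp add: field_simps power2_eq_square)
	finally have e2: "(euc (Suc n) (to_sphere n r x) (to_sphere n r y))^2 = r^2 * (2 - 2 * m / (a * b))" .
	have "0 \<le> (a - b)^2" by simp
	then have "a * b * (2 - 2 * m / (a * b)) \<le> (euc (Suc n) x y)^2"
		unfolding e1 using pos by (simp add: power2_diff right_diff_distrib)
	moreover have "0 \<le> 2 - 2 * m / (a * b)"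
		using e2 r by (metis zero_le_mult_iff zero_le_power2 zero_less_power2 less_irrefl not_less)
	then have "(\<rho> * r)^2 * (2 - 2 * m / (a * b)) \<le> a * b * (2 - 2 * m / (a * b))"
		unfolding power2_eq_square using ab pos by (intro mult_right_mono mult_mono) auto
	ultimately have "(\<rho> * euc (Suc n) (to_sphere n r x) (to_sphere n r y))^2 \<le> (euc (Suc n) x y)^2"
		unfolding power_mult_distrib e2 by (simp add: mult.assoc power_mult_distrib)
	then have "\<rho> * euc (Suc n) (to_sphere n r x) (to_sphere n r y) \<le> euc (Suc n) x y"
		by (rule power2_le_imp_le) simp
	then show ?thesis using \<rho> by (simp add: le_divide_eq mult.commute)
qed

text \<open>One factor 1 - \<delta> is lost from arc to chord and one in the radial projection; for
  \<delta> \<le> 1/4 the constant 1 + 4 * \<delta> absorbs both.\<close>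

lemma shrink_factor:
	fixes \<delta> d e :: real
	assumes "0 \<le> \<delta>" "\<delta> \<le> 1/4" "d * (1 - \<delta>) \<le> e / (1 - \<delta>)" "0 \<le> e"
	shows "d \<le> (1 + 4 * \<delta>) * e"
proof -
	have "d * (1 - \<delta>)^2 \<le> e"
		using assms by (simp add: le_divide_eq power2_eq_square mult.assoc)
	moreover have "1 \<le> (1 - \<delta>)^2 * (1 + 4 * \<delta>)"
	proof -
		have "0 \<le> \<delta> * (2 - 7 * \<delta> + 4 * \<delta>^2)" using assms by (intro mult_nonneg_nonneg) (auto intro: add_nonneg_nonneg)
		then show ?thesis by (simp add: power2_eq_square algebra_simps)
	qed
	then have "e * 1 \<le> e * ((1 - \<delta>)^2 * (1 + 4 * \<delta>))" using assms(4) by (rule mult_left_mono)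
	ultimately have "d * (1 - \<delta>)^2 \<le> ((1 + 4 * \<delta>) * e) * (1 - \<delta>)^2" by (simp add: mult_ac)
	moreover have "0 < (1 - \<delta>)^2" using assms by simp
	ultimately show ?thesis by (simp add: mult_le_cancel_right_pos)
qed

lemma gaussian_scale_at_top:
	assumes "(\<lambda>n. r n / sqrt (real n)) \<longlonglongrightarrow> l" "l > 0"
	shows "filterlim r at_top sequentially"
proof -
	have "filterlim (\<lambda>n. (r n / sqrt (real n)) * sqrt (real n)) at_top sequentially"
		by (rule filterlim_tendsto_pos_mult_at_top[OF assms(1,2)]) real_asymp
	moreover have "\<forall>\<^sub>F n in sequentially. (r n / sqrt (real n)) * sqrt (real n) = r n"
		using eventually_gt_at_top[of 0] by eventually_elim simp
	ultimately show ?thesis using filterlim_cong[OF refl refl, of "\<lambda>n. (r n / sqrt (real n)) * sqrt (real n)" r sequentially at_top] by blast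
qed

text \<open>Most of Z lies in a ball. Closeness in the box distance transfers this to Z' with a
  radius independent of n, so for large n the arcs that matter are short against \<open>r n\<close>,
  and the map from Gaussian sequences to Z' is almost 1-Lipschitz.\<close>

lemma sphere_upper:
	fixes Z :: "real mm"
	assumes l: "l > 0" and r: "(\<lambda>n. r n / sqrt (real n)) \<longlonglongrightarrow> l" and rpos: "\<And>n. r n > 0"
		and Z: "mm_space Z" and \<epsilon>: "\<epsilon> > 0"
	shows "\<exists>\<delta>>0. \<forall>\<^sub>F n in sequentially.
			\<forall>Z'::real mm. mm_space Z' \<and> emm_of_mm Z' \<prec>\<prec> emm_of_mm (sphere_mm n (r n)) \<and> box Z' Z < ennreal \<delta> \<longrightarrow>
				(\<exists>B::real mm. mm_space B \<and> emm_of_mm B \<prec>\<prec> gamma_infinity l \<and> box B Z < ennreal \<epsilon>)"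
proof -
	interpret Z: mm_sp Z by standard fact
	interpret G: prob_space "gauss l" by (rule prob_space_gauss[OF l])
	interpret U: prob_space U01 by (rule prob_space_unit)
	let ?G = "gauss l"
	\<comment> \<open>The net lemma with error 3 * \<eta> gives 18 * \<eta>; the passage to a real copy
	  adds \<eta> / 2 and the distance from Z' to Z adds \<eta>, which stays below 20 * \<eta>.\<close>
	define \<eta> where "\<eta> = min \<epsilon> 1 / 20"
	have \<eta>: "\<eta> > 0" "20 * \<eta> \<le> \<epsilon>" "\<eta> \<le> 1/20" using \<epsilon> by (auto simp: \<eta>_def)
	obtain z0 where z0: "z0 \<in> Z.C" using Z.P.not_empty by blast
	have zd[measurable]: "(\<lambda>z. Z.D z0 z) \<in> borel_measurable Z.M" using Z.measurable_dist_point[of "\<lambda>z. z" Z.M z0] z0 by simp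
	have Km: "{z \<in> Z.C. Z.D z0 z > a} \<in> sets Z.M" for a by measurable
	have "(\<lambda>m::nat. measure Z.M {z \<in> Z.C. Z.D z0 z > real m}) \<longlonglongrightarrow> measure Z.M (\<Inter>m::nat. {z \<in> Z.C. Z.D z0 z > real m})"
		by (rule Z.P.finite_Lim_measure_decseq) (use Km in \<open>auto simp: decseq_def\<close>)
	moreover have "(\<Inter>m::nat. {z \<in> Z.C. Z.D z0 z > real m}) = {}"
	proof -
		show ?thesis by (auto, meson linorder_not_less real_arch_simple)
	qed
	ultimately have "(\<lambda>m::nat. measure Z.M {z \<in> Z.C. Z.D z0 z > real m}) \<longlonglongrightarrow> 0" by (simp only: measure_empty)
	then have "\<forall>\<^sub>F m::nat in sequentially. measure Z.M {z \<in> Z.C. Z.D z0 z > real m} < \<eta>"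
		by (rule order_tendstoD) (use \<eta> in simp)
	then obtain K :: nat where K: "measure Z.M {z \<in> Z.C. Z.D z0 z > real K} < \<eta>" unfolding eventually_sequentially by blast
	\<comment> \<open>Two points of Z within K of z0 are at distance at most 2 K, and the
	  correspondence with Z' adds less than \<eta>.\<close>
	define d0 where "d0 = 2 * real K + \<eta>"
	have d0: "d0 > 0" using \<eta> by (simp add: d0_def)
	\<comment> \<open>Chosen for the hypothesis \<open>small\<close> of the net lemma: the diameter 2 *
	  d0 times the excess 4 * \<delta> of the Lipschitz constant is at most 3 * \<eta>.\<close>
	define \<delta> where "\<delta> = min (1/4) (3 * \<eta> / (8 * d0))"
	have \<delta>: "\<delta> > 0" "\<delta> \<le> 1/4" "2 * d0 * (4 * \<delta>) \<le> 3 * \<eta>"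
	proof -
		show "\<delta> > 0" "\<delta> \<le> 1/4" using \<eta> d0 by (auto simp: \<delta>_def)
		have "\<delta> * (8 * d0) \<le> 3 * \<eta>" using d0 mult_right_mono[of \<delta> "3 * \<eta> / (8 * d0)" "8 * d0"] by (simp add: \<delta>_def)
		then show "2 * d0 * (4 * \<delta>) \<le> 3 * \<eta>" by (simp add: mult_ac)
	qed
	have rtop: "filterlim r at_top sequentially" by (rule gaussian_scale_at_top[OF r l])
	have lln: "\<forall>\<^sub>F n in sequentially. measure ?G {x. \<bar>sqn n x / (r n)^2 - 1\<bar> > \<delta>} < \<eta>"
		by (rule order_tendstoD[OF gaussian_norm_lln[OF l r rpos \<delta>(1)]]) (use \<eta> in simp)
	have ev1: "\<forall>\<^sub>F n in sequentially. d0 \<le> r n" using rtop by (simp add: filterlim_at_top)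
	have "((\<lambda>n. (2 * d0 / r n)^2 / 24) \<longlongrightarrow> 0^2 / 24) sequentially"
		by (intro tendsto_divide tendsto_power tendsto_const tendsto_divide_0[OF tendsto_const] filterlim_at_top_imp_at_infinity rtop) simp
	then have ev2: "\<forall>\<^sub>F n in sequentially. (2 * d0 / r n)^2 / 24 < \<delta>"
		by (intro order_tendstoD(2)[where y = 0]) (use \<delta> in auto)
	have main: "\<exists>B::real mm. mm_space B \<and> emm_of_mm B \<prec>\<prec> gamma_infinity l \<and> box B Z < ennreal \<epsilon>"
		if n: "measure ?G {x. \<bar>sqn n x / (r n)^2 - 1\<bar> > \<delta>} < \<eta>" "d0 \<le> r n" "(2 * d0 / r n)^2 / 24 < \<delta>"
			and Z': "mm_space Z'" "emm_of_mm Z' \<prec>\<prec> emm_of_mm (sphere_mm n (r n))" "box Z' Z < ennreal \<eta>"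
		for n and Z' :: "real mm"
	proof -
		interpret Z': mm_sp Z' by standard fact
		let ?S = "sphere_measure n (r n)" and ?s = "to_sphere n (r n)"
		interpret S: prob_space ?S by (rule prob_space_sphere_measure[OF rpos])
		obtain \<iota> \<kappa> I0 e where I: "\<iota> \<in> parameters Z'" "\<kappa> \<in> parameters Z" "I0 \<in> sets U01"
			"0 \<le> e" "e < \<eta>" "measure lborel I0 \<ge> 1 - e"
			"\<And>s t. s \<in> I0 \<Longrightarrow> t \<in> I0 \<Longrightarrow> \<bar>Z'.D (\<iota> s) (\<iota> t) - Z.D (\<kappa> s) (\<kappa> t)\<bar> \<le> e"
			by (rule box_lessD[OF Z'(3)]) blast
		have I0sub: "I0 \<subseteq> {0..<1}" using sets.sets_into_space[OF I(3)] by simp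
		have mI0: "measure U01 I0 \<ge> 1 - \<eta>"
			using I(5,6) I0sub by (subst measure_restrict_space) auto
		define J where "J = I0 - (\<kappa> -` {z \<in> Z.C. Z.D z0 z > real K} \<inter> space U01)"
		have Js: "\<kappa> -` {z \<in> Z.C. Z.D z0 z > real K} \<inter> space U01 \<in> sets U01"
			by (rule measurable_sets[OF parameterD(1)[OF I(2)] Km])
		have "measure U01 (\<kappa> -` {z \<in> Z.C. Z.D z0 z > real K} \<inter> space U01) = measure Z.M {z \<in> Z.C. Z.D z0 z > real K}"
			using measure_distr[OF parameterD(1)[OF I(2)] Km] parameterD(2)[OF I(2)] by simp
		then have mJ: "measure U01 J \<ge> 1 - 2 * \<eta>"
			unfolding J_def using K mI0 I(3) Js
				U.finite_measure_Diff'[OF I(3) Js] U.finite_measure_mono[OF Int_lower2 Js, of I0] by linarith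
		have Jset: "J \<in> sets U01" unfolding J_def using I(3) Js by (rule sets.Diff)
		have "J \<noteq> {}" using mJ \<eta> by auto
		then obtain s0 where s0: "s0 \<in> J" by blast
		have \<iota>C: "\<iota> s \<in> Z'.C" "\<kappa> s \<in> Z.C" if "s \<in> J" for s
			using that I0sub measurable_space[OF parameterD(1)[OF I(1)], of s] measurable_space[OF parameterD(1)[OF I(2)], of s]
			by (auto simp: J_def)
		have Jd: "Z'.D (\<iota> s0) (\<iota> s) \<le> d0" if s: "s \<in> J" for s
		proof -
			have "Z.D z0 (\<kappa> s0) \<le> real K" "Z.D z0 (\<kappa> s) \<le> real K"
				using s0 s \<iota>C[OF s0] \<iota>C[OF s] I0sub by (auto simp: J_def not_less)
			then have "Z.D (\<kappa> s0) (\<kappa> s) \<le> 2 * real K"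
				using Z.triangle[OF \<iota>C(2)[OF s0] z0 \<iota>C(2)[OF s]] Z.commute[of z0 "\<kappa> s0"] by linarith
			moreover have "\<bar>Z'.D (\<iota> s0) (\<iota> s) - Z.D (\<kappa> s0) (\<kappa> s)\<bar> \<le> e" using s0 s by (intro I(7)) (auto simp: J_def)
			ultimately show ?thesis using I(5) unfolding d0_def by linarith
		qed
		define A where "A = {z \<in> Z'.C. Z'.D (\<iota> s0) z \<le> d0}"
		have [measurable]: "(\<lambda>z. Z'.D (\<iota> s0) z) \<in> borel_measurable Z'.M"
			using Z'.measurable_dist_point[of "\<lambda>z. z" Z'.M "\<iota> s0"] \<iota>C(1)[OF s0] by simp
		have Am: "A \<in> sets Z'.M" unfolding A_def by measurable
		have "measure U01 J \<le> measure U01 (\<iota> -` A \<inter> space U01)"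
		proof (rule U.finite_measure_mono)
			show "J \<subseteq> \<iota> -` A \<inter> space U01"
			proof
				fix s assume s: "s \<in> J"
				then have "s \<in> {0..<1}" using I0sub unfolding J_def by blast
				then show "s \<in> \<iota> -` A \<inter> space U01"
					using Jd[OF s] \<iota>C(1)[OF s] by (simp add: A_def)
			qed
		qed (rule measurable_sets[OF parameterD(1)[OF I(1)] Am])
		also have "\<dots> = measure Z'.M A" using measure_distr[OF parameterD(1)[OF I(1)] Am] parameterD(2)[OF I(1)] by simp
		finally have mA: "measure Z'.M A \<ge> 1 - 2 * \<eta>" using mJ by simp
		obtain \<phi> E where \<phi>: "\<phi> \<in> ?S \<rightarrow>\<^sub>M Z'.M" "E \<in> sets ?S" "distr ?S Z'.M \<phi> = Z'.M" "emeasure ?S E = 1"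
			"\<And>x y. x \<in> E \<Longrightarrow> y \<in> E \<Longrightarrow> ennreal (Z'.D (\<phi> x) (\<phi> y)) \<le> ennreal (geo n (r n) x y)"
			using Z'(2) unfolding emm_prec_def emm_simps mm_simps by blast
		have sm: "?s \<in> ?G \<rightarrow>\<^sub>M ?S" "distr ?G ?S ?s = ?S" by (rule to_sphere_law[OF l rpos])+
		define f where "f = \<phi> \<circ> ?s"
		have f: "f \<in> ?G \<rightarrow>\<^sub>M Z'.M" unfolding f_def by (rule measurable_comp[OF sm(1) \<phi>(1)])
		have flaw: "distr ?G Z'.M f = Z'.M" unfolding f_def using distr_distr[OF \<phi>(1) sm(1)] sm(2) \<phi>(3) by simp
		have coord: "(\<lambda>x. x i) \<in> borel_measurable ?G" for i by (rule measurable_gaussian_coordinate[OF l])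
		have [measurable]: "sqn n \<in> borel_measurable ?G" by (intro borel_measurable_sum borel_measurable_power coord)
		\<comment> \<open>E1 is where \<phi> is 1-Lipschitz, of full measure; E2 where the image lies in
		  the bounded set A, missing at most 2 * \<eta>; E3 is the shell around the sphere, missing at
		  most \<eta>.\<close>
		define E1 where "E1 = ?s -` E \<inter> space ?G"
		define E2 where "E2 = f -` A \<inter> space ?G"
		define E3 where "E3 = {x \<in> space ?G. \<bar>sqn n x / (r n)^2 - 1\<bar> \<le> \<delta>}"
		have Es: "E1 \<in> sets ?G" "E2 \<in> sets ?G" "E3 \<in> sets ?G"
			unfolding E1_def E2_def E3_def using measurable_sets[OF sm(1) \<phi>(2)] measurable_sets[OF f Am] by measurable
		have "measure ?G E1 = 1" unfolding E1_def using measure_distr[OF sm(1) \<phi>(2)] sm(2) \<phi>(4) by (simp add: measure_def)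
		moreover have "measure ?G E2 \<ge> 1 - 2 * \<eta>" unfolding E2_def using measure_distr[OF f Am] flaw mA by simp
		moreover have "measure ?G E3 \<ge> 1 - \<eta>"
		proof -
			have "{x. \<bar>sqn n x / (r n)^2 - 1\<bar> > \<delta>} = space ?G - E3" by (auto simp: E3_def)
			then show ?thesis using n(1) G.prob_compl[OF Es(3)] by simp
		qed
		moreover have "measure ?G (E1 \<inter> E2) \<ge> measure ?G E1 + measure ?G E2 - 1"
			by (rule G.prob_Int_ge[OF Es(1,2)])
		moreover have "measure ?G (E1 \<inter> E2 \<inter> E3) \<ge> measure ?G (E1 \<inter> E2) + measure ?G E3 - 1"
			by (rule G.prob_Int_ge[OF sets.Int[OF Es(1,2)] Es(3)])
		ultimately have mE: "measure ?G (E1 \<inter> E2 \<inter> E3) \<ge> 1 - 3 * \<eta>" by linarith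
		have sS: "?s x \<in> sphere_set n (r n)" for x by (rule to_sphere_mem[OF rpos])
		have diam: "Z'.D (f x) (f y) \<le> 2 * d0" if "x \<in> E1 \<inter> E2 \<inter> E3" "y \<in> E1 \<inter> E2 \<inter> E3" for x y
		proof -
			have "f x \<in> A" "f y \<in> A" using that by (auto simp: E2_def)
			then show ?thesis
				using Z'.triangle[of "f x" "\<iota> s0" "f y"] \<iota>C(1)[OF s0] Z'.commute[of "f x" "\<iota> s0"] by (auto simp: A_def)
		qed
		have lip: "Z'.D (f x) (f y) \<le> (1 + 4 * \<delta>) * euc (Suc n) x y" if xy: "x \<in> E1 \<inter> E2 \<inter> E3" "y \<in> E1 \<inter> E2 \<inter> E3" for x y
		proof (rule shrink_factor)
			have "ennreal (Z'.D (f x) (f y)) \<le> ennreal (geo n (r n) (?s x) (?s y))"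
				using \<phi>(5)[of "?s x" "?s y"] xy by (simp add: f_def E1_def)
			moreover have "0 \<le> geo n (r n) (?s x) (?s y)"
				using Metric_space.nonneg[OF sphere_metric[OF rpos]] .
			ultimately have dg: "Z'.D (f x) (f y) \<le> geo n (r n) (?s x) (?s y)" by simp
			have "Z'.D (f x) (f y) * (1 - (2 * d0 / r n)^2 / 24) \<le> euc (Suc n) (?s x) (?s y)"
				by (rule geodesic_truncated_le_euc[OF rpos sS sS _ dg diam[OF xy]]) (use n(2) in auto)
			moreover have "Z'.D (f x) (f y) * (1 - \<delta>) \<le> Z'.D (f x) (f y) * (1 - (2 * d0 / r n)^2 / 24)"
				using n(3) by (intro mult_left_mono) auto
			moreover have "euc (Suc n) (?s x) (?s y) \<le> euc (Suc n) x y / (1 - \<delta>)"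
				by (rule to_sphere_lipschitz[OF rpos]) (use sphere_shell(3)[OF rpos, of \<delta>] xy \<delta> in \<open>auto simp: E3_def\<close>)
			ultimately show "Z'.D (f x) (f y) * (1 - \<delta>) \<le> euc (Suc n) x y / (1 - \<delta>)" by linarith
		qed (use \<delta> in auto)
		obtain B :: "(nat \<Rightarrow> real) mm" where B: "mm_space B" "emm_of_mm B \<prec>\<prec> gamma_infinity l" "box B Z' \<le> ennreal (6 * (3 * \<eta>))"
			using gaussian_lipschitz_net[OF l Z'(1) f flaw _ mE, of "1 + 4 * \<delta>" "Suc n" "2 * d0"] Es lip diam \<eta> \<delta> by auto
		obtain B' :: "real mm" where B': "mm_space B'" "mm_iso B B'" using mm_real_copy[OF B(1)] by blast
		have "emm_of_mm B' \<prec>\<prec> gamma_infinity l"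
			by (rule emm_prec_trans[OF _ iso_prec[OF B(1) B'(2)] B(2)])
				(use prob_space_gauss[OF l] in \<open>simp add: gamma_infinity_def gauss_def\<close>)
		moreover have "box B' Z' < ennreal (18 * \<eta> + \<eta> / 2)"
		proof (rule box_triangle_less[OF B(1)])
			show "box B' B < ennreal (\<eta> / 8)" using box_iso[OF B(1) B'(2)] \<eta> by (simp add: box_commute[of B'])
			show "box B Z' < ennreal (18 * \<eta> + \<eta> / 8)" using B(3) \<eta> by (elim order_le_less_trans) (simp add: ennreal_less_iff)
		qed (use \<eta> in simp)
		then have "box B' Z < ennreal \<epsilon>"
			by (rule box_triangle_less[OF Z'(1) _ Z'(3)]) (use \<eta> in simp)
		ultimately show ?thesis using B'(1) by blast
	qed
	show ?thesis
	proof (intro exI[of _ \<eta>] conjI \<eta>(1))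
		show "\<forall>\<^sub>F n in sequentially. \<forall>Z'::real mm. mm_space Z' \<and> emm_of_mm Z' \<prec>\<prec> emm_of_mm (sphere_mm n (r n)) \<and> box Z' Z < ennreal \<eta> \<longrightarrow>
				(\<exists>B::real mm. mm_space B \<and> emm_of_mm B \<prec>\<prec> gamma_infinity l \<and> box B Z < ennreal \<epsilon>)"
			using lln ev1 ev2 by eventually_elim (use main in blast)
	qed
qed

lemma prob_space_gamma_infinity: "l > 0 \<Longrightarrow> prob_space (emm_measure (gamma_infinity l))"
	using prob_space_gauss by (simp add: gamma_infinity_def gauss_def)

theorem sphere_converges_gaussian:
	assumes "l > 0" "(\<lambda>n. r n / sqrt (real n)) \<longlonglongrightarrow> l" "\<And>n. r n > 0"
	shows "converges_tau_Pi (\<lambda>n. emm_of_mm (sphere_mm n (r n))) (gamma_infinity l)"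
	unfolding converges_tau_Pi_def
proof (intro conjI allI emm_space_sphere emm_space_gamma_infinity assms painleve_kuratowskiI prob_space_gamma_infinity)
	show "prob_space (emm_measure (emm_of_mm (sphere_mm n (r n))))" for n
		by (simp add: prob_space_sphere_measure assms)
qed (use sphere_lower[OF assms] sphere_upper[OF assms] in blast)+

section \<open>Spheres of large radius\<close>

text \<open>The dilation by r' / r. Its effect on the uniform measure is read off the Gaussian
  representation, since dilating \<open>to_sphere n r\<close> gives
  \<open>to_sphere n r'\<close>.\<close>

lemma sphere_prec_mono:
	assumes r: "0 < r'" "r' \<le> r"
	shows "emm_of_mm (sphere_mm n r') \<prec>\<prec> emm_of_mm (sphere_mm n r)"
proof -
	have r0: "r > 0" using r by simp
	interpret S: prob_space "sphere_measure n r" by (rule prob_space_sphere_measure[OF r0])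
	define sc where "sc x = (\<lambda>i\<in>{..n}. r' / r * x i)" for x :: "nat \<Rightarrow> real"
	have scS: "sc x \<in> sphere_set n r'" if "x \<in> sphere_set n r" for x
	proof -
		have "(\<Sum>i\<le>n. (sc x i)^2) = (r' / r)^2 * sqn n x"
			by (simp add: sc_def power_mult_distrib power_divide sum_distrib_left)
		then show ?thesis using that r0 by (simp add: sphere_set_def sc_def power_divide)
	qed
	have m: "sc \<in> sphere_measure n r \<rightarrow>\<^sub>M sphere_measure n r'"
	proof -
		have "sc \<in> sphere_measure n r \<rightarrow>\<^sub>M leb n"
			unfolding sc_def euclidean_lebesgue_def
		proof (rule measurable_restrict)
			fix i
			have "(\<lambda>x. x i) \<in> borel_measurable (sphere_measure n r)"
				by (rule measurable_product_then_coordinatewise[OF measurable_id_sphere[OF r0]])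
			then show "(\<lambda>x. r' / r * x i) \<in> sphere_measure n r \<rightarrow>\<^sub>M lborel" by simp
		qed
		then have "sc \<in> sphere_measure n r \<rightarrow>\<^sub>M restrict_space (leb n) (sphere_set n r')"
			by (intro measurable_restrict_space2) (use scS in auto)
		then show ?thesis using measurable_cong_sets[OF refl sets_sphere_measure[of n r'], of "sphere_measure n r"] by simp
	qed
	have comp: "sc \<circ> to_sphere n r = to_sphere n r'"
		using r0 by (auto simp: fun_eq_iff sc_def to_sphere_def radial_projection_def)
	have "distr (sphere_measure n r) (sphere_measure n r') sc = distr (distr (gauss 1) (sphere_measure n r) (to_sphere n r)) (sphere_measure n r') sc"
		using to_sphere_law(2)[of 1 r n] r0 by simp
	also have "\<dots> = distr (gauss 1) (sphere_measure n r') (sc \<circ> to_sphere n r)"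
		by (rule distr_distr[OF m to_sphere_law(1)]) (use r0 in auto)
	also have "\<dots> = sphere_measure n r'" unfolding comp using to_sphere_law(2)[of 1 r' n] r by simp
	finally have law: "distr (sphere_measure n r) (sphere_measure n r') sc = sphere_measure n r'" .
	show ?thesis
		unfolding emm_prec_def emm_simps mm_simps
	proof (intro bexI[OF _ m] bexI[of _ "space (sphere_measure n r)"] conjI ballI law)
		show "emeasure (sphere_measure n r) (space (sphere_measure n r)) = 1" by (rule S.emeasure_space_1)
		fix x y assume "x \<in> space (sphere_measure n r)" "y \<in> space (sphere_measure n r)"
		then have xy: "x \<in> sphere_set n r" "y \<in> sphere_set n r" by auto
		have "(\<Sum>i\<le>n. sc x i * sc y i) = (r' / r)^2 * (\<Sum>i\<le>n. x i * y i)"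
			by (simp add: sc_def sum_distrib_left power2_eq_square mult_ac)
		then have "(\<Sum>i\<le>n. sc x i * sc y i) / r'^2 = (\<Sum>i\<le>n. x i * y i) / r^2" using r by (simp add: power_divide)
		then have eq: "geo n r' (sc x) (sc y) = r' * arccos ((\<Sum>i\<le>n. x i * y i) / r^2)"
			using scS xy by (simp add: sphere_geodesic_dist_def)
		have "0 \<le> arccos ((\<Sum>i\<le>n. x i * y i) / r^2)"
			using sphere_inner_bound[OF r0 xy] by (intro arccos_lbound) linarith+
		then have "geo n r' (sc x) (sc y) \<le> geo n r x y"
			unfolding eq using xy r by (simp add: sphere_geodesic_dist_def mult_right_mono)
		then show "ennreal (geo n r' (sc x) (sc y)) \<le> ennreal (geo n r x y)" by (rule ennreal_leI)
	qed (rule sets.top)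
qed

text \<open>The distribution function of an atomless law is uniformly distributed under it, so such
  a law can replace the unit interval as a source of parameters.\<close>

lemma distr_cdf_atomless:
	fixes \<nu> :: "real measure"
	assumes \<nu>: "prob_space \<nu>" "sets \<nu> = sets borel" and atomless: "\<And>x. measure \<nu> {x} = 0"
		and f: "f \<in> U01 \<rightarrow>\<^sub>M M"
	shows "\<exists>g \<in> \<nu> \<rightarrow>\<^sub>M M. distr \<nu> M g = distr U01 M f"
proof -
	interpret \<nu>: real_distribution \<nu> using \<nu> sets_eq_imp_space_eq[OF \<nu>(2)] by (simp add: real_distribution_def real_distribution_axioms_def)
	obtain q where q: "q \<in> borel_measurable U01" "distr U01 borel q = \<nu>"
		"\<And>s x. s \<in> {0<..<1} \<Longrightarrow> s \<le> cdf \<nu> x \<longleftrightarrow> q s \<le> x"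
		using real_param_quantile[OF \<nu>] by blast
	have inv: "cdf \<nu> (q s) = s" if s: "s \<in> {0<..<1}" for s
	proof (rule antisym)
		show "s \<le> cdf \<nu> (q s)" using q(3)[OF s] by simp
		have cont: "(cdf \<nu> \<longlongrightarrow> cdf \<nu> (q s)) (at_left (q s))"
			using \<nu>.isCont_cdf[of "q s"] atomless[of "q s"] unfolding isCont_def by (simp add: filterlim_at_split)
		show "cdf \<nu> (q s) \<le> s"
		proof (rule tendsto_upperbound[OF cont])
			show "\<forall>\<^sub>F x in at_left (q s). cdf \<nu> x \<le> s"
			proof -
				have "cdf \<nu> x \<le> s" if "x < q s" for x using q(3)[OF s, of x] that by linarith
				then show ?thesis unfolding eventually_at_filter by (intro always_eventually) simp
			qed
		qed simp
	qed
	\<comment> \<open>\<open>U01\<close> lives on the half-open interval, so the value 1 of the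
	  distribution function is redirected to 0. At the quantiles \<open>q s\<close> with 0 < s < 1
	  nothing changes.\<close>
	define c where "c x = (if cdf \<nu> x \<in> {0..<1} then cdf \<nu> x else 0)" for x
	have "cdf \<nu> \<in> borel_measurable borel" by (intro borel_measurable_mono monoI \<nu>.cdf_nondecreasing)
	then have cdfm: "cdf \<nu> \<in> borel_measurable \<nu>" using \<nu>(2) by (simp cong: measurable_cong_sets)
	have cm: "c \<in> \<nu> \<rightarrow>\<^sub>M U01"
	proof (rule measurable_restrict_space2)
		show "c \<in> space \<nu> \<rightarrow> {0..<1}" by (auto simp: c_def)
		show "c \<in> \<nu> \<rightarrow>\<^sub>M lborel" unfolding c_def using cdfm by measurable
	qed
	have q': "q \<in> U01 \<rightarrow>\<^sub>M \<nu>" using q(1) \<nu>(2) by (simp cong: measurable_cong_sets)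
	have q2: "distr U01 \<nu> q = \<nu>" using q(2) \<nu>(2) by (metis distr_cong)
	have "distr \<nu> M (f \<circ> c) = distr (distr U01 \<nu> q) M (f \<circ> c)" by (simp only: q2)
	also have "\<dots> = distr U01 M ((f \<circ> c) \<circ> q)"
		by (rule distr_distr[OF measurable_comp[OF cm f] q'])
	also have "\<dots> = distr U01 M f"
	proof (rule distr_cong_AE[OF refl refl])
		have "AE s in lborel. s \<in> {0..<1} \<longrightarrow> s \<in> {0<..<1::real}"
			using AE_lborel_singleton[of 0] by eventually_elim auto
		then have "AE s in U01. s \<in> {0<..<1}" by (subst AE_restrict_space_iff) auto
		then show "AE s in U01. ((f \<circ> c) \<circ> q) s = f s"
			by eventually_elim (auto simp: c_def inv)
		show "(f \<circ> c) \<circ> q \<in> U01 \<rightarrow>\<^sub>M M" by (rule measurable_comp[OF q' measurable_comp[OF cm f]])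
	qed (rule f)
	finally show ?thesis using measurable_comp[OF cm f] by blast
qed

lemma separated_compacts:
	fixes K :: "nat \<Rightarrow> real set"
	assumes "\<And>j. compact (K j)" "\<And>i j. i \<noteq> j \<Longrightarrow> K i \<inter> K j = {}"
	shows "\<exists>\<delta>>0. \<forall>i<N. \<forall>j<N. i \<noteq> j \<longrightarrow> (\<forall>x\<in>K i. \<forall>y\<in>K j. \<delta> \<le> \<bar>x - y\<bar>)"
proof -
	have "\<exists>d>0. \<forall>x\<in>K i. \<forall>y\<in>K j. d \<le> dist x y" if "i \<noteq> j" for i j
		using separate_compact_closed[OF assms(1) compact_imp_closed[OF assms(1)] assms(2)[OF that]] .
	then obtain d where d: "\<And>i j. i \<noteq> j \<Longrightarrow> d i j > 0 \<and> (\<forall>x\<in>K i. \<forall>y\<in>K j. d i j \<le> dist x y)" by metis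
	define \<delta> where "\<delta> = Min (insert 1 ((\<lambda>(i, j). d i j) ` {(i, j). i < N \<and> j < N \<and> i \<noteq> j}))"
	have fin: "finite {(i, j). i < N \<and> j < N \<and> i \<noteq> j}"
		by (rule finite_subset[of _ "{..<N} \<times> {..<N}"]) auto
	have "\<delta> > 0" unfolding \<delta>_def using fin d by (subst Min_gr_iff) auto
	moreover have "\<delta> \<le> d i j" if "i < N" "j < N" "i \<noteq> j" for i j
		unfolding \<delta>_def using fin that by (intro Min_le) auto
	ultimately show ?thesis
	proof (intro exI[of _ \<delta>] conjI allI impI ballI)
		fix i j x y assume *: "\<And>i j. i < N \<Longrightarrow> j < N \<Longrightarrow> i \<noteq> j \<Longrightarrow> \<delta> \<le> d i j" "i < N" "j < N" "i \<noteq> j" "x \<in> K i" "y \<in> K j"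
		have "\<delta> \<le> d i j" by (rule *(1)) fact+
		also have "\<dots> \<le> dist x y" using d[OF *(4)] *(5,6) by blast
		finally show "\<delta> \<le> \<bar>x - y\<bar>" by (simp add: dist_real_def)
	qed
qed

text \<open>A Gaussian variable of large variance takes values in finitely many compact sets that are far
	apart, with high probability; so it dominates approximately any finite metric space.\<close>

lemma gaussian_dominates_approx:
	fixes Z :: "'a mm"
	assumes Z: "mm_space Z" and e: "e > 0"
	shows "\<exists>l>0. \<exists>B::(nat \<Rightarrow> real) mm. mm_space B \<and> emm_of_mm B \<prec>\<prec> gamma_infinity l \<and> box B Z < ennreal e"
proof -
	interpret Z: mm_sp Z by standard fact
	\<comment> \<open>The net lemma with error 2 * \<eta> gives 12 * \<eta>, and rounding to the net
	  gives 2 * \<eta>; with room for strict inequalities the sum is below 20 * \<eta>.\<close>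
	define \<eta> where "\<eta> = min e 1 / 20"
	have \<eta>: "\<eta> > 0" "20 * \<eta> \<le> e" "\<eta> \<le> 1/20" using e by (auto simp: \<eta>_def)
	let ?N = "density lborel (normal_density 0 1)"
	interpret N: prob_space ?N by (rule prob_space_normal_density) simp
	have Ns: "sets ?N = sets borel" by simp
	have atomless: "measure ?N {x} = 0" for x
	proof -
		have "emeasure ?N {x} = (\<integral>\<^sup>+t. ennreal (normal_density 0 1 t) * indicator {x} t \<partial>lborel)" by (rule emeasure_density) auto
		also have "\<dots> = 0"
			by (subst nn_integral_0_iff_AE) (use AE_lborel_singleton[of x] in \<open>auto elim: eventually_mono\<close>)
		finally show ?thesis by (simp add: measure_def)
	qed
	obtain \<kappa> where \<kappa>: "\<kappa> \<in> parameters Z" using Z.parameters_nonempty by blast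
	obtain \<xi> where \<xi>0: "\<xi> \<in> ?N \<rightarrow>\<^sub>M Z.M" "distr ?N Z.M \<xi> = distr U01 Z.M \<kappa>"
		using distr_cdf_atomless[OF N.prob_space_axioms Ns atomless parameterD(1)[OF \<kappa>]] by blast
	note \<xi> = \<xi>0(1) \<xi>0(2)[unfolded parameterD(2)[OF \<kappa>]]
	have \<xi>C: "\<xi> t \<in> Z.C" for t using measurable_space[OF \<xi>(1)] by simp
	obtain q :: "nat \<Rightarrow> 'a" where q: "\<And>j. q j \<in> Z.C" "\<And>x r. x \<in> Z.C \<Longrightarrow> r > 0 \<Longrightarrow> \<exists>j. Z.D (q j) x < r"
		by (rule Z.dense_sequence) blast
	define c where "c y = (LEAST j. Z.D (q j) y < \<eta>)" for y
	have cD: "Z.D (q (c y)) y < \<eta>" if "y \<in> Z.C" for y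
		unfolding c_def by (rule LeastI_ex) (use q(2)[OF that \<eta>(1)] in simp)
	have Dq: "(\<lambda>x. Z.D (q j) x) \<in> borel_measurable Z.M" for j
		using Z.measurable_dist_point[of "\<lambda>x. x" Z.M "q j"] q(1) by simp
	have cm: "c \<in> Z.M \<rightarrow>\<^sub>M count_space UNIV" unfolding c_def using Dq by measurable
	define V where "V j = {t. c (\<xi> t) = j}" for j
	have V[measurable]: "V j \<in> sets ?N" for j
		using measurable_sets[OF measurable_comp[OF \<xi>(1) cm], of "{j}"] by (simp add: V_def vimage_def)
	have "(\<lambda>n. measure ?N (\<Union>j<n. V j)) \<longlonglongrightarrow> measure ?N (\<Union>n. \<Union>j<n. V j)"
	proof (rule N.finite_Lim_measure_incseq)
		have "(\<Union>j<n. V j) \<in> sets ?N" for n by (intro sets.finite_UN V) auto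
		then show "range (\<lambda>n. \<Union>j<n. V j) \<subseteq> sets ?N" by blast
		show "incseq (\<lambda>n. \<Union>j<n. V j)" by (auto simp: incseq_def intro: less_le_trans)
	qed
	moreover have "(\<Union>n. \<Union>j<n. V j) = space ?N" by (auto simp: V_def)
	ultimately have "(\<lambda>n. measure ?N (\<Union>j<n. V j)) \<longlonglongrightarrow> 1" using N.prob_space by simp
	then have "\<forall>\<^sub>F n in sequentially. measure ?N (\<Union>j<n. V j) > 1 - \<eta>"
		by (rule order_tendstoD) (use \<eta> in simp)
	then obtain m where m: "measure ?N (\<Union>j<m. V j) > 1 - \<eta>" unfolding eventually_sequentially by blast
	\<comment> \<open>The cells \<open>V j\<close> may touch each other. Disjoint compact sets have
	  positive distances, so each cell is exhausted from inside up to \<eta> / (m + 1).\<close>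
	have "\<exists>K. compact K \<and> K \<subseteq> V j \<and> measure ?N (V j) - \<eta> / real (Suc m) < measure ?N K" for j
	proof -
		have ir: "emeasure ?N (V j) = (SUP K\<in>{K. K \<subseteq> V j \<and> compact K}. emeasure ?N K)"
			by (rule inner_regular) (use V N.emeasure_finite in auto)
		show ?thesis
		proof (cases "measure ?N (V j) - \<eta> / real (Suc m) < 0")
			case True
			then show ?thesis by (intro exI[of _ "{}"]) simp
		next
			case False
			have "ennreal (measure ?N (V j) - \<eta> / real (Suc m)) < emeasure ?N (V j)"
				using False \<eta> by (simp add: N.emeasure_eq_measure ennreal_less_iff)
			then obtain K where K: "K \<subseteq> V j" "compact K" "ennreal (measure ?N (V j) - \<eta> / real (Suc m)) < emeasure ?N K"
				unfolding ir less_SUP_iff by blast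
			then show ?thesis using False by (intro exI[of _ K]) (simp add: N.emeasure_eq_measure ennreal_less_iff)
		qed
	qed
	then obtain K where K: "\<And>j. compact (K j)" "\<And>j. K j \<subseteq> V j" "\<And>j. measure ?N (V j) - \<eta> / real (Suc m) < measure ?N (K j)"
		by metis
	have Ks[measurable]: "K j \<in> sets ?N" for j using compact_imp_closed[OF K(1)] by simp
	have disj: "K i \<inter> K j = {}" if "i \<noteq> j" for i j using K(2)[of i] K(2)[of j] that unfolding V_def by blast
	define KK where "KK = (\<Union>j<m. K j)"
	have KKs: "KK \<in> sets ?N" unfolding KK_def by (intro sets.finite_UN Ks) auto
	have "measure ?N (\<Union>j<m. V j) = (\<Sum>j<m. measure ?N (V j))"
		by (rule N.finite_measure_finite_Union) (use V in \<open>auto simp: disjoint_family_on_def V_def\<close>)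
	moreover have "measure ?N KK = (\<Sum>j<m. measure ?N (K j))"
		unfolding KK_def by (rule N.finite_measure_finite_Union) (use Ks disj in \<open>auto simp: disjoint_family_on_def\<close>)
	moreover have "(\<Sum>j<m. measure ?N (V j) - \<eta> / real (Suc m)) \<le> (\<Sum>j<m. measure ?N (K j))"
		by (intro sum_mono less_imp_le K(3))
	moreover have "(\<Sum>j<m. \<eta> / real (Suc m)) \<le> \<eta>" using \<eta> by (simp add: field_simps)
	ultimately have mKK: "measure ?N KK \<ge> 1 - 2 * \<eta>" using m by (simp add: sum_subtractf)
	obtain \<delta> where \<delta>: "\<delta> > 0" "\<And>i j x y. i < m \<Longrightarrow> j < m \<Longrightarrow> i \<noteq> j \<Longrightarrow> x \<in> K i \<Longrightarrow> y \<in> K j \<Longrightarrow> \<delta> \<le> \<bar>x - y\<bar>"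
		using separated_compacts[of K m, OF K(1) disj] by blast
	define dm where "dm = Max (insert 0 ((\<lambda>(i, j). Z.D (q i) (q j)) ` ({..<m} \<times> {..<m})))"
	have dm: "Z.D (q i) (q j) \<le> dm" if "i < m" "j < m" for i j
		unfolding dm_def using that by (intro Max_ge) auto
	have dm0: "0 \<le> dm" unfolding dm_def by (intro Max_ge) auto
	\<comment> \<open>Scaling the line by l spreads the compact sets to mutual distances at least
	  \<delta> * l, which is at least the diameter \<open>dm\<close> of the net; then any assignment of
	  net points to them is 1-Lipschitz.\<close>
	define l where "l = max 1 (dm / \<delta>)"
	have l: "l > 0" "dm \<le> \<delta> * l" using \<delta>(1) by (auto simp: l_def max_def field_simps)
	let ?G = "gauss l"
	interpret G: prob_space ?G by (rule prob_space_gauss[OF l(1)])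
	have pm: "(\<lambda>x. x 0 / l) \<in> borel_measurable ?G" using measurable_gaussian_coordinate[OF l(1), of 0] by measurable
	have plaw: "distr ?G borel (\<lambda>x. x 0 / l) = ?N"
	proof -
		let ?Nl = "density lborel (normal_density 0 l)"
		interpret Nl: prob_space ?Nl by (rule prob_space_normal_density[OF l(1)])
		have "distributed ?Nl lborel (\<lambda>x. x) (normal_density 0 l)"
			by (auto simp: distributed_def distr_id2)
		from Nl.normal_density_affine[OF this l(1), of "1 / l" 0]
		have "distributed ?Nl lborel (\<lambda>x. x / l) (normal_density 0 1)" using l(1) by simp
		then have a: "distr ?Nl lborel (\<lambda>x. x / l) = ?N" by (rule distributed_distr_eq_density)
		have "distr ?G borel (\<lambda>x. x 0 / l) = distr (distr ?G borel (\<lambda>x. x 0)) borel (\<lambda>x. x / l)"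
			by (subst distr_distr) (use measurable_gaussian_coordinate[OF l(1), of 0] in \<open>auto simp: comp_def\<close>)
		also have "\<dots> = distr ?Nl lborel (\<lambda>x. x / l)"
			unfolding distr_gaussian_coordinate[OF l(1)] by (rule distr_cong) auto
		finally show ?thesis unfolding a .
	qed
	have pm': "(\<lambda>x. x 0 / l) \<in> ?G \<rightarrow>\<^sub>M ?N" using pm by simp
	have plaw': "distr ?G ?N (\<lambda>x. x 0 / l) = ?N" using plaw by (metis Ns distr_cong)
	define \<omega> where "\<omega> x = \<xi> (x 0 / l)" for x :: "nat \<Rightarrow> real"
	have \<omega>: "\<omega> \<in> ?G \<rightarrow>\<^sub>M Z.M" unfolding \<omega>_def by (rule measurable_compose[OF pm' \<xi>(1)])
	have \<omega>law: "distr ?G Z.M \<omega> = Z.M"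
		using distr_distr[OF \<xi>(1) pm'] plaw' \<xi>(2) by (simp add: \<omega>_def[abs_def] comp_def)
	\<comment> \<open>Rounding to the net makes the map constant on each compact set, where no
	  Lipschitz bound would otherwise be available.\<close>
	define \<phi> where "\<phi> x = q (c (\<omega> x))" for x
	have \<phi>: "\<phi> \<in> ?G \<rightarrow>\<^sub>M Z.M"
	proof -
		have "q \<in> count_space UNIV \<rightarrow>\<^sub>M Z.M" using q(1) by auto
		from measurable_compose[OF measurable_compose[OF \<omega> cm] this] show ?thesis by (simp add: \<phi>_def[abs_def])
	qed
	define Z' where "Z' = \<lparr>mm_dist = Z.D, mm_measure = distr ?G Z.M \<phi>\<rparr>"
	have mmZ': "mm_space Z'" unfolding Z'_def by (rule Z.mm_space_distr[OF G.prob_space_axioms \<phi>])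
	have Z's: "mm_dist Z' = Z.D" "mm_measure Z' = distr ?G Z.M \<phi>" by (simp_all add: Z'_def)
	have \<phi>': "\<phi> \<in> ?G \<rightarrow>\<^sub>M mm_measure Z'" "distr ?G (mm_measure Z') \<phi> = mm_measure Z'"
		using \<phi> unfolding Z's by (auto intro: distr_cong)
	have "box Z' Z \<le> ennreal (2 * \<eta>)"
	proof (rule box_le_coupling[OF _ G.prob_space_axioms \<phi>' \<omega> \<omega>law sets.top])
		show "real_coded ?G" by (rule real_coded_borel) simp
		show "1 - 2 * \<eta> \<le> measure ?G (space ?G)" using G.prob_space \<eta> by simp
		fix x y
		have C: "\<omega> z \<in> Z.C" for z by (simp add: \<omega>_def \<xi>C)
		have d: "Z.D (\<phi> z) (\<omega> z) < \<eta>" for z unfolding \<phi>_def by (rule cD[OF C])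
		have \<phi>C: "\<phi> z \<in> Z.C" for z by (simp add: \<phi>_def q(1))
		show "\<bar>mm_dist Z' (\<phi> x) (\<phi> y) - Z.D (\<omega> x) (\<omega> y)\<bar> \<le> 2 * \<eta>"
			unfolding Z's
			using Z.triangle[OF \<phi>C[of x] C[of x] \<phi>C[of y]] Z.triangle[OF C[of x] C[of y] \<phi>C[of y]]
				Z.triangle[OF C[of x] \<phi>C[of x] C[of y]] Z.triangle[OF \<phi>C[of x] \<phi>C[of y] C[of y]]
				Z.commute[of "\<phi> x" "\<omega> x"] Z.commute[of "\<phi> y" "\<omega> y"] d[of x] d[of y]
			by linarith
	qed (use \<eta> in simp)
	then have bZ: "box Z' Z < ennreal (3 * \<eta>)" using \<eta> by (elim order_le_less_trans) (simp add: ennreal_less_iff)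
	define E where "E = {x :: nat \<Rightarrow> real. x 0 / l \<in> KK}"
	have Es: "E \<in> sets ?G" using measurable_sets[OF pm' KKs] by (simp add: E_def vimage_def)
	have "measure ?G E = measure ?N KK" using measure_distr[OF pm' KKs] plaw' by (simp add: E_def vimage_def)
	then have mE: "measure ?G E \<ge> 1 - 2 * \<eta>" using mKK by simp
	have lip: "Z.D (\<phi> x) (\<phi> y) \<le> min dm (euc 1 x y)" if xy: "x \<in> E" "y \<in> E" for x y
	proof -
		obtain i j where ij: "i < m" "j < m" "x 0 / l \<in> K i" "y 0 / l \<in> K j" using xy by (auto simp: E_def KK_def)
		have cij: "c (\<omega> x) = i" "c (\<omega> y) = j" using ij K(2) by (auto simp: V_def \<omega>_def)
		have eq: "Z.D (\<phi> x) (\<phi> y) = Z.D (q i) (q j)" by (simp add: \<phi>_def cij)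
		have "Z.D (q i) (q j) \<le> euc 1 x y"
		proof (cases "i = j")
			case True
			then show ?thesis using q(1) by simp
		next
			case False
			have "\<delta> \<le> \<bar>x 0 / l - y 0 / l\<bar>" by (rule \<delta>(2)[OF ij(1,2) False ij(3,4)])
			also have "\<dots> = \<bar>x 0 - y 0\<bar> / l" using l(1) by (simp add: abs_divide flip: diff_divide_distrib)
			finally have "\<delta> * l \<le> \<bar>x 0 - y 0\<bar>" using l(1) by (simp add: le_divide_eq)
			then have "dm \<le> \<bar>x 0 - y 0\<bar>" using l(2) by linarith
			also have "\<dots> \<le> euc 1 x y" by (rule euc_component) simp
			finally show ?thesis using dm[OF ij(1,2)] by linarith
		qed
		then show ?thesis using dm[OF ij(1,2)] eq by simp
	qed
	obtain B :: "(nat \<Rightarrow> real) mm" where B: "mm_space B" "emm_of_mm B \<prec>\<prec> gamma_infinity l" "box B Z' \<le> ennreal (6 * (2 * \<eta>))"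
		using gaussian_lipschitz_net[OF l(1) mmZ' \<phi>' Es mE, of 1 1 dm] lip \<eta> by (auto simp: Z's)
	have "box B Z' < ennreal (13 * \<eta>)" using B(3) \<eta> by (elim order_le_less_trans) (simp add: ennreal_less_iff)
	then have "box B Z < ennreal e" by (rule box_triangle_less[OF mmZ' _ bZ]) (use \<eta> in simp)
	then show ?thesis using B l(1) by blast
qed

text \<open>Distinct points are infinitely far apart, so every map is 1-Lipschitz and domination
  amounts to the existence of a parameter. The map t moves the endpoint 1 into the half-open
  interval.\<close>

lemma I_infinity_dominates:
	assumes "mm_space Z"
	shows "emm_of_mm Z \<prec>\<prec> I_infinity"
proof -
	interpret Z: mm_sp Z by standard fact
	let ?I = "restrict_space lborel {0..1::real}"
	have "prob_space ?I" by (auto simp: emeasure_restrict_space space_restrict_space intro!: prob_spaceI)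
	then interpret I: prob_space ?I .
	obtain \<kappa> where \<kappa>: "\<kappa> \<in> parameters Z" using Z.parameters_nonempty by blast
	define t where "t x = (if x \<in> {0..<1} then x else 0)" for x :: real
	have t: "t \<in> ?I \<rightarrow>\<^sub>M U01"
	proof (rule measurable_restrict_space2)
		show "t \<in> space ?I \<rightarrow> {0..<1}" by (auto simp: t_def)
		show "t \<in> ?I \<rightarrow>\<^sub>M lborel" unfolding t_def by (rule measurable_restrict_space1) measurable
	qed
	have "distr ?I U01 t = U01"
	proof (rule measure_eqI)
		fix A assume "A \<in> sets (distr ?I U01 t)"
		then have A: "A \<in> sets U01" by simp
		have A': "A \<subseteq> {0..<1}" "A \<in> sets borel"
			using sets.sets_into_space[OF A] A by (auto simp: sets_restrict_space)
		have tA: "t -` A \<inter> {0..1} \<in> sets borel"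
			using measurable_sets[OF t A] by (auto simp: space_restrict_space sets_restrict_space)
		have "emeasure (distr ?I U01 t) A = emeasure lborel (t -` A \<inter> {0..1})"
			by (subst emeasure_distr[OF t A]) (simp add: space_restrict_space emeasure_restrict_space)
		also have "\<dots> = emeasure lborel A"
		proof (rule emeasure_eq_AE)
			show "AE x in lborel. (x \<in> t -` A \<inter> {0..1}) = (x \<in> A)"
				using AE_lborel_singleton[of 1] by eventually_elim (use A' in \<open>auto simp: t_def\<close>)
		qed (use tA A' in auto)
		also have "\<dots> = emeasure U01 A" using A' by (subst emeasure_restrict_space) auto
		finally show "emeasure (distr ?I U01 t) A = emeasure U01 A" .
	qed simp
	then have "distr ?I Z.M (\<kappa> \<circ> t) = Z.M"
		using distr_distr[OF parameterD(1)[OF \<kappa>] t] parameterD(2)[OF \<kappa>] by simp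
	then show ?thesis
		unfolding emm_prec_def emm_simps I_infinity_def emm.simps
	proof (intro bexI[of _ "\<kappa> \<circ> t"] bexI[of _ "space ?I"] conjI ballI)
		show "\<kappa> \<circ> t \<in> ?I \<rightarrow>\<^sub>M Z.M" by (rule measurable_comp[OF t parameterD(1)[OF \<kappa>]])
		show "emeasure ?I (space ?I) = 1" by (rule I.emeasure_space_1)
		fix x y
		have "\<kappa> (t x) \<in> Z.C" using measurable_space[OF parameterD(1)[OF \<kappa>], of "t x"] by (auto simp: t_def)
		then show "ennreal (Z.D ((\<kappa> \<circ> t) x) ((\<kappa> \<circ> t) y)) \<le> (if x = y then 0 else \<infinity>)" by (cases "x = y") auto
	qed (assumption | rule sets.top)+
qed

theorem sphere_converges_I_infinity:
	assumes r: "filterlim (\<lambda>n. r n / sqrt (real n)) at_top sequentially" and rpos: "\<And>n. r n > 0"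
	shows "converges_tau_Pi (\<lambda>n. emm_of_mm (sphere_mm n (r n))) I_infinity"
	unfolding converges_tau_Pi_def
proof (intro conjI allI emm_space_sphere emm_space_I_infinity rpos painleve_kuratowskiI)
	show probS: "prob_space (emm_measure (emm_of_mm (sphere_mm n (r n))))" for n
		by (simp add: prob_space_sphere_measure rpos)
	show "prob_space (emm_measure I_infinity)"
		using emm_space_I_infinity unfolding emm_space_def Let_def by blast
	fix Z :: "real mm" and e :: real assume Z: "mm_space Z" and e: "e > 0"
	\<comment> \<open>The limit space dominates every mm-space, so Z approximates itself and upper
	  limits impose no condition.\<close>
	show "\<exists>d>0. \<forall>\<^sub>F n in sequentially. \<forall>Z'::real mm. mm_space Z' \<and> emm_of_mm Z' \<prec>\<prec> emm_of_mm (sphere_mm n (r n)) \<and> box Z' Z < ennreal d \<longrightarrow>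
			(\<exists>B::real mm. mm_space B \<and> emm_of_mm B \<prec>\<prec> I_infinity \<and> box B Z < ennreal e)"
		using Z I_infinity_dominates[OF Z] box_refl[OF Z] e by (intro exI[of _ 1]) (auto intro!: always_eventually exI[of _ Z])
	obtain l and B0 :: "(nat \<Rightarrow> real) mm" where l: "l > 0" and B0: "mm_space B0" "emm_of_mm B0 \<prec>\<prec> gamma_infinity l" "box B0 Z < ennreal (e/4)"
		using gaussian_dominates_approx[OF Z, of "e/4"] e by auto
	obtain B :: "real mm" where B: "mm_space B" "mm_iso B0 B" using mm_real_copy[OF B0(1)] by blast
	have BG: "emm_of_mm B \<prec>\<prec> gamma_infinity l"
		by (rule emm_prec_trans[OF prob_space_gamma_infinity[OF l] iso_prec[OF B0(1) B(2)] B0(2)])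
	have "box B B0 < ennreal (e/8)" using box_iso[OF B0(1) B(2)] e by (simp add: box_commute[of B])
	then have BZ: "box B Z < ennreal (e/2)" by (rule box_triangle_less[OF B0(1) _ B0(3)]) (use e in simp)
	\<comment> \<open>The successor keeps the radius positive for n = 0 and does not affect the limit
	  l.\<close>
	define r' where "r' n = l * sqrt (real (Suc n))" for n
	have r'pos: "r' n > 0" for n using l by (simp add: r'_def)
	have "(\<lambda>n. sqrt (real (Suc n)) / sqrt (real n)) \<longlonglongrightarrow> 1" by real_asymp
	then have "(\<lambda>n. l * (sqrt (real (Suc n)) / sqrt (real n))) \<longlonglongrightarrow> l * 1" by (intro tendsto_mult tendsto_const)
	then have r'lim: "(\<lambda>n. r' n / sqrt (real n)) \<longlonglongrightarrow> l" by (simp add: r'_def)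
	have low: "\<forall>\<^sub>F n in sequentially. \<exists>Z'::real mm. mm_space Z' \<and> emm_of_mm Z' \<prec>\<prec> emm_of_mm (sphere_mm n (r' n)) \<and> box Z' B < ennreal (e/4)"
		by (rule sphere_lower[OF l r'lim r'pos B(1) BG]) (use e in simp)
	have "\<forall>\<^sub>F n in sequentially. r' n / sqrt (real n) < l + 1"
		by (rule order_tendstoD[OF r'lim]) simp
	moreover have "\<forall>\<^sub>F n in sequentially. l + 1 \<le> r n / sqrt (real n)" using r by (simp add: filterlim_at_top)
	ultimately have ev: "\<forall>\<^sub>F n in sequentially. r' n \<le> r n"
		using eventually_gt_at_top[of 0]
	proof eventually_elim
		case (elim n)
		then have "r' n / sqrt (real n) \<le> r n / sqrt (real n)" by linarith
		then show ?case using elim(3) by (simp add: divide_le_cancel)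
	qed
	show "\<forall>\<^sub>F n in sequentially. \<exists>Z'::real mm. mm_space Z' \<and> emm_of_mm Z' \<prec>\<prec> emm_of_mm (sphere_mm n (r n)) \<and> box Z' Z < ennreal e"
		using low ev
	proof eventually_elim
		case (elim n)
		then obtain Z' :: "real mm" where Z': "mm_space Z'" "emm_of_mm Z' \<prec>\<prec> emm_of_mm (sphere_mm n (r' n))" "box Z' B < ennreal (e/4)" by blast
		have "emm_of_mm Z' \<prec>\<prec> emm_of_mm (sphere_mm n (r n))"
			by (rule emm_prec_trans[OF probS Z'(2) sphere_prec_mono[OF r'pos elim(2)]])
		moreover have "box Z' Z < ennreal e" by (rule box_triangle_less[OF B(1) Z'(3) BZ]) (use e in simp)
		ultimately show ?case using Z'(1) by blast
	qed
qed

section \<open>Concentration of measure on spheres\<close>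

text \<open>The compact sets are required to be nonempty because their extreme points are used next;
  adding a fixed point of A to an arbitrary compact subset achieves this.\<close>

lemma lborel_inner_compact:
	fixes A :: "real set"
	assumes A: "A \<in> sets borel" "A \<noteq> {}"
	shows "emeasure lborel A = (SUP K\<in>{K. K \<subseteq> A \<and> compact K \<and> K \<noteq> {}}. emeasure lborel K)"
proof (rule antisym)
	show "(SUP K\<in>{K. K \<subseteq> A \<and> compact K \<and> K \<noteq> {}}. emeasure lborel K) \<le> emeasure lborel A"
		by (rule SUP_least) (use A in \<open>auto intro!: emeasure_mono\<close>)
	obtain a where a: "a \<in> A" using A by blast
	let ?S = "SUP K\<in>{K. K \<subseteq> A \<and> compact K \<and> K \<noteq> {}}. emeasure lborel K"
	have "emeasure lborel (A \<inter> {- real m..real m}) \<le> ?S" for m :: nat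
	proof -
		\<comment> \<open>Inner regularity is applied to finite measures, so Lebesgue measure is cut down
		  to [- m, m].\<close>
		let ?M = "density lborel (indicator {- real m..real m})"
		have em: "emeasure ?M X = emeasure lborel (X \<inter> {- real m..real m})" if "X \<in> sets borel" for X
			using that by (subst emeasure_density) (auto simp: nn_integral_set_ennreal[symmetric] indicator_inter_arith[symmetric] Int_commute simp flip: nn_integral_indicator)
		have "emeasure ?M (space ?M) \<noteq> \<infinity>" using em[of UNIV] by simp
		then have "emeasure ?M A = (SUP K\<in>{K. K \<subseteq> A \<and> compact K}. emeasure ?M K)"
			by (intro inner_regular) (use A in auto)
		also have "\<dots> \<le> ?S"
		proof (rule SUP_least)
			fix K assume K: "K \<in> {K. K \<subseteq> A \<and> compact K}"
			then have Kb: "K \<in> sets borel" by (auto intro: borel_closed compact_imp_closed)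
			have "emeasure ?M K \<le> emeasure lborel (insert a K)"
				unfolding em[OF Kb] using Kb by (intro emeasure_mono) auto
			also have "\<dots> \<le> ?S" by (rule SUP_upper) (use K a in auto)
			finally show "emeasure ?M K \<le> ?S" .
		qed
		finally show ?thesis unfolding em[OF A(1)] .
	qed
	then have "(SUP m. emeasure lborel (A \<inter> {- real m..real m})) \<le> ?S" by (intro SUP_least)
	moreover have "(SUP m. emeasure lborel (A \<inter> {- real m..real m})) = emeasure lborel (\<Union>m::nat. A \<inter> {- real m..real m})"
		by (rule SUP_emeasure_incseq) (use A in \<open>auto simp: incseq_def\<close>)
	moreover have "(\<Union>m::nat. A \<inter> {- real m..real m}) = A"
	proof -
		have "\<exists>m::nat. - real m \<le> x \<and> x \<le> real m" for x
		proof -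
			obtain m :: nat where "\<bar>x\<bar> \<le> real m" using real_arch_simple by blast
			then show ?thesis by (intro exI[of _ m]) linarith
		qed
		then show ?thesis by auto
	qed
	ultimately show "emeasure lborel A \<le> ?S" by simp
qed

section \<open>Midpoints of sets on the line\<close>

lemma emeasure_affine_preimage:
	assumes "A \<in> sets borel"
	shows "2 * emeasure lborel {t::real. 2 * t - c \<in> A} = emeasure lborel A"
proof -
	have [measurable]: "A \<in> sets borel" by fact
	have m: "{t. 2 * t - c \<in> A} \<in> sets borel"
		using measurable_sets[of "\<lambda>t. 2 * t - c" borel borel A] assms by (simp add: vimage_def)
	have "emeasure lborel A = (\<integral>\<^sup>+x. indicator A x \<partial>lborel)" using assms by simp
	also have "\<dots> = ennreal \<bar>2\<bar> * (\<integral>\<^sup>+x. indicator A (- c + 2 * x) \<partial>lborel)"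
		by (rule nn_integral_real_affine) auto
	also have "(\<integral>\<^sup>+x. indicator A (- c + 2 * x) \<partial>lborel) = (\<integral>\<^sup>+x. indicator {t. 2 * t - c \<in> A} x \<partial>lborel)"
		by (intro nn_integral_cong) (simp add: indicator_def)
	also have "\<dots> = emeasure lborel {t. 2 * t - c \<in> A}" using m by simp
	finally show ?thesis by simp
qed

text \<open>For compact K with maximum k and compact L with minimum m, the sets (K + m) / 2 and (k +
  L) / 2 consist of midpoints and meet at most in (k + m) / 2, so their measures add up. C is any
  Borel set containing the midpoints, as the set of midpoints itself may fail to be Borel.\<close>

lemma brunn_minkowski_1d:
	fixes A B C :: "real set"
	assumes A: "A \<in> sets borel" "A \<noteq> {}" and B: "B \<in> sets borel" "B \<noteq> {}" and C: "C \<in> sets borel"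
		and sum: "\<And>a b. a \<in> A \<Longrightarrow> b \<in> B \<Longrightarrow> (a + b) / 2 \<in> C"
	shows "emeasure lborel A + emeasure lborel B \<le> 2 * emeasure lborel C"
proof -
	have comp: "emeasure lborel K + emeasure lborel L \<le> 2 * emeasure lborel C"
		if K: "K \<subseteq> A" "compact K" "K \<noteq> {}" and L: "L \<subseteq> B" "compact L" "L \<noteq> {}" for K L
	proof -
		obtain k where k: "k \<in> K" "\<And>x. x \<in> K \<Longrightarrow> x \<le> k" using compact_attains_sup[OF K(2,3)] by blast
		obtain m where m: "m \<in> L" "\<And>x. x \<in> L \<Longrightarrow> m \<le> x" using compact_attains_inf[OF L(2,3)] by blast
		let ?S = "{t. 2 * t - m \<in> K}" and ?T = "{t. 2 * t - k \<in> L}"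
		have Kb: "K \<in> sets borel" "L \<in> sets borel" using K(2) L(2) by (auto intro: borel_closed compact_imp_closed)
		have S: "?S \<in> sets borel" "?T \<in> sets borel"
			using measurable_sets[of "\<lambda>t. 2 * t - m" borel borel K] measurable_sets[of "\<lambda>t. 2 * t - k" borel borel L] Kb
			by (simp_all add: vimage_def)
		have sub: "?S \<union> ?T \<subseteq> C"
		proof
			fix t assume "t \<in> ?S \<union> ?T"
			then show "t \<in> C"
			proof
				assume "t \<in> ?S"
				then have "((2 * t - m) + m) / 2 \<in> C" using sum K(1) L(1) m(1) by blast
				then show ?thesis by simp
			next
				assume "t \<in> ?T"
				then have "(k + (2 * t - k)) / 2 \<in> C" using sum K(1) L(1) k(1) by blast
				then show ?thesis by simp
			qed
		qed
		have "?S \<inter> ?T \<subseteq> {(k + m) / 2}"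
		proof
			fix t assume "t \<in> ?S \<inter> ?T"
			then have "2 * t - m \<le> k" "m \<le> 2 * t - k" using k(2) m(2) by auto
			then show "t \<in> {(k + m) / 2}" by simp
		qed
		then have "emeasure lborel (?S \<inter> ?T) \<le> emeasure lborel {(k + m) / 2}" by (rule emeasure_mono) simp
		then have I0: "emeasure lborel (?S \<inter> ?T) = 0" by simp
		have "emeasure lborel K + emeasure lborel L = 2 * (emeasure lborel ?S + emeasure lborel ?T)"
			using emeasure_affine_preimage[OF Kb(1), of m] emeasure_affine_preimage[OF Kb(2), of k] by (simp add: distrib_left)
		also have "emeasure lborel ?S + emeasure lborel ?T = emeasure lborel (?S \<union> ?T)"
			using emeasure_Un_Int[of ?S lborel ?T] S I0 by simp
		also have "\<dots> \<le> emeasure lborel C" using sub C by (intro emeasure_mono) auto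
		finally show ?thesis by (simp add: mult_left_mono)
	qed
	let ?I = "\<lambda>A. {K. K \<subseteq> A \<and> compact K \<and> K \<noteq> {}}"
	have ne: "?I A \<noteq> {}" if "A \<noteq> {}" for A :: "real set" using that by (auto intro: exI[of _ "{_}"])
	have 1: "emeasure lborel A + emeasure lborel L \<le> 2 * emeasure lborel C" if L: "L \<subseteq> B" "compact L" "L \<noteq> {}" for L
	proof -
		have "emeasure lborel A + emeasure lborel L = (SUP K\<in>?I A. emeasure lborel K + emeasure lborel L)"
			unfolding lborel_inner_compact[OF A] by (rule ennreal_SUP_add_left[symmetric]) (rule ne[OF A(2)])
		also have "\<dots> \<le> 2 * emeasure lborel C" by (rule SUP_least) (use comp L in blast)
		finally show ?thesis .
	qed
	have "emeasure lborel A + emeasure lborel B = (SUP L\<in>?I B. emeasure lborel A + emeasure lborel L)"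
		unfolding lborel_inner_compact[OF B] add.commute[of "emeasure lborel A"] by (rule ennreal_SUP_add_left[symmetric]) (rule ne[OF B(2)])
	also have "\<dots> \<le> 2 * emeasure lborel C" by (rule SUP_least) (use 1 in blast)
	finally show ?thesis .
qed

section \<open>The Prekopa-Leindler inequality with equal weights\<close>

lemma nn_integral_layer_cake:
	assumes [measurable]: "f \<in> borel_measurable lborel"
	shows "(\<integral>\<^sup>+t. indicator {0<..<1} t * emeasure lborel {x::real. ennreal t < f x} \<partial>lborel) = (\<integral>\<^sup>+x. min 1 (f x) \<partial>lborel)"
proof -
	have [measurable]: "(\<lambda>x. f x) \<in> borel_measurable borel" using assms by simp
	have inner: "min 1 y = (\<integral>\<^sup>+t. indicator {0<..<1} t * indicator {t. ennreal t < y} t \<partial>lborel)" for y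
	proof (cases "y < 1")
		case True
		then obtain r where r: "y = ennreal r" "0 \<le> r" by (cases y) auto
		have r1: "r < 1" using True r by simp
		have "(\<integral>\<^sup>+t. indicator {0<..<1} t * indicator {t. ennreal t < y} t \<partial>lborel) = (\<integral>\<^sup>+t. indicator {0<..<r} t \<partial>lborel)"
			by (rule nn_integral_cong) (use r r1 in \<open>auto simp: indicator_def ennreal_less_iff\<close>)
		then show ?thesis using r r1 True by (simp add: min_def)
	next
		case False
		have "(\<integral>\<^sup>+t. indicator {0<..<1} t * indicator {t. ennreal t < y} t \<partial>lborel) = (\<integral>\<^sup>+t. indicator {0<..<1::real} t \<partial>lborel)"
		proof (rule nn_integral_cong)
			fix t :: real
			have "ennreal t < y" if "t \<in> {0<..<1}"
			proof -
				have "ennreal t < 1" using that by (simp add: ennreal_less_one_iff)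
				then show ?thesis by (rule order_less_le_trans) (use False in \<open>simp add: not_less\<close>)
			qed
			then show "indicator {0<..<1} t * indicator {t. ennreal t < y} t = (indicator {0<..<1} t :: ennreal)" by (auto simp: indicator_def)
		qed
		then show ?thesis using False by (simp add: min_def not_less)
	qed
	have em: "emeasure lborel {x. ennreal t < f x} = (\<integral>\<^sup>+x. indicator {t. ennreal t < f x} t \<partial>lborel)" for t
	proof -
		have "{x \<in> space lborel. ennreal t < f x} \<in> sets lborel" by measurable
		then have "emeasure lborel {x. ennreal t < f x} = (\<integral>\<^sup>+x. indicator {x. ennreal t < f x} x \<partial>lborel)" by simp
		then show ?thesis by (simp add: indicator_def)
	qed
	have m: "(\<lambda>z. indicator {0<..<1} (snd z) * indicator {t. ennreal t < f (fst z)} (snd z) :: ennreal) \<in> borel_measurable (lborel \<Otimes>\<^sub>M lborel)"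
		unfolding indicator_def mem_Collect_eq by measurable
	have "(\<integral>\<^sup>+t. indicator {0<..<1} t * emeasure lborel {x. ennreal t < f x} \<partial>lborel)
			= (\<integral>\<^sup>+t. \<integral>\<^sup>+x. indicator {0<..<1} t * indicator {t. ennreal t < f x} t \<partial>lborel \<partial>lborel)"
		unfolding em
	proof (intro nn_integral_cong nn_integral_cmult[symmetric])
		fix t :: real
		show "(\<lambda>x. indicator {t. ennreal t < f x} t) \<in> borel_measurable lborel"
			unfolding indicator_def mem_Collect_eq by measurable
	qed
	also have "\<dots> = (\<integral>\<^sup>+x. \<integral>\<^sup>+t. indicator {0<..<1} t * indicator {t. ennreal t < f x} t \<partial>lborel \<partial>lborel)"
		using lborel_pair.Fubini[OF m] by simp
	finally show ?thesis by (simp flip: inner)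
qed

text \<open>When both suprema are 1, the superlevel sets at each height t < 1 are nonempty, so the
  one-dimensional inequality applies at every height. Integrating over the heights gives an additive
  form.\<close>

lemma prekopa_leindler_normalized:
	fixes F G H :: "real \<Rightarrow> ennreal"
	assumes [measurable]: "F \<in> borel_measurable lborel" "G \<in> borel_measurable lborel" "H \<in> borel_measurable lborel"
		and F: "\<And>x. F x \<le> 1" "\<And>t. t < 1 \<Longrightarrow> \<exists>x. t < F x" and G: "\<And>x. G x \<le> 1" "\<And>t. t < 1 \<Longrightarrow> \<exists>x. t < G x"
		and H: "\<And>x y. F x * G y \<le> (H ((x + y) / 2))^2"
	shows "(\<integral>\<^sup>+x. F x \<partial>lborel) + (\<integral>\<^sup>+x. G x \<partial>lborel) \<le> 2 * (\<integral>\<^sup>+x. H x \<partial>lborel)"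
proof -
	have ms: "{x. ennreal t < f x} \<in> sets borel" if [measurable]: "f \<in> borel_measurable lborel" for f :: "real \<Rightarrow> ennreal" and t
	proof -
		have "{x \<in> space lborel. ennreal t < f x} \<in> sets lborel" by measurable
		then show ?thesis by simp
	qed
	have mm: "(\<lambda>t. indicator {0<..<1} t * emeasure lborel {x::real. ennreal t < f x}) \<in> borel_measurable lborel"
		if [measurable]: "f \<in> borel_measurable lborel" for f :: "real \<Rightarrow> ennreal"
	proof -
		have "(\<lambda>(t, x). indicator {x. ennreal t < f x} x :: ennreal) \<in> borel_measurable (lborel \<Otimes>\<^sub>M lborel)"
			unfolding indicator_def mem_Collect_eq case_prod_beta' by measurable
		then have "(\<lambda>t. \<integral>\<^sup>+x. indicator {x. ennreal t < f x} x \<partial>lborel) \<in> borel_measurable lborel"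
			by (rule lborel.borel_measurable_nn_integral)
		then have "(\<lambda>t. emeasure lborel {x. ennreal t < f x}) \<in> borel_measurable lborel"
			using ms[OF that] by simp
		then show ?thesis by (intro borel_measurable_times_ennreal borel_measurable_indicator) simp_all
	qed
	have min1: "min 1 (f x) = f x" if "\<And>x. f x \<le> (1::ennreal)" for f :: "real \<Rightarrow> ennreal" and x using that[of x] by (rule min_absorb2)
	have "(\<integral>\<^sup>+x. F x \<partial>lborel) + (\<integral>\<^sup>+x. G x \<partial>lborel) =
			(\<integral>\<^sup>+t. indicator {0<..<1} t * emeasure lborel {x. ennreal t < F x} \<partial>lborel) + (\<integral>\<^sup>+t. indicator {0<..<1} t * emeasure lborel {x. ennreal t < G x} \<partial>lborel)"
		using nn_integral_layer_cake[of F] nn_integral_layer_cake[of G] assms by (simp add: min1)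
	also have "\<dots> = (\<integral>\<^sup>+t. indicator {0<..<1} t * emeasure lborel {x. ennreal t < F x} + indicator {0<..<1} t * emeasure lborel {x. ennreal t < G x} \<partial>lborel)"
		by (rule nn_integral_add[symmetric]) (use mm assms in auto)
	also have "\<dots> \<le> (\<integral>\<^sup>+t. 2 * (indicator {0<..<1} t * emeasure lborel {x. ennreal t < H x}) \<partial>lborel)"
	proof (rule nn_integral_mono)
		fix t :: real
		show "indicator {0<..<1} t * emeasure lborel {x. ennreal t < F x} + indicator {0<..<1} t * emeasure lborel {x. ennreal t < G x}
				\<le> 2 * (indicator {0<..<1} t * emeasure lborel {x. ennreal t < H x})"
		proof (cases "t \<in> {0<..<1}")
			case True
			then have t1: "ennreal t < 1" by (simp add: ennreal_less_one_iff)
			have "emeasure lborel {x. ennreal t < F x} + emeasure lborel {x. ennreal t < G x} \<le> 2 * emeasure lborel {x. ennreal t < H x}"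
			proof (rule brunn_minkowski_1d)
				show "{x. ennreal t < F x} \<noteq> {}" "{x. ennreal t < G x} \<noteq> {}" using F(2)[OF t1] G(2)[OF t1] by auto
				fix a b assume ab: "a \<in> {x. ennreal t < F x}" "b \<in> {x. ennreal t < G x}"
				have "ennreal t < H ((a + b) / 2)"
				proof (rule ccontr)
					assume "\<not> ennreal t < H ((a + b) / 2)"
					then have "(H ((a + b) / 2))^2 \<le> (ennreal t)^2" by (intro power_mono) auto
					also have "\<dots> < F a * G b"
					proof -
						have "F a < top" "G b < top" using F(1)[of a] G(1)[of b] by (auto simp: order_le_less_trans)
						then obtain p q where pq: "F a = ennreal p" "0 \<le> p" "G b = ennreal q" "0 \<le> q" by (cases "F a"; cases "G b") auto
						have t: "t < p" "t < q" "0 < t" using ab pq True by (auto simp: ennreal_less_iff)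
						have "t * t < p * q" by (rule mult_strict_mono) (use t in auto)
						then show ?thesis using pq t by (simp add: power2_eq_square ennreal_less_iff flip: ennreal_mult)
					qed
					finally show False using H[of a b] by simp
				qed
				then show "(a + b) / 2 \<in> {x. ennreal t < H x}" by simp
			qed (use ms assms in auto)
			then show ?thesis using True by simp
		qed simp
	qed
	also have "\<dots> = 2 * (\<integral>\<^sup>+x. min 1 (H x) \<partial>lborel)"
		using mm[of H] assms by (subst nn_integral_cmult) (auto simp: nn_integral_layer_cake)
	also have "\<dots> \<le> 2 * (\<integral>\<^sup>+x. H x \<partial>lborel)" by (intro mult_left_mono nn_integral_mono) auto
	finally show ?thesis .
qed

lemma ennreal_amgm: "u + v \<le> 2 * w \<Longrightarrow> u * v \<le> (w::ennreal)^2"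
proof (cases w)
	case (real c)
	assume le: "u + v \<le> 2 * w"
	have w2: "2 * w = ennreal (2 * c)" using real by (simp add: ennreal_mult')
	have "u + v < top" using le unfolding w2 by (rule order_le_less_trans) simp
	then obtain a b where ab: "u = ennreal a" "v = ennreal b" "0 \<le> a" "0 \<le> b" by (cases u; cases v) auto
	have "ennreal (a + b) \<le> ennreal (2 * c)" using le unfolding w2 using ab by simp
	then have "a + b \<le> 2 * c" using real(1) by (simp add: ennreal_le_iff)
	moreover have "a * b \<le> ((a + b) / 2)^2"
		using sum_squares_bound[of a b] by (simp add: power2_eq_square algebra_simps)
	moreover have "((a + b) / 2)^2 \<le> c^2" if "a + b \<le> 2 * c" using ab that by (intro power_mono) auto
	ultimately have "a * b \<le> c^2" by linarith
	then have "ennreal (a * b) \<le> ennreal (c^2)" by (rule ennreal_leI)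
	then show ?thesis using ab real by (simp add: ennreal_mult' ennreal_power)
qed simp

text \<open>Divide F and G by their suprema a and b, and H by sqrt (a b). The arithmetic-geometric
  mean inequality turns the additive form into a product.\<close>

lemma prekopa_leindler_bounded:
	fixes F G H :: "real \<Rightarrow> ennreal"
	assumes [measurable]: "F \<in> borel_measurable lborel" "G \<in> borel_measurable lborel" "H \<in> borel_measurable lborel"
		and F: "\<And>x. F x \<le> ennreal c" and G: "\<And>x. G x \<le> ennreal c"
		and H: "\<And>x y. F x * G y \<le> (H ((x + y) / 2))^2"
	shows "(\<integral>\<^sup>+x. F x \<partial>lborel) * (\<integral>\<^sup>+x. G x \<partial>lborel) \<le> (\<integral>\<^sup>+x. H x \<partial>lborel)^2"
proof (cases "(SUP x. F x) = 0 \<or> (SUP x. G x) = 0")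
	case True
	have "\<forall>x. f x = 0" if "(SUP x. f x) = 0" for f :: "real \<Rightarrow> ennreal"
		using SUP_upper[of _ UNIV f] that by (metis UNIV_I le_zero_eq)
	then have "(\<forall>x. F x = 0) \<or> (\<forall>x. G x = 0)" using True by blast
	then show ?thesis by auto
next
	case False
	have fin: "(SUP x. f x) < top" if "\<And>x. f x \<le> ennreal c" for f :: "real \<Rightarrow> ennreal"
		using that by (meson SUP_least ennreal_less_top order_le_less_trans)
	define a b where "a = enn2real (SUP x. F x)" and "b = enn2real (SUP x. G x)"
	have a: "(SUP x. F x) = ennreal a" "a > 0"
		using fin[OF F] False by (simp_all add: a_def enn2real_positive_iff zero_less_iff_neq_zero)
	have b: "(SUP x. G x) = ennreal b" "b > 0"
		using fin[OF G] False by (simp_all add: b_def enn2real_positive_iff zero_less_iff_neq_zero)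
	define s where "s = sqrt (a * b)"
	have s: "s > 0" "s^2 = a * b" using a b by (simp_all add: s_def)
	have scale: "ennreal d * (ennreal (1 / d) * y) = y" if "d > 0" for d y
		using that by (simp flip: mult.assoc ennreal_mult')
	let ?F = "\<lambda>x. ennreal (1 / a) * F x" and ?G = "\<lambda>x. ennreal (1 / b) * G x" and ?H = "\<lambda>x. ennreal (1 / s) * H x"
	have norm: "ennreal (1 / d) * f x \<le> 1 \<and> (t < 1 \<longrightarrow> (\<exists>x. t < ennreal (1 / d) * f x))" if "(SUP x. f x) = ennreal d" "d > 0" for f :: "real \<Rightarrow> ennreal" and d t x
	proof
		have "f x \<le> ennreal d" using SUP_upper[of x UNIV f] that by simp
		then have "ennreal (1 / d) * f x \<le> ennreal (1 / d) * ennreal d" by (rule mult_left_mono) simp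
		then show "ennreal (1 / d) * f x \<le> 1" using that(2) by (simp flip: ennreal_mult')
		show "t < 1 \<longrightarrow> (\<exists>x. t < ennreal (1 / d) * f x)"
		proof
			assume "t < 1"
			then obtain t' where t': "t = ennreal t'" "0 \<le> t'" "t' < 1" by (cases t) auto
			have "ennreal (t' * d) < (SUP x. f x)" using that t' by (simp add: ennreal_less_iff)
			then obtain x where x: "ennreal (t' * d) < f x" by (auto simp: less_SUP_iff)
			have "t = ennreal (1 / d) * ennreal (t' * d)" using t' that(2) by (simp flip: ennreal_mult')
			also have "\<dots> < ennreal (1 / d) * f x" using x that(2) by (intro ennreal_mult_strict_left_mono) auto
			finally show "\<exists>x. t < ennreal (1 / d) * f x" by blast
		qed
	qed
	have "(\<integral>\<^sup>+x. ?F x \<partial>lborel) + (\<integral>\<^sup>+x. ?G x \<partial>lborel) \<le> 2 * (\<integral>\<^sup>+x. ?H x \<partial>lborel)"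
	proof (rule prekopa_leindler_normalized)
		fix x y
		have "?F x * ?G y = ennreal (1 / s^2) * (F x * G y)"
		proof -
			have "ennreal (1 / a) * ennreal (1 / b) = ennreal (1 / s^2)"
				using a(2) b(2) s(2) by (simp flip: ennreal_mult')
			then show ?thesis by (simp add: mult_ac flip: mult.assoc)
		qed
		also have "\<dots> \<le> ennreal (1 / s^2) * (H ((x + y) / 2))^2" by (intro mult_left_mono H) simp
		also have "\<dots> = (?H ((x + y) / 2))^2"
			using s by (simp add: power_mult_distrib ennreal_power power_divide)
		finally show "?F x * ?G y \<le> (?H ((x + y) / 2))^2" .
	qed (use norm[OF a] norm[OF b] in auto)
	then have "(\<integral>\<^sup>+x. ?F x \<partial>lborel) * (\<integral>\<^sup>+x. ?G x \<partial>lborel) \<le> (\<integral>\<^sup>+x. ?H x \<partial>lborel)^2" by (rule ennreal_amgm)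
	then have "ennreal (s^2) * ((ennreal (1 / a) * (\<integral>\<^sup>+x. F x \<partial>lborel)) * (ennreal (1 / b) * (\<integral>\<^sup>+x. G x \<partial>lborel)))
			\<le> ennreal (s^2) * (ennreal (1 / s) * (\<integral>\<^sup>+x. H x \<partial>lborel))^2"
		by (subst (asm) (1 2 3) nn_integral_cmult) (auto intro: mult_left_mono)
	moreover have "ennreal (s^2) * ((ennreal (1 / a) * u) * (ennreal (1 / b) * v)) = u * v" for u v
	proof -
		have "ennreal (s^2) * ((ennreal (1 / a) * u) * (ennreal (1 / b) * v)) = (ennreal a * (ennreal (1 / a) * u)) * (ennreal b * (ennreal (1 / b) * v))"
			using a b s by (simp add: ennreal_mult' mult_ac)
		then show ?thesis using scale a b by simp
	qed
	moreover have "ennreal (s^2) * (ennreal (1 / s) * w)^2 = w^2" for w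
	proof -
		have "ennreal (s^2) * (ennreal (1 / s) * w)^2 = (ennreal s * (ennreal (1 / s) * w))^2"
			using s by (simp add: power_mult_distrib ennreal_power)
		then show ?thesis using scale s by simp
	qed
	ultimately show ?thesis by simp
qed

text \<open>Truncation of F and G preserves the hypothesis, since it only lowers the left-hand side;
  monotone convergence is then applied to one factor at a time.\<close>

lemma prekopa_leindler_1d:
	fixes F G H :: "real \<Rightarrow> ennreal"
	assumes [measurable]: "F \<in> borel_measurable lborel" "G \<in> borel_measurable lborel" "H \<in> borel_measurable lborel"
		and H: "\<And>x y. F x * G y \<le> (H ((x + y) / 2))^2"
	shows "(\<integral>\<^sup>+x. F x \<partial>lborel) * (\<integral>\<^sup>+x. G x \<partial>lborel) \<le> (\<integral>\<^sup>+x. H x \<partial>lborel)^2"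
proof -
	let ?t = "\<lambda>(f :: real \<Rightarrow> ennreal) (k::nat) x. min (f x) (ennreal (real k))"
	have SUPt: "(SUP k. min y (ennreal (real k))) = y" for y
	proof (cases y)
		case (real r)
		obtain k :: nat where k: "r \<le> real k" using real_arch_simple by blast
		show ?thesis
		proof (rule antisym)
			show "(SUP k. min y (ennreal (real k))) \<le> y" by (rule SUP_least) simp
			have "y \<le> min y (ennreal (real k))" using k real by (simp add: ennreal_leI)
			also have "\<dots> \<le> (SUP k. min y (ennreal (real k)))" by (rule SUP_upper) simp
			finally show "y \<le> (SUP k. min y (ennreal (real k)))" .
		qed
	next
		case top
		then show ?thesis using ennreal_SUP_of_nat_eq_top by (simp add: ennreal_of_nat_eq_real_of_nat)
	qed
	have conv: "(\<integral>\<^sup>+x. f x \<partial>lborel) = (SUP k. \<integral>\<^sup>+x. ?t f k x \<partial>lborel)" if [measurable]: "f \<in> borel_measurable lborel" for f :: "real \<Rightarrow> ennreal"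
	proof -
		have "(\<integral>\<^sup>+x. f x \<partial>lborel) = (\<integral>\<^sup>+x. (SUP k. ?t f k x) \<partial>lborel)" by (simp only: SUPt)
		also have "\<dots> = (SUP k. \<integral>\<^sup>+x. ?t f k x \<partial>lborel)"
			by (rule nn_integral_monotone_convergence_SUP) (auto simp: incseq_def le_fun_def intro: min.coboundedI2 ennreal_leI)
		finally show ?thesis .
	qed
	have b: "(\<integral>\<^sup>+x. ?t F j x \<partial>lborel) * (\<integral>\<^sup>+x. ?t G k x \<partial>lborel) \<le> (\<integral>\<^sup>+x. H x \<partial>lborel)^2" for j k
	proof (rule prekopa_leindler_bounded[where c = "real (max j k)"])
		fix x y
		show "?t F j x \<le> ennreal (real (max j k))" "?t G k x \<le> ennreal (real (max j k))"
			by (auto intro!: min.coboundedI2 ennreal_leI)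
		have "?t F j x * ?t G k y \<le> F x * G y" by (intro mult_mono) auto
		then show "?t F j x * ?t G k y \<le> (H ((x + y) / 2))^2" using H order_trans by blast
	qed auto
	have c: "(\<integral>\<^sup>+x. F x \<partial>lborel) * (\<integral>\<^sup>+x. ?t G k x \<partial>lborel) \<le> (\<integral>\<^sup>+x. H x \<partial>lborel)^2" for k
		unfolding conv[OF assms(1)] SUP_mult_right_ennreal by (rule SUP_least) (rule b)
	show ?thesis
		unfolding conv[OF assms(2)] SUP_mult_left_ennreal by (rule SUP_least) (rule c)
qed

text \<open>Tensorisation: for fixed values of the new coordinate the induction hypothesis says that
  the partial integrals satisfy the assumption of the one-dimensional inequality.\<close>

lemma prekopa_leindler:
	assumes "finite I" "f \<in> borel_measurable (PiM I (\<lambda>_. lborel :: real measure))"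
		"g \<in> borel_measurable (PiM I (\<lambda>_. lborel))" "h \<in> borel_measurable (PiM I (\<lambda>_. lborel))"
		"\<And>x y. x \<in> I \<rightarrow>\<^sub>E UNIV \<Longrightarrow> y \<in> I \<rightarrow>\<^sub>E UNIV \<Longrightarrow> f x * g y \<le> (h (\<lambda>i\<in>I. (x i + y i) / 2) :: ennreal)^2"
	shows "(\<integral>\<^sup>+x. f x \<partial>PiM I (\<lambda>_. lborel)) * (\<integral>\<^sup>+x. g x \<partial>PiM I (\<lambda>_. lborel)) \<le> (\<integral>\<^sup>+x. h x \<partial>PiM I (\<lambda>_. lborel))^2"
	using assms
proof (induction I arbitrary: f g h)
	case empty
	then show ?case using empty.prems(4)[of "\<lambda>_. undefined" "\<lambda>_. undefined"]
		by (simp add: PiM_empty nn_integral_count_space_finite restrict_def)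
next
	case (insert i I)
	let ?P = "PiM I (\<lambda>_. lborel :: real measure)"
	let ?Q = "PiM (insert i I) (\<lambda>_. lborel :: real measure)"
	interpret I: sigma_finite_measure ?P by (rule lb.sigma_finite) fact
	have slice: "(\<lambda>x. u (x(i := s))) \<in> borel_measurable ?P" if "u \<in> borel_measurable ?Q" for u :: "('a \<Rightarrow> real) \<Rightarrow> ennreal" and s
		by (rule measurable_compose[OF _ that]) measurable
	have marg: "(\<lambda>s. \<integral>\<^sup>+x. u (x(i := s)) \<partial>?P) \<in> borel_measurable lborel" if "u \<in> borel_measurable ?Q" for u :: "('a \<Rightarrow> real) \<Rightarrow> ennreal"
	proof -
		have "(\<lambda>z. (snd z)(i := fst z)) \<in> lborel \<Otimes>\<^sub>M ?P \<rightarrow>\<^sub>M ?Q" by measurable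
		from measurable_compose[OF this that]
		have "(\<lambda>(s, x). u (x(i := s))) \<in> borel_measurable (lborel \<Otimes>\<^sub>M ?P)" by (simp add: case_prod_beta')
		then show ?thesis by (rule I.borel_measurable_nn_integral)
	qed
	have fub: "(\<integral>\<^sup>+x. u x \<partial>?Q) = (\<integral>\<^sup>+s. \<integral>\<^sup>+x. u (x(i := s)) \<partial>?P \<partial>lborel)" if "u \<in> borel_measurable ?Q" for u :: "('a \<Rightarrow> real) \<Rightarrow> ennreal"
		by (rule lb.product_nn_integral_insert_rev) (use insert that in auto)
	show ?case
		unfolding fub[OF insert.prems(1)] fub[OF insert.prems(2)] fub[OF insert.prems(3)]
	proof (rule prekopa_leindler_1d[OF marg marg marg])
		fix s t
		show "(\<integral>\<^sup>+x. f (x(i := s)) \<partial>?P) * (\<integral>\<^sup>+x. g (x(i := t)) \<partial>?P) \<le> (\<integral>\<^sup>+x. h (x(i := (s + t) / 2)) \<partial>?P)^2"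
		proof (rule insert.IH[OF slice slice slice])
			fix x y assume xy: "x \<in> I \<rightarrow>\<^sub>E (UNIV :: real set)" "y \<in> I \<rightarrow>\<^sub>E (UNIV :: real set)"
			have "x(i := s) \<in> insert i I \<rightarrow>\<^sub>E UNIV" "y(i := t) \<in> insert i I \<rightarrow>\<^sub>E UNIV"
				using xy by (auto simp: PiE_iff extensional_def)
			from insert.prems(4)[OF this]
			have "f (x(i := s)) * g (y(i := t)) \<le> (h (\<lambda>j\<in>insert i I. ((x(i := s)) j + (y(i := t)) j) / 2))^2" .
			moreover have "(\<lambda>j\<in>insert i I. ((x(i := s)) j + (y(i := t)) j) / 2) = (\<lambda>j\<in>I. (x j + y j) / 2)(i := (s + t) / 2)"
				using insert.hyps by (auto simp: fun_eq_iff)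
			ultimately show "f (x(i := s)) * g (y(i := t)) \<le> (h ((\<lambda>j\<in>I. (x j + y j) / 2)(i := (s + t) / 2)))^2" by simp
		qed (use insert.prems in auto)
	qed (use insert.prems in auto)
qed

text \<open>By the parallelogram identity the midpoint of two points of the unit ball at distance at
  least \<rho> has squared norm at most 1 - \<rho>^2 / 4. The Prekopa-Leindler inequality for
  indicators bounds the product of volumes by the squared volume of that smaller ball.\<close>

lemma ball_concentration:
	assumes A: "A \<in> sets (leb n)" and B: "B \<in> sets (leb n)"
		and ball: "\<And>x. x \<in> A \<union> B \<Longrightarrow> sqn n x \<le> 1" and \<rho>: "0 \<le> \<rho>" "\<rho> < 2"
		and far: "\<And>x y. x \<in> A \<Longrightarrow> y \<in> B \<Longrightarrow> \<rho> \<le> euc (Suc n) x y"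
	shows "measure (leb n) A * measure (leb n) B
		\<le> (1 - \<rho>^2 / 4) ^ Suc n * (measure (leb n) {x \<in> {..n} \<rightarrow>\<^sub>E UNIV. sqn n x \<le> 1})^2"
proof -
	let ?E = "leb n" and ?B = "{x \<in> {..n} \<rightarrow>\<^sub>E UNIV. sqn n x \<le> 1}"
	define t where "t = sqrt (1 - \<rho>^2 / 4)"
	have "\<rho>^2 < 2^2" using \<rho> by (intro power_strict_mono) auto
	then have t: "t > 0" "t^2 = 1 - \<rho>^2 / 4" by (simp_all add: t_def)
	let ?C = "{x \<in> {..n} \<rightarrow>\<^sub>E UNIV. sqn n x \<le> t^2}"
	have sp: "A \<subseteq> {..n} \<rightarrow>\<^sub>E UNIV" "B \<subseteq> {..n} \<rightarrow>\<^sub>E UNIV" using sets.sets_into_space[OF A] sets.sets_into_space[OF B] by auto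
	have sub: "A \<subseteq> ?B" "B \<subseteq> ?B" using ball sp by auto
	have fin: "emeasure ?E ?B < \<infinity>" using unit_ball_emeasure(2)[of n] by (simp add: top.not_eq_extremum)
	have finA: "emeasure ?E A = ennreal (measure ?E A)" "emeasure ?E B = ennreal (measure ?E B)" "emeasure ?E ?B = ennreal (measure ?E ?B)"
		using fin emeasure_mono[OF sub(1) ball_space] emeasure_mono[OF sub(2) ball_space]
		by (intro emeasure_eq_ennreal_measure; force)+
	have "(\<integral>\<^sup>+x. indicator A x \<partial>?E) * (\<integral>\<^sup>+x. indicator B x \<partial>?E) \<le> (\<integral>\<^sup>+x. indicator ?C x \<partial>?E)^2"
		unfolding euclidean_lebesgue_def
	proof (rule prekopa_leindler)
		fix x y :: "nat \<Rightarrow> real" assume xy: "x \<in> {..n} \<rightarrow>\<^sub>E UNIV" "y \<in> {..n} \<rightarrow>\<^sub>E UNIV"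
		let ?m = "\<lambda>i\<in>{..n}. (x i + y i) / 2"
		have "?m \<in> ?C" if "x \<in> A" "y \<in> B"
		proof -
			have "sqn n ?m = (\<Sum>i\<le>n. ((x i)^2 + (y i)^2) / 2 - (x i - y i)^2 / 4)"
				by (intro sum.cong refl) (auto simp: power2_eq_square field_simps)
			also have "\<dots> = (sqn n x + sqn n y) / 2 - (euc (Suc n) x y)^2 / 4"
				by (simp add: euc_power2 lessThan_Suc_atMost sum_subtractf sum.distrib flip: sum_divide_distrib)
			also have "\<dots> \<le> 1 - \<rho>^2 / 4"
			proof -
				have "\<rho>^2 \<le> (euc (Suc n) x y)^2" using far[OF that] \<rho> by (intro power_mono) auto
				moreover have "sqn n x \<le> 1" "sqn n y \<le> 1" using ball that by auto
				moreover have "(p + q) / 2 - u / 4 \<le> 1 - v / 4" if "v \<le> u" "p \<le> 1" "q \<le> 1" for p q u v :: real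
					using that by (simp add: field_simps)
				ultimately show ?thesis by blast
			qed
			finally show ?thesis using t by simp
		qed
		then show "indicator A x * indicator B y \<le> (indicator ?C ?m :: ennreal)^2"
			by (auto simp: indicator_def)
	next
		show "indicator ?C \<in> borel_measurable (PiM {..n} (\<lambda>_. lborel))"
			using ball_space[of n "t^2"] unfolding euclidean_lebesgue_def by simp
	qed (use A B in \<open>auto simp: euclidean_lebesgue_def\<close>)
	then have "emeasure ?E A * emeasure ?E B \<le> (emeasure ?E ?C)^2"
		using A B ball_space[of n "t^2"] by simp
	also have "emeasure ?E ?C = ennreal (t ^ Suc n) * emeasure ?E ?B"
	proof -
		have "emeasure ?E {x \<in> space ?E. sqn n x \<le> t^2} = ennreal (t ^ Suc n) * emeasure ?E {x \<in> space ?E. sqn n x \<le> 1}"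
			by (rule emeasure_scaled_cone[OF sets.top t(1)]) auto
		then show ?thesis unfolding space_euclidean_lebesgue .
	qed
	finally have "ennreal (measure ?E A) * ennreal (measure ?E B) \<le> (ennreal (t ^ Suc n) * ennreal (measure ?E ?B))^2"
		unfolding finA .
	then have "ennreal (measure ?E A * measure ?E B) \<le> ennreal ((t ^ Suc n * measure ?E ?B)^2)"
		using t(1) by (simp add: ennreal_mult'[symmetric] ennreal_power del: power_Suc)
	then have "measure ?E A * measure ?E B \<le> (t ^ Suc n * measure ?E ?B)^2"
		by (subst (asm) ennreal_le_iff) auto
	also have "\<dots> = (t^2) ^ Suc n * (measure ?E ?B)^2"
		by (simp add: power_mult_distrib power_mult[symmetric] mult.commute del: power_Suc)
	finally show ?thesis unfolding t(2) .
qed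

text \<open>A and B are lifted to the shell between the radii 1/2 and 1, where the projection is 2
  r-Lipschitz, so a chord r * \<theta> becomes a distance \<theta> / 2. The ball of radius 1/2 that
  is left out accounts for the term (1/2)^(n+1).\<close>

lemma sphere_concentration:
	assumes r: "r > 0" and n: "n \<ge> 1" and A: "A \<in> sets (sphere_measure n r)" and B: "B \<in> sets (sphere_measure n r)"
		and \<theta>: "0 < \<theta>" "\<theta> \<le> 1" and far: "\<And>x y. x \<in> A \<Longrightarrow> y \<in> B \<Longrightarrow> r * \<theta> \<le> euc (Suc n) x y"
		and half: "1 / 2 \<le> measure (sphere_measure n r) A"
	shows "measure (sphere_measure n r) B \<le> (1 / 2) ^ Suc n + 4 * exp (- (real (Suc n) * \<theta>^2 / 16))"
proof -
	let ?E = "leb n" and ?B = "{x \<in> {..n} \<rightarrow>\<^sub>E UNIV. sqn n x \<le> 1}"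
	let ?\<sigma> = "sphere_measure n r"
	define V where "V = measure ?E ?B"
	have fin: "emeasure ?E ?B < \<infinity>" using unit_ball_emeasure(2)[of n] by (simp add: top.not_eq_extremum)
	have V: "V > 0" using unit_ball_emeasure[of n] fin by (simp add: V_def measure_def enn2real_positive_iff zero_less_iff_neq_zero)
	have S_in: "sphere_set n r \<inter> space ?E \<in> sets ?E" using sphere_set_sets[of n r] by blast
	have "emeasure ?E {x \<in> space ?E. sqn n x \<le> (1/2)^2} = ennreal ((1/2) ^ Suc n) * emeasure ?E {x \<in> space ?E. sqn n x \<le> 1}"
		by (rule emeasure_scaled_cone[OF sets.top]) auto
	then have small: "measure ?E {x \<in> space ?E. sqn n x \<le> (1/2)^2} = (1 / 2) ^ Suc n * V"
		by (simp add: V_def measure_def enn2real_mult del: power_Suc)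
	define L where "L X = {x \<in> space ?E. radial_projection n r x \<in> X \<and> sqn n x \<le> 1 \<and> 1 / 4 \<le> sqn n x}" for X
	have XE: "X \<subseteq> sphere_set n r" "X \<in> sets ?E" if "X \<in> sets ?\<sigma>" for X
		using that unfolding sets_sphere_measure sets_restrict_space_iff[OF S_in] by auto
	have Lm: "L X \<in> sets ?E" if "X \<in> sets ?\<sigma>" for X
	proof -
		have [measurable]: "X \<in> sets ?E" using XE that by blast
		show ?thesis unfolding L_def by measurable
	qed
	have lower: "(measure ?\<sigma> X - (1/2) ^ Suc n) * V \<le> measure ?E (L X)" if X: "X \<in> sets ?\<sigma>" for X
	proof -
		let ?R = "radial_projection n r -` X \<inter> space ?E"
		have R: "?R \<in> sets ?E" by (rule measurable_sets[OF measurable_radial XE(2)[OF X]])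
		have "measure ?\<sigma> X = measure (distr (unit_ball_measure n) ?E (radial_projection n r)) X"
			unfolding sphere_measure_def by (rule measure_restrict_space) (use XE[OF X] S_in in simp_all)
		also have "\<dots> = measure (unit_ball_measure n) ?R"
			using XE[OF X] by (subst measure_distr) (auto simp: measurable_radial)
		also have "\<dots> = measure ?E (?B \<inter> ?R) / V"
			unfolding V_def by (rule measure_uniform_measure) (use unit_ball_emeasure[of n] R in auto)
		finally have "measure ?\<sigma> X * V = measure ?E (?B \<inter> ?R)" using V by simp
		also have "\<dots> \<le> measure ?E (L X \<union> {x \<in> space ?E. sqn n x \<le> (1/2)^2})"
		proof (rule measure_mono_fmeasurable)
			have c: "L X \<union> {x \<in> space ?E. sqn n x \<le> (1/2)^2} \<subseteq> ?B" by (auto simp: L_def power2_eq_square)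
			show "L X \<union> {x \<in> space ?E. sqn n x \<le> (1/2)^2} \<in> fmeasurable ?E"
				using fin ball_space[of n "(1/2)^2"] Lm[OF X] emeasure_mono[OF c ball_space] by (intro fmeasurableI) auto
			show "?B \<inter> ?R \<subseteq> L X \<union> {x \<in> space ?E. sqn n x \<le> (1/2)^2}" by (auto simp: L_def power2_eq_square)
			show "?B \<inter> ?R \<in> sets ?E" using ball_space R by blast
		qed
		also have "\<dots> \<le> measure ?E (L X) + (1/2) ^ Suc n * V"
			unfolding small[symmetric] by (rule measure_Un_le) (use Lm[OF X] ball_space[of n "(1/2)^2"] in simp_all)
		finally show ?thesis by (simp add: algebra_simps)
	qed
	have "measure ?E (L A) * measure ?E (L B) \<le> (1 - (\<theta>/2)^2 / 4) ^ Suc n * V^2"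
		unfolding V_def
	proof (rule ball_concentration[OF Lm[OF A] Lm[OF B]])
		fix x y assume xy: "x \<in> L A" "y \<in> L B"
		have sq: "1/2 \<le> sqrt (sqn n z)" "to_sphere n r z = radial_projection n r z" if "z \<in> L X" for z X
		proof -
			have q: "1/4 \<le> sqn n z" using that by (simp add: L_def)
			then have "(1/2)^2 \<le> sqn n z" by (simp add: power2_eq_square)
			then show "1/2 \<le> sqrt (sqn n z)" by (rule real_le_rsqrt)
			show "to_sphere n r z = radial_projection n r z" using q by (auto simp: to_sphere_def)
		qed
		have "r * \<theta> \<le> euc (Suc n) (to_sphere n r x) (to_sphere n r y)"
			using xy far[of "to_sphere n r x" "to_sphere n r y"] sq(2)[OF xy(1)] sq(2)[OF xy(2)] by (simp add: L_def)
		also have "\<dots> \<le> euc (Suc n) x y / (1 / (2 * r))"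
			by (rule to_sphere_lipschitz[OF r]) (use r sq(1)[OF xy(1)] sq(1)[OF xy(2)] in auto)
		finally have "r * \<theta> \<le> r * (2 * euc (Suc n) x y)" by (simp add: mult_ac)
		then show "\<theta> / 2 \<le> euc (Suc n) x y" using r by simp
	qed (use \<theta> in \<open>auto simp: L_def\<close>)
	moreover have "(1/4 * V) * ((measure ?\<sigma> B - (1/2) ^ Suc n) * V) \<le> measure ?E (L A) * measure ?E (L B)"
		if "0 \<le> measure ?\<sigma> B - (1/2) ^ Suc n"
	proof (rule mult_mono)
		\<comment> \<open>With n \<ge> 1 the discarded ball takes at most 1/4 of the volume, so the lift
		  of A keeps at least 1/4; this is the origin of the factor 4.\<close>
		have "(1/2) ^ Suc n \<le> (1/2 :: real) ^ 2" using n by (intro power_decreasing) auto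
		then have "1/4 \<le> measure ?\<sigma> A - (1/2) ^ Suc n" using half by (simp add: power2_eq_square)
		then have "1/4 * V \<le> (measure ?\<sigma> A - (1/2) ^ Suc n) * V" using V by (intro mult_right_mono) auto
		then show "1/4 * V \<le> measure ?E (L A)" using lower[OF A] by linarith
	qed (use lower[OF B] that V in auto)
	moreover have "(1 - (\<theta>/2)^2 / 4) ^ Suc n \<le> exp (- (real (Suc n) * \<theta>^2 / 16))"
	proof -
		have "1 - (\<theta>/2)^2 / 4 \<le> exp (- (\<theta>^2 / 16))" using exp_ge_add_one_self[of "- (\<theta>^2/16)"] by (simp add: power_divide)
		moreover have "\<theta>^2 \<le> 1^2" using \<theta> by (intro power_mono) auto
		ultimately have "(1 - (\<theta>/2)^2 / 4) ^ Suc n \<le> exp (- (\<theta>^2 / 16)) ^ Suc n"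
			by (intro power_mono) (auto simp: power_divide)
		also have "\<dots> = exp (real (Suc n) * - (\<theta>^2 / 16))" by (rule exp_of_nat_mult[symmetric])
		finally show ?thesis by simp
	qed
	ultimately have *: "V^2 * ((measure ?\<sigma> B - (1/2) ^ Suc n) / 4) \<le> V^2 * exp (- (real (Suc n) * \<theta>^2 / 16))"
		if "0 \<le> measure ?\<sigma> B - (1/2) ^ Suc n"
		using that mult_right_mono[of "(1 - (\<theta>/2)^2 / 4) ^ Suc n" "exp (- (real (Suc n) * \<theta>^2 / 16))" "V^2"]
		by (simp add: power2_eq_square mult_ac)
	show ?thesis
	proof (cases "0 \<le> measure ?\<sigma> B - (1/2) ^ Suc n")
		case True
		have "V^2 > 0" using V by simp
		then have "(measure ?\<sigma> B - (1/2) ^ Suc n) / 4 \<le> exp (- (real (Suc n) * \<theta>^2 / 16))"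
			using *[OF True] by (simp add: mult_le_cancel_left_pos)
		then show ?thesis by simp
	next
		case False
		have "0 \<le> exp (- (real (Suc n) * \<theta>^2 / 16))" by simp
		then show ?thesis using False by linarith
	qed
qed

text \<open>Members of \<open>Lip1\<close> are arbitrary off the support and are therefore cut off
  there. On the support, {f < a} is the trace of the balls around its points y with radius a - f
  y.\<close>

lemma (in mm_sp) measurable_Lip1:
	assumes f: "f \<in> Lip1 X"
	shows "(\<lambda>x. if x \<in> mm_support X then f x else 0) \<in> borel_measurable M"
proof -
	have SC: "mm_support X \<subseteq> C" by (auto simp: mm_support_def)
	have "(\<lambda>x. if x \<in> mm_support X then f x else 0) \<in> borel_measurable M
			\<longleftrightarrow> f \<in> borel_measurable (restrict_space M (mm_support X))"
		using measurable_restrict_space_iff[of "mm_support X" M 0 borel f] support_sets SC by (simp add: Int_absorb2)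
	moreover have "f \<in> borel_measurable (restrict_space M (mm_support X))"
		unfolding borel_measurable_iff_less
	proof
		fix a
		let ?U = "\<Union>y\<in>{y \<in> mm_support X. f y < a}. mball y (a - f y)"
		have U: "openin mtopology ?U" by auto
		have "{x \<in> space (restrict_space M (mm_support X)). f x < a} = mm_support X \<inter> ?U"
		proof (intro equalityI subsetI)
			fix x assume "x \<in> {x \<in> space (restrict_space M (mm_support X)). f x < a}"
			then have x: "x \<in> mm_support X" "f x < a" by (auto simp: space_restrict_space)
			then have "x \<in> mball x (a - f x)" using SC by auto
			then show "x \<in> mm_support X \<inter> ?U" using x by blast
		next
			fix x assume "x \<in> mm_support X \<inter> ?U"
			then obtain y where x: "x \<in> mm_support X" and y: "y \<in> mm_support X" "D y x < a - f y" by auto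
			have "\<bar>f y - f x\<bar> \<le> D y x" using f x y(1) by (auto simp: Lip1_def)
			then have "f x < a" using y(2) by linarith
			then show "x \<in> {x \<in> space (restrict_space M (mm_support X)). f x < a}" using x SC by (auto simp: space_restrict_space)
		qed
		then show "{x \<in> space (restrict_space M (mm_support X)). f x < a} \<in> sets (restrict_space M (mm_support X))"
			using open_sets[OF U] support_sets by (auto simp: sets_restrict_space)
	qed
	ultimately show ?thesis by simp
qed

text \<open>The quantile at 1/2. The second inequality needs the left limit of the distribution
  function, which is at most 1/2 by the adjunction.\<close>

lemma (in prob_space) median_exists:
	assumes [measurable]: "f \<in> borel_measurable M"
	obtains m :: real where "1 / 2 \<le> prob {x \<in> space M. f x \<le> m}" "1 / 2 \<le> prob {x \<in> space M. m \<le> f x}"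
proof -
	let ?\<nu> = "distr M borel f"
	interpret \<nu>: prob_space ?\<nu> by (rule prob_space_distr) simp
	interpret \<nu>: real_distribution ?\<nu> by (simp add: real_distribution_def real_distribution_axioms_def \<nu>.prob_space_axioms)
	obtain q where q: "\<And>s x. s \<in> {0<..<1} \<Longrightarrow> s \<le> cdf ?\<nu> x \<longleftrightarrow> q s \<le> x"
		using real_param_quantile[OF \<nu>.prob_space_axioms] by auto
	define m where "m = q (1 / 2)"
	have "1 / 2 \<le> cdf ?\<nu> m" using q[of "1/2" m] by (simp add: m_def)
	then have 1: "1 / 2 \<le> prob {x \<in> space M. f x \<le> m}"
		by (simp add: cdf_def measure_distr vimage_def Int_def conj_commute)
	have "measure ?\<nu> {..<m} \<le> 1 / 2"
	proof (rule tendsto_upperbound[OF \<nu>.cdf_at_left])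
		have "cdf ?\<nu> x \<le> 1 / 2" if "x < m" for x using q[of "1/2" x] that by (simp add: m_def not_le)
		then show "\<forall>\<^sub>F x in at_left m. cdf ?\<nu> x \<le> 1 / 2" by (auto simp: eventually_at_filter)
	qed simp
	then have "prob {x \<in> space M. f x < m} \<le> 1 / 2"
		by (simp add: measure_distr vimage_def Int_def conj_commute)
	moreover have "prob {x \<in> space M. \<not> f x < m} = 1 - prob {x \<in> space M. f x < m}"
		by (rule prob_neg) measurable
	ultimately have 2: "1 / 2 \<le> prob {x \<in> space M. m \<le> f x}" by (simp add: not_less)
	show thesis by (rule that[OF 1 2])
qed

text \<open>m is a median, and concentration is applied to each half against the set where f
  deviates by e on the other side. A deviation of e forces an arc of length e and a chord of e / 3,
  whence \<theta>; the minimum with 1 meets the range of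
  \<open>sphere_concentration\<close>.\<close>

lemma sphere_Lip1_concentration:
	fixes e :: real
	assumes r: "r > 0" and n: "n \<ge> 1" and e: "e > 0" and f: "f \<in> Lip1 (sphere_mm n r)"
	defines "\<theta> \<equiv> min (e / (3 * r)) 1"
	shows "\<exists>m. \<exists>N\<in>sets (sphere_measure n r). measure (sphere_measure n r) N \<le> 2 * ((1 / 2) ^ Suc n + 4 * exp (- (real (Suc n) * \<theta>^2 / 16)))
		\<and> (\<forall>x\<in>sphere_set n r - N. \<bar>f x - m\<bar> \<le> e)"
proof -
	interpret X: mm_sp "sphere_mm n r" by standard (rule mm_space_sphere[OF r])
	interpret prob_space "sphere_measure n r" by (rule prob_space_sphere_measure[OF r])
	let ?\<sigma> = "sphere_measure n r" and ?S = "mm_support (sphere_mm n r)"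
	define g where "g x = (if x \<in> ?S then f x else 0)" for x
	have g[measurable]: "g \<in> borel_measurable ?\<sigma>" using X.measurable_Lip1[OF f] by (simp add: g_def[abs_def])
	have S[measurable]: "?S \<in> sets ?\<sigma>" using X.support_sets by simp
	have AES: "AE x in ?\<sigma>. x \<in> ?S" using X.emeasure_support S by (simp add: AE_in_set_eq_1 measure_def)
	have Ssp: "?S \<subseteq> sphere_set n r" using sets.sets_into_space[OF S] by simp
	obtain m where m: "1 / 2 \<le> prob {x \<in> space ?\<sigma>. g x \<le> m}" "1 / 2 \<le> prob {x \<in> space ?\<sigma>. m \<le> g x}"
		by (rule median_exists[OF g])
	have half: "1 / 2 \<le> prob (Y \<inter> ?S)" if "1 / 2 \<le> prob Y" "Y \<in> sets ?\<sigma>" for Y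
	proof -
		have "prob Y = prob (Y \<inter> ?S)" by (rule finite_measure_eq_AE) (use AES that in auto)
		then show ?thesis using that by simp
	qed
	have \<theta>: "0 < \<theta>" "\<theta> \<le> 1" using e r by (auto simp: \<theta>_def)
	have far: "r * \<theta> \<le> euc (Suc n) x y" if "x \<in> ?S" "y \<in> ?S" "e \<le> \<bar>g x - g y\<bar>" for x y
	proof -
		have "e \<le> geo n r x y" using f that by (force simp: Lip1_def g_def)
		also have "\<dots> \<le> 3 * euc (Suc n) x y" by (rule geodesic_le_euc[OF r]) (use that Ssp in auto)
		finally have "e / 3 \<le> euc (Suc n) x y" by simp
		moreover have "r * \<theta> \<le> r * (e / (3 * r))" using r by (intro mult_left_mono) (auto simp: \<theta>_def)
		ultimately show ?thesis using r by simp
	qed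
	let ?N1 = "{x \<in> space ?\<sigma>. m + e \<le> g x} \<inter> ?S" and ?N2 = "{x \<in> space ?\<sigma>. g x \<le> m - e} \<inter> ?S"
	let ?b = "(1 / 2) ^ Suc n + 4 * exp (- (real (Suc n) * \<theta>^2 / 16))"
	have setsA: "{x \<in> space ?\<sigma>. g x \<le> m} \<inter> ?S \<in> sets ?\<sigma>" "{x \<in> space ?\<sigma>. m \<le> g x} \<inter> ?S \<in> sets ?\<sigma>" by measurable
	have sets: "?N1 \<in> sets ?\<sigma>" "?N2 \<in> sets ?\<sigma>" by measurable
	have N1: "prob ?N1 \<le> ?b"
	proof (rule sphere_concentration[OF r n setsA(1) sets(1) \<theta>])
		show "1 / 2 \<le> prob ({x \<in> space ?\<sigma>. g x \<le> m} \<inter> ?S)" by (rule half[OF m(1)]) measurable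
	qed (auto intro!: far)
	have N2: "prob ?N2 \<le> ?b"
	proof (rule sphere_concentration[OF r n setsA(2) sets(2) \<theta>])
		show "1 / 2 \<le> prob ({x \<in> space ?\<sigma>. m \<le> g x} \<inter> ?S)" by (rule half[OF m(2)]) measurable
	qed (auto intro!: far)
	have N3: "prob (space ?\<sigma> - ?S) = 0"
		using X.emeasure_support S by (subst prob_compl) (auto simp: measure_def)
	show ?thesis
	proof (intro exI[of _ m] bexI[of _ "?N1 \<union> ?N2 \<union> (space ?\<sigma> - ?S)"] conjI ballI)
		have "prob (?N1 \<union> ?N2 \<union> (space ?\<sigma> - ?S)) \<le> prob ?N1 + prob ?N2 + prob (space ?\<sigma> - ?S)"
			using measure_Un_le[OF sets.Un[OF sets] sets.Diff[OF sets.top S]] add_right_mono[OF measure_Un_le[OF sets]] by (rule order_trans)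
		also have "\<dots> \<le> ?b + ?b + 0" by (intro add_mono N1 N2 eq_refl[OF N3])
		finally show "prob (?N1 \<union> ?N2 \<union> (space ?\<sigma> - ?S)) \<le> 2 * ?b" by (simp only: mult_2 add_0_right)
		fix x assume x: "x \<in> sphere_set n r - (?N1 \<union> ?N2 \<union> (space ?\<sigma> - ?S))"
		then have "x \<in> ?S" by auto
		then show "\<bar>f x - m\<bar> \<le> e" using x by (auto simp: g_def abs_le_iff)
	next
		show "?N1 \<union> ?N2 \<union> (space ?\<sigma> - ?S) \<in> sets ?\<sigma>" by (intro sets.Un sets sets.Diff sets.top S)
	qed
qed

section \<open>Observable distance to the one-point space\<close>

lemma ky_fan_leI:
	assumes "e > 0" "measure lebesgue {s \<in> {0..<1}. \<bar>f s - g s\<bar> > e} \<le> e"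
	shows "ky_fan f g \<le> ennreal e"
	unfolding ky_fan_def by (rule Inf_lower) (use assms in auto)

text \<open>Pulled back to the interval, the Lipschitz functions on a point are the constants.
  Constants are Lipschitz on the sphere too, so all that counts is how close each Lipschitz function
  on the sphere is to a constant. Any choice of parameters works.\<close>

lemma d_conc_sphere_point:
	fixes e :: real
	assumes r: "r > 0" and n: "n \<ge> 1" and e: "e > 0"
	defines "\<theta> \<equiv> min (e / (3 * r)) 1"
	assumes le: "2 * ((1 / 2) ^ Suc n + 4 * exp (- (real (Suc n) * \<theta>^2 / 16))) \<le> e"
	shows "d_conc (sphere_mm n r) one_point_mm \<le> ennreal e"
proof -
	interpret X: mm_sp "sphere_mm n r" by standard (rule mm_space_sphere[OF r])
	interpret P: mm_sp one_point_mm by standard (rule mm_space_point)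
	let ?\<sigma> = "sphere_measure n r"
	obtain \<iota> where \<iota>p: "\<iota> \<in> parameters (sphere_mm n r)" using X.parameters_nonempty by blast
	obtain \<kappa> where \<kappa>: "\<kappa> \<in> parameters one_point_mm" using P.parameters_nonempty by blast
	have \<iota>: "\<iota> \<in> U01 \<rightarrow>\<^sub>M ?\<sigma>" "distr U01 ?\<sigma> \<iota> = ?\<sigma>"
		using \<iota>p by (simp_all add: parameters_def)
	have "hausdorff_ky_fan ((\<lambda>f. f \<circ> \<iota>) ` Lip1 (sphere_mm n r)) ((\<lambda>f. f \<circ> \<kappa>) ` Lip1 one_point_mm) \<le> ennreal e"
		unfolding hausdorff_ky_fan_def
	proof (rule max.boundedI; rule SUP_least)
		fix h assume "h \<in> (\<lambda>f. f \<circ> \<iota>) ` Lip1 (sphere_mm n r)"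
		then obtain f where f: "f \<in> Lip1 (sphere_mm n r)" and h: "h = f \<circ> \<iota>" by blast
		obtain m N where N: "N \<in> sets ?\<sigma>" "measure ?\<sigma> N \<le> e" "\<And>x. x \<in> sphere_set n r - N \<Longrightarrow> \<bar>f x - m\<bar> \<le> e"
			using sphere_Lip1_concentration[OF r n e f] le unfolding \<theta>_def by force
		let ?T = "{s \<in> {0..<1}. \<bar>h s - m\<bar> > e}" and ?N = "\<iota> -` N \<inter> {0..<1}"
		have "?N \<in> sets U01" using measurable_sets[OF \<iota>(1) N(1)] by (simp add: space_restrict_space)
		then have Nb: "?N \<in> sets lborel" by (simp add: sets_restrict_space_iff)
		have sub: "?T \<subseteq> ?N"
		proof
			fix s assume s: "s \<in> ?T"
			have "\<iota> s \<in> sphere_set n r" using measurable_space[OF \<iota>(1), of s] s by (simp add: space_restrict_space)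
			then show "s \<in> ?N" using N(3)[of "\<iota> s"] s by (auto simp: h)
		qed
		\<comment> \<open>If ?T is not Lebesgue measurable, its \<open>measure\<close> is 0 by convention
		  and the bound is trivial.\<close>
		have "measure lebesgue ?T \<le> measure lebesgue ?N"
		proof (cases "?T \<in> sets lebesgue")
			case True
			have "emeasure lebesgue ?N \<le> emeasure lebesgue {0..<1::real}" by (rule emeasure_mono) auto
			then have "emeasure lebesgue ?N < \<infinity>" by (rule order_le_less_trans) simp
			then have "?N \<in> fmeasurable lebesgue" using sets_completionI_sets[OF Nb] by (rule fmeasurableI[rotated])
			then show ?thesis by (rule measure_mono_fmeasurable[OF sub True])
		qed (simp add: measure_notin_sets)
		also have "\<dots> = measure lborel ?N" using Nb by simp
		also have "\<dots> = measure U01 ?N" by (rule measure_restrict_space[symmetric]) auto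
		also have "\<dots> = measure (distr U01 ?\<sigma> \<iota>) N"
			by (subst measure_distr[OF \<iota>(1) N(1)]) (simp add: space_restrict_space)
		also have "\<dots> \<le> e" unfolding \<iota>(2) by (rule N(2))
		finally have "ky_fan h (\<lambda>_. m) \<le> ennreal e" by (intro ky_fan_leI e) simp
		moreover have "(\<lambda>_. m) \<in> (\<lambda>f. f \<circ> \<kappa>) ` Lip1 one_point_mm"
			by (rule image_eqI[of _ _ "\<lambda>_. m"]) (auto simp: Lip1_def one_point_mm_def)
		ultimately show "(INF g\<in>(\<lambda>f. f \<circ> \<kappa>) ` Lip1 one_point_mm. ky_fan h g) \<le> ennreal e" by (rule INF_lower2[rotated])
	next
		fix g assume "g \<in> (\<lambda>f. f \<circ> \<kappa>) ` Lip1 one_point_mm"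
		then obtain c where g: "g = (\<lambda>_. c)" by (auto simp: fun_eq_iff)
		have "ky_fan (\<lambda>_. c) g \<le> ennreal e" by (rule ky_fan_leI[OF e]) (use e in \<open>simp add: g\<close>)
		moreover have "(\<lambda>_. c) \<in> (\<lambda>f. f \<circ> \<iota>) ` Lip1 (sphere_mm n r)"
		proof (rule image_eqI[of _ _ "\<lambda>_. c"])
			show "(\<lambda>_. c) \<in> Lip1 (sphere_mm n r)" using X.nonneg by (auto simp: Lip1_def)
		qed auto
		ultimately show "(INF f\<in>(\<lambda>f. f \<circ> \<iota>) ` Lip1 (sphere_mm n r). ky_fan f g) \<le> ennreal e" by (rule INF_lower2[rotated])
	qed
	moreover have "d_conc (sphere_mm n r) one_point_mm \<le> hausdorff_ky_fan ((\<lambda>f. f \<circ> \<iota>) ` Lip1 (sphere_mm n r)) ((\<lambda>f. f \<circ> \<kappa>) ` Lip1 one_point_mm)"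
		unfolding d_conc_def by (rule INF_lower2[OF \<iota>p INF_lower[OF \<kappa>]])
	ultimately show ?thesis by (rule order_trans[rotated])
qed

theorem sphere_converges_point:
	assumes r: "\<And>n. r n > 0" and lim: "(\<lambda>n. r n / sqrt (real n)) \<longlonglongrightarrow> 0"
	shows "(\<lambda>n. d_conc (sphere_mm n (r n)) one_point_mm) \<longlonglongrightarrow> 0"
proof (rule order_tendstoI)
	fix a :: ennreal assume a: "0 < a"
	obtain d where d: "d > 0" "ennreal d \<le> a" by (rule ennreal_pos_real[OF a])
	define \<epsilon> where "\<epsilon> = d / 2"
	have "ennreal \<epsilon> < ennreal d" using d(1) by (simp add: \<epsilon>_def ennreal_less_iff)
	then have \<epsilon>: "\<epsilon> > 0" "ennreal \<epsilon> < a" using d by (auto simp: \<epsilon>_def)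
	define \<theta> where "\<theta> n = min (\<epsilon> / (3 * r n)) 1" for n
	have inf: "filterlim (\<lambda>n. real (Suc n) * (\<theta> n)^2 / 16) at_top sequentially"
		unfolding filterlim_at_top
	proof
		fix K :: real
		\<comment> \<open>It suffices to have sqrt c \<le> sqrt n * \<theta>. The two branches of the
		  minimum in \<theta> are handled by r / sqrt n tending to 0 and by n \<ge> c; the added 1 keeps c
		  positive.\<close>
		define c where "c = 16 * \<bar>K\<bar> + 1"
		have c: "c > 0" by (simp add: c_def)
		have "\<forall>\<^sub>F n in sequentially. r n / sqrt (real n) < \<epsilon> / (3 * sqrt c)"
			by (rule order_tendstoD(2)[OF lim]) (use \<epsilon> c in simp)
		moreover have "\<forall>\<^sub>F n in sequentially. c \<le> real n" using filterlim_real_sequentially by (simp add: filterlim_at_top)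
		ultimately show "\<forall>\<^sub>F n in sequentially. K \<le> real (Suc n) * (\<theta> n)^2 / 16"
			using eventually_gt_at_top[of 0]
		proof eventually_elim
			case (elim n)
			have "r n * (3 * sqrt c) < \<epsilon> * sqrt (real n)" using elim(1,3) c by (simp add: field_simps)
			then have 1: "sqrt c \<le> sqrt (real n) * (\<epsilon> / (3 * r n))" using r[of n] by (simp add: field_simps)
			have 2: "sqrt c \<le> sqrt (real n)" using elim(2) by simp
			have "sqrt c \<le> sqrt (real n) * \<theta> n" using 1 2 unfolding \<theta>_def min_def by auto
			then have "(sqrt c)^2 \<le> (sqrt (real n) * \<theta> n)^2" using c by (intro power_mono) auto
			then have "c \<le> real n * (\<theta> n)^2" using c by (simp add: power_mult_distrib)
			also have "\<dots> \<le> real (Suc n) * (\<theta> n)^2" by (intro mult_right_mono) auto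
			finally show ?case by (simp add: c_def)
		qed
	qed
	have "(\<lambda>n. 2 * ((1 / 2) ^ Suc n + 4 * exp (- (real (Suc n) * (\<theta> n)^2 / 16)))) \<longlonglongrightarrow> 2 * (0 + 4 * 0)"
	proof (intro tendsto_mult tendsto_add tendsto_const)
		show "(\<lambda>n. (1 / 2 :: real) ^ Suc n) \<longlonglongrightarrow> 0" by (rule LIMSEQ_Suc) (rule LIMSEQ_power_zero, simp)
		show "(\<lambda>n. exp (- (real (Suc n) * (\<theta> n)^2 / 16))) \<longlonglongrightarrow> 0"
			by (rule filterlim_compose[OF exp_at_bot]) (use inf in \<open>simp add: filterlim_uminus_at_bot\<close>)
	qed
	then have "\<forall>\<^sub>F n in sequentially. 2 * ((1 / 2) ^ Suc n + 4 * exp (- (real (Suc n) * (\<theta> n)^2 / 16))) < \<epsilon>"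
		by (rule order_tendstoD(2)) (use \<epsilon> in simp)
	then show "\<forall>\<^sub>F n in sequentially. d_conc (sphere_mm n (r n)) one_point_mm < a"
		using eventually_ge_at_top[of 1]
	proof eventually_elim
		case (elim n)
		then have "d_conc (sphere_mm n (r n)) one_point_mm \<le> ennreal \<epsilon>"
			by (intro d_conc_sphere_point r \<epsilon>(1)) (auto simp: \<theta>_def)
		then show ?case using \<epsilon>(2) by (rule order_le_less_trans)
	qed
qed simp

section \<open>Abstract Wiener spaces\<close>

text \<open>Used twice: integrands are bounded on each \<open>K m\<close>, which makes vector-valued
  integrals available, and an injective continuous map has a measurable inverse on the
  union.\<close>

lemma tight_sequence:
	fixes \<mu> :: "'a::polish_space measure"
	assumes "prob_space \<mu>" "sets \<mu> = sets borel"
	obtains K :: "nat \<Rightarrow> 'a set" where "\<And>m. compact (K m)" "incseq K" "emeasure \<mu> (\<Union>m. K m) = 1"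
proof -
	interpret prob_space \<mu> by fact
	have sp: "space \<mu> = UNIV" using sets_eq_imp_space_eq[OF assms(2)] by simp
	have "\<exists>L. compact L \<and> ennreal (1 - 1 / real (Suc m)) < emeasure \<mu> L" for m
	proof -
		have "emeasure \<mu> UNIV = (SUP L\<in>{L. L \<subseteq> UNIV \<and> compact L}. emeasure \<mu> L)"
			by (rule inner_regular) (use assms sp in auto)
		moreover have "ennreal (1 - 1 / real (Suc m)) < 1" by (subst ennreal_less_one_iff) simp
		ultimately have "ennreal (1 - 1 / real (Suc m)) < (SUP L\<in>{L. L \<subseteq> UNIV \<and> compact L}. emeasure \<mu> L)"
			using emeasure_space_1 sp by simp
		then show ?thesis by (auto simp: less_SUP_iff)
	qed
	then obtain L where L: "\<And>m. compact (L m)" "\<And>m. ennreal (1 - 1 / real (Suc m)) < emeasure \<mu> (L m)" by metis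
	define K where "K m = (\<Union>l\<le>m. L l)" for m
	have Kb: "(\<Union>m. K m) \<in> sets \<mu>"
		unfolding assms(2) K_def using L(1) by (intro sets.countable_UN' sets.finite_UN) (auto intro: borel_closed compact_imp_closed)
	show thesis
	proof
		show "compact (K m)" for m unfolding K_def using L(1) by (intro compact_UN) auto
		show "incseq K" by (auto simp: incseq_def K_def intro: order_trans)
		show "emeasure \<mu> (\<Union>m. K m) = 1"
		proof (rule antisym)
			show "emeasure \<mu> (\<Union>m. K m) \<le> 1" by (rule subprob_emeasure_le_1)
			have "(\<lambda>m. ennreal (1 - 1 / real (Suc m))) \<longlonglongrightarrow> ennreal (1 - 0)"
				by (intro tendsto_ennrealI tendsto_diff tendsto_const LIMSEQ_Suc[OF lim_1_over_n])
			then have "ennreal (1 - 0) \<le> emeasure \<mu> (\<Union>m. K m)"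
			proof (rule tendsto_upperbound)
				have "ennreal (1 - 1 / real (Suc m)) \<le> emeasure \<mu> (\<Union>m. K m)" for m
				proof -
					have "L m \<subseteq> (\<Union>m. K m)" by (auto simp: K_def)
					then have "emeasure \<mu> (L m) \<le> emeasure \<mu> (\<Union>m. K m)" by (rule emeasure_mono) (rule Kb)
					then show ?thesis using L(2)[of m] by simp
				qed
				then show "\<forall>\<^sub>F m in sequentially. ennreal (1 - 1 / real (Suc m)) \<le> emeasure \<mu> (\<Union>m. K m)" by simp
			qed simp
			then show "1 \<le> emeasure \<mu> (\<Union>m. K m)" by simp
		qed
	qed
qed

section \<open>Functionals and their Cameron-Martin representatives\<close>

locale wiener =
	fixes i :: "'h::{real_inner, polish_space} \<Rightarrow> 'w::{banach, polish_space}" and \<mu> :: "'w measure"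
	assumes aws: "abstract_wiener_space i \<mu>"
begin

lemma embedding: "bounded_linear i" "inj i" "closure (range i) = UNIV"
	and range_embedding: "range i = {w. cameron_martin_norm \<mu> w < \<infinity>}"
	and norm_embedding: "cameron_martin_norm \<mu> (i h) = ennreal (norm h)"
	and sets_mu [measurable_cong, simp]: "sets \<mu> = sets borel"
	and gaussian_law: "bounded_linear f \<Longrightarrow> centred_gaussian_real (distr \<mu> borel f)"
	using aws by (auto simp: abstract_wiener_space_def centred_gaussian_def)

sublocale prob_space \<mu>
	using aws by (simp add: abstract_wiener_space_def centred_gaussian_def)

lemma space_mu [simp]: "space \<mu> = UNIV"
	using sets_eq_imp_space_eq[OF sets_mu] by simp

lemma measurable_functional: "bounded_linear f \<Longrightarrow> f \<in> borel_measurable \<mu>" for f :: "'w \<Rightarrow> real"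
	by (subst measurable_cong_sets[OF sets_mu refl])
		(intro borel_measurable_continuous_onI continuous_at_imp_continuous_on ballI linear_continuous_at)

text \<open>The degenerate law is a separate case, since a point mass has no normal density.\<close>

lemma functional_law:
	fixes f :: "'w \<Rightarrow> real"
	assumes f: "bounded_linear f"
	shows "integrable \<mu> (\<lambda>w. (f w)^2)"
		and "(distr \<mu> borel f = return borel 0 \<and> (\<integral>w. (f w)^2 \<partial>\<mu>) = 0) \<or>
			(\<exists>\<sigma>>0. distr \<mu> borel f = density lborel (normal_density 0 \<sigma>) \<and> (\<integral>w. (f w)^2 \<partial>\<mu>) = \<sigma>^2)"
proof -
	have m[measurable]: "f \<in> borel_measurable \<mu>" by (rule measurable_functional[OF f])
	have tr: "integrable \<mu> (\<lambda>w. (f w)^2) \<longleftrightarrow> integrable (distr \<mu> borel f) (\<lambda>x. x^2)"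
		"(\<integral>w. (f w)^2 \<partial>\<mu>) = (\<integral>x. x^2 \<partial>distr \<mu> borel f)"
		by (simp_all add: integrable_distr_eq integral_distr)
	have "integrable \<mu> (\<lambda>w. (f w)^2) \<and> ((distr \<mu> borel f = return borel 0 \<and> (\<integral>w. (f w)^2 \<partial>\<mu>) = 0) \<or>
			(\<exists>\<sigma>>0. distr \<mu> borel f = density lborel (normal_density 0 \<sigma>) \<and> (\<integral>w. (f w)^2 \<partial>\<mu>) = \<sigma>^2))"
	proof (cases "distr \<mu> borel f = return borel 0")
		case True
		then show ?thesis unfolding tr by (simp add: integral_return integrable_iff_bounded nn_integral_return)
	next
		case False
		then obtain \<sigma> where \<sigma>: "\<sigma> > 0" "distr \<mu> borel f = density lborel (normal_density 0 \<sigma>)"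
			using gaussian_law[OF f] by (auto simp: centred_gaussian_real_def)
		have "integrable lborel (\<lambda>x. normal_density 0 \<sigma> x * x^2)" using integrable_normal_moment[OF \<sigma>(1), of 0 2] by simp
		moreover have "(\<integral>x. normal_density 0 \<sigma> x * x^2 \<partial>lborel) = \<sigma>^2"
			using integral_normal_moment_even[OF \<sigma>(1), of 0 1] \<sigma>(1) by (simp add: fact_numeral)
		ultimately show ?thesis
			unfolding tr \<sigma>(2) using \<sigma>(1)
			by (auto simp: integrable_density integral_density normal_density_nonneg intro!: exI[of _ \<sigma>])
	qed
	then show "integrable \<mu> (\<lambda>w. (f w)^2)"
		"(distr \<mu> borel f = return borel 0 \<and> (\<integral>w. (f w)^2 \<partial>\<mu>) = 0) \<or>
			(\<exists>\<sigma>>0. distr \<mu> borel f = density lborel (normal_density 0 \<sigma>) \<and> (\<integral>w. (f w)^2 \<partial>\<mu>) = \<sigma>^2)" by blast+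
qed

lemma integrable_product:
	assumes f: "bounded_linear f" and g: "bounded_linear g"
	shows "integrable \<mu> (\<lambda>w. f w * g w :: real)"
proof (rule Bochner_Integration.integrable_bound)
	show "integrable \<mu> (\<lambda>w. (f w)^2 + (g w)^2)" using functional_law(1)[OF f] functional_law(1)[OF g] by simp
	show "(\<lambda>w. f w * g w) \<in> borel_measurable \<mu>"
		using measurable_functional[OF f] measurable_functional[OF g] by simp
	have "\<bar>f w * g w\<bar> \<le> (f w)^2 + (g w)^2" for w
	proof -
		have "0 \<le> \<bar>f w\<bar> * \<bar>g w\<bar>" by simp
		moreover have "2 * (\<bar>f w\<bar> * \<bar>g w\<bar>) \<le> (f w)^2 + (g w)^2"
			using sum_squares_bound[of "\<bar>f w\<bar>" "\<bar>g w\<bar>"] by (simp add: mult.assoc)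
		ultimately show ?thesis unfolding abs_mult by linarith
	qed
	then show "AE w in \<mu>. norm (f w * g w) \<le> norm ((f w)^2 + (g w)^2)" by (intro AE_I2) simp
qed

lemma functional_bound:
	fixes f :: "'w \<Rightarrow> real"
	assumes f: "bounded_linear f" and s: "s > 0" "(\<integral>w. (f w)^2 \<partial>\<mu>) \<le> s^2"
	shows "f (i h) \<le> s * norm h"
proof -
	let ?g = "\<lambda>w. f w / s"
	have "(\<integral>\<^sup>+w. ennreal ((?g w)^2) \<partial>\<mu>) = ennreal (\<integral>w. (?g w)^2 \<partial>\<mu>)"
		using functional_law(1)[OF f] by (intro nn_integral_eq_integral) (simp_all add: power_divide)
	also have "\<dots> \<le> 1" using s by (simp add: power_divide)
	finally have "?g \<in> {f. bounded_linear f \<and> (\<integral>\<^sup>+w. ennreal ((f w)^2) \<partial>\<mu>) \<le> 1}"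
		using bounded_linear_compose[OF bounded_linear_divide f] by simp
	then have "ennreal (?g (i h)) \<le> cameron_martin_norm \<mu> (i h)"
		unfolding cameron_martin_norm_def by (rule SUP_upper)
	then have "f (i h) / s \<le> norm h" unfolding norm_embedding by (simp add: ennreal_le_iff)
	then show ?thesis using s(1) by (simp add: divide_le_eq mult.commute)
qed

lemma cameron_martin_norm_leI:
	assumes "\<And>f. bounded_linear f \<Longrightarrow> (\<integral>w. (f w)^2 \<partial>\<mu>) \<le> 1 \<Longrightarrow> f v \<le> s"
	shows "cameron_martin_norm \<mu> v \<le> ennreal s"
	unfolding cameron_martin_norm_def
proof (rule SUP_least)
	fix f :: "'w \<Rightarrow> real" assume "f \<in> {f. bounded_linear f \<and> (\<integral>\<^sup>+w. ennreal ((f w)^2) \<partial>\<mu>) \<le> 1}"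
	then have f: "bounded_linear f" "(\<integral>\<^sup>+w. ennreal ((f w)^2) \<partial>\<mu>) \<le> 1" by auto
	then have "ennreal (\<integral>w. (f w)^2 \<partial>\<mu>) \<le> 1"
		using nn_integral_eq_integral[OF functional_law(1)[OF f(1)]] by simp
	then show "ennreal (f v) \<le> ennreal s" using assms[OF f(1)] by (intro ennreal_leI) simp
qed

text \<open>If all functionals vanish at w, its Cameron-Martin norm is 0. Being finite, it puts w
  into the range of the embedding, and the preimage has norm 0.\<close>

lemma functionals_separate:
	assumes "\<And>f :: 'w \<Rightarrow> real. bounded_linear f \<Longrightarrow> f w = 0"
	shows "w = 0"
proof -
	have z: "cameron_martin_norm \<mu> w \<le> ennreal 0" by (rule cameron_martin_norm_leI) (simp add: assms)
	then have "w \<in> range i" unfolding range_embedding by (simp add: le_zero_eq)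
	then obtain h where h: "w = i h" by blast
	then have "h = 0" using z norm_embedding[of h] by simp
	then show ?thesis using h linear_simps(3)[OF embedding(1)] by simp
qed

lemma functional_eq_0:
	fixes f :: "'w \<Rightarrow> real"
	assumes f: "bounded_linear f" and "\<And>h. f (i h) = 0"
	shows "f w = 0"
proof -
	have "closed {w. f w = 0}"
		using f by (intro closed_Collect_eq continuous_on_const linear_continuous_on)
	moreover have "range i \<subseteq> {w. f w = 0}" using assms(2) by auto
	ultimately have "closure (range i) \<subseteq> {w. f w = 0}" by (rule closure_minimal[rotated])
	then show ?thesis using embedding(3) by auto
qed

text \<open>The open sets where some functional does not vanish cover everything except 0; by the
  Lindelof property countably many of them suffice. The zero functional is added so that the family
  can be enumerated even if it is empty.\<close>

lemma separating_sequence: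
	obtains g :: "nat \<Rightarrow> 'w \<Rightarrow> real" where "\<And>m. bounded_linear (g m)" "\<And>w. (\<And>m. g m w = 0) \<Longrightarrow> w = 0"
proof -
	let ?B = "{f :: 'w \<Rightarrow> real. bounded_linear f}"
	let ?U = "\<lambda>f :: 'w \<Rightarrow> real. {w. f w \<noteq> 0}"
	have "open S" if "S \<in> ?U ` ?B" for S
		using that by (auto intro!: open_Collect_neq continuous_on_const linear_continuous_on)
	then obtain F where F: "F \<subseteq> ?U ` ?B" "countable F" "\<Union>F = \<Union>(?U ` ?B)" by (rule Lindelof)
	then have "\<exists>G. countable G \<and> G \<subseteq> ?B \<and> F = ?U ` G" using countable_subset_image[of F ?U ?B] by simp
	then obtain G where G: "G \<subseteq> ?B" "countable G" "F = ?U ` G" by (elim exE conjE)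
	have z: "(\<lambda>_. 0) \<in> ?B" by (simp add: bounded_linear_zero)
	have range: "range (from_nat_into (insert (\<lambda>_. 0) G)) = insert (\<lambda>_. 0) G" using G(2) by (intro range_from_nat_into) auto
	show thesis
	proof (rule that[of "from_nat_into (insert (\<lambda>_. 0) G)"])
		fix m
		have "\<forall>f\<in>insert (\<lambda>_. 0) G. bounded_linear f" using G(1) z by auto
		moreover have "from_nat_into (insert (\<lambda>_. 0) G) m \<in> insert (\<lambda>_. 0) G" by (rule from_nat_into) simp
		ultimately show "bounded_linear (from_nat_into (insert (\<lambda>_. 0) G) m)" by (rule bspec)
	next
		fix w assume w: "\<And>m. from_nat_into (insert (\<lambda>_. 0) G) m w = 0"
		have "f w = 0" if "f \<in> G" for f
		proof -
			have "f \<in> range (from_nat_into (insert (\<lambda>_. 0) G))" unfolding range using that by simp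
			then show ?thesis using w by auto
		qed
		then have "w \<notin> \<Union>F" using G(3) by auto
		then show "w = 0" unfolding F(3) by (intro functionals_separate) auto
	qed
qed

text \<open>The Cauchy-Schwarz inequality in the measure with weight a, used as 2 g f \<le> s g^2 +
  f^2 / s. The weights in use are the indicators of a compact set and of the difference of two, and
  the constant 1.\<close>

lemma cameron_martin_norm_weighted_le:
	fixes f a :: "'w \<Rightarrow> real"
	assumes f: "bounded_linear f" and s: "s > 0" and a: "\<And>w. 0 \<le> a w" "\<And>w. a w \<le> 1" "a \<in> borel_measurable \<mu>"
		and u: "\<And>g :: 'w \<Rightarrow> real. bounded_linear g \<Longrightarrow> g u = (\<integral>w. a w * (g w * f w) \<partial>\<mu>)"
		and le: "(\<integral>w. a w * (f w)^2 \<partial>\<mu>) \<le> s^2"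
	shows "cameron_martin_norm \<mu> u \<le> ennreal s"
proof (rule cameron_martin_norm_leI)
	fix g :: "'w \<Rightarrow> real" assume g: "bounded_linear g" "(\<integral>w. (g w)^2 \<partial>\<mu>) \<le> 1"
	note [measurable] = a(3) measurable_functional[OF f] measurable_functional[OF g(1)]
	have i1: "integrable \<mu> (\<lambda>w. a w * (f w)^2)"
		by (rule Bochner_Integration.integrable_bound[OF functional_law(1)[OF f]]) (use a in \<open>auto simp: abs_mult intro!: AE_I2 mult_left_le_one_le\<close>)
	have i2: "integrable \<mu> (\<lambda>w. a w * (g w * f w))"
		by (rule Bochner_Integration.integrable_bound[OF integrable_product[OF g(1) f]]) (use a in \<open>auto simp: abs_mult intro!: AE_I2 mult_left_le_one_le\<close>)
	have pt: "a w * (g w * f w) \<le> (s * (g w)^2 + a w * (f w)^2 / s) / 2" for w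
	proof -
		have "0 \<le> (s * g w - f w)^2" by simp
		then have "2 * s * (g w * f w) \<le> s^2 * (g w)^2 + (f w)^2" by (simp add: power2_eq_square algebra_simps)
		then have "g w * f w \<le> (s * (g w)^2 + (f w)^2 / s) / 2" using s by (simp add: field_simps power2_eq_square)
		then have "a w * (g w * f w) \<le> a w * ((s * (g w)^2 + (f w)^2 / s) / 2)" by (rule mult_left_mono) (rule a(1))
		also have "\<dots> = (a w * (s * (g w)^2) + a w * (f w)^2 / s) / 2" by (simp add: algebra_simps)
		also have "a w * (s * (g w)^2) \<le> s * (g w)^2" using a(1)[of w] a(2)[of w] s by (intro mult_left_le_one_le) auto
		finally show ?thesis by simp
	qed
	have "g u \<le> (\<integral>w. (s * (g w)^2 + a w * (f w)^2 / s) / 2 \<partial>\<mu>)"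
		unfolding u[OF g(1)] by (rule integral_mono[OF i2 _ pt]) (use i1 functional_law(1)[OF g(1)] in auto)
	also have "\<dots> = (s * (\<integral>w. (g w)^2 \<partial>\<mu>) + (\<integral>w. a w * (f w)^2 \<partial>\<mu>) / s) / 2"
		using i1 functional_law(1)[OF g(1)] by simp
	also have "\<dots> \<le> (s * 1 + s^2 / s) / 2"
		using s g(2) le by (intro divide_right_mono add_mono mult_left_mono) auto
	also have "\<dots> = s" using s by (simp add: power2_eq_square)
	finally show "g u \<le> s" .
qed

text \<open>h stands for the Bochner integral of \<open>f w *\<^sub>R w\<close>. It is taken over
  the compact sets \<open>K m\<close>, where the integrand is bounded. The weighted bound shows that
  these integrals lie in the range of the embedding and that their preimages form a Cauchy sequence,
  because the second moment of f outside \<open>K m\<close> tends to 0.\<close>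

lemma representing_vector:
	fixes f :: "'w \<Rightarrow> real"
	assumes f: "bounded_linear f"
	shows "\<exists>h. \<forall>g::'w \<Rightarrow> real. bounded_linear g \<longrightarrow> g (i h) = (\<integral>w. g w * f w \<partial>\<mu>)"
proof -
	obtain K :: "nat \<Rightarrow> 'w set" where K: "\<And>m. compact (K m)" "incseq K" "emeasure \<mu> (\<Union>m. K m) = 1"
		by (rule tight_sequence[OF prob_space_axioms sets_mu]) blast
	have Kb[measurable]: "K m \<in> sets borel" for m using K(1) by (simp add: borel_closed compact_imp_closed)
	have [measurable]: "f \<in> borel_measurable \<mu>" by (rule measurable_functional[OF f])
	have AEK: "AE w in \<mu>. \<exists>m. w \<in> K m"
	proof -
		have U: "(\<Union>m. K m) \<in> sets \<mu>" by (intro sets.countable_UN') auto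
		show ?thesis using AE_in_set_eq_1[OF U] K(3) by (simp add: measure_def)
	qed
	define F where "F m w = (indicator (K m) w :: real) *\<^sub>R (f w *\<^sub>R w)" for m w
	have int: "integrable \<mu> (F m)" for m
	proof -
		have "continuous_on (K m) (\<lambda>w. f w *\<^sub>R w)"
			using f by (intro continuous_intros linear_continuous_on)
		then have "compact ((\<lambda>w. f w *\<^sub>R w) ` K m)" by (rule compact_continuous_image[OF _ K(1)])
		then have "bounded ((\<lambda>w. f w *\<^sub>R w) ` K m)" by (rule compact_imp_bounded)
		then obtain B where "\<forall>x\<in>(\<lambda>w. f w *\<^sub>R w) ` K m. norm x \<le> B" unfolding bounded_iff by (elim exE)
		then have B: "norm (f w *\<^sub>R w) \<le> B" if "w \<in> K m" for w using that by blast
		show ?thesis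
		proof (rule integrable_const_bound[where B = "max B 0"])
			show "AE w in \<mu>. norm (F m w) \<le> max B 0"
			proof (intro AE_I2)
				fix w show "norm (F m w) \<le> max B 0" using B[of w] unfolding F_def by (cases "w \<in> K m") auto
			qed
			show "F m \<in> borel_measurable \<mu>" unfolding F_def[abs_def] by measurable
		qed
	qed
	define v where "v m = integral\<^sup>L \<mu> (F m)" for m
	have gv: "g (v m) = (\<integral>w. indicator (K m) w * (g w * f w) \<partial>\<mu>)" if g: "bounded_linear g" for g :: "'w \<Rightarrow> real" and m
		unfolding v_def integral_bounded_linear[OF g int, symmetric] F_def
		by (simp add: linear_simps(5)[OF g] mult_ac)
	have gfi: "integrable \<mu> (\<lambda>w. indicator (K m) w * (g w * f w))" if g: "bounded_linear g" for g and m
		using integrable_real_mult_indicator[OF _ integrable_product[OF g f], of "K m"] by (simp add: mult.commute)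
	have ffi: "integrable \<mu> (\<lambda>w. (1 - indicator (K m) w) * (f w)^2)" for m
		using integrable_real_mult_indicator[OF _ functional_law(1)[OF f], of "- K m"]
		by (simp add: mult.commute indicator_compl)
	have "v m \<in> range i" for m
	proof -
		\<comment> \<open>The summand 1 makes s positive even if the integral vanishes; at this point only
		  finiteness of the norm matters.\<close>
		define s where "s = sqrt ((\<integral>w. indicator (K m) w * (f w)^2 \<partial>\<mu>)) + 1"
		have nn: "0 \<le> (\<integral>w. indicator (K m) w * (f w)^2 \<partial>\<mu>)" by (rule Bochner_Integration.integral_nonneg) auto
		have s: "s > 0" "sqrt (\<integral>w. indicator (K m) w * (f w)^2 \<partial>\<mu>) \<le> s" using nn by (simp_all add: s_def add_nonneg_pos)
		have "cameron_martin_norm \<mu> (v m) \<le> ennreal s"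
			by (rule cameron_martin_norm_weighted_le[OF f, where s = s and a = "indicator (K m)"]) (use s gv sqrt_le_D[OF s(2)] in \<open>auto simp: indicator_def\<close>)
		then show ?thesis unfolding range_embedding by (simp add: order_le_less_trans)
	qed
	then have "\<forall>m. \<exists>x. v m = i x" by blast
	then obtain h where h: "\<And>m. v m = i (h m)" by (auto dest: choice)
	define e where "e m = (\<integral>w. (1 - indicator (K m) w) * (f w)^2 \<partial>\<mu>)" for m
	have e0: "e \<longlonglongrightarrow> 0"
	proof -
		have "e \<longlonglongrightarrow> (\<integral>w. 0 \<partial>\<mu>)"
			unfolding e_def
		proof (rule integral_dominated_convergence[where w = "\<lambda>w. (f w)^2"])
			show "AE w in \<mu>. (\<lambda>m. (1 - indicator (K m) w) * (f w)^2) \<longlonglongrightarrow> 0"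
				using AEK
			proof eventually_elim
				case (elim w)
				then obtain m0 where "w \<in> K m0" by blast
				then have "w \<in> K m" if "m \<ge> m0" for m using K(2) that by (auto simp: incseq_def)
				then have "\<forall>\<^sub>F m in sequentially. (1 - indicator (K m) w) * (f w)^2 = 0"
					by (auto simp: eventually_sequentially intro!: exI[of _ m0])
				then show ?case by (rule tendsto_eventually)
			qed
		qed (use functional_law(1)[OF f] in \<open>auto simp: indicator_def\<close>)
		then show ?thesis by simp
	qed
	have diff: "norm (h n - h m) \<le> s" if s: "s > 0" "e m \<le> s^2" and nm: "m \<le> n" for s n m
	proof -
		have sub: "K m \<subseteq> K n" using K(2) nm by (auto simp: incseq_def)
		have "cameron_martin_norm \<mu> (i (h n - h m)) \<le> ennreal s"
		proof (rule cameron_martin_norm_weighted_le[OF f s(1), where a = "indicator (K n - K m)"])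
			fix g :: "'w \<Rightarrow> real" assume g: "bounded_linear g"
			have "g (i (h n - h m)) = g (v n) - g (v m)"
				by (simp add: h linear_simps(2)[OF g] linear_simps(2)[OF embedding(1)])
			also have "\<dots> = (\<integral>w. indicator (K n) w * (g w * f w) - indicator (K m) w * (g w * f w) \<partial>\<mu>)"
				unfolding gv[OF g] by (rule Bochner_Integration.integral_diff[symmetric]) (rule gfi[OF g])+
			also have "\<dots> = (\<integral>w. indicator (K n - K m) w * (g w * f w) \<partial>\<mu>)"
				by (intro Bochner_Integration.integral_cong refl) (use sub in \<open>auto simp: indicator_def\<close>)
			finally show "g (i (h n - h m)) = (\<integral>w. indicator (K n - K m) w * (g w * f w) \<partial>\<mu>)" .
		next
			have "(\<integral>w. indicator (K n - K m) w * (f w)^2 \<partial>\<mu>) \<le> e m"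
				unfolding e_def
			proof (rule integral_mono[OF _ ffi])
				show "integrable \<mu> (\<lambda>w. indicator (K n - K m) w * (f w)^2)"
					using integrable_real_mult_indicator[OF _ functional_law(1)[OF f], of "K n - K m"] by (simp add: mult.commute)
			qed (auto simp: indicator_def)
			then show "(\<integral>w. indicator (K n - K m) w * (f w)^2 \<partial>\<mu>) \<le> s^2" using s(2) by simp
		qed (auto simp: indicator_def)
		then show ?thesis unfolding norm_embedding using s(1) by (simp add: ennreal_le_iff)
	qed
	have "Cauchy h"
	proof (rule metric_CauchyI)
		fix c :: real assume c: "c > 0"
		have "\<forall>\<^sub>F m in sequentially. e m < (c/4)^2" using e0 by (rule order_tendstoD(2)) (use c in simp)
		then obtain m where m: "e m < (c/4)^2" by (auto simp: eventually_sequentially)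
		have "dist (h p) (h q) < c" if "p \<ge> m" "q \<ge> m" for p q
		proof -
			have "norm (h p - h m) \<le> c/4" "norm (h q - h m) \<le> c/4" using diff[of "c/4" m] that c m by auto
			then have "norm ((h p - h m) - (h q - h m)) < c" using norm_triangle_ineq4[of "h p - h m" "h q - h m"] c by linarith
			then show ?thesis by (simp add: dist_norm)
		qed
		then show "\<exists>M. \<forall>p\<ge>M. \<forall>q\<ge>M. dist (h p) (h q) < c" by blast
	qed
	then obtain k where k: "h \<longlonglongrightarrow> k" using Cauchy_convergent convergent_def by blast
	show ?thesis
	proof (intro exI[of _ k] allI impI)
		fix g :: "'w \<Rightarrow> real" assume g: "bounded_linear g"
		have [measurable]: "g \<in> borel_measurable \<mu>" by (rule measurable_functional[OF g])
		have "(\<lambda>m. g (i (h m))) \<longlonglongrightarrow> g (i k)"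
			by (intro bounded_linear.tendsto[OF g] bounded_linear.tendsto[OF embedding(1)] k)
		moreover have "(\<lambda>m. g (i (h m))) \<longlonglongrightarrow> (\<integral>w. g w * f w \<partial>\<mu>)"
			unfolding h[symmetric] gv[OF g]
		proof (rule integral_dominated_convergence[where w = "\<lambda>w. \<bar>g w * f w\<bar>"])
			show "AE w in \<mu>. (\<lambda>m. indicator (K m) w * (g w * f w)) \<longlonglongrightarrow> g w * f w"
				using AEK
			proof eventually_elim
				case (elim w)
				then obtain m0 where "w \<in> K m0" by blast
				then have "w \<in> K m" if "m \<ge> m0" for m using K(2) that by (auto simp: incseq_def)
				then have "\<forall>\<^sub>F m in sequentially. indicator (K m) w * (g w * f w) = g w * f w"
					by (auto simp: eventually_sequentially intro!: exI[of _ m0])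
				then show ?case by (rule tendsto_eventually)
			qed
			show "integrable \<mu> (\<lambda>w. \<bar>g w * f w\<bar>)" by (rule integrable_abs[OF integrable_product[OF g f]])
		qed (auto simp: indicator_def)
		ultimately show "g (i k) = (\<integral>w. g w * f w \<partial>\<mu>)" by (rule LIMSEQ_unique)
	qed
qed

text \<open>The vector h has norm sqrt q, the functional is bounded on the Hilbert space by sqrt q,
  and its value at h is q. A functional that attains its norm at h is the inner product with h, as a
  first variation shows.\<close>

lemma riesz_representation:
	fixes f :: "'w \<Rightarrow> real"
	assumes f: "bounded_linear f"
	shows "\<exists>h. (\<forall>k. h \<bullet> k = f (i k)) \<and> (\<forall>g::'w \<Rightarrow> real. bounded_linear g \<longrightarrow> g (i h) = (\<integral>w. g w * f w \<partial>\<mu>))"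
proof -
	obtain h where h: "\<And>g :: 'w \<Rightarrow> real. bounded_linear g \<Longrightarrow> g (i h) = (\<integral>w. g w * f w \<partial>\<mu>)"
		using representing_vector[OF f] by blast
	define q where "q = (\<integral>w. (f w)^2 \<partial>\<mu>)"
	have q: "0 \<le> q" by (simp add: q_def)
	have fh: "f (i h) = q" using h[OF f] by (simp add: q_def power2_eq_square)
	\<comment> \<open>\<open>functional_bound\<close> asks for s > 0 whereas q may be 0, so the bound
	  is a limit as s decreases to sqrt q.\<close>
	have bound: "f (i k) \<le> sqrt q * norm k" for k
	proof -
		have "((\<lambda>s. s * norm k) \<longlongrightarrow> sqrt q * norm k) (at_right (sqrt q))" by (intro tendsto_intros)
		then show ?thesis
		proof (rule tendsto_lowerbound)
			show "\<forall>\<^sub>F s in at_right (sqrt q). f (i k) \<le> s * norm k"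
				unfolding eventually_at_filter
			proof (intro always_eventually allI impI)
				fix s assume "s \<in> {sqrt q<..}"
				then have s: "sqrt q < s" by simp
				then have s0: "0 < s" using q by (meson order_le_less_trans real_sqrt_ge_zero)
				have "q \<le> s^2" using s by (intro sqrt_le_D) simp
				then show "f (i k) \<le> s * norm k" by (intro functional_bound[OF f s0]) (simp add: q_def)
			qed
		qed simp
	qed
	have "norm h \<le> sqrt q"
	proof (rule dense_ge)
		fix s assume s: "sqrt q < s"
		then have s0: "0 < s" using q by (meson order_le_less_trans real_sqrt_ge_zero)
		have qs: "q \<le> s^2" using s by (intro sqrt_le_D) simp
		have "cameron_martin_norm \<mu> (i h) \<le> ennreal s"
			by (rule cameron_martin_norm_weighted_le[OF f s0, where a = "\<lambda>_. 1"]) (use h qs in \<open>auto simp: q_def\<close>)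
		then show "norm h \<le> s" unfolding norm_embedding using s0 by (simp add: ennreal_le_iff)
	qed
	moreover have "sqrt q \<le> norm h"
	proof (cases "q = 0")
		case False
		then have "sqrt q > 0" using q by simp
		moreover have "sqrt q * sqrt q \<le> sqrt q * norm h" using bound[of h] fh q by simp
		ultimately show ?thesis by (rule mult_left_le_imp_le[rotated])
	qed simp
	ultimately have nh: "sqrt q = norm h" by simp
	then have q2: "q = (norm h)^2" using q by (metis real_sqrt_pow2)
	have "h \<bullet> k = f (i k)" for k
	proof -
		\<comment> \<open>d is the defect to be shown 0. The variation is made with t = d / c, and the
		  summand 1 in c allows k = 0.\<close>
		define d c where "d = f (i k) - h \<bullet> k" and "c = (norm k)^2 + 1"
		have quad: "t * d \<le> t^2 * (norm k)^2 / 2" for t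
		proof -
			have "q + t * f (i k) = f (i (h + t *\<^sub>R k))"
				by (simp add: fh linear_simps(1)[OF f] linear_simps(1)[OF embedding(1)] linear_simps(5)[OF f] linear_simps(5)[OF embedding(1)])
			also have "\<dots> \<le> norm h * norm (h + t *\<^sub>R k)" using bound[of "h + t *\<^sub>R k"] nh by simp
			also have "\<dots> \<le> ((norm h)^2 + (norm (h + t *\<^sub>R k))^2) / 2"
				using sum_squares_bound[of "norm h" "norm (h + t *\<^sub>R k)"] by simp
			also have "(norm (h + t *\<^sub>R k))^2 = (norm h)^2 + 2 * t * (h \<bullet> k) + t^2 * (norm k)^2"
				unfolding power2_norm_eq_inner
				by (simp add: inner_add_left inner_add_right inner_commute[of k h] power2_eq_square algebra_simps)
			finally show ?thesis unfolding q2 d_def by (simp add: algebra_simps)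
		qed
		have c: "c > 0" "(norm k)^2 \<le> c" by (simp_all add: c_def add_nonneg_pos)
		have "d / c * d \<le> (d / c)^2 * (norm k)^2 / 2" by (rule quad)
		also have "\<dots> \<le> (d / c)^2 * c / 2" using c by (intro divide_right_mono mult_left_mono) auto
		finally have "d^2 / c \<le> d^2 / c / 2" using c by (simp add: power2_eq_square)
		then have "d^2 / c \<le> 0" by simp
		then have "d = 0" using c by (simp add: divide_le_0_iff)
		then show ?thesis by (simp add: d_def)
	qed
	then show ?thesis using h by blast
qed

text \<open>The adjoint of the embedding applied to f. By the second clause the inner product of two
  representatives is the covariance of the functionals; \<open>f (i (riesz g))\<close> is how it is
  written below.\<close>

definition riesz :: "('w \<Rightarrow> real) \<Rightarrow> 'h" where
	"riesz f = (SOME h. (\<forall>k. h \<bullet> k = f (i k)) \<and> (\<forall>g::'w \<Rightarrow> real. bounded_linear g \<longrightarrow> g (i h) = (\<integral>w. g w * f w \<partial>\<mu>)))"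

lemma riesz:
	fixes f :: "'w \<Rightarrow> real"
	assumes "bounded_linear f"
	shows "riesz f \<bullet> k = f (i k)" "bounded_linear g \<Longrightarrow> g (i (riesz f)) = (\<integral>w. g w * f w \<partial>\<mu>)"
	using someI_ex[OF riesz_representation[OF assms]] unfolding riesz_def by blast+

lemma riesz_commute:
	fixes f g :: "'w \<Rightarrow> real"
	shows "bounded_linear f \<Longrightarrow> bounded_linear g \<Longrightarrow> f (i (riesz g)) = g (i (riesz f))"
	by (metis inner_commute riesz(1))

lemma riesz_scale:
	fixes f :: "'w \<Rightarrow> real"
	assumes f: "bounded_linear f"
	shows "riesz (\<lambda>w. f w / s) = riesz f /\<^sub>R s"
proof -
	have "bounded_linear (\<lambda>w. f w / s)" by (rule bounded_linear_compose[OF bounded_linear_divide f])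
	then have "riesz (\<lambda>w. f w / s) \<bullet> k = (riesz f /\<^sub>R s) \<bullet> k" for k
		using riesz(1)[OF f, of k] riesz(1)[of "\<lambda>w. f w / s" k] by (simp add: divide_inverse mult.commute)
	then show ?thesis using vector_eq_rdot[of "riesz (\<lambda>w. f w / s)" "riesz f /\<^sub>R s"] by (simp add: inner_commute)
qed

text \<open>\<open>rem\<close> is the part orthogonal to the functionals already chosen. If g has no
  such part, infinite dimension provides another functional that does, for otherwise the finitely
  many representatives would span the whole space. Thus the sequence never stops.\<close>

lemma gram_schmidt_step:
	fixes F :: "nat \<Rightarrow> 'w \<Rightarrow> real" and g :: "'w \<Rightarrow> real"
	assumes inf: "\<nexists>B. finite B \<and> span B = (UNIV :: 'h set)"
		and F: "\<And>j. j < n \<Longrightarrow> bounded_linear (F j)"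
			"\<And>j k. j < n \<Longrightarrow> k < n \<Longrightarrow> F j (i (riesz (F k))) = (if j = k then 1 else 0)"
		and g: "bounded_linear g"
	shows "\<exists>e c. bounded_linear e \<and> e (i (riesz e)) = 1 \<and> (\<forall>j<n. e (i (riesz (F j))) = 0) \<and>
		(\<forall>w. g w = (\<Sum>j<n. c j * F j w) + c n * e w)"
proof -
	define rem where "rem f w = f w - (\<Sum>j<n. f (i (riesz (F j))) * F j w)" for f :: "'w \<Rightarrow> real" and w
	have rem: "bounded_linear (rem f)" if "bounded_linear f" for f
		unfolding rem_def[abs_def] using that F(1) by (intro bounded_linear_sub bounded_linear_sum bounded_linear_const_mult) auto
	have rem_orth: "rem f (i (riesz (F k))) = 0" if "k < n" for f k
	proof -
		have "(\<Sum>j<n. f (i (riesz (F j))) * F j (i (riesz (F k)))) = (\<Sum>j<n. if j = k then f (i (riesz (F j))) else 0)"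
			using F(2) that by (intro sum.cong) auto
		then show ?thesis using that by (simp add: rem_def)
	qed
	have norm: "\<exists>s e. bounded_linear e \<and> e (i (riesz e)) = 1 \<and> (\<forall>j<n. e (i (riesz (F j))) = 0) \<and> (\<forall>w. rem f w = s * e w)"
		if f: "bounded_linear f" and ne: "rem f w0 \<noteq> 0" for f w0
	proof -
		define s where "s = norm (riesz (rem f))"
		have "s \<noteq> 0"
		proof
			assume "s = 0"
			then have "rem f (i k) = 0" for k using riesz(1)[OF rem[OF f], of k] by (simp add: s_def)
			then show False using functional_eq_0[OF rem[OF f]] ne by blast
		qed
		moreover have "rem f (i (riesz (rem f))) = s^2"
			using riesz(1)[OF rem[OF f]] by (simp add: s_def power2_norm_eq_inner)
		ultimately show ?thesis
			by (intro exI[of _ s] exI[of _ "\<lambda>w. rem f w / s"])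
				(auto simp: riesz_scale[OF rem[OF f]] rem_orth linear_simps(5)[OF rem[OF f]] linear_simps(5)[OF embedding(1)]
					power2_eq_square intro: bounded_linear_compose[OF bounded_linear_divide rem[OF f]])
	qed
	show ?thesis
	proof (cases "\<exists>w0. rem g w0 \<noteq> 0")
		case True
		then obtain s e where e: "bounded_linear e" "e (i (riesz e)) = 1" "\<forall>j<n. e (i (riesz (F j))) = 0" "\<And>w. rem g w = s * e w"
			using norm[OF g] by blast
		let ?c = "\<lambda>j. if j < n then g (i (riesz (F j))) else s"
		have gw: "g w = (\<Sum>j<n. g (i (riesz (F j))) * F j w) + s * e w" for w
			using e(4)[of w] by (simp add: rem_def)
		have "\<forall>w. g w = (\<Sum>j<n. ?c j * F j w) + ?c n * e w" by (intro allI trans[OF gw]) simp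
		then show ?thesis by (intro exI[of _ e] exI[of _ ?c] conjI e(1-3))
	next
		case False
		have "\<exists>f w0. bounded_linear f \<and> rem f w0 \<noteq> 0"
		proof (rule ccontr)
			assume "\<not> ?thesis"
			then have z: "rem f w = 0" if "bounded_linear f" for f w using that by blast
			have "k \<in> span (riesz ` F ` {..<n})" for k :: 'h
			proof -
				let ?k = "k - (\<Sum>j<n. F j (i k) *\<^sub>R riesz (F j))"
				have "f (i ?k) = 0" if f: "bounded_linear f" for f :: "'w \<Rightarrow> real"
				proof -
					have "f (i ?k) = f (i k) - (\<Sum>j<n. F j (i k) * f (i (riesz (F j))))"
						using f embedding(1) by (simp add: linear_simps(2) linear_simps(5) linear_sum[OF bounded_linear.linear])
					also have "\<dots> = rem f (i k)" by (simp add: rem_def mult.commute)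
					finally show ?thesis using z[OF f] by simp
				qed
				then have "i ?k = 0" by (rule functionals_separate)
				then have "?k = 0" using embedding(2) linear_simps(3)[OF embedding(1)] by (metis injD)
				then have "k = (\<Sum>j<n. F j (i k) *\<^sub>R riesz (F j))" by simp
				also have "\<dots> \<in> span (riesz ` F ` {..<n})" by (intro span_sum span_scale span_base) auto
				finally show ?thesis .
			qed
			then have "span (riesz ` F ` {..<n}) = UNIV" by blast
			then show False using inf by (metis finite_imageI finite_lessThan)
		qed
		then obtain s e where e: "bounded_linear e" "e (i (riesz e)) = 1" "\<forall>j<n. e (i (riesz (F j))) = 0"
			using norm by blast
		let ?c = "\<lambda>j. if j < n then g (i (riesz (F j))) else 0"
		have gw: "g w = (\<Sum>j<n. g (i (riesz (F j))) * F j w)" for w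
		proof -
			have "rem g w = 0" using False by blast
			then show ?thesis by (simp only: rem_def right_minus_eq)
		qed
		have "\<forall>w. g w = (\<Sum>j<n. ?c j * F j w) + ?c n * e w" by (intro allI trans[OF gw]) simp
		then show ?thesis by (intro exI[of _ e] exI[of _ ?c] conjI e)
	qed
qed

text \<open>Step n leaves the earlier functionals alone and puts \<open>g n\<close> into the span of
  the first n + 1. A vector killed by the new sequence is therefore killed by the separating
  sequence.\<close>

lemma orthonormal_sequence:
	assumes inf: "\<nexists>B. finite B \<and> span B = (UNIV :: 'h set)"
	obtains f :: "nat \<Rightarrow> 'w \<Rightarrow> real" where "\<And>j. bounded_linear (f j)"
		"\<And>j k. f j (i (riesz (f k))) = (if j = k then 1 else 0)" "\<And>w. (\<And>j. f j w = 0) \<Longrightarrow> w = 0"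
proof -
	obtain g :: "nat \<Rightarrow> 'w \<Rightarrow> real" where g: "\<And>m. bounded_linear (g m)" "\<And>w. (\<And>m. g m w = 0) \<Longrightarrow> w = 0"
		by (rule separating_sequence) blast
	define P where "P n F \<longleftrightarrow> (\<forall>j<n. bounded_linear (F j)) \<and> (\<forall>j<n. \<forall>k<n. F j (i (riesz (F k))) = (if j = k then 1 else 0))"
		for n and F :: "nat \<Rightarrow> 'w \<Rightarrow> real"
	define Q where "Q n F F' \<longleftrightarrow> (\<forall>j<n. F' j = F j) \<and> (\<exists>c. \<forall>w. g n w = (\<Sum>j<Suc n. c j * F' j w))"
		for n and F F' :: "nat \<Rightarrow> 'w \<Rightarrow> real"
	have "\<exists>F. \<forall>n. P n (F n) \<and> Q n (F n) (F (Suc n))"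
	proof (rule dependent_nat_choice)
		show "\<exists>F. P 0 F" by (simp add: P_def)
		fix F n assume F: "P n F"
		then obtain e c where e: "bounded_linear e" "e (i (riesz e)) = 1" "\<And>j. j < n \<Longrightarrow> e (i (riesz (F j))) = 0"
			"\<And>w. g n w = (\<Sum>j<n. c j * F j w) + c n * e w"
			using gram_schmidt_step[OF inf, of n F "g n"] g(1)[of n] unfolding P_def by blast
		have e': "F j (i (riesz e)) = 0" if "j < n" for j
			using e(3)[OF that] riesz_commute[OF e(1), of "F j"] F that by (simp add: P_def)
		show "\<exists>F'. P (Suc n) F' \<and> Q n F F'"
		proof (intro exI[of _ "F(n := e)"] conjI)
			show "P (Suc n) (F(n := e))" using F e(1-3) e' by (auto simp: P_def less_Suc_eq)
			show "Q n F (F(n := e))" using e(4) by (auto simp: Q_def intro!: exI[of _ c])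
		qed
	qed
	then obtain F where F: "\<And>n. P n (F n)" "\<And>n. Q n (F n) (F (Suc n))" by blast
	define f where "f j = F (Suc j) j" for j
	have Ff: "F n j = f j" if "j < n" for n j
		using that
	proof (induction n)
		case (Suc n)
		show ?case
		proof (cases "j = n")
			case False
			then have "F (Suc n) j = F n j" using F(2)[of n] Suc.prems by (auto simp: Q_def)
			then show ?thesis using Suc False by simp
		qed (simp add: f_def)
	qed simp
	show thesis
	proof (rule that[of f])
		show "bounded_linear (f j)" for j using F(1)[of "Suc j"] by (simp add: P_def f_def)
		show "f j (i (riesz (f k))) = (if j = k then 1 else 0)" for j k
		proof -
			let ?n = "Suc (max j k)"
			have n: "j < ?n" "k < ?n" by auto
			have "F ?n j (i (riesz (F ?n k))) = (if j = k then 1 else 0)" using F(1)[of ?n] n unfolding P_def by blast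
			then show ?thesis unfolding Ff[OF n(1)] Ff[OF n(2)] .
		qed
		fix w assume w: "\<And>j. f j w = 0"
		have "g n w = 0" for n
		proof -
			obtain c where c: "\<And>w. g n w = (\<Sum>j<Suc n. c j * F (Suc n) j w)" using F(2)[of n] unfolding Q_def by blast
			show ?thesis unfolding c using w by (intro sum.neutral) (auto simp: Ff)
		qed
		then show "w = 0" by (rule g(2))
	qed
qed

end

text \<open>Re Z may change sign, but 2 + Re Z lies between 1 and 3 and becomes a probability
  density after normalisation. Under it X has the standard normal characteristic function, because
  the integrals against 1, Z and its conjugate are all multiples of that function.\<close>

lemma (in prob_space) normal_law_weighted_Re:
	fixes X :: "'a \<Rightarrow> real" and Z :: "'a \<Rightarrow> complex" and C :: complex
	assumes X[measurable]: "X \<in> borel_measurable M" and law: "distr M borel X = std_normal_distribution"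
		and Z[measurable]: "Z \<in> borel_measurable M" and bd: "\<And>x. norm (Z x) \<le> 1"
		and char: "\<And>t. (\<integral>x. Z x * iexp (t * X x) \<partial>M) = C * complex_of_real (exp (- (t^2) / 2))"
		and A[measurable]: "A \<in> sets borel"
	shows "(\<integral>x. Re (Z x) * indicator A (X x) \<partial>M) = Re C * measure std_normal_distribution A"
proof -
	let ?\<gamma> = "std_normal_distribution"
	interpret \<gamma>: real_distribution ?\<gamma> by (rule real_dist_normal_dist)
	define W where "W x = 2 + Re (Z x)" for x
	define a where "a = 2 + Re C"
	have [measurable]: "W \<in> borel_measurable M" unfolding W_def by measurable
	have W: "1 \<le> W x" "W x \<le> 3" for x using abs_Re_le_cmod[of "Z x"] bd[of x] by (auto simp: W_def abs_le_iff)
	have Zi: "integrable M Z" by (rule integrable_const_bound[where B = 1]) (use bd in auto)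
	have Ei: "integrable M (\<lambda>x. iexp (t * X x))" for t
		by (rule integrable_const_bound[where B = 1]) auto
	have ZEi: "integrable M (\<lambda>x. Z x * iexp (t * X x))" for t
		by (rule integrable_const_bound[where B = 1]) (use bd in \<open>auto simp: norm_mult\<close>)
	have Wb: "norm (W x) \<le> 3" for x using W(1)[of x] W(2)[of x] by simp
	have Wi: "integrable M W" by (rule integrable_const_bound[where B = 3]) (use Wb in auto)
	have EW: "(\<integral>x. W x \<partial>M) = a"
	proof -
		have "(\<integral>x. W x \<partial>M) = 2 + (\<integral>x. Re (Z x) \<partial>M)" using Zi by (simp add: W_def prob_space)
		also have "(\<integral>x. Re (Z x) \<partial>M) = Re C" using char[of 0] Zi by simp
		finally show ?thesis by (simp add: a_def)
	qed
	have a: "a \<ge> 1"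
	proof -
		have "(\<integral>x. 1 \<partial>M) \<le> (\<integral>x. W x \<partial>M)" by (rule integral_mono[OF _ Wi W(1)]) simp
		then show ?thesis by (simp add: EW prob_space)
	qed
	let ?P = "density M (\<lambda>x. ennreal (W x / a))"
	let ?\<nu> = "distr ?P borel X"
	have Wn: "0 \<le> W x / a" for x using W(1)[of x] a by simp
	have P: "prob_space ?P"
	proof
		have "emeasure ?P (space ?P) = (\<integral>\<^sup>+x. ennreal (W x / a) \<partial>M)"
			by (subst emeasure_density) (auto intro!: nn_integral_cong)
		also have "\<dots> = ennreal (\<integral>x. W x / a \<partial>M)" using Wi Wn by (intro nn_integral_eq_integral) auto
		also have "(\<integral>x. W x / a \<partial>M) = 1" using EW a by simp
		finally show "emeasure ?P (space ?P) = 1" by simp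
	qed
	interpret P: prob_space ?P by (rule P)
	have XP: "X \<in> borel_measurable ?P" by simp
	interpret \<nu>: real_distribution ?\<nu>
		using P.prob_space_distr[OF XP] by (simp add: real_distribution_def real_distribution_axioms_def)
	have "char ?\<nu> = char ?\<gamma>"
	proof
		fix t :: real
		have E: "(\<integral>x. iexp (t * X x) \<partial>M) = complex_of_real (exp (- (t^2) / 2))"
		proof -
			have "(\<integral>x. iexp (t * X x) \<partial>M) = (\<integral>x. iexp (t * x) \<partial>distr M borel X)" by (rule integral_distr[symmetric]) auto
			also have "\<dots> = char ?\<gamma> t" unfolding law char_def ..
			finally show ?thesis by (simp add: char_std_normal_distribution)
		qed
		have cn: "(\<integral>x. cnj (Z x) * iexp (t * X x) \<partial>M) = cnj C * complex_of_real (exp (- (t^2) / 2))"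
		proof -
			have "(\<integral>x. cnj (Z x) * iexp (t * X x) \<partial>M) = (\<integral>x. cnj (Z x * iexp (- t * X x)) \<partial>M)"
				by (intro Bochner_Integration.integral_cong refl) (simp add: exp_cnj)
			also have "\<dots> = cnj (\<integral>x. Z x * iexp (- t * X x) \<partial>M)" by (rule Bochner_Integration.integral_cnj)
			also have "\<dots> = cnj C * complex_of_real (exp (- (t^2) / 2))" unfolding char[of "- t"] by (simp flip: exp_of_real add: exp_cnj)
			finally show ?thesis .
		qed
		have cZEi: "integrable M (\<lambda>x. cnj (Z x) * iexp (t * X x))"
			using Bochner_Integration.integrable_cnj[OF ZEi[of "- t"]] by (simp add: exp_cnj)
		have "char ?\<nu> t = (\<integral>x. iexp (t * X x) \<partial>?P)" unfolding char_def by (rule integral_distr) auto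
		also have "\<dots> = (\<integral>x. (W x / a) *\<^sub>R iexp (t * X x) \<partial>M)" by (rule integral_density) (use Wn in auto)
		also have "\<dots> = (\<integral>x. (2 * iexp (t * X x) + (Z x * iexp (t * X x) + cnj (Z x) * iexp (t * X x)) / 2) / a \<partial>M)"
		proof (intro Bochner_Integration.integral_cong refl)
			fix x
			have "complex_of_real (W x) = 2 + (Z x + cnj (Z x)) / 2" by (simp add: W_def complex_eq_iff)
			then show "(W x / a) *\<^sub>R iexp (t * X x) = (2 * iexp (t * X x) + (Z x * iexp (t * X x) + cnj (Z x) * iexp (t * X x)) / 2) / a"
				by (simp add: scaleR_conv_of_real algebra_simps add_divide_distrib)
		qed
		also have "\<dots> = (2 * complex_of_real (exp (- (t^2) / 2)) + (C * complex_of_real (exp (- (t^2) / 2)) + cnj C * complex_of_real (exp (- (t^2) / 2))) / 2) / a"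
			using Ei[of t] ZEi[of t] cZEi E char[of t] cn by simp
		also have "\<dots> = complex_of_real (exp (- (t^2) / 2)) * (2 + (C + cnj C) / 2) / a" by (simp add: algebra_simps add_divide_distrib)
		also have "2 + (C + cnj C) / 2 = complex_of_real a" by (simp add: a_def complex_eq_iff)
		also have "complex_of_real (exp (- (t^2) / 2)) * complex_of_real a / complex_of_real a = char ?\<gamma> t" using a by (simp add: char_std_normal_distribution)
		finally show "char ?\<nu> t = char ?\<gamma> t" .
	qed
	then have eq: "?\<nu> = ?\<gamma>" by (intro Levy_uniqueness) unfold_locales
	have "norm (Re (Z x) * indicator A (X x)) \<le> 1" for x
		using abs_Re_le_cmod[of "Z x"] bd[of x] by (simp add: indicator_def)
	then have IA: "integrable M (\<lambda>x. indicator A (X x) :: real)" "integrable M (\<lambda>x. Re (Z x) * indicator A (X x))"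
		by (auto intro!: integrable_const_bound[where B = 1])
	have "(\<integral>x. indicator A (X x) \<partial>M) = (\<integral>x. (indicator A x :: real) \<partial>distr M borel X)" by (rule integral_distr[symmetric]) auto
	then have 1: "(\<integral>x. indicator A (X x) \<partial>M) = measure ?\<gamma> A" unfolding law by (simp add: Bochner_Integration.integral_indicator)
	have "measure ?\<gamma> A = (\<integral>x. indicator A x \<partial>?\<nu>)" unfolding eq by (simp add: Bochner_Integration.integral_indicator)
	also have "\<dots> = (\<integral>x. indicator A (X x) \<partial>?P)" by (rule integral_distr) auto
	also have "\<dots> = (\<integral>x. (W x / a) *\<^sub>R indicator A (X x) \<partial>M)" by (rule integral_density) (use Wn in auto)
	also have "\<dots> = (\<integral>x. (2 * indicator A (X x) + Re (Z x) * indicator A (X x)) / a \<partial>M)"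
		by (intro Bochner_Integration.integral_cong refl) (simp add: W_def algebra_simps)
	also have "\<dots> = (2 * measure ?\<gamma> A + (\<integral>x. Re (Z x) * indicator A (X x) \<partial>M)) / a" using IA 1 by simp
	finally show ?thesis using a by (simp add: a_def field_simps)
qed

text \<open>Fourier uniqueness for the law of a real variable under a bounded complex weight. It replaces
	the multivariate uniqueness theorem below.\<close>

lemma (in prob_space) normal_law_weighted:
	fixes X :: "'a \<Rightarrow> real" and Z :: "'a \<Rightarrow> complex" and C :: complex
	assumes X[measurable]: "X \<in> borel_measurable M" and law: "distr M borel X = std_normal_distribution"
		and Z[measurable]: "Z \<in> borel_measurable M" and bd: "\<And>x. norm (Z x) \<le> 1"
		and char: "\<And>t. (\<integral>x. Z x * iexp (t * X x) \<partial>M) = C * complex_of_real (exp (- (t^2) / 2))"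
		and A[measurable]: "A \<in> sets borel"
	shows "(\<integral>x. Z x * indicator A (X x) \<partial>M) = C * measure std_normal_distribution A"
proof -
	have ZA: "integrable M (\<lambda>x. Z x * indicator A (X x))"
		by (rule integrable_const_bound[where B = 1]) (use bd in \<open>auto simp: norm_mult indicator_def\<close>)
	\<comment> \<open>The imaginary part of Z is the real part of - \<i> Z.\<close>
	have "(\<integral>x. Re (- \<i> * Z x) * indicator A (X x) \<partial>M) = Re (- \<i> * C) * measure std_normal_distribution A"
	proof (rule normal_law_weighted_Re[OF X law _ _ _ A])
		fix t
		have "(\<integral>x. - \<i> * (Z x * iexp (t * X x)) \<partial>M) = - \<i> * (\<integral>x. Z x * iexp (t * X x) \<partial>M)" by (rule integral_mult_right_zero)
		then show "(\<integral>x. - \<i> * Z x * iexp (t * X x) \<partial>M) = - \<i> * C * complex_of_real (exp (- (t^2) / 2))"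
			unfolding char by (simp only: mult.assoc)
	qed (use bd in \<open>auto simp: norm_mult\<close>)
	then have Im: "(\<integral>x. Im (Z x) * indicator A (X x) \<partial>M) = Im C * measure std_normal_distribution A" by simp
	have c: "Re (indicator A y) = indicator A y" "Im (indicator A y) = 0" for y :: real
		by (simp_all add: indicator_def)
	show ?thesis
		using Im normal_law_weighted_Re[OF assms] integral_Re[OF ZA] integral_Im[OF ZA] by (intro complex_eqI) (simp_all add: c)
qed

section \<open>Characteristic functions of functionals\<close>

context wiener begin

lemma functional_std_normal:
	fixes f :: "'w \<Rightarrow> real"
	assumes f: "bounded_linear f" and v: "(\<integral>w. (f w)^2 \<partial>\<mu>) = 1"
	shows "distr \<mu> borel f = std_normal_distribution"
proof -
	obtain \<sigma> where \<sigma>: "\<sigma> > 0" "distr \<mu> borel f = density lborel (normal_density 0 \<sigma>)" "\<sigma>^2 = 1"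
		using functional_law(2)[OF f] v by auto
	then have "\<sigma> = 1" by (simp add: power2_eq_1_iff)
	then show ?thesis using \<sigma>(2) by simp
qed

lemma functional_char:
	fixes f :: "'w \<Rightarrow> real"
	assumes f: "bounded_linear f"
	shows "(\<integral>w. iexp (f w) \<partial>\<mu>) = exp (- (\<integral>w. (f w)^2 \<partial>\<mu>) / 2)"
	using functional_law(2)[OF f]
proof (elim disjE exE conjE)
	have [measurable]: "f \<in> borel_measurable \<mu>" by (rule measurable_functional[OF f])
	assume z: "distr \<mu> borel f = return borel 0" "(\<integral>w. (f w)^2 \<partial>\<mu>) = 0"
	have "(\<integral>w. iexp (f w) \<partial>\<mu>) = (\<integral>x. iexp x \<partial>distr \<mu> borel f)" by (rule integral_distr[symmetric]) auto
	also have "\<dots> = 1" unfolding z(1) by (subst integral_return) auto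
	finally show ?thesis using z(2) by simp
next
	fix \<sigma> :: real assume \<sigma>: "0 < \<sigma>" "(\<integral>w. (f w)^2 \<partial>\<mu>) = \<sigma>^2"
	let ?g = "\<lambda>w. f w / \<sigma>"
	have g: "bounded_linear ?g" by (rule bounded_linear_compose[OF bounded_linear_divide f])
	have [measurable]: "?g \<in> borel_measurable \<mu>" by (rule measurable_functional[OF g])
	have law: "distr \<mu> borel ?g = std_normal_distribution"
		by (rule functional_std_normal[OF g]) (use \<sigma> in \<open>simp add: power_divide\<close>)
	have "(\<integral>w. iexp (f w) \<partial>\<mu>) = (\<integral>w. iexp (\<sigma> * ?g w) \<partial>\<mu>)" using \<sigma>(1) by simp
	also have "\<dots> = (\<integral>x. iexp (\<sigma> * x) \<partial>distr \<mu> borel ?g)" by (rule integral_distr[symmetric]) auto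
	also have "\<dots> = char std_normal_distribution \<sigma>" unfolding law char_def ..
	finally show ?thesis unfolding \<sigma>(2) by (simp add: char_std_normal_distribution)
qed

end

section \<open>Orthonormal coordinates on a Wiener space\<close>

locale wiener_coordinates = wiener +
	fixes f :: "nat \<Rightarrow> 'b \<Rightarrow> real"
	assumes functional: "bounded_linear (f j)"
		and orthonormal: "f j (i (riesz (f k))) = (if j = k then 1 else 0)"
		and separating: "(\<And>j. f j w = 0) \<Longrightarrow> w = 0"
begin

lemma measurable_coordinate [measurable]: "f j \<in> borel_measurable \<mu>"
	by (rule measurable_functional[OF functional])

lemma variance_combination:
	assumes J: "finite J"
	shows "(\<integral>w. (\<Sum>j\<in>J. c j * f j w)^2 \<partial>\<mu>) = (\<Sum>j\<in>J. (c j)^2)"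
proof -
	define F where "F w = (\<Sum>j\<in>J. c j * f j w)" for w
	have F: "bounded_linear F" unfolding F_def by (intro bounded_linear_sum bounded_linear_const_mult functional)
	have Fk: "F (i (riesz (f k))) = c k" if "k \<in> J" for k
	proof -
		have "F (i (riesz (f k))) = (\<Sum>j\<in>J. if j = k then c j else 0)"
			unfolding F_def by (intro sum.cong) (auto simp: orthonormal)
		then show ?thesis using J that by simp
	qed
	have "(\<integral>w. (F w)^2 \<partial>\<mu>) = F (i (riesz F))" using riesz(2)[OF F F] by (simp add: power2_eq_square)
	also have "\<dots> = (\<Sum>j\<in>J. c j * F (i (riesz (f j))))"
		by (subst F_def) (simp add: riesz_commute[OF functional F])
	also have "\<dots> = (\<Sum>j\<in>J. (c j)^2)" by (simp add: Fk power2_eq_square)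
	finally show ?thesis by (simp add: F_def)
qed

text \<open>Interpolates between a characteristic function (k = 0) and a joint law (k = n). Each
  step turns one character into an indicator, with the remaining factors as the bounded complex
  weight; c is arbitrary in the induction so that its k-th entry can run over all t.\<close>

lemma coordinates_joint:
	assumes "k \<le> n" "\<And>j. A j \<in> sets borel"
	shows "(\<integral>w. (\<Prod>j<k. indicator (A j) (f j w)) * iexp (\<Sum>j\<in>{k..<n}. c j * f j w) \<partial>\<mu>)
		= complex_of_real ((\<Prod>j<k. measure std_normal_distribution (A j)) * exp (- (\<Sum>j\<in>{k..<n}. (c j)^2) / 2))"
	using assms(1)
proof (induction k arbitrary: c)
	case 0
	have "bounded_linear (\<lambda>w. \<Sum>j\<in>{0..<n}. c j * f j w)"
		by (intro bounded_linear_sum bounded_linear_const_mult functional)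
	from functional_char[OF this] show ?case by (simp add: variance_combination)
next
	case (Suc k)
	note [measurable] = assms(2)
	let ?S = "\<lambda>w. \<Sum>j\<in>{Suc k..<n}. c j * f j w"
	let ?Z = "\<lambda>w. (\<Prod>j<k. indicator (A j) (f j w)) * iexp (?S w)"
	let ?C = "complex_of_real ((\<Prod>j<k. measure std_normal_distribution (A j)) * exp (- (\<Sum>j\<in>{Suc k..<n}. (c j)^2) / 2))"
	have "(\<integral>w. ?Z w * indicator (A k) (f k w) \<partial>\<mu>) = ?C * measure std_normal_distribution (A k)"
	proof (rule normal_law_weighted)
		show "distr \<mu> borel (f k) = std_normal_distribution"
			using riesz(2)[OF functional functional, of k k] by (intro functional_std_normal functional) (simp add: orthonormal power2_eq_square)
		have "norm (\<Prod>j<k. indicator (A j) (f j w) :: complex) \<le> 1" for w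
			unfolding prod_norm[symmetric] by (rule prod_le_1) (auto simp: indicator_def)
		then show "norm (?Z w) \<le> 1" for w by (simp add: norm_mult)
		show "A k \<in> sets borel" by (rule assms(2))
		fix t :: real
		let ?c = "c(k := t)"
		have split: "(\<Sum>j\<in>{k..<n}. g j) = g k + (\<Sum>j\<in>{Suc k..<n}. g j)" for g :: "nat \<Rightarrow> real"
			using Suc.prems by (simp add: sum.atLeast_Suc_lessThan)
		have s1: "(\<Sum>j\<in>{k..<n}. ?c j * f j w) = t * f k w + ?S w" for w
			unfolding split by simp
		have s2: "(\<Sum>j\<in>{k..<n}. (?c j)^2) = t^2 + (\<Sum>j\<in>{Suc k..<n}. (c j)^2)"
			unfolding split by simp
		have "(\<integral>w. ?Z w * iexp (t * f k w) \<partial>\<mu>)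
				= (\<integral>w. (\<Prod>j<k. indicator (A j) (f j w)) * iexp (\<Sum>j\<in>{k..<n}. ?c j * f j w) \<partial>\<mu>)"
			unfolding s1 by (intro Bochner_Integration.integral_cong refl) (simp add: algebra_simps exp_add)
		also have "\<dots> = complex_of_real ((\<Prod>j<k. measure std_normal_distribution (A j)) * exp (- (t^2 + (\<Sum>j\<in>{Suc k..<n}. (c j)^2)) / 2))"
			using Suc.IH[of ?c] Suc.prems unfolding s2 by simp
		also have "exp (- (t^2 + (\<Sum>j\<in>{Suc k..<n}. (c j)^2)) / 2) = exp (- (\<Sum>j\<in>{Suc k..<n}. (c j)^2) / 2) * exp (- (t^2) / 2)"
			by (simp add: add_divide_distrib flip: exp_add)
		finally show "(\<integral>w. ?Z w * iexp (t * f k w) \<partial>\<mu>) = ?C * complex_of_real (exp (- (t^2) / 2))" by (simp add: mult.assoc)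
	qed measurable
	then show ?case by (simp add: mult_ac)
qed

definition coordinates :: "'b \<Rightarrow> nat \<Rightarrow> real" where
	"coordinates w j = f j w"

lemma continuous_coordinates: "continuous_on UNIV coordinates"
	by (rule continuous_on_coordinatewise_then_product) (simp add: coordinates_def linear_continuous_on[OF functional])

lemma measurable_coordinates [measurable]: "coordinates \<in> borel_measurable \<mu>"
	by (subst measurable_cong_sets[OF sets_mu refl]) (rule borel_measurable_continuous_onI[OF continuous_coordinates])

lemma inj_coordinates: "inj coordinates"
proof (rule injI)
	fix x y assume "coordinates x = coordinates y"
	then have "f j (x - y) = 0" for j
		by (simp add: coordinates_def fun_eq_iff linear_simps(2)[OF functional])
	then show "x = y" using separating[of "x - y"] by simp
qed

lemma coordinates_law: "distr \<mu> borel coordinates = gauss 1"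
	unfolding gauss_def
proof (rule product_prob_space.PiM_eq[OF gaussian_product])
	let ?\<gamma> = "std_normal_distribution"
	show "sets (distr \<mu> borel coordinates) = sets (PiM UNIV (\<lambda>_. ?\<gamma>))"
		using sets_gauss[of 1] by (simp add: gauss_def)
	fix J :: "nat set" and F :: "nat \<Rightarrow> real set"
	assume J: "finite J" and F: "\<And>j. j \<in> J \<Longrightarrow> F j \<in> sets ?\<gamma>"
	interpret \<gamma>: prob_space ?\<gamma> by (rule prob_space_normal_density) simp
	obtain n where n: "J \<subseteq> {..<n}" using J finite_nat_iff_bounded by blast
	\<comment> \<open>Padding with \<open>UNIV\<close> lets the rectangle constrain every coordinate
	  below n, which is the shape of \<open>coordinates_joint\<close>.\<close>
	define A where "A j = (if j \<in> J then F j else UNIV)" for j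
	have A[measurable]: "A j \<in> sets borel" for j using F[of j] by (simp add: A_def)
	let ?E = "{w. \<forall>j\<in>J. f j w \<in> F j}"
	have E: "?E \<in> sets \<mu>"
	proof -
		have "{w \<in> space \<mu>. \<forall>j\<in>{..<n}. f j w \<in> A j} \<in> sets \<mu>" by measurable
		also have "{w \<in> space \<mu>. \<forall>j\<in>{..<n}. f j w \<in> A j} = ?E" using n by (auto simp: A_def)
		finally show ?thesis .
	qed
	have "prod_emb UNIV (\<lambda>_. ?\<gamma>) J (Pi\<^sub>E J F) = {x. \<forall>j\<in>J. x j \<in> F j}"
		by (auto simp: prod_emb_def PiE_iff)
	moreover have "{x :: nat \<Rightarrow> real. \<forall>j\<in>J. x j \<in> F j} \<in> sets borel"
	proof -
		have "prod_emb UNIV (\<lambda>_. ?\<gamma>) J (Pi\<^sub>E J F) \<in> sets (PiM UNIV (\<lambda>_. ?\<gamma>))"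
			by (rule sets_PiM_I) (use J F in auto)
		then show ?thesis using sets_gauss[of 1] calculation by (simp add: gauss_def)
	qed
	ultimately have "emeasure (distr \<mu> borel coordinates) (prod_emb UNIV (\<lambda>_. ?\<gamma>) J (Pi\<^sub>E J F)) = emeasure \<mu> ?E"
		by (simp add: emeasure_distr vimage_def coordinates_def)
	also have "\<dots> = ennreal (prob ?E)" by (rule emeasure_eq_measure)
	also have "prob ?E = (\<Prod>j<n. measure ?\<gamma> (A j))"
	proof -
		have "(\<Prod>j<n. indicator (A j) (f j w)) = complex_of_real (indicator ?E w)" for w
		proof (cases "w \<in> ?E")
			case True
			then have "(\<Prod>j<n. indicator (A j) (f j w)) = (\<Prod>j<n. 1 :: complex)" by (intro prod.cong) (auto simp: A_def)
			then show ?thesis using True by simp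
		next
			case False
			then obtain j where j: "j \<in> J" "f j w \<notin> F j" by blast
			have "(\<Prod>j<n. indicator (A j) (f j w)) = (0 :: complex)"
				by (rule prod_zero) (use n j in \<open>auto simp: A_def intro!: bexI[of _ j]\<close>)
			then show ?thesis using False by simp
		qed
		then have "(\<integral>w. (\<Prod>j<n. indicator (A j) (f j w)) \<partial>\<mu>) = complex_of_real (\<integral>w. indicator ?E w \<partial>\<mu>)"
			by (simp only: integral_complex_of_real)
		then have "complex_of_real (prob ?E) = complex_of_real (\<Prod>j<n. measure ?\<gamma> (A j))"
			using coordinates_joint[of n n A] A E by simp
		then show ?thesis by (simp only: of_real_eq_iff)
	qed
	also have "(\<Prod>j<n. measure ?\<gamma> (A j)) = (\<Prod>j\<in>J. measure ?\<gamma> (F j))"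
		using n \<gamma>.prob_space by (intro prod.mono_neutral_cong_right) (auto simp: A_def)
	also have "ennreal \<dots> = (\<Prod>j\<in>J. emeasure ?\<gamma> (F j))"
		by (simp add: prod_ennreal \<gamma>.emeasure_eq_measure)
	finally show "emeasure (distr \<mu> borel coordinates) (prod_emb UNIV (\<lambda>_. ?\<gamma>) J (Pi\<^sub>E J F)) = (\<Prod>j\<in>J. emeasure ?\<gamma> (F j))" .
qed simp

lemma inner_combination:
	assumes "finite J"
	shows "(\<Sum>j\<in>J. a j *\<^sub>R riesz (f j)) \<bullet> (\<Sum>j\<in>J. b j *\<^sub>R riesz (f j)) = (\<Sum>j\<in>J. a j * b j)"
proof -
	have e: "riesz (f j) \<bullet> riesz (f k) = (if j = k then 1 else 0)" for j k
		by (simp add: riesz(1)[OF functional] orthonormal)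
	have "riesz (f k) \<bullet> (\<Sum>j\<in>J. b j *\<^sub>R riesz (f j)) = b k" if "k \<in> J" for k
		using assms that by (simp add: inner_sum_right e if_distrib[of "\<lambda>x. _ * x"] sum.delta' cong: if_cong)
	then show ?thesis by (simp add: inner_sum_left)
qed

text \<open>If the squares are summable, the orthonormal series converges in the Hilbert space to
  some h, and w = i h because both have the same coordinates; the norm is Parseval's identity.
  Conversely Bessel's inequality makes the squares summable for w in the range.\<close>

lemma cameron_martin_coordinates:
	"(if w \<in> range i then ennreal (norm (inv i w)) else \<infinity>) =
		(if summable (\<lambda>j. (f j w)^2) then ennreal (sqrt (\<Sum>j. (f j w)^2)) else \<infinity>)"
proof (cases "summable (\<lambda>j. (f j w)^2)")
	case True
	define s where "s n = (\<Sum>j<n. f j w *\<^sub>R riesz (f j))" for n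
	have ns: "(norm (\<Sum>j\<in>J. f j w *\<^sub>R riesz (f j)))^2 = (\<Sum>j\<in>J. (f j w)^2)" if "finite J" for J
		unfolding power2_norm_eq_inner inner_combination[OF that] by (simp add: power2_eq_square)
	have "Cauchy s"
	proof (rule CauchyI')
		fix e :: real assume e: "0 < e"
		obtain N where N: "\<And>m n. m \<ge> N \<Longrightarrow> norm (\<Sum>j\<in>{m..<n}. (f j w)^2) < e^2"
			using True e unfolding summable_Cauchy by (metis zero_less_power)
		have "norm (s m - s n) < e" if "m \<ge> N" "n > m" for m n
		proof -
			have "s n - s m = (\<Sum>j\<in>{m..<n}. f j w *\<^sub>R riesz (f j))"
				using sum_diff_nat_ivl[of 0 m n "\<lambda>j. f j w *\<^sub>R riesz (f j)"] that by (simp add: s_def atLeast0LessThan)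
			then have "(norm (s n - s m))^2 = (\<Sum>j\<in>{m..<n}. (f j w)^2)" using ns[of "{m..<n}"] by simp
			then have "(norm (s n - s m))^2 < e^2" using N[OF that(1), of n] by simp
			then show ?thesis using e by (simp add: norm_minus_commute power2_less_imp_less)
		qed
		then show "\<exists>M. \<forall>m\<ge>M. \<forall>n>m. dist (s m) (s n) < e" unfolding dist_norm by blast
	qed
	then obtain h where h: "s \<longlonglongrightarrow> h" using Cauchy_convergent convergent_def by blast
	have "f k (w - i h) = 0" for k
	proof -
		have "(\<lambda>n. riesz (f k) \<bullet> s n) \<longlonglongrightarrow> riesz (f k) \<bullet> h" by (intro tendsto_inner tendsto_const h)
		moreover have "\<forall>\<^sub>F n in sequentially. riesz (f k) \<bullet> s n = f k w"
		proof (rule eventually_mono[OF eventually_gt_at_top[of k]])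
			fix n assume "k < n"
			then show "riesz (f k) \<bullet> s n = f k w"
				by (simp add: s_def inner_sum_right riesz(1)[OF functional] orthonormal if_distrib[of "\<lambda>x. _ * x"] sum.delta' cong: if_cong)
		qed
		ultimately have "riesz (f k) \<bullet> h = f k w" by (metis LIMSEQ_unique tendsto_eventually)
		then show ?thesis by (simp add: linear_simps(2)[OF functional] riesz(1)[OF functional])
	qed
	then have w: "w = i h" using separating[of "w - i h"] by simp
	have "(\<lambda>n. (norm (s n))^2) \<longlonglongrightarrow> (norm h)^2" by (intro tendsto_intros h)
	moreover have "(\<lambda>n. (norm (s n))^2) \<longlonglongrightarrow> (\<Sum>j. (f j w)^2)"
		unfolding s_def ns[OF finite_lessThan] by (rule summable_LIMSEQ[OF True])
	ultimately have "(norm h)^2 = (\<Sum>j. (f j w)^2)" by (rule LIMSEQ_unique)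
	then have "norm h = sqrt (\<Sum>j. (f j w)^2)" by (metis norm_ge_zero real_sqrt_abs2 real_sqrt_unique)
	moreover have "inv i w = h" unfolding w by (rule inv_f_f[OF embedding(2)])
	ultimately show ?thesis using True w by simp
next
	case False
	have "w \<notin> range i"
	proof
		assume "w \<in> range i"
		then obtain h where w: "w = i h" by blast
		have "(\<Sum>j<n. (f j w)^2) \<le> (norm h)^2" for n
		proof -
			define p where "p = (\<Sum>j<n. f j w *\<^sub>R riesz (f j))"
			have pp: "p \<bullet> p = (\<Sum>j<n. (f j w)^2)" unfolding p_def inner_combination[OF finite_lessThan] by (simp add: power2_eq_square)
			have ph: "p \<bullet> h = (\<Sum>j<n. (f j w)^2)"
				by (simp add: p_def inner_sum_left riesz(1)[OF functional] w power2_eq_square)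
			have "0 \<le> (h - p) \<bullet> (h - p)" by simp
			also have "\<dots> = (norm h)^2 - 2 * (p \<bullet> h) + p \<bullet> p"
				by (simp add: power2_norm_eq_inner inner_diff_left inner_diff_right inner_commute[of h p])
			finally show ?thesis by (simp add: pp ph)
		qed
		then have "summable (\<lambda>j. (f j w)^2)" by (intro summableI_nonneg_bounded[of _ "(norm h)^2"]) auto
		then show False using False by simp
	qed
	then show ?thesis using False by simp
qed

lemma wiener_dist: "emm_dist (wiener_emm i \<mu>) w1 w2 = ell2_dist (coordinates w1) (coordinates w2)"
	using cameron_martin_coordinates[of "w1 - w2"]
	by (simp add: wiener_emm_def ell2_dist_def coordinates_def linear_simps(2)[OF functional])

text \<open>The metric axioms and lower semicontinuity are pulled back along the coordinates.
  Completeness is proved in the Hilbert space, and the finer topology comes from boundedness of the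
  embedding.\<close>

lemma emm_space_wiener: "emm_space (wiener_emm i \<mu>)"
proof -
	let ?d = "emm_dist (wiener_emm i \<mu>)"
	have sel: "emm_top (wiener_emm i \<mu>) = euclidean" "emm_measure (wiener_emm i \<mu>) = \<mu>" by (simp_all add: wiener_emm_def)
	have dH: "?d x y = ennreal (norm h)" if "x - y = i h" for x y h
		using that by (simp add: wiener_emm_def inv_f_f[OF embedding(2)])
	have fin: "\<exists>h. x - y = i h" if "?d x y < \<infinity>" for x y
		using that by (auto simp: wiener_emm_def split: if_splits)
	have complete: "\<exists>x. (\<lambda>j. ?d (u j) x) \<longlonglongrightarrow> 0" if u: "\<And>\<epsilon>. \<epsilon> > 0 \<Longrightarrow> \<exists>N. \<forall>j\<ge>N. \<forall>k\<ge>N. ?d (u j) (u k) < \<epsilon>" for u :: "nat \<Rightarrow> 'b"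
	proof -
		obtain N where N: "\<And>j k. j \<ge> N \<Longrightarrow> k \<ge> N \<Longrightarrow> ?d (u j) (u k) < 1" using u[of 1] by auto
		\<comment> \<open>Distances below 1 are finite, so from N on the sequence stays in one translate
		  of the Cameron-Martin space.\<close>
		have "\<exists>h. u (k + N) - u N = i h" for k
			by (rule fin, rule order_less_trans[OF N]) auto
		then obtain h where h: "\<And>k. u (k + N) - u N = i (h k)" by metis
		have diff: "u (j + N) - (u N + i k) = i (h j - k)" for j k
			using h[of j] by (simp add: linear_simps(2)[OF embedding(1)] algebra_simps)
		have dd: "?d (u (j + N)) (u (k + N)) = ennreal (norm (h j - h k))" for j k
			using diff[of j "h k"] h[of k] by (intro dH) (simp add: algebra_simps)
		have "Cauchy h"
		proof (rule metric_CauchyI)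
			fix e :: real assume e: "0 < e"
			obtain M where M: "\<forall>j\<ge>M. \<forall>k\<ge>M. ?d (u j) (u k) < ennreal e" using u[of "ennreal e"] e by auto
			have "dist (h j) (h k) < e" if "j \<ge> M" "k \<ge> M" for j k
			proof -
				have "?d (u (j + N)) (u (k + N)) < ennreal e" using M that by simp
				then show ?thesis unfolding dd using e by (simp add: ennreal_less_iff dist_norm)
			qed
			then show "\<exists>M. \<forall>j\<ge>M. \<forall>k\<ge>M. dist (h j) (h k) < e" by blast
		qed
		then obtain k where k: "h \<longlonglongrightarrow> k" using Cauchy_convergent convergent_def by blast
		have "(\<lambda>j. norm (h j - k)) \<longlonglongrightarrow> norm (k - k)" by (intro tendsto_intros k)
		then have "(\<lambda>j. ennreal (norm (h j - k))) \<longlonglongrightarrow> ennreal 0" by (intro tendsto_ennrealI) simp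
		then have "(\<lambda>j. ?d (u (j + N)) (u N + i k)) \<longlonglongrightarrow> 0" by (simp add: dH[OF diff])
		then have "(\<lambda>j. ?d (u j) (u N + i k)) \<longlonglongrightarrow> 0" by (rule LIMSEQ_offset)
		then show ?thesis by blast
	qed
	have lsc: "closed {(x, y). ?d x y \<le> c}" for c
	proof -
		have "closed {(x, y). ell2_dist x y \<le> c}"
			using emm_space_gamma_infinity[of 1] unfolding emm_space_def Let_def gamma_infinity_def
			by (simp add: closedin_prod_euclidean)
		moreover have "continuous_on UNIV (\<lambda>p. (coordinates (fst p), coordinates (snd p)))"
			by (intro continuous_on_Pair continuous_on_compose2[OF continuous_coordinates] continuous_on_fst continuous_on_snd continuous_on_id) auto
		ultimately have "closed ((\<lambda>p. (coordinates (fst p), coordinates (snd p))) -` {(x, y). ell2_dist x y \<le> c})"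
			by (rule closed_vimage)
		moreover have "(\<lambda>p. (coordinates (fst p), coordinates (snd p))) -` {(x, y). ell2_dist x y \<le> c} = {(x, y). ?d x y \<le> c}"
			by (auto simp: wiener_dist)
		ultimately show ?thesis by simp
	qed
	have finer: "\<exists>\<epsilon>>0. \<forall>y. ?d x y < \<epsilon> \<longrightarrow> y \<in> U" if U: "open U" "x \<in> U" for U x
	proof -
		obtain e where e: "e > 0" "ball x e \<subseteq> U" using U open_contains_ball by blast
		obtain K where K: "K > 0" "\<And>h. norm (i h) \<le> norm h * K" using bounded_linear.pos_bounded[OF embedding(1)] by blast
		show ?thesis
		proof (intro exI[of _ "ennreal (e / K)"] conjI allI impI)
			show "0 < ennreal (e / K)" using e K by simp
			fix y assume d: "?d x y < ennreal (e / K)"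
			then obtain h where h: "x - y = i h" using fin[of x y] order_less_trans[OF d] by auto
			have "norm h < e / K" using d unfolding dH[OF h] by (simp add: ennreal_less_iff)
			then have "norm h * K < e" using K(1) by (simp add: less_divide_eq)
			then have "norm (x - y) < e" unfolding h using K(2)[of h] by simp
			then show "y \<in> U" using e(2) by (auto simp: dist_norm)
		qed
	qed
	show ?thesis
		unfolding emm_space_def Let_def sel topspace_euclidean
	proof (intro conjI ballI allI impI)
		show "completely_metrizable_space (euclidean :: 'b topology)" by (rule completely_metrizable_space_euclidean)
		show "separable_space (euclidean :: 'b topology)" by (rule separable_space_euclidean)
		show "space \<mu> = UNIV" "prob_space \<mu>" by simp_all unfold_locales
		show "sets \<mu> = borel_sets_of euclidean" by (simp add: borel_sets_of_def sets_borel)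
		fix x y z :: 'b
		show "?d x y = 0 \<longleftrightarrow> x = y" by (simp add: wiener_dist ell2_dist_eq_0 inj_eq[OF inj_coordinates])
		show "?d x y = ?d y x" by (simp add: wiener_dist ell2_dist_commute)
		show "?d x z \<le> ?d x y + ?d y z" unfolding wiener_dist by (rule ell2_dist_triangle)
	next
		fix u :: "nat \<Rightarrow> 'b" assume "range u \<subseteq> UNIV \<and> (\<forall>\<epsilon>>0. \<exists>N. \<forall>j\<ge>N. \<forall>k\<ge>N. ?d (u j) (u k) < \<epsilon>)"
		then show "\<exists>x\<in>UNIV. (\<lambda>j. ?d (u j) x) \<longlonglongrightarrow> 0" using complete[of u] by simp
	next
		fix c show "closedin (prod_topology euclidean euclidean) {(x, y) \<in> UNIV \<times> UNIV. ?d x y \<le> c}"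
			using lsc[of c] by (simp add: closedin_prod_euclidean)
	next
		fix U and x :: 'b assume "openin euclidean U" "x \<in> U"
		then show "\<exists>\<epsilon>>0. \<forall>y\<in>UNIV. ?d x y < \<epsilon> \<longrightarrow> y \<in> U" using finer[of U x] by simp
	qed
qed

lemma gamma_prec_wiener: "gamma_infinity 1 \<prec>\<prec> wiener_emm i \<mu>"
	unfolding emm_prec_def
proof (intro bexI[of _ coordinates] bexI[of _ UNIV] conjI ballI)
	have sel: "emm_measure (gamma_infinity 1) = gauss 1" "emm_dist (gamma_infinity 1) = ell2_dist"
		"emm_measure (wiener_emm i \<mu>) = \<mu>"
		by (simp_all add: gamma_infinity_def gauss_def wiener_emm_def)
	show "coordinates \<in> emm_measure (wiener_emm i \<mu>) \<rightarrow>\<^sub>M emm_measure (gamma_infinity 1)"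
		unfolding sel by (subst measurable_cong_sets[OF refl sets_gauss]) (rule measurable_coordinates)
	show "distr (emm_measure (wiener_emm i \<mu>)) (emm_measure (gamma_infinity 1)) coordinates = emm_measure (gamma_infinity 1)"
		unfolding sel using coordinates_law by (simp cong: distr_cong)
	show "emeasure (emm_measure (wiener_emm i \<mu>)) UNIV = 1" unfolding sel using emeasure_space_1 by simp
	show "emm_dist (gamma_infinity 1) (coordinates x) (coordinates y) \<le> emm_dist (wiener_emm i \<mu>) x y" for x y
		unfolding sel wiener_dist ..
qed (simp add: wiener_emm_def)

text \<open>The inverse of the injection is measurable because it is continuous on compact sets and \<open>\<mu>\<close>
	lives on a countable union of compact sets.\<close>

lemma wiener_prec_gamma: "wiener_emm i \<mu> \<prec>\<prec> gamma_infinity 1"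
proof -
	have sel: "emm_measure (gamma_infinity 1) = gauss 1" "emm_dist (gamma_infinity 1) = ell2_dist"
		"emm_measure (wiener_emm i \<mu>) = \<mu>"
		by (simp_all add: gamma_infinity_def gauss_def wiener_emm_def)
	interpret G: prob_space "gauss 1" by (rule prob_space_gauss) simp
	obtain K :: "nat \<Rightarrow> 'b set" where K: "\<And>m. compact (K m)" "incseq K" "emeasure \<mu> (\<Union>m. K m) = 1"
		by (rule tight_sequence[OF prob_space_axioms sets_mu]) blast
	define L where "L = (\<Union>m. K m)"
	have Lb: "L \<in> sets \<mu>" unfolding L_def using K(1) by (intro sets.countable_UN') (auto intro: borel_closed compact_imp_closed)
	\<comment> \<open>The inverse is used on the image of the compact sets, a Borel set of full
	  measure; elsewhere the value 0 keeps the map total and Borel.\<close>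
	define \<phi> where "\<phi> y = (if y \<in> coordinates ` L then inv coordinates y else 0)" for y
	have \<phi>: "\<phi> (coordinates w) = w" if "w \<in> L" for w
		using that by (simp add: \<phi>_def inv_f_f[OF inj_coordinates])
	have img: "coordinates ` (F \<inter> L) \<in> sets borel" if "closed F" for F
	proof -
		have "compact (coordinates ` (F \<inter> K m))" for m
			using K(1)[of m] that by (intro compact_continuous_image[OF continuous_on_subset[OF continuous_coordinates]]) (auto intro: closed_Int_compact)
		then have "(\<Union>m. coordinates ` (F \<inter> K m)) \<in> sets borel"
			by (intro sets.countable_UN') (auto intro: borel_closed compact_imp_closed)
		moreover have "(\<Union>m. coordinates ` (F \<inter> K m)) = coordinates ` (F \<inter> L)" by (auto simp: L_def)
		ultimately show ?thesis by simp
	qed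
	have imL: "coordinates ` L \<in> sets borel" using img[of UNIV] by simp
	have \<phi>b: "\<phi> \<in> borel_measurable borel"
		unfolding borel_eq_closed[where 'a = 'b]
	proof (rule measurable_measure_of)
		fix F :: "'b set" assume "F \<in> Collect closed"
		then have F: "closed F" by simp
		have "\<phi> -` F \<inter> space borel = coordinates ` (F \<inter> L) \<union> (if 0 \<in> F then - coordinates ` L else {})"
		proof (intro set_eqI)
			fix y
			show "y \<in> \<phi> -` F \<inter> space borel \<longleftrightarrow> y \<in> coordinates ` (F \<inter> L) \<union> (if 0 \<in> F then - coordinates ` L else {})"
			proof (cases "y \<in> coordinates ` L")
				case True
				then obtain w where w: "w \<in> L" "y = coordinates w" by blast
				have "y \<in> coordinates ` (F \<inter> L) \<longleftrightarrow> w \<in> F" using w by (auto simp: inj_eq[OF inj_coordinates])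
				then show ?thesis using True \<phi>[OF w(1)] w(2) by auto
			qed (auto simp: \<phi>_def)
		qed
		then show "\<phi> -` F \<inter> space borel \<in> sets borel" using img[OF F] imL by auto
	qed auto
	have E1: "emeasure (gauss 1) (coordinates ` L) = 1"
	proof (rule antisym)
		show "emeasure (gauss 1) (coordinates ` L) \<le> 1" by (rule G.subprob_emeasure_le_1)
		have "1 = emeasure \<mu> L" using K(3) by (simp add: L_def)
		also have "\<dots> \<le> emeasure \<mu> (coordinates -` (coordinates ` L) \<inter> space \<mu>)"
			by (rule emeasure_mono) (use measurable_sets[OF measurable_coordinates imL] in auto)
		also have "\<dots> = emeasure (gauss 1) (coordinates ` L)"
			unfolding coordinates_law[symmetric] by (rule emeasure_distr[symmetric]) (use imL in auto)
		finally show "1 \<le> emeasure (gauss 1) (coordinates ` L)" .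
	qed
	have law: "distr (gauss 1) \<mu> \<phi> = \<mu>"
	proof -
		have "distr (gauss 1) \<mu> \<phi> = distr (distr \<mu> borel coordinates) \<mu> \<phi>" by (simp only: coordinates_law)
		also have "\<dots> = distr \<mu> \<mu> (\<phi> \<circ> coordinates)"
			by (rule distr_distr) (use \<phi>b in \<open>simp_all cong: measurable_cong_sets\<close>)
		also have "\<dots> = distr \<mu> \<mu> (\<lambda>w. w)"
		proof (rule distr_cong_AE)
			have "AE w in \<mu>. w \<in> L" using AE_in_set_eq_1[OF Lb] K(3) by (simp add: measure_def L_def)
			then show "AE w in \<mu>. (\<phi> \<circ> coordinates) w = w" by eventually_elim (simp add: \<phi>)
			show "\<phi> \<circ> coordinates \<in> \<mu> \<rightarrow>\<^sub>M \<mu>"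
				using measurable_comp[OF measurable_coordinates \<phi>b] by (simp cong: measurable_cong_sets)
		qed simp_all
		also have "\<dots> = \<mu>" by (rule distr_id2) simp
		finally show ?thesis .
	qed
	show ?thesis
		unfolding emm_prec_def sel wiener_dist
	proof (intro bexI[of _ \<phi>] bexI[of _ "coordinates ` L"] conjI ballI)
		show "\<phi> \<in> gauss 1 \<rightarrow>\<^sub>M \<mu>" using \<phi>b by (simp cong: measurable_cong_sets)
		show "coordinates ` L \<in> sets (gauss 1)" using imL by simp
		fix x y assume "x \<in> coordinates ` L" "y \<in> coordinates ` L"
		then show "ell2_dist (coordinates (\<phi> x)) (coordinates (\<phi> y)) \<le> ell2_dist x y" by (auto simp: \<phi>)
	qed (fact law E1)+
qed

lemma pyramid_wiener: "pyramid (wiener_emm i \<mu>) = pyramid (gamma_infinity 1)"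
proof -
	have 1: "prob_space (emm_measure (wiener_emm i \<mu>))" using prob_space_axioms by (simp add: wiener_emm_def)
	have 2: "prob_space (emm_measure (gamma_infinity 1))"
		using prob_space_gauss[of 1] by (simp add: gamma_infinity_def gauss_def)
	show ?thesis
		unfolding pyramid_def
		by (auto intro: emm_prec_trans[OF 1 _ gamma_prec_wiener] emm_prec_trans[OF 2 _ wiener_prec_gamma])
qed

end

theorem sphere_converges_wiener:
	fixes i :: "'h::{real_inner, polish_space} \<Rightarrow> 'w::{banach, polish_space}"
	assumes W: "abstract_wiener_space i \<mu>" and inf: "\<nexists>B. finite B \<and> span B = (UNIV :: 'h set)"
		and lim: "(\<lambda>n. r n / sqrt (real n)) \<longlonglongrightarrow> 1" and r: "\<And>n. r n > 0"
	shows "converges_tau_Pi (\<lambda>n. emm_of_mm (sphere_mm n (r n))) (wiener_emm i \<mu>)"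
proof -
	interpret wiener i \<mu> by standard (rule W)
	obtain f :: "nat \<Rightarrow> 'w \<Rightarrow> real" where f: "\<And>j. bounded_linear (f j)"
		"\<And>j k. f j (i (riesz (f k))) = (if j = k then 1 else 0)" "\<And>w. (\<And>j. f j w = 0) \<Longrightarrow> w = 0"
		by (rule orthonormal_sequence[OF inf]) blast
	interpret wiener_coordinates i \<mu> f
		by (rule wiener_coordinates.intro[OF wiener_axioms], rule wiener_coordinates_axioms.intro)
			(fact f(1), fact f(2), rule f(3), assumption)
	show ?thesis
		using sphere_converges_gaussian[OF _ lim r] emm_space_wiener unfolding converges_tau_Pi_def pyramid_wiener by simp
qed

theorem corollary1p11:
  fixes r :: "nat \<Rightarrow> real"
    and i :: "'h::{real_inner, polish_space} \<Rightarrow> 'w::{banach, polish_space}"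
    and \<mu> :: "'w measure"
  assumes "\<And>n. r n > 0"
  shows "((\<lambda>n. r n / sqrt (real n)) \<longlonglongrightarrow> 0 \<longrightarrow>
           (\<lambda>n. d_conc (sphere_mm n (r n)) one_point_mm) \<longlonglongrightarrow> 0)
       \<and> (\<forall>l>0. (\<lambda>n. r n / sqrt (real n)) \<longlonglongrightarrow> l \<longrightarrow>
           converges_tau_Pi (\<lambda>n. emm_of_mm (sphere_mm n (r n))) (gamma_infinity l))
       \<and> (filterlim (\<lambda>n. r n / sqrt (real n)) at_top sequentially \<longrightarrow>
           converges_tau_Pi (\<lambda>n. emm_of_mm (sphere_mm n (r n))) I_infinity)
       \<and> (abstract_wiener_space i \<mu> \<and> (\<nexists>B. finite B \<and> span B = (UNIV :: 'h set)) \<longrightarrow>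
           (\<lambda>n. r n / sqrt (real n)) \<longlonglongrightarrow> 1 \<longrightarrow>
           converges_tau_Pi (\<lambda>n. emm_of_mm (sphere_mm n (r n))) (wiener_emm i \<mu>))"
proof (intro conjI allI impI)
  assume "(\<lambda>n. r n / sqrt (real n)) \<longlonglongrightarrow> 0"
  then show "(\<lambda>n. d_conc (sphere_mm n (r n)) one_point_mm) \<longlonglongrightarrow> 0"
    by (rule sphere_converges_point[OF assms])
next
  fix l :: real assume "l > 0" "(\<lambda>n. r n / sqrt (real n)) \<longlonglongrightarrow> l"
  then show "converges_tau_Pi (\<lambda>n. emm_of_mm (sphere_mm n (r n))) (gamma_infinity l)"
    by (rule sphere_converges_gaussian[OF _ _ assms])
next
  assume "filterlim (\<lambda>n. r n / sqrt (real n)) at_top sequentially"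
  then show "converges_tau_Pi (\<lambda>n. emm_of_mm (sphere_mm n (r n))) I_infinity"
    by (rule sphere_converges_I_infinity[OF _ assms])
next
  assume "abstract_wiener_space i \<mu> \<and> (\<nexists>B. finite B \<and> span B = (UNIV :: 'h set))"
    "(\<lambda>n. r n / sqrt (real n)) \<longlonglongrightarrow> 1"
  then show "converges_tau_Pi (\<lambda>n. emm_of_mm (sphere_mm n (r n))) (wiener_emm i \<mu>)"
    by (intro sphere_converges_wiener assms) simp_all
qed

end
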